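(* Let $\nu\in\mathbb C\setminus\mathbb Z_{\ge 0}$ and $t,k\in\mathbb C$. The deformed double current algebra $\mathcal D_{t,k,\nu}=\mathrm{End}_{\mathrm{Rep}(H_{t,k}(\nu))}(H_{t,k}(\nu)\mathbf e)$ is given by the restricted ultraproduct of spherical subalgebras of rational Cherednik algebras: $$\mathcal D_{t,k,\nu}\;=\;\prod_{\mathcal F}^{r}\mathcal B_{t_n,k_n}(\nu_n):=\bigcup_{L\ge 0}\ \prod_{\mathcal F}F^L\mathcal B_{t_n,k_n}(\nu_n),$$ the restricted ultraproduct being taken with respect to the filtrations determined by $\deg x_i=\deg y_i=1$, $\deg s_{ij}=0$.
   Context: **Cherednik algebras.** For a field $\Bbbk$, $t,k\in\Bbbk$, $n\ge1$, $H_{t,k}(n)$ is the quotient of $\Bbbk[S_n]\ltimes T(\mathfrak h\oplus\mathfrak h^* )$, where $\mathfrak h=\Bbbk^n$ is the permutation representation with basis $y_i$ and $\mathfrak h^*$ has dual basis $x_i$, by $[x_i,x_j]=0$, $[y_i,y_j]=0$, $[y_i,x_j]=\delta_{ij}(t-k\sum_{m\ne i}s_{im})+(1-\delta_{ij})k s_{ij}$. It is filtered by $\deg x_i=\deg y_i=1$, $\deg g=0$ for $g\in S_n$. If $\mathrm{char}\,\Bbbk=0$ or $>n$, $\mathbf e\in\Bbbk[S_n]$ is the averaging idempotent, and $\mathcal B_{t,k}(n)=\mathbf eH_{t,k}(n)\mathbf e$ with the induced filtration $F^L$. **Ultraproducts.** $\mathcal F$ is a fixed non-principal ultrafilter on $\mathbb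 N$; "for almost all $n$" means for all $n$ in some set belonging to $\mathcal F$; $\prod_{\mathcal F}$ is the ultraproduct. Put $\overline{\mathbb F}_0:=\overline{\mathbb Q}$. If $\nu$ is transcendental, put $\nu_n=n$, $p_n=0$; if $\nu$ is algebraic (not a nonnegative integer), choose distinct primes $p_n$ and integers $0<\nu_n<p_n$ tending to infinity. In both cases these are chosen together with a field isomorphism $\prod_{\mathcal F}\overline{\mathbb F}_{p_n}\simeq\mathbb C$ sending $\prod_{\mathcal F}\nu_n$ to $\nu$ (such choices exist). The elements $t_n,k_n\in\overline{\mathbb F}_{p_n}$ satisfy $\prod_{\mathcal F}t_n=t$, $\prod_{\mathcal F}k_n=k$. **Deligne category.** The ultraproduct of categories has sequences of objects as objects and ultraproducts of Hom-sets as morphisms. $\mathrm{Rep}(S_\nu)$ is Deligne's semisimple tensor category over $\mathbb C$; it is identified with the full subcategory of $\prod_{\mathcal F}\mathbf{Rep}^f(S_{\nu_n};\overline{\mathbb F}_{p_n})$ (finite dimensional representations) generated by the object $\mathfrak h=\prod_{\mathcal F}\mathfrak h_{\nu_n}$ ($\mathfrak h_m$ the permutation representation of $S_m$) under tensor products, direct sums and direct summands. $\mathrm{IND}(\mathrm{Rep}(S_\nu))$ is its ind-completion. $\Omega$ is the endomorphism of the identity functor of $\mathrm{Rep}(S_\nu)$ obtained as the ultraproduct of the central elements $\sum_{i<j}s_{ij}\in\overline{\mathbb F}_{p_n}[S_{\nu_n}]$. $\sigma$ denotes the symmetry permuting two tensor factors. **$\mathrm{Rep}(H_{t,k}(\nu))$.**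 Objects are triples $(M,x,y)$, with $M\in\mathrm{IND}(\mathrm{Rep}(S_\nu))$ and morphisms $x:\mathfrak h^*\otimes M\to M$, $y:\mathfrak h\otimes M\to M$ such that $x\circ(1\otimes x)\circ((1-\sigma)\otimes1)=0$, $y\circ(1\otimes y)\circ((1-\sigma)\otimes1)=0$, and, as maps $\mathfrak h\otimes\mathfrak h^*\otimes M\to M$, $$y\circ(1\otimes x)-x\circ(1\otimes y)\circ(\sigma\otimes1)=t\,\mathrm{ev}_{\mathfrak h}\otimes1-k(\mathrm{ev}_{\mathfrak h}\otimes1)\circ(\Omega^{3}-\Omega^{1,3}),$$ where upper indices indicate the tensor factors on which $\Omega$ acts. Morphisms are morphisms of ind-objects commuting with $x,y$. **Induction and the DDCA.** $\mathrm{Ind}_{S_\nu}^{H_{t,k}(\nu)}V$ is the object with underlying ind-object $\bigoplus_{i,j\ge0}S^i(\mathfrak h^* )\otimes S^j(\mathfrak h)\otimes V$, where $x$ acts by multiplication in $S^\bullet(\mathfrak h^* )$, $y$ acts on the part $i=0$ by multiplication in $S^\bullet(\mathfrak h)$, and $y$ is extended to all $i$ inductively by the commutation relation above; it satisfies $\mathrm{Hom}(\mathrm{Ind}\,V,M)=\mathrm{Hom}_{\mathrm{IND}(\mathrm{Rep}(S_\nu))}(V,M)$. Put $H_{t,k}(\nu)\mathbf e:=\mathrm{Ind}_{S_\nu}^{H_{t,k}(\nu)}(\mathbb C)$, with $\mathbb C$ the unit object, and $\mathcal D_{t,k,\nu}:=\mathrm{End}_{\mathrm{Rep}(H_{t,k}(\nu))}(H_{t,k}(\nu)\mathbf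 e)=\mathrm{Hom}_{\mathrm{IND}(\mathrm{Rep}(S_\nu))}(\mathbb C,H_{t,k}(\nu)\mathbf e)$. *)

theory Defs
  imports Complex_Main "HOL-Library.Multiset" "HOL-Computational_Algebra.Polynomial"
    "HOL-Combinatorics.Permutations" "HOL-Algebra.Module" "HOL-Algebra.QuotRing"
    "HOL-Algebra.Generated_Fields" "HOL-Algebra.Algebraic_Closure_Type"
begin

section \<open>Ultrafilters and ultraproducts\<close>

text \<open>The ultrafilter is given as a filter on the naturals; ``for almost all n'' is
  \<open>\<forall>\<^sub>F n in F\<close>.\<close>

definition nonprincipal_ultrafilter :: "nat filter \<Rightarrow> bool" where
  "nonprincipal_ultrafilter F \<longleftrightarrow> F \<noteq> bot
     \<and> (\<forall>P. (\<forall>\<^sub>F n in F. P n) \<or> (\<forall>\<^sub>F n in F. \<not> P n))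
     \<and> (\<forall>m. \<forall>\<^sub>F n in F. n \<noteq> m)"

text \<open>Elements of an ultraproduct are classes of sequences, two sequences being identified if they
  agree almost everywhere.\<close>

definition uclass :: "nat filter \<Rightarrow> (nat \<Rightarrow> 'a set) \<Rightarrow> (nat \<Rightarrow> 'a) \<Rightarrow> (nat \<Rightarrow> 'a) set" where
  "uclass F A s = {f \<in> Pi UNIV A. \<forall>\<^sub>F n in F. f n = s n}"

definition uprod :: "nat filter \<Rightarrow> (nat \<Rightarrow> 'a set) \<Rightarrow> (nat \<Rightarrow> 'a) set set" where
  "uprod F A = uclass F A ` Pi UNIV A"

definition uprod_ring :: "nat filter \<Rightarrow> (nat \<Rightarrow> ('a, 'b) ring_scheme) \<Rightarrow> (nat \<Rightarrow> 'a) set ring" where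
  "uprod_ring F R = (let cl = uclass F (\<lambda>n. carrier (R n)) in
     \<lparr> carrier = uprod F (\<lambda>n. carrier (R n)),
       monoid.mult = (\<lambda>P Q. \<Union>p\<in>P. \<Union>q\<in>Q. cl (\<lambda>n. p n \<otimes>\<^bsub>R n\<^esub> q n)),
       one = cl (\<lambda>n. \<one>\<^bsub>R n\<^esub>),
       ring.zero = cl (\<lambda>n. \<zero>\<^bsub>R n\<^esub>),
       add = (\<lambda>P Q. \<Union>p\<in>P. \<Union>q\<in>Q. cl (\<lambda>n. p n \<oplus>\<^bsub>R n\<^esub> q n)) \<rparr>)"

abbreviation complex_ring :: "complex ring" where
  "complex_ring \<equiv> ring_of_type_algebra"

text \<open>The inverse of the identification \<open>\<psi>\<close> of the ultraproduct field with the complex numbers, by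
  which complex numbers act on ultraproducts.\<close>

definition uscalar :: "nat filter \<Rightarrow> (nat \<Rightarrow> 'k ring) \<Rightarrow> ((nat \<Rightarrow> 'k) set \<Rightarrow> complex)
    \<Rightarrow> complex \<Rightarrow> (nat \<Rightarrow> 'k) set" where
  "uscalar F K \<psi> = inv_into (carrier (uprod_ring F K)) \<psi>"

text \<open>The restricted ultraproduct of algebras \<open>R n\<close> over \<open>K n\<close> with filtrations \<open>Fil n\<close>, as
  an algebra over the complex numbers by means of \<open>\<psi>\<close>. Algebras (not necessarily commutative) are
  \<open>module\<close> records, which carry both a ring structure and a scalar multiplication.\<close>

definition restricted_uprod :: "nat filter \<Rightarrow> (nat \<Rightarrow> 'k ring) \<Rightarrow> ((nat \<Rightarrow> 'k) set \<Rightarrow> complex)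
    \<Rightarrow> (nat \<Rightarrow> ('k, 'a) module) \<Rightarrow> (nat \<Rightarrow> nat \<Rightarrow> 'a set) \<Rightarrow> (complex, (nat \<Rightarrow> 'a) set) module" where
  "restricted_uprod F K \<psi> R Fil = (let cl = uclass F (\<lambda>n. carrier (R n)) in
     \<lparr> carrier = (\<Union>L. cl ` Pi UNIV (\<lambda>n. Fil n L)),
       monoid.mult = (\<lambda>P Q. \<Union>p\<in>P. \<Union>q\<in>Q. cl (\<lambda>n. p n \<otimes>\<^bsub>R n\<^esub> q n)),
       one = cl (\<lambda>n. \<one>\<^bsub>R n\<^esub>),
       ring.zero = cl (\<lambda>n. \<zero>\<^bsub>R n\<^esub>),
       add = (\<lambda>P Q. \<Union>p\<in>P. \<Union>q\<in>Q. cl (\<lambda>n. p n \<oplus>\<^bsub>R n\<^esub> q n)),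
       module.smult = (\<lambda>c P. \<Union>s\<in>uscalar F K \<psi> c. \<Union>p\<in>P. cl (\<lambda>n. s n \<odot>\<^bsub>R n\<^esub> p n)) \<rparr>)"

definition algebra_iso :: "('k, 'b) ring_scheme \<Rightarrow> ('k, 'a, 'c) module_scheme
    \<Rightarrow> ('k, 'd, 'e) module_scheme \<Rightarrow> ('a \<Rightarrow> 'd) set" where
  "algebra_iso K A B = {f \<in> ring_iso A B.
     \<forall>c\<in>carrier K. \<forall>a\<in>carrier A. f (c \<odot>\<^bsub>A\<^esub> a) = c \<odot>\<^bsub>B\<^esub> f a}"


section \<open>Algebraic closures of prime fields\<close>

definition has_characteristic :: "('a, 'b) ring_scheme \<Rightarrow> nat \<Rightarrow> bool" where
  "has_characteristic R p \<longleftrightarrow> (\<forall>m::nat. [m] \<cdot>\<^bsub>R\<^esub> \<one>\<^bsub>R\<^esub> = \<zero>\<^bsub>R\<^esub> \<longleftrightarrow> p dvd m)"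

text \<open>\<open>generate_field R {}\<close> is the prime field; for \<open>p = 0\<close> this describes the algebraic closure of
  the rationals.\<close>

definition is_prime_field_closure :: "nat \<Rightarrow> 'a ring \<Rightarrow> bool" where
  "is_prime_field_closure p R \<longleftrightarrow>
     algebraic_closure R (generate_field R {}) \<and> has_characteristic R p"


section \<open>Rational Cherednik algebras\<close>

text \<open>Everything indexed by \<open>1, \<dots>, n\<close> is indexed by \<open>{..<n}\<close>. \<open>Yv i\<close> is the basis of the
  permutation representation and \<open>Xv i\<close> the dual basis; both are permuted in the same way.\<close>

datatype gen = Xv nat | Yv nat

primrec gact :: "(nat \<Rightarrow> nat) \<Rightarrow> gen \<Rightarrow> gen" where
  "gact g (Xv i) = Xv (g i)"
| "gact g (Yv i) = Yv (g i)"

text \<open>The smash product of the group algebra with the tensor algebra has as basis the pairs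
  \<open>(w, g)\<close>, standing for the product \<open>w g\<close> of a word \<open>w\<close> in the \<open>Xv i\<close>, \<open>Yv i\<close> and a permutation
  \<open>g\<close>. Its elements are finitely supported functions on this basis.\<close>

type_synonym smono = "gen list \<times> (nat \<Rightarrow> nat)"

definition smonos :: "nat \<Rightarrow> smono set" where
  "smonos n = {(w, g). set w \<subseteq> Xv ` {..<n} \<union> Yv ` {..<n} \<and> g permutes {..<n}}"

definition smono_mult :: "smono \<Rightarrow> smono \<Rightarrow> smono" where
  "smono_mult u v = (fst u @ map (gact (snd u)) (fst v), snd u \<circ> snd v)"

definition smono_elt :: "'k ring \<Rightarrow> smono \<Rightarrow> smono \<Rightarrow> 'k" where
  "smono_elt K u = (\<lambda>v. if v = u then \<one>\<^bsub>K\<^esub> else \<zero>\<^bsub>K\<^esub>)"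

definition smash :: "'k ring \<Rightarrow> nat \<Rightarrow> ('k, smono \<Rightarrow> 'k) module" where
  "smash K n =
     \<lparr> carrier = {f. (\<forall>u. f u \<in> carrier K) \<and> finite {u. f u \<noteq> \<zero>\<^bsub>K\<^esub>} \<and> {u. f u \<noteq> \<zero>\<^bsub>K\<^esub>} \<subseteq> smonos n},
       monoid.mult = (\<lambda>f f' w. finsum K (\<lambda>(u, v). f u \<otimes>\<^bsub>K\<^esub> f' v)
          {(u, v). f u \<noteq> \<zero>\<^bsub>K\<^esub> \<and> f' v \<noteq> \<zero>\<^bsub>K\<^esub> \<and> smono_mult u v = w}),
       one = smono_elt K ([], id),
       ring.zero = (\<lambda>u. \<zero>\<^bsub>K\<^esub>),
       add = (\<lambda>f f' u. f u \<oplus>\<^bsub>K\<^esub> f' u),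
       module.smult = (\<lambda>c f u. c \<otimes>\<^bsub>K\<^esub> f u) \<rparr>"

definition xel :: "'k ring \<Rightarrow> nat \<Rightarrow> smono \<Rightarrow> 'k" where
  "xel K i = smono_elt K ([Xv i], id)"

definition yel :: "'k ring \<Rightarrow> nat \<Rightarrow> smono \<Rightarrow> 'k" where
  "yel K i = smono_elt K ([Yv i], id)"

definition gel :: "'k ring \<Rightarrow> (nat \<Rightarrow> nat) \<Rightarrow> smono \<Rightarrow> 'k" where
  "gel K g = smono_elt K ([], g)"

definition commutator :: "('a, 'b) ring_scheme \<Rightarrow> 'a \<Rightarrow> 'a \<Rightarrow> 'a" where
  "commutator R a b = a \<otimes>\<^bsub>R\<^esub> b \<ominus>\<^bsub>R\<^esub> b \<otimes>\<^bsub>R\<^esub> a"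

definition cherednik_rhs :: "'k ring \<Rightarrow> nat \<Rightarrow> 'k \<Rightarrow> 'k \<Rightarrow> nat \<Rightarrow> nat \<Rightarrow> smono \<Rightarrow> 'k" where
  "cherednik_rhs K n t k i j = (let A = smash K n in
     if i = j
     then t \<odot>\<^bsub>A\<^esub> \<one>\<^bsub>A\<^esub> \<ominus>\<^bsub>A\<^esub> k \<odot>\<^bsub>A\<^esub> (\<Oplus>\<^bsub>A\<^esub>m\<in>{..<n} - {i}. gel K (transpose i m))
     else k \<odot>\<^bsub>A\<^esub> gel K (transpose i j))"

definition cherednik_rels :: "'k ring \<Rightarrow> nat \<Rightarrow> 'k \<Rightarrow> 'k \<Rightarrow> (smono \<Rightarrow> 'k) set" where
  "cherednik_rels K n t k = (let A = smash K n in
     {commutator A (xel K i) (xel K j) | i j. i < n \<and> j < n}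
   \<union> {commutator A (yel K i) (yel K j) | i j. i < n \<and> j < n}
   \<union> {commutator A (yel K i) (xel K j) \<ominus>\<^bsub>A\<^esub> cherednik_rhs K n t k i j | i j. i < n \<and> j < n})"

definition cherednik_ideal :: "'k ring \<Rightarrow> nat \<Rightarrow> 'k \<Rightarrow> 'k \<Rightarrow> (smono \<Rightarrow> 'k) set" where
  "cherednik_ideal K n t k = Idl\<^bsub>smash K n\<^esub> (cherednik_rels K n t k)"

definition cherednik_proj :: "'k ring \<Rightarrow> nat \<Rightarrow> 'k \<Rightarrow> 'k \<Rightarrow> (smono \<Rightarrow> 'k) \<Rightarrow> (smono \<Rightarrow> 'k) set" where
  "cherednik_proj K n t k f = cherednik_ideal K n t k +>\<^bsub>smash K n\<^esub> f"

definition cherednik :: "'k ring \<Rightarrow> nat \<Rightarrow> 'k \<Rightarrow> 'k \<Rightarrow> ('k, (smono \<Rightarrow> 'k) set) module" where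
  "cherednik K n t k = (let Q = smash K n Quot cherednik_ideal K n t k in
     \<lparr> carrier = carrier Q, monoid.mult = monoid.mult Q, one = one Q, ring.zero = ring.zero Q, add = add Q,
       module.smult = (\<lambda>c P. \<Union>f\<in>P. cherednik_proj K n t k (c \<odot>\<^bsub>smash K n\<^esub> f)) \<rparr>)"

definition cherednik_filt :: "'k ring \<Rightarrow> nat \<Rightarrow> 'k \<Rightarrow> 'k \<Rightarrow> nat \<Rightarrow> (smono \<Rightarrow> 'k) set set" where
  "cherednik_filt K n t k L = cherednik_proj K n t k `
     {f \<in> carrier (smash K n). \<forall>w g. f (w, g) \<noteq> \<zero>\<^bsub>K\<^esub> \<longrightarrow> length w \<le> L}"

text \<open>The averaging idempotent; only meaningful if \<open>n!\<close> is invertible in \<open>K\<close>.\<close>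

definition avg_idem :: "'k ring \<Rightarrow> nat \<Rightarrow> 'k \<Rightarrow> 'k \<Rightarrow> (smono \<Rightarrow> 'k) set" where
  "avg_idem K n t k = cherednik_proj K n t k
     (inv\<^bsub>K\<^esub> ([(fact n :: nat)] \<cdot>\<^bsub>K\<^esub> \<one>\<^bsub>K\<^esub>) \<odot>\<^bsub>smash K n\<^esub>
       (\<Oplus>\<^bsub>smash K n\<^esub>g\<in>{g. g permutes {..<n}}. gel K g))"

definition spherical :: "'k ring \<Rightarrow> nat \<Rightarrow> 'k \<Rightarrow> 'k \<Rightarrow> ('k, (smono \<Rightarrow> 'k) set) module" where
  "spherical K n t k = (let H = cherednik K n t k; e = avg_idem K n t k in
     H \<lparr> carrier := {e \<otimes>\<^bsub>H\<^esub> a \<otimes>\<^bsub>H\<^esub> e | a. a \<in> carrier H}, one := e \<rparr>)"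

definition spherical_filt :: "'k ring \<Rightarrow> nat \<Rightarrow> 'k \<Rightarrow> 'k \<Rightarrow> nat \<Rightarrow> (smono \<Rightarrow> 'k) set set" where
  "spherical_filt K n t k L = carrier (spherical K n t k) \<inter> cherednik_filt K n t k L"


section \<open>Linear symmetric tensor categories\<close>

text \<open>The data of a linear symmetric tensor category: \<open>asc\<close> is the associator
  \<open>(U \<otimes> V) \<otimes> W \<rightarrow> U \<otimes> (V \<otimes> W)\<close>, \<open>asci\<close> its inverse, \<open>lun\<close> the left unitor
  \<open>1 \<otimes> V \<rightarrow> V\<close> and \<open>swp\<close> the symmetry.\<close>

record ('o, 'm, 's) tcat =
  obs :: "'o set"
  ars :: "'m set"
  src :: "'m \<Rightarrow> 'o"
  tgt :: "'m \<Rightarrow> 'o"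
  idn :: "'o \<Rightarrow> 'm"
  cmp :: "'m \<Rightarrow> 'm \<Rightarrow> 'm"  (infixr \<open>\<bullet>\<index>\<close> 75)
  zer :: "'o \<Rightarrow> 'o \<Rightarrow> 'm"
  pls :: "'m \<Rightarrow> 'm \<Rightarrow> 'm"
  scl :: "'s \<Rightarrow> 'm \<Rightarrow> 'm"
  unt :: "'o"
  tno :: "'o \<Rightarrow> 'o \<Rightarrow> 'o"
  tna :: "'m \<Rightarrow> 'm \<Rightarrow> 'm"
  asc :: "'o \<Rightarrow> 'o \<Rightarrow> 'o \<Rightarrow> 'm"
  asci :: "'o \<Rightarrow> 'o \<Rightarrow> 'o \<Rightarrow> 'm"
  lun :: "'o \<Rightarrow> 'm"
  swp :: "'o \<Rightarrow> 'o \<Rightarrow> 'm"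

definition hom_set :: "('o, 'm, 's, 'z) tcat_scheme \<Rightarrow> 'o \<Rightarrow> 'o \<Rightarrow> 'm set" where
  "hom_set C V W = {f \<in> ars C. src C f = V \<and> tgt C f = W}"

definition is_biproduct :: "('o, 'm, 's, 'z) tcat_scheme \<Rightarrow> 'o \<Rightarrow> 'o \<Rightarrow> 'o \<Rightarrow> bool" where
  "is_biproduct C V W Z \<longleftrightarrow> (\<exists>i\<in>hom_set C V Z. \<exists>j\<in>hom_set C W Z. \<exists>p\<in>hom_set C Z V. \<exists>q\<in>hom_set C Z W.
     p \<bullet>\<^bsub>C\<^esub> i = idn C V \<and> q \<bullet>\<^bsub>C\<^esub> j = idn C W \<and> p \<bullet>\<^bsub>C\<^esub> j = zer C W V \<and> q \<bullet>\<^bsub>C\<^esub> i = zer C V W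
     \<and> pls C (i \<bullet>\<^bsub>C\<^esub> p) (j \<bullet>\<^bsub>C\<^esub> q) = idn C Z)"

definition is_summand :: "('o, 'm, 's, 'z) tcat_scheme \<Rightarrow> 'o \<Rightarrow> 'o \<Rightarrow> bool" where
  "is_summand C V W \<longleftrightarrow> (\<exists>i\<in>hom_set C V W. \<exists>p\<in>hom_set C W V. p \<bullet>\<^bsub>C\<^esub> i = idn C V)"

inductive_set generated_obs :: "('o, 'm, 's, 'z) tcat_scheme \<Rightarrow> 'o \<Rightarrow> 'o set"
  for C :: "('o, 'm, 's, 'z) tcat_scheme" and h :: 'o where
  base: "h \<in> generated_obs C h"
| unit: "unt C \<in> generated_obs C h"
| tensor: "V \<in> generated_obs C h \<Longrightarrow> W \<in> generated_obs C h \<Longrightarrow> tno C V W \<in> generated_obs C h"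
| sum: "V \<in> generated_obs C h \<Longrightarrow> W \<in> generated_obs C h \<Longrightarrow> Z \<in> obs C \<Longrightarrow> is_biproduct C V W Z
    \<Longrightarrow> Z \<in> generated_obs C h"
| summand: "W \<in> generated_obs C h \<Longrightarrow> V \<in> obs C \<Longrightarrow> is_summand C V W \<Longrightarrow> V \<in> generated_obs C h"


section \<open>Finite dimensional representations of symmetric groups\<close>

text \<open>Basis vectors are taken from a fixed type that is closed under pairing, so that tensor
  products stay in the same type: \<open>Tns u v\<close> stands for the tensor product of two basis vectors,
  \<open>Unt\<close> for the basis vector of the trivial representation, and \<open>Mon a\<close> for a monomial in a
  symmetric power. A representation is a finite set of basis vectors with a matrix \<open>act g r c\<close>
  (row \<open>r\<close>, column \<open>c\<close>) for each group element; matrices vanish outside the given bases.\<close>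

datatype bvec = Gen gen | Unt | Tns bvec bvec | Mon "gen multiset"

primrec bact :: "(nat \<Rightarrow> nat) \<Rightarrow> bvec \<Rightarrow> bvec" where
  "bact g (Gen z) = Gen (gact g z)"
| "bact g Unt = Unt"
| "bact g (Tns u v) = Tns (bact g u) (bact g v)"
| "bact g (Mon a) = Mon (image_mset (gact g) a)"

type_synonym 'k mtx = "bvec \<Rightarrow> bvec \<Rightarrow> 'k"

record 'k rep =
  basis :: "bvec set"
  act :: "(nat \<Rightarrow> nat) \<Rightarrow> 'k mtx"

record 'k rmor =
  rsrc :: "'k rep"
  rtgt :: "'k rep"
  rmat :: "'k mtx"

definition mtxs :: "'k ring \<Rightarrow> bvec set \<Rightarrow> bvec set \<Rightarrow> 'k mtx set" where
  "mtxs K R S = {A. (\<forall>r c. A r c \<in> carrier K) \<and> (\<forall>r c. r \<notin> R \<or> c \<notin> S \<longrightarrow> A r c = \<zero>\<^bsub>K\<^esub>)}"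

definition mtx_mult :: "'k ring \<Rightarrow> bvec set \<Rightarrow> 'k mtx \<Rightarrow> 'k mtx \<Rightarrow> 'k mtx" where
  "mtx_mult K S A B = (\<lambda>r c. \<Oplus>\<^bsub>K\<^esub>b\<in>S. A r b \<otimes>\<^bsub>K\<^esub> B b c)"

text \<open>The matrix of the linear map sending the basis vector \<open>c \<in> S\<close> to the basis vector \<open>\<phi> c\<close>.\<close>

definition map_mtx :: "'k ring \<Rightarrow> bvec set \<Rightarrow> (bvec \<Rightarrow> bvec) \<Rightarrow> 'k mtx" where
  "map_mtx K S \<phi> = (\<lambda>r c. if c \<in> S \<and> r = \<phi> c then \<one>\<^bsub>K\<^esub> else \<zero>\<^bsub>K\<^esub>)"

definition map_mor :: "'k ring \<Rightarrow> 'k rep \<Rightarrow> 'k rep \<Rightarrow> (bvec \<Rightarrow> bvec) \<Rightarrow> 'k rmor" where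
  "map_mor K V W \<phi> = \<lparr> rsrc = V, rtgt = W, rmat = map_mtx K (basis V) \<phi> \<rparr>"

fun kronecker :: "'k ring \<Rightarrow> 'k mtx \<Rightarrow> 'k mtx \<Rightarrow> 'k mtx" where
  "kronecker K A B (Tns r r') (Tns c c') = A r c \<otimes>\<^bsub>K\<^esub> B r' c'"
| "kronecker K A B _ _ = \<zero>\<^bsub>K\<^esub>"

definition is_rep :: "'k ring \<Rightarrow> nat \<Rightarrow> 'k rep \<Rightarrow> bool" where
  "is_rep K m V \<longleftrightarrow> finite (basis V)
     \<and> (\<forall>g. g permutes {..<m} \<longrightarrow> act V g \<in> mtxs K (basis V) (basis V))
     \<and> act V id = map_mtx K (basis V) id
     \<and> (\<forall>g g'. g permutes {..<m} \<and> g' permutes {..<m} \<longrightarrow>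
          act V (g \<circ> g') = mtx_mult K (basis V) (act V g) (act V g'))"

definition is_rmor :: "'k ring \<Rightarrow> nat \<Rightarrow> 'k rmor \<Rightarrow> bool" where
  "is_rmor K m f \<longleftrightarrow> is_rep K m (rsrc f) \<and> is_rep K m (rtgt f)
     \<and> rmat f \<in> mtxs K (basis (rtgt f)) (basis (rsrc f))
     \<and> (\<forall>g. g permutes {..<m} \<longrightarrow>
          mtx_mult K (basis (rsrc f)) (rmat f) (act (rsrc f) g)
          = mtx_mult K (basis (rtgt f)) (act (rtgt f) g) (rmat f))"

definition perm_rep :: "'k ring \<Rightarrow> bvec set \<Rightarrow> 'k rep" where
  "perm_rep K S = \<lparr> basis = S, act = (\<lambda>g. map_mtx K S (bact g)) \<rparr>"

definition rep_tensor :: "'k ring \<Rightarrow> 'k rep \<Rightarrow> 'k rep \<Rightarrow> 'k rep" where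
  "rep_tensor K V W = \<lparr> basis = {Tns u v | u v. u \<in> basis V \<and> v \<in> basis W},
     act = (\<lambda>g. kronecker K (act V g) (act W g)) \<rparr>"

fun assoc_map :: "bvec \<Rightarrow> bvec" where
  "assoc_map (Tns (Tns u v) w) = Tns u (Tns v w)"
| "assoc_map b = b"

fun assoc_inv_map :: "bvec \<Rightarrow> bvec" where
  "assoc_inv_map (Tns u (Tns v w)) = Tns (Tns u v) w"
| "assoc_inv_map b = b"

fun lunit_map :: "bvec \<Rightarrow> bvec" where
  "lunit_map (Tns Unt v) = v"
| "lunit_map b = b"

fun swap_map :: "bvec \<Rightarrow> bvec" where
  "swap_map (Tns u v) = Tns v u"
| "swap_map b = b"

definition rep_cat :: "'k ring \<Rightarrow> nat \<Rightarrow> ('k rep, 'k rmor, 'k) tcat" where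
  "rep_cat K m = (let tn = rep_tensor K; un = perm_rep K {Unt} in
     \<lparr> obs = {V. is_rep K m V},
       ars = {f. is_rmor K m f},
       src = rsrc,
       tgt = rtgt,
       idn = (\<lambda>V. map_mor K V V id),
       cmp = (\<lambda>g f. \<lparr> rsrc = rsrc f, rtgt = rtgt g,
          rmat = mtx_mult K (basis (rtgt f)) (rmat g) (rmat f) \<rparr>),
       zer = (\<lambda>V W. \<lparr> rsrc = V, rtgt = W, rmat = (\<lambda>r c. \<zero>\<^bsub>K\<^esub>) \<rparr>),
       pls = (\<lambda>f g. \<lparr> rsrc = rsrc f, rtgt = rtgt f, rmat = (\<lambda>r c. rmat f r c \<oplus>\<^bsub>K\<^esub> rmat g r c) \<rparr>),
       scl = (\<lambda>a f. \<lparr> rsrc = rsrc f, rtgt = rtgt f, rmat = (\<lambda>r c. a \<otimes>\<^bsub>K\<^esub> rmat f r c) \<rparr>),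
       unt = un,
       tno = tn,
       tna = (\<lambda>f g. \<lparr> rsrc = tn (rsrc f) (rsrc g), rtgt = tn (rtgt f) (rtgt g),
          rmat = kronecker K (rmat f) (rmat g) \<rparr>),
       asc = (\<lambda>U V W. map_mor K (tn (tn U V) W) (tn U (tn V W)) assoc_map),
       asci = (\<lambda>U V W. map_mor K (tn U (tn V W)) (tn (tn U V) W) assoc_inv_map),
       lun = (\<lambda>V. map_mor K (tn un V) V lunit_map),
       swp = (\<lambda>V W. map_mor K (tn V W) (tn W V) swap_map) \<rparr>)"

definition h_rep :: "'k ring \<Rightarrow> nat \<Rightarrow> 'k rep" where
  "h_rep K m = perm_rep K (Gen ` Yv ` {..<m})"

definition hd_rep :: "'k ring \<Rightarrow> nat \<Rightarrow> 'k rep" where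
  "hd_rep K m = perm_rep K (Gen ` Xv ` {..<m})"

definition ev_mor :: "'k ring \<Rightarrow> nat \<Rightarrow> 'k rmor" where
  "ev_mor K m = \<lparr> rsrc = rep_tensor K (h_rep K m) (hd_rep K m), rtgt = perm_rep K {Unt},
     rmat = (\<lambda>r c. if r = Unt \<and> (\<exists>i<m. c = Tns (Gen (Yv i)) (Gen (Xv i))) then \<one>\<^bsub>K\<^esub> else \<zero>\<^bsub>K\<^esub>) \<rparr>"

definition omega_mor :: "'k ring \<Rightarrow> nat \<Rightarrow> 'k rep \<Rightarrow> 'k rmor" where
  "omega_mor K m V = \<lparr> rsrc = V, rtgt = V,
     rmat = (\<lambda>r c. finsum K (\<lambda>(i, j). act V (transpose i j) r c) {(i, j). i < j \<and> j < m}) \<rparr>"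

text \<open>\<open>sym_part K m D\<close> is the direct sum of \<open>S^i(h*) \<otimes> S^j(h)\<close> over \<open>(i, j) \<in> D\<close>. The symmetric
  powers have the bases of monomials, which determine their degrees, so that the direct sum is given
  by the union of the bases. The group permutes monomials.\<close>

definition sym_basis :: "gen set \<Rightarrow> nat \<Rightarrow> bvec set" where
  "sym_basis S i = {Mon a | a. size a = i \<and> set_mset a \<subseteq> S}"

definition sym_part :: "'k ring \<Rightarrow> nat \<Rightarrow> (nat \<times> nat) set \<Rightarrow> 'k rep" where
  "sym_part K m D = perm_rep K (\<Union>(i, j)\<in>D.
     {Tns u v | u v. u \<in> sym_basis (Xv ` {..<m}) i \<and> v \<in> sym_basis (Yv ` {..<m}) j})"

text \<open>Multiplication \<open>h* \<otimes> (S(h*) \<otimes> S(h) \<otimes> V) \<rightarrow> S(h*) \<otimes> S(h) \<otimes> V\<close> in the first, and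
  \<open>h \<otimes> (S(h*) \<otimes> S(h) \<otimes> V) \<rightarrow> S(h*) \<otimes> S(h) \<otimes> V\<close> in the second tensor factor.\<close>

fun mult_x_map :: "bvec \<Rightarrow> bvec" where
  "mult_x_map (Tns (Gen z) (Tns (Tns (Mon a) (Mon b)) v)) = Tns (Tns (Mon (add_mset z a)) (Mon b)) v"
| "mult_x_map b = b"

fun mult_y_map :: "bvec \<Rightarrow> bvec" where
  "mult_y_map (Tns (Gen z) (Tns (Tns (Mon a) (Mon b)) v)) = Tns (Tns (Mon a) (Mon (add_mset z b))) v"
| "mult_y_map b = b"


section \<open>Ultraproducts of categories and the Deligne category\<close>

text \<open>The class of a sequence of arrows.\<close>

definition ucls :: "nat filter \<Rightarrow> (nat \<Rightarrow> ('o, 'm, 's) tcat) \<Rightarrow> (nat \<Rightarrow> 'm) \<Rightarrow> (nat \<Rightarrow> 'm) set" where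
  "ucls F C f = uclass F (\<lambda>n. hom_set (C n) (src (C n) (f n)) (tgt (C n) (f n))) f"

definition uprod_cat :: "nat filter \<Rightarrow> (nat \<Rightarrow> ('o, 'm, 's) tcat)
    \<Rightarrow> (nat \<Rightarrow> 'o, (nat \<Rightarrow> 'm) set, (nat \<Rightarrow> 's) set) tcat" where
  "uprod_cat F C =
     \<lparr> obs = Pi UNIV (\<lambda>n. obs (C n)),
       ars = (\<Union>V\<in>Pi UNIV (\<lambda>n. obs (C n)). \<Union>W\<in>Pi UNIV (\<lambda>n. obs (C n)).
          uprod F (\<lambda>n. hom_set (C n) (V n) (W n))),
       src = (\<lambda>P n. src (C n) ((SOME p. p \<in> P) n)),
       tgt = (\<lambda>P n. tgt (C n) ((SOME p. p \<in> P) n)),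
       idn = (\<lambda>V. ucls F C (\<lambda>n. idn (C n) (V n))),
       cmp = (\<lambda>Q P. \<Union>q\<in>Q. \<Union>p\<in>P. ucls F C (\<lambda>n. q n \<bullet>\<^bsub>C n\<^esub> p n)),
       zer = (\<lambda>V W. ucls F C (\<lambda>n. zer (C n) (V n) (W n))),
       pls = (\<lambda>P Q. \<Union>p\<in>P. \<Union>q\<in>Q. ucls F C (\<lambda>n. pls (C n) (p n) (q n))),
       scl = (\<lambda>A P. \<Union>a\<in>A. \<Union>p\<in>P. ucls F C (\<lambda>n. scl (C n) (a n) (p n))),
       unt = (\<lambda>n. unt (C n)),
       tno = (\<lambda>V W n. tno (C n) (V n) (W n)),
       tna = (\<lambda>P Q. \<Union>p\<in>P. \<Union>q\<in>Q. ucls F C (\<lambda>n. tna (C n) (p n) (q n))),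
       asc = (\<lambda>U V W. ucls F C (\<lambda>n. asc (C n) (U n) (V n) (W n))),
       asci = (\<lambda>U V W. ucls F C (\<lambda>n. asci (C n) (U n) (V n) (W n))),
       lun = (\<lambda>V. ucls F C (\<lambda>n. lun (C n) (V n))),
       swp = (\<lambda>V W. ucls F C (\<lambda>n. swp (C n) (V n) (W n))) \<rparr>"

text \<open>The full tensor subcategory on the objects in \<open>S\<close>, with scalars restricted along \<open>\<phi>\<close>.\<close>

definition full_subcat :: "('o, 'm, 's) tcat \<Rightarrow> 'o set \<Rightarrow> ('r \<Rightarrow> 's) \<Rightarrow> ('o, 'm, 'r) tcat" where
  "full_subcat C S \<phi> =
     \<lparr> obs = S,
       ars = {f \<in> ars C. src C f \<in> S \<and> tgt C f \<in> S},
       src = src C, tgt = tgt C, idn = idn C, cmp = cmp C, zer = zer C, pls = pls C,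
       scl = (\<lambda>a. scl C (\<phi> a)),
       unt = unt C, tno = tno C, tna = tna C, asc = asc C, asci = asci C, lun = lun C, swp = swp C \<rparr>"

definition deligne_cat :: "nat filter \<Rightarrow> (nat \<Rightarrow> 'k ring) \<Rightarrow> (nat \<Rightarrow> nat)
    \<Rightarrow> ((nat \<Rightarrow> 'k) set \<Rightarrow> complex) \<Rightarrow> (nat \<Rightarrow> 'k rep, (nat \<Rightarrow> 'k rmor) set, complex) tcat" where
  "deligne_cat F K \<nu>s \<psi> = (let U = uprod_cat F (\<lambda>n. rep_cat (K n) (\<nu>s n)) in
     full_subcat U (generated_obs U (\<lambda>n. h_rep (K n) (\<nu>s n))) (uscalar F K \<psi>))"


section \<open>Ind-objects\<close>

text \<open>Ind-objects are formal filtered colimits. The index categories are directed preorders, to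
  which arbitrary small filtered index categories can be reduced. The type of indices is arbitrary
  and may be different for different ind-objects.\<close>

record ('i, 'o, 'm) indob =
  idx :: "'i set"
  idle :: "'i \<Rightarrow> 'i \<Rightarrow> bool"
  lev :: "'i \<Rightarrow> 'o"
  trn :: "'i \<Rightarrow> 'i \<Rightarrow> 'm"

definition ind_obs :: "('o, 'm, 's, 'z) tcat_scheme \<Rightarrow> ('i, 'o, 'm) indob set" where
  "ind_obs C = {M. idx M \<noteq> {}
     \<and> (\<forall>i\<in>idx M. idle M i i)
     \<and> (\<forall>i\<in>idx M. \<forall>j\<in>idx M. \<forall>l\<in>idx M. idle M i j \<and> idle M j l \<longrightarrow> idle M i l)
     \<and> (\<forall>i\<in>idx M. \<forall>j\<in>idx M. \<exists>l\<in>idx M. idle M i l \<and> idle M j l)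
     \<and> (\<forall>i\<in>idx M. lev M i \<in> obs C \<and> trn M i i = idn C (lev M i))
     \<and> (\<forall>i\<in>idx M. \<forall>j\<in>idx M. idle M i j \<longrightarrow> trn M i j \<in> hom_set C (lev M i) (lev M j))
     \<and> (\<forall>i\<in>idx M. \<forall>j\<in>idx M. \<forall>l\<in>idx M. idle M i j \<and> idle M j l \<longrightarrow>
          trn M j l \<bullet>\<^bsub>C\<^esub> trn M i j = trn M i l)}"

text \<open>For an object \<open>W\<close> and an ind-object \<open>N\<close>, \<open>colim_hom C W N\<close> is the colimit over \<open>j\<close> of
  \<open>Hom(W, N j)\<close>. Its elements are classes of pairs \<open>(j, f)\<close> with \<open>f : W \<rightarrow> N j\<close>.\<close>

definition colim_cls :: "('o, 'm, 's, 'z) tcat_scheme \<Rightarrow> 'o \<Rightarrow> ('i, 'o, 'm) indob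
    \<Rightarrow> 'i \<times> 'm \<Rightarrow> ('i \<times> 'm) set" where
  "colim_cls C W N = (\<lambda>(j, f). {(j', f'). j' \<in> idx N \<and> f' \<in> hom_set C W (lev N j')
     \<and> (\<exists>l\<in>idx N. idle N j l \<and> idle N j' l \<and> trn N j l \<bullet>\<^bsub>C\<^esub> f = trn N j' l \<bullet>\<^bsub>C\<^esub> f')})"

definition colim_hom :: "('o, 'm, 's, 'z) tcat_scheme \<Rightarrow> 'o \<Rightarrow> ('i, 'o, 'm) indob
    \<Rightarrow> ('i \<times> 'm) set set" where
  "colim_hom C W N = colim_cls C W N ` {(j, f). j \<in> idx N \<and> f \<in> hom_set C W (lev N j)}"

text \<open>A morphism \<open>M \<rightarrow> N\<close> is an element of the limit over \<open>i\<close> of the colimit over \<open>j\<close> of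
  \<open>Hom(M i, N j)\<close>.\<close>

record ('i, 'j, 'o, 'm) indmor =
  isrc :: "('i, 'o, 'm) indob"
  itgt :: "('j, 'o, 'm) indob"
  cpt :: "'i \<Rightarrow> ('j \<times> 'm) set"

definition ind_hom :: "('o, 'm, 's, 'z) tcat_scheme \<Rightarrow> ('i, 'o, 'm) indob \<Rightarrow> ('j, 'o, 'm) indob
    \<Rightarrow> ('i, 'j, 'o, 'm) indmor set" where
  "ind_hom C M N = {f. isrc f = M \<and> itgt f = N
     \<and> (\<forall>i\<in>idx M. cpt f i \<in> colim_hom C (lev M i) N)
     \<and> (\<forall>i. i \<notin> idx M \<longrightarrow> cpt f i = {})
     \<and> (\<forall>i\<in>idx M. \<forall>i'\<in>idx M. idle M i i' \<longrightarrow>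
          (\<forall>(j, a)\<in>cpt f i'. (j, a \<bullet>\<^bsub>C\<^esub> trn M i i') \<in> cpt f i))}"

text \<open>The morphism whose component at \<open>i\<close> is the class of any of the elements of \<open>S i\<close>.\<close>

definition ind_mk :: "('o, 'm, 's, 'z) tcat_scheme \<Rightarrow> ('i, 'o, 'm) indob \<Rightarrow> ('j, 'o, 'm) indob
    \<Rightarrow> ('i \<Rightarrow> ('j \<times> 'm) set) \<Rightarrow> ('i, 'j, 'o, 'm) indmor" where
  "ind_mk C M N S = \<lparr> isrc = M, itgt = N,
     cpt = (\<lambda>i. if i \<in> idx M then \<Union>r\<in>S i. colim_cls C (lev M i) N r else {}) \<rparr>"

definition ind_lev :: "('o, 'm, 's, 'z) tcat_scheme \<Rightarrow> ('i, 'o, 'm) indob \<Rightarrow> ('i, 'o, 'm) indob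
    \<Rightarrow> ('i \<Rightarrow> 'm) \<Rightarrow> ('i, 'i, 'o, 'm) indmor" where
  "ind_lev C M N a = ind_mk C M N (\<lambda>i. {(i, a i)})"

definition ind_id :: "('o, 'm, 's, 'z) tcat_scheme \<Rightarrow> ('i, 'o, 'm) indob
    \<Rightarrow> ('i, 'i, 'o, 'm) indmor" where
  "ind_id C M = ind_lev C M M (\<lambda>i. idn C (lev M i))"

definition ind_cmp :: "('o, 'm, 's, 'z) tcat_scheme \<Rightarrow> ('j, 'l, 'o, 'm) indmor
    \<Rightarrow> ('i, 'j, 'o, 'm) indmor \<Rightarrow> ('i, 'l, 'o, 'm) indmor"  (infixr \<open>\<star>\<index>\<close> 75) where
  "g \<star>\<^bsub>C\<^esub> f = ind_mk C (isrc f) (itgt g)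
     (\<lambda>i. {(l, b \<bullet>\<^bsub>C\<^esub> a) | j l a b. (j, a) \<in> cpt f i \<and> (l, b) \<in> cpt g j})"

definition ind_zer :: "('o, 'm, 's, 'z) tcat_scheme \<Rightarrow> ('i, 'o, 'm) indob \<Rightarrow> ('j, 'o, 'm) indob
    \<Rightarrow> ('i, 'j, 'o, 'm) indmor" where
  "ind_zer C M N = ind_mk C M N (\<lambda>i. {(j, zer C (lev M i) (lev N j)) | j. j \<in> idx N})"

definition ind_pls :: "('o, 'm, 's, 'z) tcat_scheme \<Rightarrow> ('i, 'j, 'o, 'm) indmor
    \<Rightarrow> ('i, 'j, 'o, 'm) indmor \<Rightarrow> ('i, 'j, 'o, 'm) indmor"  (infixl \<open>\<boxplus>\<index>\<close> 65) where
  "f \<boxplus>\<^bsub>C\<^esub> g = ind_mk C (isrc f) (itgt f)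
     (\<lambda>i. {(j, pls C a b) | j a b. (j, a) \<in> cpt f i \<and> (j, b) \<in> cpt g i})"

definition ind_scl :: "('o, 'm, 's, 'z) tcat_scheme \<Rightarrow> 's
    \<Rightarrow> ('i, 'j, 'o, 'm) indmor \<Rightarrow> ('i, 'j, 'o, 'm) indmor" where
  "ind_scl C c f = ind_mk C (isrc f) (itgt f) (\<lambda>i. {(j, scl C c a) | j a. (j, a) \<in> cpt f i})"

definition ind_mns :: "('o, 'm, complex, 'z) tcat_scheme \<Rightarrow> ('i, 'j, 'o, 'm) indmor
    \<Rightarrow> ('i, 'j, 'o, 'm) indmor \<Rightarrow> ('i, 'j, 'o, 'm) indmor"  (infixl \<open>\<boxminus>\<index>\<close> 65) where
  "f \<boxminus>\<^bsub>C\<^esub> g = f \<boxplus>\<^bsub>C\<^esub> ind_scl C (- 1) g"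

text \<open>Tensor product of an object, respectively a morphism, of \<open>C\<close> with an ind-object, respectively
  a morphism of ind-objects.\<close>

definition ind_tno :: "('o, 'm, 's, 'z) tcat_scheme \<Rightarrow> 'o \<Rightarrow> ('i, 'o, 'm) indob
    \<Rightarrow> ('i, 'o, 'm) indob" where
  "ind_tno C V M = \<lparr> idx = idx M, idle = idle M, lev = (\<lambda>i. tno C V (lev M i)),
     trn = (\<lambda>i j. tna C (idn C V) (trn M i j)) \<rparr>"

definition ind_tna :: "('o, 'm, 's, 'z) tcat_scheme \<Rightarrow> 'm \<Rightarrow> ('i, 'j, 'o, 'm) indmor
    \<Rightarrow> ('i, 'j, 'o, 'm) indmor"  (infixr \<open>\<boxtimes>\<index>\<close> 80) where
  "f \<boxtimes>\<^bsub>C\<^esub> g = ind_mk C (ind_tno C (src C f) (isrc g)) (ind_tno C (tgt C f) (itgt g))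
     (\<lambda>i. {(j, tna C f b) | j b. (j, b) \<in> cpt g i})"

definition ind_asc :: "('o, 'm, 's, 'z) tcat_scheme \<Rightarrow> 'o \<Rightarrow> 'o \<Rightarrow> ('i, 'o, 'm) indob
    \<Rightarrow> ('i, 'i, 'o, 'm) indmor" where
  "ind_asc C V W M = ind_lev C (ind_tno C (tno C V W) M) (ind_tno C V (ind_tno C W M))
     (\<lambda>i. asc C V W (lev M i))"

definition ind_asci :: "('o, 'm, 's, 'z) tcat_scheme \<Rightarrow> 'o \<Rightarrow> 'o \<Rightarrow> ('i, 'o, 'm) indob
    \<Rightarrow> ('i, 'i, 'o, 'm) indmor" where
  "ind_asci C V W M = ind_lev C (ind_tno C V (ind_tno C W M)) (ind_tno C (tno C V W) M)
     (\<lambda>i. asci C V W (lev M i))"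

definition ind_lun :: "('o, 'm, 's, 'z) tcat_scheme \<Rightarrow> ('i, 'o, 'm) indob
    \<Rightarrow> ('i, 'i, 'o, 'm) indmor" where
  "ind_lun C M = ind_lev C (ind_tno C (unt C) M) M (\<lambda>i. lun C (lev M i))"


section \<open>Representations of the Cherednik algebra in complex rank\<close>

text \<open>A complex-linear tensor category together with the objects \<open>h\<close> and \<open>h*\<close>, the evaluation
  \<open>h \<otimes> h* \<rightarrow> 1\<close>, the endomorphism of the identity functor \<open>\<Omega>\<close>, and the parameters \<open>t\<close> and \<open>k\<close>.\<close>

record ('o, 'm) ccat = "('o, 'm, complex) tcat" +
  hob :: "'o"
  hdob :: "'o"
  evm :: "'m"
  omg :: "'o \<Rightarrow> 'm"
  tpar :: complex
  kpar :: complex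

definition ind_omg :: "('o, 'm) ccat \<Rightarrow> ('i, 'o, 'm) indob \<Rightarrow> ('i, 'i, 'o, 'm) indmor" where
  "ind_omg C M = ind_lev C M M (\<lambda>i. omg C (lev M i))"

text \<open>\<open>\<Omega>\<^sup>3\<close> and \<open>\<Omega>\<^sup>1\<^sup>,\<^sup>3\<close> on \<open>(h \<otimes> h*) \<otimes> M\<close>: the latter is conjugate to \<open>\<Omega>\<close> on the factor
  \<open>h \<otimes> M\<close> of \<open>h* \<otimes> (h \<otimes> M)\<close>.\<close>

definition omega3 :: "('o, 'm) ccat \<Rightarrow> ('i, 'o, 'm) indob \<Rightarrow> ('i, 'i, 'o, 'm) indmor" where
  "omega3 C M = idn C (tno C (hob C) (hdob C)) \<boxtimes>\<^bsub>C\<^esub> ind_omg C M"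

definition omega13 :: "('o, 'm) ccat \<Rightarrow> ('i, 'o, 'm) indob \<Rightarrow> ('i, 'i, 'o, 'm) indmor" where
  "omega13 C M = (let h = hob C; h' = hdob C in
     (swp C h' h \<boxtimes>\<^bsub>C\<^esub> ind_id C M) \<star>\<^bsub>C\<^esub> ind_asci C h' h M
     \<star>\<^bsub>C\<^esub> (idn C h' \<boxtimes>\<^bsub>C\<^esub> ind_omg C (ind_tno C h M))
     \<star>\<^bsub>C\<^esub> ind_asc C h' h M \<star>\<^bsub>C\<^esub> (swp C h h' \<boxtimes>\<^bsub>C\<^esub> ind_id C M))"

text \<open>For \<open>V = h\<close> or \<open>V = h*\<close> and \<open>z : V \<otimes> M \<rightarrow> M\<close>:
  \<open>z \<circ> (1 \<otimes> z) \<circ> ((1 - \<sigma>) \<otimes> 1) = 0\<close> on \<open>(V \<otimes> V) \<otimes> M\<close>.\<close>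

definition commuting_action :: "('o, 'm) ccat \<Rightarrow> 'o \<Rightarrow> ('i, 'o, 'm) indob
    \<Rightarrow> ('i, 'i, 'o, 'm) indmor \<Rightarrow> bool" where
  "commuting_action C V M z \<longleftrightarrow>
     z \<star>\<^bsub>C\<^esub> (idn C V \<boxtimes>\<^bsub>C\<^esub> z) \<star>\<^bsub>C\<^esub> ind_asc C V V M
       \<star>\<^bsub>C\<^esub> (pls C (idn C (tno C V V)) (scl C (- 1) (swp C V V)) \<boxtimes>\<^bsub>C\<^esub> ind_id C M)
     = ind_zer C (ind_tno C (tno C V V) M) M"

definition cherednik_relation :: "('o, 'm) ccat \<Rightarrow> ('i, 'o, 'm) indob
    \<Rightarrow> ('i, 'i, 'o, 'm) indmor \<Rightarrow> ('i, 'i, 'o, 'm) indmor \<Rightarrow> bool" where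
  "cherednik_relation C M x y \<longleftrightarrow> (let h = hob C; h' = hdob C;
       ev1 = ind_lun C M \<star>\<^bsub>C\<^esub> (evm C \<boxtimes>\<^bsub>C\<^esub> ind_id C M) in
     (y \<star>\<^bsub>C\<^esub> (idn C h \<boxtimes>\<^bsub>C\<^esub> x) \<star>\<^bsub>C\<^esub> ind_asc C h h' M)
     \<boxminus>\<^bsub>C\<^esub> (x \<star>\<^bsub>C\<^esub> (idn C h' \<boxtimes>\<^bsub>C\<^esub> y) \<star>\<^bsub>C\<^esub> ind_asc C h' h M \<star>\<^bsub>C\<^esub> (swp C h h' \<boxtimes>\<^bsub>C\<^esub> ind_id C M))
     = ind_scl C (tpar C) ev1
     \<boxminus>\<^bsub>C\<^esub> ind_scl C (kpar C) (ev1 \<star>\<^bsub>C\<^esub> (omega3 C M \<boxminus>\<^bsub>C\<^esub> omega13 C M)))"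

type_synonym ('i, 'o, 'm) hmod =
  "('i, 'o, 'm) indob \<times> ('i, 'i, 'o, 'm) indmor \<times> ('i, 'i, 'o, 'm) indmor"

definition RepH_obs :: "('o, 'm) ccat \<Rightarrow> ('i, 'o, 'm) hmod set" where
  "RepH_obs C = {(M, x, y). M \<in> ind_obs C
     \<and> x \<in> ind_hom C (ind_tno C (hdob C) M) M \<and> y \<in> ind_hom C (ind_tno C (hob C) M) M
     \<and> commuting_action C (hdob C) M x \<and> commuting_action C (hob C) M y
     \<and> cherednik_relation C M x y}"

definition RepH_hom :: "('o, 'm) ccat \<Rightarrow> ('i, 'o, 'm) hmod \<Rightarrow> ('j, 'o, 'm) hmod
    \<Rightarrow> ('i, 'j, 'o, 'm) indmor set" where
  "RepH_hom C = (\<lambda>(M, x, y) (N, x', y'). {f \<in> ind_hom C M N.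
     (M, x, y) \<in> RepH_obs C \<and> (N, x', y') \<in> RepH_obs C
     \<and> f \<star>\<^bsub>C\<^esub> x = x' \<star>\<^bsub>C\<^esub> (idn C (hdob C) \<boxtimes>\<^bsub>C\<^esub> f)
     \<and> f \<star>\<^bsub>C\<^esub> y = y' \<star>\<^bsub>C\<^esub> (idn C (hob C) \<boxtimes>\<^bsub>C\<^esub> f)})"

definition RepH_End :: "('o, 'm) ccat \<Rightarrow> ('i, 'o, 'm) hmod
    \<Rightarrow> (complex, ('i, 'i, 'o, 'm) indmor) module" where
  "RepH_End C A = (let M = fst A in
     \<lparr> carrier = RepH_hom C A A, monoid.mult = ind_cmp C, one = ind_id C M, ring.zero = ind_zer C M M,
       add = ind_pls C, module.smult = ind_scl C \<rparr>)"


section \<open>Induction and the deformed double current algebra\<close>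

definition deligne_ccat :: "nat filter \<Rightarrow> (nat \<Rightarrow> 'k ring) \<Rightarrow> (nat \<Rightarrow> nat)
    \<Rightarrow> ((nat \<Rightarrow> 'k) set \<Rightarrow> complex) \<Rightarrow> complex \<Rightarrow> complex
    \<Rightarrow> (nat \<Rightarrow> 'k rep, (nat \<Rightarrow> 'k rmor) set) ccat" where
  "deligne_ccat F K \<nu>s \<psi> t k = (let cl = ucls F (\<lambda>n. rep_cat (K n) (\<nu>s n)) in
     tcat.extend (deligne_cat F K \<nu>s \<psi>) (ccat.fields
       (\<lambda>n. h_rep (K n) (\<nu>s n))
       (\<lambda>n. hd_rep (K n) (\<nu>s n))
       (cl (\<lambda>n. ev_mor (K n) (\<nu>s n)))
       (\<lambda>V. cl (\<lambda>n. omega_mor (K n) (\<nu>s n) (V n)))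
       t k))"

text \<open>For a family of finite, increasing sets \<open>D L\<close> of bidegrees: the ind-object given by the direct
  sum of \<open>S^i(h*) \<otimes> S^j(h) \<otimes> V\<close> over the union of the \<open>D L\<close>, as the colimit of its
  subobjects \<open>sym_lev K \<nu>s (D L) V\<close>.\<close>

definition sym_lev :: "(nat \<Rightarrow> 'k ring) \<Rightarrow> (nat \<Rightarrow> nat) \<Rightarrow> (nat \<times> nat) set \<Rightarrow> (nat \<Rightarrow> 'k rep)
    \<Rightarrow> nat \<Rightarrow> 'k rep" where
  "sym_lev K \<nu>s D V = (\<lambda>n. rep_tensor (K n) (sym_part (K n) (\<nu>s n) D) (V n))"

definition sym_incl :: "nat filter \<Rightarrow> (nat \<Rightarrow> 'k ring) \<Rightarrow> (nat \<Rightarrow> nat) \<Rightarrow> (nat \<times> nat) set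
    \<Rightarrow> (nat \<times> nat) set \<Rightarrow> (nat \<Rightarrow> 'k rep) \<Rightarrow> (nat \<Rightarrow> 'k rmor) set" where
  "sym_incl F K \<nu>s D D' V = ucls F (\<lambda>n. rep_cat (K n) (\<nu>s n))
     (\<lambda>n. map_mor (K n) (sym_lev K \<nu>s D V n) (sym_lev K \<nu>s D' V n) id)"

definition sym_ind :: "nat filter \<Rightarrow> (nat \<Rightarrow> 'k ring) \<Rightarrow> (nat \<Rightarrow> nat) \<Rightarrow> (nat \<Rightarrow> (nat \<times> nat) set)
    \<Rightarrow> (nat \<Rightarrow> 'k rep) \<Rightarrow> (nat, nat \<Rightarrow> 'k rep, (nat \<Rightarrow> 'k rmor) set) indob" where
  "sym_ind F K \<nu>s D V = \<lparr> idx = UNIV, idle = (\<le>), lev = (\<lambda>L. sym_lev K \<nu>s (D L) V),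
     trn = (\<lambda>L L'. sym_incl F K \<nu>s (D L) (D L') V) \<rparr>"

definition all_deg :: "nat \<Rightarrow> (nat \<times> nat) set" where
  "all_deg L = {(i, j). i + j \<le> L}"

definition y_deg :: "nat \<Rightarrow> (nat \<times> nat) set" where
  "y_deg L = {(i, j). i = 0 \<and> j \<le> L}"

definition mult_x :: "nat filter \<Rightarrow> (nat \<Rightarrow> 'k ring) \<Rightarrow> (nat \<Rightarrow> nat)
    \<Rightarrow> (nat \<Rightarrow> 'k rep, (nat \<Rightarrow> 'k rmor) set) ccat \<Rightarrow> (nat \<Rightarrow> 'k rep)
    \<Rightarrow> (nat, nat, nat \<Rightarrow> 'k rep, (nat \<Rightarrow> 'k rmor) set) indmor" where
  "mult_x F K \<nu>s C V = (let M = sym_ind F K \<nu>s all_deg V in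
     ind_mk C (ind_tno C (hdob C) M) M (\<lambda>L. {(Suc L, ucls F (\<lambda>n. rep_cat (K n) (\<nu>s n))
       (\<lambda>n. map_mor (K n) (tno C (hdob C) (lev M L) n) (lev M (Suc L) n) mult_x_map))}))"

definition mult_y0 :: "nat filter \<Rightarrow> (nat \<Rightarrow> 'k ring) \<Rightarrow> (nat \<Rightarrow> nat)
    \<Rightarrow> (nat \<Rightarrow> 'k rep, (nat \<Rightarrow> 'k rmor) set) ccat \<Rightarrow> (nat \<Rightarrow> 'k rep)
    \<Rightarrow> (nat, nat, nat \<Rightarrow> 'k rep, (nat \<Rightarrow> 'k rmor) set) indmor" where
  "mult_y0 F K \<nu>s C V = (let M = sym_ind F K \<nu>s all_deg V; P = sym_ind F K \<nu>s y_deg V in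
     ind_mk C (ind_tno C (hob C) P) M (\<lambda>L. {(Suc L, ucls F (\<lambda>n. rep_cat (K n) (\<nu>s n))
       (\<lambda>n. map_mor (K n) (tno C (hob C) (lev P L) n) (lev M (Suc L) n) mult_y_map))}))"

definition y0_incl :: "nat filter \<Rightarrow> (nat \<Rightarrow> 'k ring) \<Rightarrow> (nat \<Rightarrow> nat)
    \<Rightarrow> (nat \<Rightarrow> 'k rep, (nat \<Rightarrow> 'k rmor) set) ccat \<Rightarrow> (nat \<Rightarrow> 'k rep)
    \<Rightarrow> (nat, nat, nat \<Rightarrow> 'k rep, (nat \<Rightarrow> 'k rmor) set) indmor" where
  "y0_incl F K \<nu>s C V = ind_lev C (sym_ind F K \<nu>s y_deg V) (sym_ind F K \<nu>s all_deg V)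
     (\<lambda>L. sym_incl F K \<nu>s (y_deg L) (all_deg L) V)"

text \<open>Multiplication \<open>h* \<otimes> S^i(h*) \<rightarrow> S^(i+1)(h*)\<close> is an epimorphism, so the commutation relation
  determines \<open>y\<close> on the part of degree \<open>i + 1\<close> in \<open>h*\<close> from \<open>y\<close> on the part of degree \<open>i\<close>. Hence
  \<open>y\<close> is the unique morphism with the prescribed restriction to the part \<open>i = 0\<close> that satisfies
  the commutation relation.\<close>

definition ind_y :: "nat filter \<Rightarrow> (nat \<Rightarrow> 'k ring) \<Rightarrow> (nat \<Rightarrow> nat)
    \<Rightarrow> (nat \<Rightarrow> 'k rep, (nat \<Rightarrow> 'k rmor) set) ccat \<Rightarrow> (nat \<Rightarrow> 'k rep)
    \<Rightarrow> (nat, nat, nat \<Rightarrow> 'k rep, (nat \<Rightarrow> 'k rmor) set) indmor" where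
  "ind_y F K \<nu>s C V = (let M = sym_ind F K \<nu>s all_deg V in
     THE y. y \<in> ind_hom C (ind_tno C (hob C) M) M
       \<and> y \<star>\<^bsub>C\<^esub> (idn C (hob C) \<boxtimes>\<^bsub>C\<^esub> y0_incl F K \<nu>s C V) = mult_y0 F K \<nu>s C V
       \<and> cherednik_relation C M (mult_x F K \<nu>s C V) y)"

definition induced :: "nat filter \<Rightarrow> (nat \<Rightarrow> 'k ring) \<Rightarrow> (nat \<Rightarrow> nat)
    \<Rightarrow> (nat \<Rightarrow> 'k rep, (nat \<Rightarrow> 'k rmor) set) ccat \<Rightarrow> (nat \<Rightarrow> 'k rep)
    \<Rightarrow> (nat, nat \<Rightarrow> 'k rep, (nat \<Rightarrow> 'k rmor) set) hmod" where
  "induced F K \<nu>s C V =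
     (sym_ind F K \<nu>s all_deg V, mult_x F K \<nu>s C V, ind_y F K \<nu>s C V)"

definition DDCA :: "nat filter \<Rightarrow> (nat \<Rightarrow> 'k ring) \<Rightarrow> (nat \<Rightarrow> nat)
    \<Rightarrow> ((nat \<Rightarrow> 'k) set \<Rightarrow> complex) \<Rightarrow> complex \<Rightarrow> complex
    \<Rightarrow> (complex, (nat, nat, nat \<Rightarrow> 'k rep, (nat \<Rightarrow> 'k rmor) set) indmor) module" where
  "DDCA F K \<nu>s \<psi> t k = (let C = deligne_ccat F K \<nu>s \<psi> t k in
     RepH_End C (induced F K \<nu>s C (unt C)))"

end

theory Submission
  imports Defs
begin

text \<open>An element of the underlying object of \<open>He\<close> at a finite rank \<open>n\<close> is a polynomial in the \<open>x\<^sub>i\<close> and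
  \<open>y\<^sub>i\<close>. On this space \<open>P\<close>, let \<open>X\<^sub>i\<close> be multiplication by \<open>x\<^sub>i\<close> and let \<open>Y\<^sub>i\<close> be the operator obtained by
  moving \<open>y\<^sub>i\<close> to the right past the \<open>x\<^sub>j\<close>. The Jacobi identity for the brackets \<open>[y\<^sub>i, x\<^sub>j]\<close> shows that the \<open>Y\<^sub>i\<close>
  commute, so \<open>P\<close> satisfies the Cherednik relations, and an invariant vector \<open>v\<close> of any module with these
  relations extends uniquely to a map from \<open>P\<close> that sends \<open>1\<close> to \<open>v\<close>. The interchange of \<open>x\<^sub>i\<close> and \<open>y\<^sub>i\<close>
  reverses products and preserves the relations; hence \<open>eH\<close> with right multiplication by \<open>y\<^sub>i\<close>, \<open>x\<^sub>i\<close> is such a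
  module too. The map \<open>\<Psi> : P \<rightarrow> eH\<close>, \<open>1 \<mapsto> e\<close>, is bijective, because \<open>P\<close> is conversely a right
  \<open>H\<close>-module generated by \<open>1\<close>; it respects degrees, takes the invariants onto \<open>eHe\<close>, and takes the
  composition of endomorphisms of \<open>P\<close> to the product.

  In the Deligne category a morphism of the ind-objects in question is a sequence of column families
  up to equality almost everywhere in every bounded degree; a single sequence serves all degrees
  at once by a diagonal argument. An endomorphism of \<open>He\<close> is therefore determined by its value at \<open>1\<close>,
  which is a sequence of invariants of bounded degree modulo equality almost everywhere, and \<open>\<Psi>\<close>
  turns this into an element of the restricted ultraproduct of the algebras \<open>eHe\<close>.\<close>

section \<open>Free modules\<close>

text \<open>The bijectivity of \<open>Psi\<close> carries the content of the PBW theorem for eH: the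
  space \<open>P\<close> is fixed in advance, its operators are shown to satisfy the relations, and
  the right action of H on it supplies the inverse. End(He) is by nature the opposite algebra of
  eHe; the interchange of x and y undoes the reversal, so the final isomorphism preserves products.

  Two kinds of invertibility enter. The idempotent e needs n! to be a unit at every index, where the
  characteristic is 0 or exceeds the rank. The symmetric powers must lie in the category generated
  by h, hence be summands of tensor powers; this needs each fixed integer i + 1 to be a unit at
  almost all indices, and here the distinctness of the primes is used.

  Only permutation representations occur, and their tensor products are literally permutation
  representations. Morphisms are therefore families of columns written without source and target, so
  one family can describe an ind-morphism in all degrees. A single degree bound for all indices
  comes from the component of an endomorphism in degree 0.\<close>

definition vec :: "'k ring \<Rightarrow> 'b set \<Rightarrow> ('k, 'b \<Rightarrow> 'k) module" where
  "vec K B = \<lparr> carrier = {f. (\<forall>u. f u \<in> carrier K) \<and> finite {u. f u \<noteq> \<zero>\<^bsub>K\<^esub>} \<and> {u. f u \<noteq> \<zero>\<^bsub>K\<^esub>} \<subseteq> B},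
     monoid.mult = (\<lambda>f g u. \<zero>\<^bsub>K\<^esub>), one = (\<lambda>u. \<zero>\<^bsub>K\<^esub>), ring.zero = (\<lambda>u. \<zero>\<^bsub>K\<^esub>),
     add = (\<lambda>f g u. f u \<oplus>\<^bsub>K\<^esub> g u), module.smult = (\<lambda>c f u. c \<otimes>\<^bsub>K\<^esub> f u) \<rparr>"

definition ve :: "'k ring \<Rightarrow> 'b \<Rightarrow> 'b \<Rightarrow> 'k" where
  "ve K c = (\<lambda>u. if u = c then \<one>\<^bsub>K\<^esub> else \<zero>\<^bsub>K\<^esub>)"

definition lin :: "'k ring \<Rightarrow> ('k, 'n) module \<Rightarrow> ('b \<Rightarrow> 'n) \<Rightarrow> ('b \<Rightarrow> 'k) \<Rightarrow> 'n" where
  "lin K N T v = finsum N (\<lambda>c. v c \<odot>\<^bsub>N\<^esub> T c) {c. v c \<noteq> \<zero>\<^bsub>K\<^esub>}"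

definition klin :: "'k ring \<Rightarrow> ('k, 'm) module \<Rightarrow> ('k, 'n) module \<Rightarrow> ('m \<Rightarrow> 'n) \<Rightarrow> bool" where
  "klin K M N f \<longleftrightarrow> (\<forall>x\<in>carrier M. f x \<in> carrier N)
     \<and> (\<forall>x\<in>carrier M. \<forall>y\<in>carrier M. f (x \<oplus>\<^bsub>M\<^esub> y) = f x \<oplus>\<^bsub>N\<^esub> f y)
     \<and> (\<forall>a\<in>carrier K. \<forall>x\<in>carrier M. f (a \<odot>\<^bsub>M\<^esub> x) = a \<odot>\<^bsub>N\<^esub> f x)"

lemma klinD:
  assumes "klin K M N f"
  shows "x \<in> carrier M \<Longrightarrow> f x \<in> carrier N"
    and "x \<in> carrier M \<Longrightarrow> y \<in> carrier M \<Longrightarrow> f (x \<oplus>\<^bsub>M\<^esub> y) = f x \<oplus>\<^bsub>N\<^esub> f y"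
    and "a \<in> carrier K \<Longrightarrow> x \<in> carrier M \<Longrightarrow> f (a \<odot>\<^bsub>M\<^esub> x) = a \<odot>\<^bsub>N\<^esub> f x"
  using assms by (auto simp: klin_def)

lemma klin_id: "klin K M M (\<lambda>x. x)"
  by (auto simp: klin_def)

lemma klin_comp: "klin K M N f \<Longrightarrow> klin K N Q g \<Longrightarrow> klin K M Q (\<lambda>x. g (f x))"
  by (auto simp: klin_def)

lemma klin_zero: "module K M \<Longrightarrow> module K N \<Longrightarrow> klin K M N f \<Longrightarrow> f \<zero>\<^bsub>M\<^esub> = \<zero>\<^bsub>N\<^esub>"
proof -
  assume a: "module K M" "module K N" and f: "klin K M N f"
  interpret M: module K M by fact
  interpret N: module K N by fact
  have "f (\<zero>\<^bsub>K\<^esub> \<odot>\<^bsub>M\<^esub> \<zero>\<^bsub>M\<^esub>) = \<zero>\<^bsub>K\<^esub> \<odot>\<^bsub>N\<^esub> f \<zero>\<^bsub>M\<^esub>" by (rule klinD(3)[OF f]) auto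
  thus ?thesis using klinD(1)[OF f, of "\<zero>\<^bsub>M\<^esub>"] by simp
qed

lemma klin_neg:
  assumes "module K M" "module K N" and f: "klin K M N f" and x: "x \<in> carrier M"
  shows "f (\<ominus>\<^bsub>M\<^esub> x) = \<ominus>\<^bsub>N\<^esub> f x"
proof -
  interpret M: module K M by fact
  interpret N: module K N by fact
  have "f x \<oplus>\<^bsub>N\<^esub> f (\<ominus>\<^bsub>M\<^esub> x) = \<zero>\<^bsub>N\<^esub>" using klinD(2)[OF f, of x "\<ominus>\<^bsub>M\<^esub> x"] x klin_zero[OF assms(1,2) f]
    by (simp add: M.r_neg)
  thus ?thesis using klinD(1)[OF f] x by (metis M.a_inv_closed N.M.add.m_comm N.minus_equality)
qed

lemma klin_minus:
  assumes "module K M" "module K N" and f: "klin K M N f" and x: "x \<in> carrier M" "y \<in> carrier M"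
  shows "f (x \<ominus>\<^bsub>M\<^esub> y) = f x \<ominus>\<^bsub>N\<^esub> f y"
proof -
  interpret M: module K M by fact
  interpret N: module K N by fact
  show ?thesis using klinD[OF f] x klin_neg[OF assms(1-3)] by (simp add: a_minus_def)
qed

lemma klin_finsum:
  assumes "module K M" "module K N" and f: "klin K M N f" and "g \<in> A \<rightarrow> carrier M"
  shows "f (finsum M g A) = finsum N (\<lambda>i. f (g i)) A"
proof -
  interpret M: module K M by fact
  interpret N: module K N by fact
  show ?thesis using assms(4)
  proof (induction A rule: infinite_finite_induct)
    case (infinite A) thus ?case using klin_zero[OF assms(1-3)] by (simp add: M.M.add.finprod_infinite N.M.add.finprod_infinite)
  next
    case empty thus ?case using klin_zero[OF assms(1-3)] by simp
  next
    case (insert x A)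
    hence "(\<lambda>i. f (g i)) \<in> A \<rightarrow> carrier N" "f (g x) \<in> carrier N" "g x \<in> carrier M" "g \<in> A \<rightarrow> carrier M" using klinD(1)[OF f] by auto
    thus ?case using insert by (simp add: klinD(2)[OF f])
  qed
qed

lemma klin_zerof: "module K N \<Longrightarrow> klin K M N (\<lambda>x. \<zero>\<^bsub>N\<^esub>)"
proof -
  assume "module K N"
  then interpret N: module K N .
  show ?thesis by (auto simp: klin_def)
qed

lemma klin_add:
  assumes "module K N" "klin K M N f" "klin K M N g" shows "klin K M N (\<lambda>x. f x \<oplus>\<^bsub>N\<^esub> g x)"
proof -
  interpret N: module K N by fact
  show ?thesis using assms(2,3) by (auto simp: klin_def N.smult_r_distr N.M.add.m_ac)
qed

lemma klin_smult:
  assumes "module K N" "klin K M N f" "a \<in> carrier K" shows "klin K M N (\<lambda>x. a \<odot>\<^bsub>N\<^esub> f x)"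
proof -
  interpret N: module K N by fact
  show ?thesis using assms(2,3) by (auto simp: klin_def N.smult_r_distr N.smult_assoc1[symmetric] N.R.m_comm)
qed

lemma klin_negf:
  assumes "module K N" "klin K M N f" shows "klin K M N (\<lambda>x. \<ominus>\<^bsub>N\<^esub> f x)"
proof -
  interpret N: module K N by fact
  show ?thesis using assms(2) by (auto simp: klin_def N.minus_add N.M.add.m_comm N.smult_r_minus)
qed

lemma klin_minusf:
  assumes "module K N" "klin K M N f" "klin K M N g" shows "klin K M N (\<lambda>x. f x \<ominus>\<^bsub>N\<^esub> g x)"
  using klin_add[OF assms(1,2) klin_negf[OF assms(1,3)]] by (simp add: a_minus_def)

lemma klin_cong:
  assumes "module K M" "klin K M N f" "\<And>x. x \<in> carrier M \<Longrightarrow> g x = f x" shows "klin K M N g"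
proof -
  interpret M: module K M by fact
  show ?thesis using assms(2,3) by (auto simp: klin_def)
qed

lemma klin_finsumf:
  assumes M: "module K M" and "module K N" "\<And>i. i \<in> A \<Longrightarrow> klin K M N (f i)" shows "klin K M N (\<lambda>x. finsum N (\<lambda>i. f i x) A)"
proof -
  interpret N: module K N by fact
  show ?thesis using assms(3)
  proof (induction A rule: infinite_finite_induct)
    case (infinite A) thus ?case using klin_zerof[OF assms(2)] by (simp add: N.M.add.finprod_infinite)
  next
    case empty thus ?case using klin_zerof[OF assms(2)] by simp
  next
    case (insert i A)
    have c: "(\<lambda>i. f i x) \<in> A \<rightarrow> carrier N" "f i x \<in> carrier N" if "x \<in> carrier M" for x
      using insert(4) that by (auto simp: klin_def)
    have "klin K M N (\<lambda>x. f i x \<oplus>\<^bsub>N\<^esub> finsum N (\<lambda>i. f i x) A)"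
      by (rule klin_add[OF assms(2)]) (use insert in auto)
    moreover have "finsum N (\<lambda>i. f i x) (insert i A) = f i x \<oplus>\<^bsub>N\<^esub> finsum N (\<lambda>i. f i x) A" if "x \<in> carrier M" for x
      using insert(1,2) c[OF that] by simp
    ultimately show ?case by (rule klin_cong[OF M])
  qed
qed

locale coeff_ring = cring K for K :: "'k ring" (structure)
begin

lemma vec_carrier: "v \<in> carrier (vec K B) \<longleftrightarrow> (\<forall>u. v u \<in> carrier K) \<and> finite {u. v u \<noteq> \<zero>} \<and> {u. v u \<noteq> \<zero>} \<subseteq> B"
  by (simp add: vec_def)

lemma vec_simps: "\<zero>\<^bsub>vec K B\<^esub> = (\<lambda>u. \<zero>)" "v \<oplus>\<^bsub>vec K B\<^esub> w = (\<lambda>u. v u \<oplus> w u)" "a \<odot>\<^bsub>vec K B\<^esub> v = (\<lambda>u. a \<otimes> v u)"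
  by (simp_all add: vec_def)

lemma vec_mono: "v \<in> carrier (vec K B) \<Longrightarrow> B \<subseteq> B' \<Longrightarrow> v \<in> carrier (vec K B')"
  by (auto simp: vec_carrier)

lemma vec_module: "module K (vec K B)"
proof (rule moduleI)
  show "cring K" by (rule is_cring)
  show "abelian_group (vec K B)"
  proof (rule abelian_groupI)
    fix x y assume a: "x \<in> carrier (vec K B)" "y \<in> carrier (vec K B)"
    have "{u. x u \<oplus> y u \<noteq> \<zero>} \<subseteq> {u. x u \<noteq> \<zero>} \<union> {u. y u \<noteq> \<zero>}" using a by (auto simp: vec_carrier)
    thus "x \<oplus>\<^bsub>vec K B\<^esub> y \<in> carrier (vec K B)" using a finite_subset[of "{u. x u \<oplus> y u \<noteq> \<zero>}" "{u. x u \<noteq> \<zero>} \<union> {u. y u \<noteq> \<zero>}"]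
      unfolding vec_carrier vec_simps by (intro conjI allI) auto
  next
    fix x assume a: "x \<in> carrier (vec K B)"
    have "{u. \<ominus> x u \<noteq> \<zero>} \<subseteq> {u. x u \<noteq> \<zero>}" by auto
    hence "(\<lambda>u. \<ominus> x u) \<in> carrier (vec K B)" using a finite_subset[of "{u. \<ominus> x u \<noteq> \<zero>}" "{u. x u \<noteq> \<zero>}"]
      unfolding vec_carrier by (intro conjI allI) auto
    moreover have "(\<lambda>u. \<ominus> x u) \<oplus>\<^bsub>vec K B\<^esub> x = \<zero>\<^bsub>vec K B\<^esub>" using a by (auto simp: vec_carrier vec_simps l_neg)
    ultimately show "\<exists>y\<in>carrier (vec K B). y \<oplus>\<^bsub>vec K B\<^esub> x = \<zero>\<^bsub>vec K B\<^esub>" by blast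
  qed (auto simp: vec_carrier vec_simps a_ac)
  fix a x assume a: "a \<in> carrier K" "x \<in> carrier (vec K B)"
  have "{u. a \<otimes> x u \<noteq> \<zero>} \<subseteq> {u. x u \<noteq> \<zero>}" using a by (auto simp: vec_carrier)
  thus "a \<odot>\<^bsub>vec K B\<^esub> x \<in> carrier (vec K B)" using a finite_subset[of "{u. a \<otimes> x u \<noteq> \<zero>}" "{u. x u \<noteq> \<zero>}"]
    unfolding vec_carrier vec_simps by (intro conjI allI) auto
qed (auto simp: vec_carrier vec_simps l_distr r_distr m_assoc)

lemma ve_carrier: "c \<in> B \<Longrightarrow> ve K c \<in> carrier (vec K B)"
  by (auto simp: vec_carrier ve_def)

lemma ve_cases: "ve K c u = (if u = c then \<one> else \<zero>)"
  by (simp add: ve_def)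

text \<open>The support is finite, so coefficients can be split off one at a time; the part that
  remains has one basis vector fewer in its support.\<close>

lemma vec_induct [consumes 1, case_names zero step]:
  assumes v: "v \<in> carrier (vec K B)" and z: "P (\<lambda>u. \<zero>)"
    and s: "\<And>a c v. v \<in> carrier (vec K B) \<Longrightarrow> a \<in> carrier K \<Longrightarrow> c \<in> B \<Longrightarrow> v c = \<zero> \<Longrightarrow> P v \<Longrightarrow> P ((a \<odot>\<^bsub>vec K B\<^esub> ve K c) \<oplus>\<^bsub>vec K B\<^esub> v)"
  shows "P v"
proof -
  define A where "A = {u. v u \<noteq> \<zero>}"
  have "finite A" using v by (simp add: A_def vec_carrier)
  thus ?thesis using v A_def
  proof (induction A arbitrary: v rule: finite_induct)
    case empty
    hence "v = (\<lambda>u. \<zero>)" by auto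
    thus ?case using z by simp
  next
    case (insert c A)
    let ?w = "v(c := \<zero>)"
    have A: "A = {u. ?w u \<noteq> \<zero>}" using insert(2,5) by auto
    have w: "?w \<in> carrier (vec K B)" using insert(1,4) A by (auto simp: vec_carrier)
    have "v = (v c \<odot>\<^bsub>vec K B\<^esub> ve K c) \<oplus>\<^bsub>vec K B\<^esub> ?w"
      using insert(4) by (auto simp: vec_simps vec_carrier ve_def)
    moreover have "v c \<in> carrier K" "c \<in> B" using insert(4,5) by (auto simp: vec_carrier)
    ultimately show ?case using s[OF w, of "v c" c] insert(3)[OF w A] by simp
  qed
qed

lemma lin_superset:
  assumes N: "module K N" and S: "finite S" "{c. v c \<noteq> \<zero>} \<subseteq> S" "\<And>c. c \<in> S \<Longrightarrow> v c \<in> carrier K" "\<And>c. c \<in> S \<Longrightarrow> T c \<in> carrier N"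
  shows "lin K N T v = finsum N (\<lambda>c. v c \<odot>\<^bsub>N\<^esub> T c) S"
proof -
  interpret N: module K N by fact
  show ?thesis unfolding lin_def
    by (rule N.M.add.finprod_mono_neutral_cong_left[OF S(1,2)]) (use S in auto)
qed

lemma lin_cong: "(\<And>c. v c \<noteq> \<zero> \<Longrightarrow> T c = T' c) \<Longrightarrow> (\<And>c. v c \<noteq> \<zero> \<Longrightarrow> v c \<odot>\<^bsub>N\<^esub> T c \<in> carrier N) \<Longrightarrow> module K N \<Longrightarrow> lin K N T v = lin K N T' v"
  unfolding lin_def by (rule abelian_monoid.finsum_cong') (auto simp: module_def abelian_group_def)

lemma lin_klin:
  assumes N: "module K N" and T: "\<And>c. c \<in> B \<Longrightarrow> T c \<in> carrier N"
  shows "klin K (vec K B) N (lin K N T)"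
proof -
  interpret N: module K N by fact
  interpret V: module K "vec K B" by (rule vec_module)
  have cl: "v c \<odot>\<^bsub>N\<^esub> T c \<in> carrier N" if "v \<in> carrier (vec K B)" "c \<in> B" for v c
    using that T by (auto simp: vec_carrier)
  have sup: "lin K N T v = finsum N (\<lambda>c. v c \<odot>\<^bsub>N\<^esub> T c) S" if "finite S" "{c. v c \<noteq> \<zero>} \<subseteq> S" "S \<subseteq> B" "v \<in> carrier (vec K B)" for v S
    by (rule lin_superset[OF N that(1,2)]) (use that T in \<open>auto simp: vec_carrier\<close>)
  show ?thesis unfolding klin_def
  proof (intro conjI ballI)
    fix x assume x: "x \<in> carrier (vec K B)"
    show "lin K N T x \<in> carrier N" unfolding lin_def using x T by (intro N.M.finsum_closed) (auto simp: vec_carrier)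
  next
    fix x y assume x: "x \<in> carrier (vec K B)" and y: "y \<in> carrier (vec K B)"
    \<comment> \<open>The support of a sum may be smaller than the union of the supports, so all
      three values are computed as sums over this common finite set.\<close>
    let ?S = "{c. x c \<noteq> \<zero>} \<union> {c. y c \<noteq> \<zero>}"
    have S: "finite ?S" "?S \<subseteq> B" using x y by (auto simp: vec_carrier)
    have xy: "x \<oplus>\<^bsub>vec K B\<^esub> y \<in> carrier (vec K B)" using x y by simp
    have "lin K N T (x \<oplus>\<^bsub>vec K B\<^esub> y) = finsum N (\<lambda>c. (x \<oplus>\<^bsub>vec K B\<^esub> y) c \<odot>\<^bsub>N\<^esub> T c) ?S"
      using xy S x y by (intro sup) (auto simp: vec_simps vec_carrier)
    also have "\<dots> = finsum N (\<lambda>c. x c \<odot>\<^bsub>N\<^esub> T c \<oplus>\<^bsub>N\<^esub> y c \<odot>\<^bsub>N\<^esub> T c) ?S"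
      using S x y T by (intro N.M.finsum_cong') (auto simp: vec_simps vec_carrier N.smult_l_distr)
    also have "\<dots> = lin K N T x \<oplus>\<^bsub>N\<^esub> lin K N T y"
      using S x y cl sup[OF S(1) _ S(2) x] sup[OF S(1) _ S(2) y] by (subst N.M.finsum_addf) auto
    finally show "lin K N T (x \<oplus>\<^bsub>vec K B\<^esub> y) = lin K N T x \<oplus>\<^bsub>N\<^esub> lin K N T y" .
  next
    fix a x assume a: "a \<in> carrier K" and x: "x \<in> carrier (vec K B)"
    let ?S = "{c. x c \<noteq> \<zero>}"
    have S: "finite ?S" "?S \<subseteq> B" using x by (auto simp: vec_carrier)
    have ax: "a \<odot>\<^bsub>vec K B\<^esub> x \<in> carrier (vec K B)" using x a by simp
    have "lin K N T (a \<odot>\<^bsub>vec K B\<^esub> x) = finsum N (\<lambda>c. (a \<odot>\<^bsub>vec K B\<^esub> x) c \<odot>\<^bsub>N\<^esub> T c) ?S"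
      using ax S a by (intro sup) (auto simp: vec_simps)
    also have "\<dots> = finsum N (\<lambda>c. a \<odot>\<^bsub>N\<^esub> (x c \<odot>\<^bsub>N\<^esub> T c)) ?S"
      using S x a T by (intro N.M.finsum_cong') (auto simp: vec_simps vec_carrier N.smult_assoc1)
    also have "\<dots> = a \<odot>\<^bsub>N\<^esub> lin K N T x" unfolding lin_def
      by (rule N.finsum_smult_ldistr[symmetric]) (use S a x cl in auto)
    finally show "lin K N T (a \<odot>\<^bsub>vec K B\<^esub> x) = a \<odot>\<^bsub>N\<^esub> lin K N T x" .
  qed
qed

lemma lin_ve:
  assumes N: "module K N" and T: "T c \<in> carrier N"
  shows "lin K N T (ve K c) = T c"
proof -
  interpret N: module K N by fact
  have "lin K N T (ve K c) = finsum N (\<lambda>d. ve K c d \<odot>\<^bsub>N\<^esub> T d) {c}"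
    by (rule lin_superset[OF N]) (use T in \<open>auto simp: ve_def\<close>)
  thus ?thesis using T by (simp add: ve_def)
qed

lemma klin_ext:
  assumes N: "module K N" and f: "klin K (vec K B) N f" and g: "klin K (vec K B) N g"
    and e: "\<And>c. c \<in> B \<Longrightarrow> f (ve K c) = g (ve K c)" and v: "v \<in> carrier (vec K B)"
  shows "f v = g v"
  using v
proof (induction v rule: vec_induct)
  case zero
  show ?case using klin_zero[OF vec_module N f] klin_zero[OF vec_module N g] by (simp add: vec_simps)
next
  case (step a c v)
  interpret V: module K "vec K B" by (rule vec_module)
  show ?case using step e ve_carrier[of c B] by (simp add: klinD[OF f] klinD[OF g])
qed

lemma klin_lin:
  assumes N: "module K N" and f: "klin K (vec K B) N f" and v: "v \<in> carrier (vec K B)"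
  shows "f v = lin K N (\<lambda>c. f (ve K c)) v"
  by (rule klin_ext[OF N f lin_klin[OF N] _ v]) (auto simp: klinD[OF f] ve_carrier lin_ve[OF N])

lemma vec_finsum:
  assumes "g \<in> A \<rightarrow> carrier (vec K B)"
  shows "finsum (vec K B) g A u = (\<Oplus>i\<in>A. g i u)"
proof -
  interpret V: module K "vec K B" by (rule vec_module)
  show ?thesis using assms
  proof (induction A rule: infinite_finite_induct)
    case (infinite A) thus ?case by (simp add: V.M.add.finprod_infinite add.finprod_infinite vec_simps)
  next
    case empty thus ?case by (simp add: vec_simps)
  next
    case (insert x A)
    hence "(\<lambda>i. g i u) \<in> A \<rightarrow> carrier K" "g x u \<in> carrier K" by (auto simp: vec_carrier Pi_iff)
    thus ?case using insert by (simp add: vec_simps)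
  qed
qed


lemma lin_vec:
  assumes "finite S" "{c. v c \<noteq> \<zero>} \<subseteq> S" "\<And>c. c \<in> S \<Longrightarrow> v c \<in> carrier K" "\<And>c. c \<in> S \<Longrightarrow> T c \<in> carrier (vec K B)"
  shows "lin K (vec K B) T v r = (\<Oplus>c\<in>S. v c \<otimes> T c r)"
proof -
  interpret V: module K "vec K B" by (rule vec_module)
  have "lin K (vec K B) T v r = finsum (vec K B) (\<lambda>c. v c \<odot>\<^bsub>vec K B\<^esub> T c) S r"
    using lin_superset[OF vec_module assms(1,2), of T B] assms(3,4) by simp
  also have "\<dots> = (\<Oplus>c\<in>S. (v c \<odot>\<^bsub>vec K B\<^esub> T c) r)"
    by (rule vec_finsum) (use assms in auto)
  finally show ?thesis by (simp add: vec_simps)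
qed

text \<open>Sums in these modules are formed coordinatewise, so the basis of the target matters only
  for membership. This moves computations freely between the pieces of bounded degree, the whole
  space \<open>P\<close> and the module on all basis vectors.\<close>

lemma lin_vec_irrel:
  assumes "v \<in> carrier (vec K C)" "\<And>c. c \<in> C \<Longrightarrow> T c \<in> carrier (vec K B)" "\<And>c. c \<in> C \<Longrightarrow> T c \<in> carrier (vec K B')"
  shows "lin K (vec K B) T v = lin K (vec K B') T v"
proof
  fix r
  have s: "finite {c. v c \<noteq> \<zero>}" "{c. v c \<noteq> \<zero>} \<subseteq> C" "\<And>c. v c \<in> carrier K" using assms(1) by (auto simp: vec_carrier)
  show "lin K (vec K B) T v r = lin K (vec K B') T v r"
    using s assms by (subst (1 2) lin_vec[where S="{c. v c \<noteq> \<zero>}"]) auto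
qed

end

text \<open>The operators attached to the elements of a multiset are applied in an arbitrarily
  chosen order; by \<open>foldr_mset\<close> the order is irrelevant as soon as they commute on an
  invariant set that contains the starting value.\<close>

definition mfold :: "('z \<Rightarrow> 'a \<Rightarrow> 'a) \<Rightarrow> 'a \<Rightarrow> 'z multiset \<Rightarrow> 'a" where
  "mfold T v a = foldr T (SOME xs. mset xs = a) v"

lemma foldr_closed:
  assumes "\<And>z x. z \<in> Z \<Longrightarrow> x \<in> S \<Longrightarrow> T z x \<in> S" "v \<in> S" "set xs \<subseteq> Z"
  shows "foldr T xs v \<in> S"
  using assms(3) by (induction xs) (auto simp: assms(1,2))

lemma foldr_mset:
  assumes T: "\<And>z x. z \<in> Z \<Longrightarrow> x \<in> S \<Longrightarrow> T z x \<in> S"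
    and C: "\<And>z z' x. z \<in> Z \<Longrightarrow> z' \<in> Z \<Longrightarrow> x \<in> S \<Longrightarrow> T z (T z' x) = T z' (T z x)"
    and v: "v \<in> S"
  shows "mset xs = mset ys \<Longrightarrow> set xs \<subseteq> Z \<Longrightarrow> foldr T xs v = foldr T ys v"
proof (induction xs arbitrary: ys)
  case (Cons z xs)
  \<comment> \<open>Commutativity pulls any occurrence of \<open>z\<close> to the front of the list,
    past the operators that precede it.\<close>
  have move: "foldr T (us @ z # ws) v = T z (foldr T (us @ ws) v)" if "set us \<subseteq> Z" "set ws \<subseteq> Z" "z \<in> Z" for us ws z
    using that
  proof (induction us)
    case (Cons u us)
    have "foldr T (us @ ws) v \<in> S" by (rule foldr_closed[of Z]) (use T v Cons in auto)
    thus ?case using Cons C by auto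
  qed simp
  have "z \<in> set ys" using Cons(2) by (metis list.set_intros(1) set_mset_mset)
  then obtain us ws where ys: "ys = us @ z # ws" by (meson split_list)
  have "set ys \<subseteq> Z" using Cons(2,3) by (metis set_mset_mset)
  hence "foldr T ys v = T z (foldr T (us @ ws) v)" using move ys by auto
  also have "foldr T (us @ ws) v = foldr T xs v"
    by (rule Cons(1)[symmetric]) (use Cons ys in auto)
  finally show ?case by simp
qed simp

lemma mfold_empty [simp]: "mfold T v {#} = v"
  by (simp add: mfold_def)

lemma mfold_set: "set (SOME xs. mset xs = a) = set_mset a" "mset (SOME xs. mset xs = a) = a"
proof -
  show "mset (SOME xs. mset xs = a) = a" by (rule someI_ex[OF ex_mset])
  thus "set (SOME xs. mset xs = a) = set_mset a" by (metis set_mset_mset)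
qed

lemma mfold_closed:
  assumes "\<And>z x. z \<in> Z \<Longrightarrow> x \<in> S \<Longrightarrow> T z x \<in> S" "v \<in> S" "set_mset a \<subseteq> Z"
  shows "mfold T v a \<in> S"
  unfolding mfold_def using assms by (intro foldr_closed[of Z]) (auto simp: mfold_set)

lemma mfold_add:
  assumes T: "\<And>z x. z \<in> Z \<Longrightarrow> x \<in> S \<Longrightarrow> T z x \<in> S"
    and C: "\<And>z z' x. z \<in> Z \<Longrightarrow> z' \<in> Z \<Longrightarrow> x \<in> S \<Longrightarrow> T z (T z' x) = T z' (T z x)"
    and v: "v \<in> S" and a: "z \<in> Z" "set_mset a \<subseteq> Z"
  shows "mfold T v (add_mset z a) = T z (mfold T v a)"
proof -
  have "foldr T (z # (SOME xs. mset xs = a)) v = foldr T (SOME xs. mset xs = add_mset z a) v"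
    by (rule foldr_mset[where Z=Z and S=S]) (use T C v a in \<open>auto simp: mfold_set\<close>)
  thus ?thesis by (simp add: mfold_def)
qed

lemma (in abelian_group) ag_cancel:
  assumes "a \<in> carrier G" "b \<in> carrier G" "c \<in> carrier G"
  shows "a \<oplus> (b \<ominus> (a \<oplus> c)) = b \<ominus> c"
proof -
  have "a \<oplus> (b \<ominus> (a \<oplus> c)) = (a \<oplus> \<ominus> a) \<oplus> (b \<oplus> \<ominus> c)"
    using assms by (simp only: a_minus_def minus_add a_ac a_closed a_inv_closed)
  thus ?thesis using assms by (simp add: r_neg a_minus_def)
qed

lemma (in abelian_group) ag_cancel2:
  "a \<in> carrier G \<Longrightarrow> b \<in> carrier G \<Longrightarrow> c \<in> carrier G \<Longrightarrow> (b \<ominus> (a \<oplus> c)) \<oplus> a = b \<ominus> c"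
  by (simp add: ag_cancel a_comm[of _ a])

lemma permutes_transpose: "i < n \<Longrightarrow> j < n \<Longrightarrow> transpose i j permutes {..<n::nat}"
  by (intro permutes_swap_id) auto

lemma transpose_conj: "bij g \<Longrightarrow> g \<circ> transpose i j = transpose (g i) (g j) \<circ> g"
  by (auto simp: fun_eq_iff transpose_def bij_def inj_def)

text \<open>An action of the symmetric group already suffices to write down the brackets as
  operators. The locale is instantiated by \<open>P\<close> and by the Cherednik algebra under right
  multiplication, which thereby share one definition of the brackets.\<close>

locale perm_group_module = coeff_ring K + module K N for K :: "'k ring" (structure) and N :: "('k, 'n) module" +
  fixes n :: nat and t k :: 'k and G :: "(nat \<Rightarrow> nat) \<Rightarrow> 'n \<Rightarrow> 'n"
  assumes t: "t \<in> carrier K" and k: "k \<in> carrier K"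
    and G: "\<And>g. g permutes {..<n} \<Longrightarrow> klin K N N (G g)"
    and G_comp: "\<And>g h p. g permutes {..<n} \<Longrightarrow> h permutes {..<n} \<Longrightarrow> p \<in> carrier N \<Longrightarrow> G (g \<circ> h) p = G g (G h p)"
    and G_id: "\<And>p. p \<in> carrier N \<Longrightarrow> G id p = p"
begin

text \<open>The action of \<open>[y\<^sub>i, x\<^sub>j]\<close>.\<close>

definition bracket :: "nat \<Rightarrow> nat \<Rightarrow> 'n \<Rightarrow> 'n" where
  "bracket i j p = (if i = j then t \<odot>\<^bsub>N\<^esub> p \<ominus>\<^bsub>N\<^esub> k \<odot>\<^bsub>N\<^esub> (finsum N (\<lambda>m. G (transpose i m) p) ({..<n} - {i}))
     else k \<odot>\<^bsub>N\<^esub> G (transpose i j) p)"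

lemma module_N: "module K N" by (rule module_axioms)

lemma Gtr: "i < n \<Longrightarrow> j < n \<Longrightarrow> klin K N N (G (transpose i j))"
  by (intro G permutes_transpose)

lemma bracket_klin: "i < n \<Longrightarrow> j < n \<Longrightarrow> klin K N N (bracket i j)"
proof -
  assume i: "i < n" "j < n"
  have s: "klin K N N (\<lambda>p. finsum N (\<lambda>m. G (transpose i m) p) ({..<n} - {i}))"
    by (rule klin_finsumf[OF module_N module_N]) (use i Gtr in auto)
  have e: "bracket i j = (if i = j then (\<lambda>p. t \<odot>\<^bsub>N\<^esub> p \<ominus>\<^bsub>N\<^esub> k \<odot>\<^bsub>N\<^esub> (finsum N (\<lambda>m. G (transpose i m) p) ({..<n} - {i})))
     else (\<lambda>p. k \<odot>\<^bsub>N\<^esub> G (transpose i j) p))" by (auto simp: bracket_def fun_eq_iff)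
  show ?thesis unfolding e
    by (split if_split) (use klin_minusf[OF module_N klin_smult[OF module_N klin_id t] klin_smult[OF module_N s k]]
      klin_smult[OF module_N Gtr[OF i] k] in blast)
qed

text \<open>Exchanging the x_i with the y_i exchanges the two indices of a bracket, so this symmetry
  is what makes the interchange compatible with the relations.\<close>

lemma bracket_sym: "bracket i j p = bracket j i p"
  by (simp add: bracket_def transpose_commute)

text \<open>Conjugation by g carries the transposition of i and m to that of g i and g m; in the
  diagonal case the range of summation is permuted as well.\<close>

lemma G_bracket:
  assumes g: "g permutes {..<n}" and i: "i < n" "j < n" and p: "p \<in> carrier N"
  shows "G g (bracket i j p) = bracket (g i) (g j) (G g p)"
proof -
  have gl: "g l < n" if "l < n" for l using g that by (metis lessThan_iff permutes_in_image)
  have gi: "g i < n" "g j < n" using gl i by auto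
  have b: "bij g" using g permutes_bij by auto
  have c: "G g (G (transpose l m) p) = G (transpose (g l) (g m)) (G g p)" if "l < n" "m < n" for l m
  proof -
    have "g l < n" "g m < n" using g that by (metis lessThan_iff permutes_in_image)+
    thus ?thesis using G_comp[OF g permutes_transpose[OF that] p] G_comp[OF permutes_transpose g p] transpose_conj[OF b, of l m] by auto
  qed
  have Gp: "G g p \<in> carrier N" using klinD(1)[OF G[OF g]] p by auto
  show ?thesis
  proof (cases "i = j")
    case True
    have im: "{..<n} - {g i} = g ` ({..<n} - {i})"
      using permutes_image[OF g] image_set_diff[OF bij_is_inj[OF b], of "{..<n}" "{i}"] by simp
    have "finsum N (\<lambda>m. G (transpose (g i) m) (G g p)) ({..<n} - {g i}) = finsum N (\<lambda>m. G (transpose (g i) (g m)) (G g p)) ({..<n} - {i})"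
      unfolding im by (rule M.add.finprod_reindex)
        (use bij_is_inj[OF b] gi Gp klinD(1)[OF Gtr] gl in \<open>auto intro: inj_on_subset\<close>)
    also have "\<dots> = finsum N (\<lambda>m. G g (G (transpose i m) p)) ({..<n} - {i})"
      by (rule M.finsum_cong') (use c i p gl Gp klinD(1)[OF Gtr] klinD(1)[OF G[OF g]] in auto)
    also have "\<dots> = G g (finsum N (\<lambda>m. (G (transpose i m) p)) ({..<n} - {i}))"
      by (rule klin_finsum[OF module_N module_N G[OF g], symmetric]) (use i p klinD(1)[OF Gtr] in auto)
    finally have s: "finsum N (\<lambda>m. G (transpose (g i) m) (G g p)) ({..<n} - {g i}) = G g (finsum N (\<lambda>m. (G (transpose i m) p)) ({..<n} - {i}))" .
    have "finsum N (\<lambda>m. (G (transpose i m) p)) ({..<n} - {i}) \<in> carrier N"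
      by (rule M.finsum_closed) (use i p klinD(1)[OF Gtr] in auto)
    thus ?thesis using True p i t k by (simp add: bracket_def s[unfolded True] klin_minus[OF module_N module_N G[OF g]] klinD[OF G[OF g]])
  next
    case False
    hence "g i \<noteq> g j" using b by (meson bij_is_inj injD)
    thus ?thesis using False p k i klinD(1)[OF Gtr] by (simp add: bracket_def klinD(3)[OF G[OF g]] c)
  qed
qed

text \<open>The Jacobi identity for the brackets with \<open>Z j\<close> and \<open>Z l\<close>, where \<open>Z\<close> is
  any family that the group permutes.\<close>

lemma bracket_swap:
  assumes Z: "\<And>i. i < n \<Longrightarrow> klin K N N (Z i)"
    and GZ: "\<And>g i p. g permutes {..<n} \<Longrightarrow> i < n \<Longrightarrow> p \<in> carrier N \<Longrightarrow> G g (Z i p) = Z (g i) (G g p)"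
    and i: "i < n" "j < n" "l < n" and p: "p \<in> carrier N"
  shows "Z j (bracket i l p) \<oplus>\<^bsub>N\<^esub> bracket i j (Z l p) = Z l (bracket i j p) \<oplus>\<^bsub>N\<^esub> bracket i l (Z j p)"
proof -
  note cl = klinD(1)[OF Z] klinD(1)[OF bracket_klin] klinD(1)[OF Gtr]
  \<comment> \<open>A diagonal bracket paired with an off-diagonal one is the only case in which
    terms have to cancel.\<close>
  have main: "Z i (bracket i l p) \<oplus>\<^bsub>N\<^esub> bracket i i (Z l p) = Z l (bracket i i p) \<oplus>\<^bsub>N\<^esub> bracket i l (Z i p)"
    if i: "i < n" "l < n" "i \<noteq> l" for i l
  proof -
    \<comment> \<open>\<open>R\<close> collects the transpositions of i and m with m different from
      l, and these commute with \<open>Z l\<close>. The transposition of i and l exchanges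
      \<open>Z i\<close> and \<open>Z l\<close>, so on each side its contribution to the diagonal
      bracket cancels against the off-diagonal bracket. What is left is the same on both
      sides.\<close>
    define R where "R = finsum N (\<lambda>m. G (transpose i m) p) ({..<n} - {i,l})"
    have R: "R \<in> carrier N" unfolding R_def by (rule M.finsum_closed) (use i p cl in auto)
    have sp: "finsum N f ({..<n} - {i}) = f l \<oplus>\<^bsub>N\<^esub> finsum N f ({..<n} - {i,l})" if "\<And>m. m < n \<Longrightarrow> f m \<in> carrier N" for f
    proof -
      have "{..<n} - {i} = insert l ({..<n} - {i,l})" using i by auto
      thus ?thesis using that i by simp
    qed
    have k1: "bracket i i p = t \<odot>\<^bsub>N\<^esub> p \<ominus>\<^bsub>N\<^esub> k \<odot>\<^bsub>N\<^esub> (G (transpose i l) p \<oplus>\<^bsub>N\<^esub> R)"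
      unfolding bracket_def R_def using sp[of "\<lambda>m. G (transpose i m) p"] i p cl by simp
    have "finsum N (\<lambda>m. G (transpose i m) (Z l p)) ({..<n} - {i,l}) = finsum N (\<lambda>m. Z l (G (transpose i m) p)) ({..<n} - {i,l})"
      by (rule M.finsum_cong') (use i p cl GZ[OF permutes_transpose] in auto)
    also have "\<dots> = Z l R" unfolding R_def
      by (rule klin_finsum[OF module_N module_N Z, symmetric]) (use i p cl in auto)
    finally have k2: "bracket i i (Z l p) = t \<odot>\<^bsub>N\<^esub> Z l p \<ominus>\<^bsub>N\<^esub> k \<odot>\<^bsub>N\<^esub> (Z i (G (transpose i l) p) \<oplus>\<^bsub>N\<^esub> Z l R)"
      unfolding bracket_def using sp[of "\<lambda>m. G (transpose i m) (Z l p)"] i p cl GZ[OF permutes_transpose, of i l l p] by simp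
    have k3: "bracket i l p = k \<odot>\<^bsub>N\<^esub> G (transpose i l) p" "bracket i l (Z i p) = k \<odot>\<^bsub>N\<^esub> Z l (G (transpose i l) p)"
      using i p GZ[OF permutes_transpose, of i l i p] by (auto simp: bracket_def)
    have "Z i (bracket i l p) \<oplus>\<^bsub>N\<^esub> bracket i i (Z l p) = t \<odot>\<^bsub>N\<^esub> Z l p \<ominus>\<^bsub>N\<^esub> k \<odot>\<^bsub>N\<^esub> Z l R"
      unfolding k2 k3 using i p R cl t k by (simp add: klinD(3)[OF Z] smult_r_distr M.ag_cancel)
    moreover have "Z l (bracket i i p) \<oplus>\<^bsub>N\<^esub> bracket i l (Z i p) = t \<odot>\<^bsub>N\<^esub> Z l p \<ominus>\<^bsub>N\<^esub> k \<odot>\<^bsub>N\<^esub> Z l R"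
      unfolding k1 k3 using i p R cl t k
      by (simp add: klinD(2,3)[OF Z] klin_minus[OF module_N module_N Z] smult_r_distr M.ag_cancel2)
    ultimately show ?thesis by simp
  qed
  consider "j = l" | "i = j" "j \<noteq> l" | "i = l" "j \<noteq> l" | "i \<noteq> j" "i \<noteq> l" "j \<noteq> l" by auto
  thus ?thesis
  proof cases
    case 1 thus ?thesis by simp
  next
    case 2 thus ?thesis using main[of i l] i by simp
  next
    case 3 thus ?thesis using main[of i j] i by simp
  next
    \<comment> \<open>With three distinct indices, each transposition fixes the index of the
      operator that it has to pass.\<close>
    case 4
    have "bracket i j (Z l p) = Z l (bracket i j p)" "bracket i l (Z j p) = Z j (bracket i l p)"
      using 4 i p k cl GZ[OF permutes_transpose, of i j l p] GZ[OF permutes_transpose, of i l j p] by (simp_all add: bracket_def klinD(3)[OF Z])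
    thus ?thesis using i p cl by (simp add: M.a_comm)
  qed
qed

end

text \<open>Modules over the Cherednik algebra, given by operators instead of an algebra action. In
  this form the axioms also cover a right module, with the roles of the two families of generators
  exchanged.\<close>

locale cherednik_operators = perm_group_module K N n t k G
  for K :: "'k ring" (structure) and N :: "('k, 'n) module" and n t k G +
  fixes Xo Yo :: "nat \<Rightarrow> 'n \<Rightarrow> 'n"
  assumes X: "\<And>i. i < n \<Longrightarrow> klin K N N (Xo i)" and Y: "\<And>i. i < n \<Longrightarrow> klin K N N (Yo i)"
    and GX: "\<And>g i p. g permutes {..<n} \<Longrightarrow> i < n \<Longrightarrow> p \<in> carrier N \<Longrightarrow> G g (Xo i p) = Xo (g i) (G g p)"
    and GY: "\<And>g i p. g permutes {..<n} \<Longrightarrow> i < n \<Longrightarrow> p \<in> carrier N \<Longrightarrow> G g (Yo i p) = Yo (g i) (G g p)"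
    and XX: "\<And>i j p. i < n \<Longrightarrow> j < n \<Longrightarrow> p \<in> carrier N \<Longrightarrow> Xo i (Xo j p) = Xo j (Xo i p)"
    and YY: "\<And>i j p. i < n \<Longrightarrow> j < n \<Longrightarrow> p \<in> carrier N \<Longrightarrow> Yo i (Yo j p) = Yo j (Yo i p)"
    and YX: "\<And>i j p. i < n \<Longrightarrow> j < n \<Longrightarrow> p \<in> carrier N \<Longrightarrow> Yo i (Xo j p) = Xo j (Yo i p) \<oplus>\<^bsub>N\<^esub> bracket i j p"

section \<open>The polynomial representation\<close>

text \<open>\<open>pm a b\<close> is the basis vector \<open>x\<^sup>a \<otimes> y\<^sup>b \<otimes> 1\<close> of \<open>S(h*) \<otimes> S(h) \<otimes> 1\<close>.\<close>

definition pm :: "gen multiset \<Rightarrow> gen multiset \<Rightarrow> bvec" where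
  "pm a b = Tns (Tns (Mon a) (Mon b)) Unt"

definition PBL :: "nat \<Rightarrow> nat \<Rightarrow> bvec set" where
  "PBL n L = {pm a b | a b. set_mset a \<subseteq> Xv ` {..<n} \<and> set_mset b \<subseteq> Yv ` {..<n} \<and> size a + size b \<le> L}"

definition PB :: "nat \<Rightarrow> bvec set" where
  "PB n = {pm a b | a b. set_mset a \<subseteq> Xv ` {..<n} \<and> set_mset b \<subseteq> Yv ` {..<n}}"

fun gix :: "gen \<Rightarrow> nat" where "gix (Xv i) = i" | "gix (Yv i) = i"

lemma PB_PBL: "c \<in> PBL n L \<Longrightarrow> c \<in> PB n" "PBL n L \<subseteq> PB n"
  by (auto simp: PB_def PBL_def)

lemma PBL_mono: "L \<le> L' \<Longrightarrow> PBL n L \<subseteq> PBL n L'"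
  by (fastforce simp: PBL_def)

lemma PBL_ex: "c \<in> PB n \<Longrightarrow> \<exists>L. c \<in> PBL n L"
  unfolding PB_def PBL_def by blast

lemma bact_pm: "bact g (pm a b) = pm (image_mset (gact g) a) (image_mset (gact g) b)"
  by (simp add: pm_def)

lemma gact_comp: "gact (g \<circ> h) z = gact g (gact h z)"
  by (cases z) auto

lemma gact_id: "gact id z = z"
  by (cases z) auto

lemma bact_comp: "bact (g \<circ> h) c = bact g (bact h c)"
proof -
  have "gact (\<lambda>a. g (h a)) = (\<lambda>z. gact g (gact h z))" using gact_comp[of g h] by (simp add: fun_eq_iff comp_def)
  thus ?thesis by (induction c) (simp_all add: comp_def multiset.map_comp)
qed

lemma bact_id: "bact id c = c"
proof -
  have "gact (\<lambda>a. a) = (\<lambda>z. z)" using gact_id by (simp add: fun_eq_iff id_def)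
  thus ?thesis by (induction c) (simp_all add: id_def)
qed

lemma pm_PBL: "pm a b \<in> PBL n L \<longleftrightarrow> set_mset a \<subseteq> Xv ` {..<n} \<and> set_mset b \<subseteq> Yv ` {..<n} \<and> size a + size b \<le> L"
  by (auto simp: PBL_def pm_def)

lemma pm_PB: "pm a b \<in> PB n \<longleftrightarrow> set_mset a \<subseteq> Xv ` {..<n} \<and> set_mset b \<subseteq> Yv ` {..<n}"
  by (auto simp: PB_def pm_def)

lemma PBL_cases:
  assumes "c \<in> PBL n L" obtains a b where "c = pm a b" "set_mset a \<subseteq> Xv ` {..<n}" "set_mset b \<subseteq> Yv ` {..<n}" "size a + size b \<le> L"
  using assms by (auto simp: PBL_def)

lemma PB_cases:
  assumes "c \<in> PB n" obtains a b where "c = pm a b" "set_mset a \<subseteq> Xv ` {..<n}" "set_mset b \<subseteq> Yv ` {..<n}"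
  using assms by (auto simp: PB_def)

lemma bact_PBL: "g permutes {..<n} \<Longrightarrow> c \<in> PBL n L \<Longrightarrow> bact g c \<in> PBL n L"
proof -
  assume g: "g permutes {..<n}" and "c \<in> PBL n L"
  then obtain a b where c: "c = pm a b" "set_mset a \<subseteq> Xv ` {..<n}" "set_mset b \<subseteq> Yv ` {..<n}" "size a + size b \<le> L"
    by (auto simp: PBL_def)
  have "g i < n" if "i < n" for i using g that by (metis lessThan_iff permutes_in_image)
  hence "set_mset (image_mset (gact g) a) \<subseteq> Xv ` {..<n}" "set_mset (image_mset (gact g) b) \<subseteq> Yv ` {..<n}"
    using c(2,3) by auto
  thus ?thesis using c(4) by (simp add: c(1) bact_pm pm_PBL)
qed

lemma bact_PB: "g permutes {..<n} \<Longrightarrow> c \<in> PB n \<Longrightarrow> bact g c \<in> PB n"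
  using PBL_ex bact_PBL PB_PBL by blast

definition Pmod :: "'k ring \<Rightarrow> nat \<Rightarrow> ('k, bvec \<Rightarrow> 'k) module" where
  "Pmod K n = vec K (PB n)"

definition PX :: "'k ring \<Rightarrow> nat \<Rightarrow> nat \<Rightarrow> (bvec \<Rightarrow> 'k) \<Rightarrow> bvec \<Rightarrow> 'k" where
  "PX K n i = lin K (Pmod K n) (\<lambda>c. ve K (mult_x_map (Tns (Gen (Xv i)) c)))"

definition PG :: "'k ring \<Rightarrow> nat \<Rightarrow> (nat \<Rightarrow> nat) \<Rightarrow> (bvec \<Rightarrow> 'k) \<Rightarrow> bvec \<Rightarrow> 'k" where
  "PG K n g = lin K (Pmod K n) (\<lambda>c. ve K (bact g c))"

definition PK :: "'k ring \<Rightarrow> nat \<Rightarrow> 'k \<Rightarrow> 'k \<Rightarrow> nat \<Rightarrow> nat \<Rightarrow> (bvec \<Rightarrow> 'k) \<Rightarrow> bvec \<Rightarrow> 'k" where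
  "PK K n t k = perm_group_module.bracket (Pmod K n) n t k (PG K n)"

text \<open>Leibniz rule: the pair consists of a monomial \<open>p\<close> and of \<open>[y\<^sub>i, p]\<close> applied to the part of
  degree zero in the \<open>Xv j\<close>.\<close>

definition PYstep :: "'k ring \<Rightarrow> nat \<Rightarrow> 'k \<Rightarrow> 'k \<Rightarrow> nat \<Rightarrow> gen \<Rightarrow> (bvec \<Rightarrow> 'k) \<times> (bvec \<Rightarrow> 'k) \<Rightarrow> (bvec \<Rightarrow> 'k) \<times> (bvec \<Rightarrow> 'k)" where
  "PYstep K n t k i z = (\<lambda>(p, d). (PX K n (gix z) p, PX K n (gix z) d \<oplus>\<^bsub>Pmod K n\<^esub> PK K n t k i (gix z) p))"

text \<open>The second component starts with y_i y^b and not with zero. After all factors of x^a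
  have been added it is therefore the full value of y_i on x^a y^b, including the term in which y_i
  has passed every x_j.\<close>

fun PYcol :: "'k ring \<Rightarrow> nat \<Rightarrow> 'k \<Rightarrow> 'k \<Rightarrow> nat \<Rightarrow> bvec \<Rightarrow> bvec \<Rightarrow> 'k" where
  "PYcol K n t k i (Tns (Tns (Mon a) (Mon b)) v) =
     snd (mfold (PYstep K n t k i) (ve K (pm {#} b), ve K (pm {#} (add_mset (Yv i) b))) a)"
| "PYcol K n t k i _ = (\<lambda>_. \<zero>\<^bsub>K\<^esub>)"

definition PY :: "'k ring \<Rightarrow> nat \<Rightarrow> 'k \<Rightarrow> 'k \<Rightarrow> nat \<Rightarrow> (bvec \<Rightarrow> 'k) \<Rightarrow> bvec \<Rightarrow> 'k" where
  "PY K n t k i = lin K (Pmod K n) (PYcol K n t k i)"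

text \<open>Every monomial arises from a pure y-monomial by multiplication with the x_j, which is
  the way the operators are defined. The degree bound travels along, so the same induction proves
  identities and degree estimates.\<close>

lemma PB_induct [consumes 1, case_names base X]:
  assumes "c \<in> PBL n L"
    and "\<And>b L. set_mset b \<subseteq> Yv ` {..<n} \<Longrightarrow> size b \<le> L \<Longrightarrow> P (pm {#} b) L"
    and "\<And>j a b L. j < n \<Longrightarrow> set_mset a \<subseteq> Xv ` {..<n} \<Longrightarrow> set_mset b \<subseteq> Yv ` {..<n} \<Longrightarrow> size a + size b \<le> L \<Longrightarrow> P (pm a b) L \<Longrightarrow> P (pm (add_mset (Xv j) a) b) (Suc L)"
  shows "P c L"
proof -
  obtain a b where c: "c = pm a b" "set_mset a \<subseteq> Xv ` {..<n}" "set_mset b \<subseteq> Yv ` {..<n}" "size a + size b \<le> L"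
    using assms(1) by (auto simp: PBL_def)
  have "P (pm a b) L" using c(2,4)
  proof (induction a arbitrary: L)
    case empty thus ?case using assms(2) c by auto
  next
    case (add z a)
    then obtain j L' where "z = Xv j" "j < n" "L = Suc L'" by (cases L) auto
    thus ?case using add assms(3) c by auto
  qed
  thus ?thesis by (simp add: c)
qed

locale cherednik_data = coeff_ring K for K :: "'k ring" (structure) +
  fixes n :: nat and t k :: 'k
  assumes t: "t \<in> carrier K" and k: "k \<in> carrier K"
begin

abbreviation "P \<equiv> Pmod K n"

lemma P_module: "module K P" by (simp add: Pmod_def vec_module)

sublocale PP: module K P by (rule P_module)

lemma ve_P: "c \<in> PB n \<Longrightarrow> ve K c \<in> carrier P"
  by (simp add: Pmod_def ve_carrier)

lemma ve_P': "c \<in> PBL n L \<Longrightarrow> ve K c \<in> carrier P"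
  using PB_PBL by (blast intro: ve_P)

lemma mult_x_pm: "mult_x_map (Tns (Gen (Xv i)) (pm a b)) = pm (add_mset (Xv i) a) b"
  by (simp add: pm_def)

lemma mult_x_PBL: "i < n \<Longrightarrow> c \<in> PBL n L \<Longrightarrow> mult_x_map (Tns (Gen (Xv i)) c) \<in> PBL n (Suc L)"
  by (erule PBL_cases) (simp add: mult_x_pm pm_PBL)

lemma mult_x_PB: "i < n \<Longrightarrow> c \<in> PB n \<Longrightarrow> mult_x_map (Tns (Gen (Xv i)) c) \<in> PB n"
  using PBL_ex mult_x_PBL PB_PBL by metis

lemma PX_klin: "i < n \<Longrightarrow> klin K P P (PX K n i)"
  unfolding PX_def Pmod_def by (intro lin_klin vec_module ve_carrier mult_x_PB)

lemma PG_klin: "g permutes {..<n} \<Longrightarrow> klin K P P (PG K n g)"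
  unfolding PG_def Pmod_def by (intro lin_klin vec_module ve_carrier bact_PB)

lemma PX_ve: "i < n \<Longrightarrow> c \<in> PB n \<Longrightarrow> PX K n i (ve K c) = ve K (mult_x_map (Tns (Gen (Xv i)) c))"
  unfolding PX_def by (rule lin_ve[OF P_module]) (intro ve_P mult_x_PB)

lemma PX_pm: "i < n \<Longrightarrow> pm a b \<in> PB n \<Longrightarrow> PX K n i (ve K (pm a b)) = ve K (pm (add_mset (Xv i) a) b)"
  by (simp add: PX_ve mult_x_pm)

lemma PG_ve: "g permutes {..<n} \<Longrightarrow> c \<in> PB n \<Longrightarrow> PG K n g (ve K c) = ve K (bact g c)"
  unfolding PG_def by (rule lin_ve[OF P_module]) (intro ve_P bact_PB)

lemma P_ext:
  assumes "module K N" "klin K P N f" "klin K P N g" "\<And>c. c \<in> PB n \<Longrightarrow> f (ve K c) = g (ve K c)" "p \<in> carrier P"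
  shows "f p = g p"
  using klin_ext[of N "PB n" f g p] assms by (simp add: Pmod_def)

sublocale S: perm_group_module K P n t k "PG K n"
proof
  show "t \<in> carrier K" "k \<in> carrier K" by (rule t k)+
  show "klin K P P (PG K n g)" if "g permutes {..<n}" for g using that by (rule PG_klin)
  show "PG K n (g \<circ> h) p = PG K n g (PG K n h p)" if "g permutes {..<n}" "h permutes {..<n}" "p \<in> carrier P" for g h p
    by (rule P_ext[OF P_module PG_klin klin_comp[OF PG_klin PG_klin] _ that(3)])
      (use that in \<open>auto simp: PG_ve bact_PB bact_comp permutes_compose\<close>)
  show "PG K n id p = p" if "p \<in> carrier P" for p
    by (rule P_ext[OF P_module PG_klin klin_id _ that]) (auto simp: PG_ve bact_id permutes_id)
qed

abbreviation "bracketP \<equiv> PK K n t k"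

lemma PK_klin: "i < n \<Longrightarrow> j < n \<Longrightarrow> klin K P P (bracketP i j)"
  unfolding PK_def by (rule S.bracket_klin)

lemma PGX:
  assumes "g permutes {..<n}" "i < n" "p \<in> carrier P"
  shows "PG K n g (PX K n i p) = PX K n (g i) (PG K n g p)"
proof -
  have gi: "g i < n" using assms by (metis lessThan_iff permutes_in_image)
  show ?thesis
  proof (rule P_ext[OF P_module klin_comp[OF PX_klin PG_klin] klin_comp[OF PG_klin PX_klin] _ assms(3)])
    fix c assume c: "c \<in> PB n"
    then obtain a b where ab: "c = pm a b" by (auto simp: PB_def)
    show "PG K n g (PX K n i (ve K c)) = PX K n (g i) (PG K n g (ve K c))"
      using c assms gi by (simp add: PG_ve PX_ve mult_x_PB bact_PB) (simp add: ab bact_pm mult_x_pm)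
  qed (use assms gi in auto)
qed

lemma PXX:
  assumes "i < n" "j < n" "p \<in> carrier P"
  shows "PX K n i (PX K n j p) = PX K n j (PX K n i p)"
  by (rule P_ext[OF P_module klin_comp[OF PX_klin PX_klin] klin_comp[OF PX_klin PX_klin] _ assms(3)])
    (use assms in \<open>auto simp: PX_pm pm_PB add_mset_commute elim!: PB_cases\<close>)

abbreviation "PL L \<equiv> carrier (vec K (PBL n L))"

lemma PL_P: "v \<in> PL L \<Longrightarrow> v \<in> carrier P"
  unfolding Pmod_def by (rule vec_mono[OF _ PB_PBL(2)])

lemma PL_mono: "v \<in> PL L \<Longrightarrow> L \<le> L' \<Longrightarrow> v \<in> PL L'"
  by (rule vec_mono[OF _ PBL_mono])

lemma lin_PL:
  assumes "\<And>c. c \<in> PBL n L \<Longrightarrow> T c \<in> carrier (vec K B)" "v \<in> PL L" "B \<subseteq> PB n" "\<And>c. c \<in> PB n \<Longrightarrow> T c \<in> carrier P"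
  shows "lin K P T v \<in> carrier (vec K B)"
proof -
  have "lin K P T v = lin K (vec K B) T v" unfolding Pmod_def
    by (rule lin_vec_irrel[OF assms(2)]) (use assms PB_PBL in \<open>auto simp: Pmod_def\<close>)
  thus ?thesis using klinD(1)[OF lin_klin[OF vec_module assms(1)] assms(2)] by simp
qed

lemma PX_PL: "i < n \<Longrightarrow> v \<in> PL L \<Longrightarrow> PX K n i v \<in> PL (Suc L)"
  unfolding PX_def by (rule lin_PL[where L=L]) (auto intro!: ve_carrier ve_P mult_x_PBL mult_x_PB PB_PBL(2))

lemma PG_PL: "g permutes {..<n} \<Longrightarrow> v \<in> PL L \<Longrightarrow> PG K n g v \<in> PL L"
  unfolding PG_def by (rule lin_PL[where L=L]) (auto intro!: ve_carrier ve_P bact_PBL bact_PB PB_PBL(2))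

lemma P_finsum_PL:
  assumes "f \<in> A \<rightarrow> PL L" shows "finsum P f A \<in> PL L"
proof -
  interpret V: module K "vec K (PBL n L)" by (rule vec_module)
  have "finsum P f A = finsum (vec K (PBL n L)) f A"
  proof
    fix u
    have "f \<in> A \<rightarrow> carrier (vec K (PB n))" using assms PL_P by (auto simp: Pmod_def)
    thus "finsum P f A u = finsum (vec K (PBL n L)) f A u"
      using vec_finsum[OF assms, of u] vec_finsum[of f A "PB n" u] by (simp add: Pmod_def)
  qed
  thus ?thesis using assms by simp
qed

lemma PL_ops:
  assumes "v \<in> PL L"
  shows "w \<in> PL L \<Longrightarrow> v \<oplus>\<^bsub>P\<^esub> w \<in> PL L" "w \<in> PL L \<Longrightarrow> v \<ominus>\<^bsub>P\<^esub> w \<in> PL L" "a \<in> carrier K \<Longrightarrow> a \<odot>\<^bsub>P\<^esub> v \<in> PL L"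
proof -
  interpret V: module K "vec K (PBL n L)" by (rule vec_module)
  show a: "w \<in> PL L \<Longrightarrow> v \<oplus>\<^bsub>P\<^esub> w \<in> PL L" using V.M.a_closed[OF assms, of w] by (simp add: Pmod_def vec_simps)
  show s: "a \<in> carrier K \<Longrightarrow> a \<odot>\<^bsub>P\<^esub> v \<in> PL L" using V.smult_closed[OF _ assms, of a] by (simp add: Pmod_def vec_simps)
  assume w: "w \<in> PL L"
  have "v \<ominus>\<^bsub>P\<^esub> w = v \<oplus>\<^bsub>P\<^esub> (\<ominus> \<one>) \<odot>\<^bsub>P\<^esub> w" using PL_P[OF w] by (simp add: a_minus_def PP.smult_l_minus)
  moreover have "(\<ominus> \<one>) \<odot>\<^bsub>P\<^esub> w \<in> PL L" using V.smult_closed[OF _ w, of "\<ominus> \<one>"] by (simp add: Pmod_def vec_simps)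
  ultimately show "v \<ominus>\<^bsub>P\<^esub> w \<in> PL L" using V.M.a_closed[OF assms] by (simp add: Pmod_def vec_simps)
qed

lemma PK_PL: "i < n \<Longrightarrow> j < n \<Longrightarrow> v \<in> PL L \<Longrightarrow> bracketP i j v \<in> PL L"
  unfolding PK_def S.bracket_def by (auto intro!: PL_ops P_finsum_PL PG_PL permutes_transpose t k)

abbreviation "stp \<equiv> PYstep K n t k"

lemma stp_sel: "fst (stp i z v) = PX K n (gix z) (fst v)" "snd (stp i z v) = PX K n (gix z) (snd v) \<oplus>\<^bsub>P\<^esub> bracketP i (gix z) (fst v)"
  by (simp_all add: PYstep_def split_beta)

text \<open>The steps for different x_j commute: their discrepancy is the identity
  \<open>bracket_swap\<close> applied to multiplication by the x_j. Hence the fold over a multiset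
  does not depend on the chosen order and may be unfolded at any factor.\<close>

lemma stp_add:
  assumes i: "i < n" and v: "v \<in> carrier P \<times> carrier P" and z: "j < n" "set_mset a \<subseteq> Xv ` {..<n}"
  shows "mfold (stp i) v (add_mset (Xv j) a) = stp i (Xv j) (mfold (stp i) v a)"
    "mfold (stp i) v a \<in> carrier P \<times> carrier P"
proof -
  note cl = klinD(1)[OF PX_klin] klinD(1)[OF PK_klin]
  have T: "stp i z x \<in> carrier P \<times> carrier P" if "z \<in> Xv ` {..<n}" "x \<in> carrier P \<times> carrier P" for z x
    using that i by (auto simp: PYstep_def cl)
  have C: "stp i z (stp i z' x) = stp i z' (stp i z x)"
    if zz: "z \<in> Xv ` {..<n}" "z' \<in> Xv ` {..<n}" "x \<in> carrier P \<times> carrier P" for z z' x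
  proof -
    obtain j l where jl: "z = Xv j" "z' = Xv l" "j < n" "l < n" using zz(1,2) by auto
    obtain p d where "x = (p, d)" by (cases x)
    note z = jl this zz(3)[unfolded this mem_Times_iff, simplified]
    have sw: "PX K n j (bracketP i l p) \<oplus>\<^bsub>P\<^esub> bracketP i j (PX K n l p) = PX K n l (bracketP i j p) \<oplus>\<^bsub>P\<^esub> bracketP i l (PX K n j p)"
      unfolding PK_def by (rule S.bracket_swap) (use PX_klin PGX i z in auto)
    have "PX K n j (PX K n l d \<oplus>\<^bsub>P\<^esub> bracketP i l p) \<oplus>\<^bsub>P\<^esub> bracketP i j (PX K n l p) = PX K n l (PX K n j d) \<oplus>\<^bsub>P\<^esub> (PX K n j (bracketP i l p) \<oplus>\<^bsub>P\<^esub> bracketP i j (PX K n l p))"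
      using z i by (simp add: klinD(2)[OF PX_klin] cl PXX[of j l] PP.M.a_assoc)
    also have "\<dots> = PX K n l (PX K n j d \<oplus>\<^bsub>P\<^esub> bracketP i j p) \<oplus>\<^bsub>P\<^esub> bracketP i l (PX K n j p)"
      unfolding sw using z i by (simp add: klinD(2)[OF PX_klin] cl PP.M.a_assoc)
    finally show ?thesis using z by (simp add: PYstep_def PXX)
  qed
  show "mfold (stp i) v (add_mset (Xv j) a) = stp i (Xv j) (mfold (stp i) v a)"
    by (rule mfold_add[where S="carrier P \<times> carrier P" and Z="Xv ` {..<n}"]) (use T C z v in auto)
  show "mfold (stp i) v a \<in> carrier P \<times> carrier P"
    by (rule mfold_closed[where S="carrier P \<times> carrier P" and Z="Xv ` {..<n}"]) (use T C z v in auto)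
qed

lemma PYcol_base: "PYcol K n t k i (pm {#} b) = ve K (pm {#} (add_mset (Yv i) b))"
  by (simp add: pm_def)

lemma PYcol_X_aux:
  assumes i: "i < n" and j: "j < n" and a: "set_mset a \<subseteq> Xv ` {..<n}" and b: "set_mset b \<subseteq> Yv ` {..<n}"
  shows "PYcol K n t k i (pm (add_mset (Xv j) a) b) = PX K n j (PYcol K n t k i (pm a b)) \<oplus>\<^bsub>P\<^esub> bracketP i j (ve K (pm a b))"
    "PYcol K n t k i (pm a b) \<in> carrier P"
proof -
  define v where "v = (ve K (pm {#} b), ve K (pm {#} (add_mset (Yv i) b)))"
  have v: "v \<in> carrier P \<times> carrier P" using i b by (auto simp: v_def pm_PB intro!: ve_P)
  \<comment> \<open>The first component of the fold is the monomial built up so far, so the next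
    step adds the bracket applied to exactly this monomial.\<close>
  have "fst (mfold (stp i) v a) = ve K (pm a b)" using a
  proof (induction a)
    case empty show ?case by (simp add: v_def)
  next
    case (add z a)
    then obtain l where l: "z = Xv l" "l < n" by auto
    show ?case using add l b by (simp add: stp_add(1)[OF i v] stp_sel PX_pm pm_PB)
  qed
  thus "PYcol K n t k i (pm (add_mset (Xv j) a) b) = PX K n j (PYcol K n t k i (pm a b)) \<oplus>\<^bsub>P\<^esub> bracketP i j (ve K (pm a b))"
    using stp_add(1)[OF i v j a] by (simp add: pm_def[of "add_mset (Xv j) a"] pm_def[of a] v_def[symmetric] stp_sel)
  show "PYcol K n t k i (pm a b) \<in> carrier P"
    using stp_add(2)[OF i v j a] by (auto simp: pm_def[of a] v_def[symmetric] mem_Times_iff)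
qed

lemma PYcol_P: "i < n \<Longrightarrow> c \<in> PB n \<Longrightarrow> PYcol K n t k i c \<in> carrier P"
  using PYcol_X_aux(2)[of i i] by (auto simp: PB_def)

lemma PYcol_PL: assumes i: "i < n" and c: "c \<in> PBL n L" shows "PYcol K n t k i c \<in> PL (Suc L)"
  using c
proof (induction rule: PB_induct)
  case (base b L) hence "pm {#} (add_mset (Yv i) b) \<in> PBL n (Suc L)" using i by (simp add: pm_PBL)
  thus ?case unfolding PYcol_base by (rule ve_carrier)
next
  case (X j a b L)
  have "ve K (pm a b) \<in> PL L" using X by (intro ve_carrier) (simp add: pm_PBL)
  hence "bracketP i j (ve K (pm a b)) \<in> PL (Suc (Suc L))" using PL_mono[OF PK_PL[OF i X(1)], of _ L "Suc (Suc L)"] by simp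
  hence "PX K n j (PYcol K n t k i (pm a b)) \<oplus>\<^bsub>P\<^esub> bracketP i j (ve K (pm a b)) \<in> PL (Suc (Suc L))"
    by (intro PL_ops(1) PX_PL X)
  thus ?case using i X by (simp add: PYcol_X_aux(1))
qed

lemma PY_klin: "i < n \<Longrightarrow> klin K P P (PY K n t k i)"
  unfolding PY_def using lin_klin[OF P_module, of "PB n" "PYcol K n t k i"] PYcol_P by (simp add: Pmod_def)

lemma PY_ve: "i < n \<Longrightarrow> c \<in> PB n \<Longrightarrow> PY K n t k i (ve K c) = PYcol K n t k i c"
  unfolding PY_def by (rule lin_ve[OF P_module]) (rule PYcol_P)

lemma PY_PL: "i < n \<Longrightarrow> v \<in> PL L \<Longrightarrow> PY K n t k i v \<in> PL (Suc L)"
  unfolding PY_def by (rule lin_PL[where L=L]) (simp_all add: PYcol_PL PYcol_P PB_PBL(2))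

lemma PYX:
  assumes "i < n" "j < n" "p \<in> carrier P"
  shows "PY K n t k i (PX K n j p) = PX K n j (PY K n t k i p) \<oplus>\<^bsub>P\<^esub> bracketP i j p"
proof (rule P_ext[OF P_module klin_comp[OF PX_klin[OF assms(2)] PY_klin[OF assms(1)]]
    klin_add[OF P_module klin_comp[OF PY_klin[OF assms(1)] PX_klin[OF assms(2)]] PK_klin[OF assms(1,2)]] _ assms(3)])
  fix c assume c: "c \<in> PB n"
  then obtain a b where ab: "c = pm a b" "set_mset a \<subseteq> Xv ` {..<n}" "set_mset b \<subseteq> Yv ` {..<n}" by (auto simp: PB_def)
  thus "PY K n t k i (PX K n j (ve K c)) = PX K n j (PY K n t k i (ve K c)) \<oplus>\<^bsub>P\<^esub> bracketP i j (ve K c)"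
    using c assms by (simp add: PX_pm PY_ve pm_PB PYcol_X_aux)
qed

text \<open>Induction for identities between linear maps on \<open>P\<close>. The step is required
  for arbitrary vectors and not only for monomials, so that the commutation relations can be
  inserted directly.\<close>

lemma P_ext_X:
  assumes N: "module K N" and f: "klin K P N f" and g: "klin K P N g"
    and b: "\<And>b. set_mset b \<subseteq> Yv ` {..<n} \<Longrightarrow> f (ve K (pm {#} b)) = g (ve K (pm {#} b))"
    and x: "\<And>j p. j < n \<Longrightarrow> p \<in> carrier P \<Longrightarrow> f p = g p \<Longrightarrow> f (PX K n j p) = g (PX K n j p)"
    and p: "p \<in> carrier P"
  shows "f p = g p"
proof (rule P_ext[OF N f g _ p])
  fix c assume "c \<in> PB n"
  then obtain L where "c \<in> PBL n L" using PBL_ex by blast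
  thus "f (ve K c) = g (ve K c)"
  proof (induction rule: PB_induct)
    case (X j a b L) thus ?case using x[of j "ve K (pm a b)"] by (auto simp: PX_pm pm_PB ve_P)
  qed (use b in auto)
qed

text \<open>On pure y-monomials \<open>Y_i\<close> just adds a factor, which the group permutes. A
  factor x_j adds a bracket on both sides, and these brackets correspond by
  \<open>G_bracket\<close>.\<close>

lemma PGY:
  assumes g: "g permutes {..<n}" and i: "i < n" and p: "p \<in> carrier P"
  shows "PG K n g (PY K n t k i p) = PY K n t k (g i) (PG K n g p)"
proof -
  have gi: "g i < n" if "i < n" for i using g that by (metis lessThan_iff permutes_in_image)
  note cl = klinD(1)[OF PX_klin] klinD(1)[OF PK_klin] klinD(1)[OF PY_klin] klinD(1)[OF PG_klin]
  show ?thesis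
  proof (rule P_ext_X[OF P_module klin_comp[OF PY_klin[OF i] PG_klin[OF g]] klin_comp[OF PG_klin[OF g] PY_klin[OF gi[OF i]]] _ _ p])
    fix b assume b: "set_mset b \<subseteq> Yv ` {..<n}"
    have b': "set_mset (image_mset (gact g) b) \<subseteq> Yv ` {..<n}" using b gi by auto
    show "PG K n g (PY K n t k i (ve K (pm {#} b))) = PY K n t k (g i) (PG K n g (ve K (pm {#} b)))"
      using b b' i gi g by (simp add: PY_ve PG_ve pm_PB PYcol_base bact_pm)
  next
    fix j p assume j: "j < n" and p: "p \<in> carrier P" and IH: "PG K n g (PY K n t k i p) = PY K n t k (g i) (PG K n g p)"
    have "PG K n g (bracketP i j p) = bracketP (g i) (g j) (PG K n g p)" unfolding PK_def using S.G_bracket g i j p by blast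
    thus "PG K n g (PY K n t k i (PX K n j p)) = PY K n t k (g i) (PG K n g (PX K n j p))"
      using j p i gi g by (simp add: PYX klinD(2)[OF PG_klin] cl PGX IH)
  qed
qed

text \<open>On pure y-monomials the operators only add factors and commute. Passing a factor x_l
  produces correction terms on both sides, and they agree by \<open>bracket_swap\<close>, this time
  with the operators \<open>Y\<close> as the permuted family.\<close>

lemma PYY:
  assumes i: "i < n" and j: "j < n" and p: "p \<in> carrier P"
  shows "PY K n t k i (PY K n t k j p) = PY K n t k j (PY K n t k i p)"
proof (rule P_ext_X[OF P_module klin_comp[OF PY_klin[OF j] PY_klin[OF i]] klin_comp[OF PY_klin[OF i] PY_klin[OF j]] _ _ p])
  fix b assume "set_mset b \<subseteq> Yv ` {..<n}"
  thus "PY K n t k i (PY K n t k j (ve K (pm {#} b))) = PY K n t k j (PY K n t k i (ve K (pm {#} b)))"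
    using i j by (simp add: PY_ve pm_PB PYcol_base add_mset_commute)
next
  note cl = klinD(1)[OF PX_klin] klinD(1)[OF PK_klin] klinD(1)[OF PY_klin] klinD(1)[OF PG_klin]
  fix l p assume l: "l < n" and p: "p \<in> carrier P" and IH: "PY K n t k i (PY K n t k j p) = PY K n t k j (PY K n t k i p)"
  \<comment> \<open>The index shared by the two brackets is that of x_l, so it comes first here; the
    symmetry of the brackets then restores the usual order.\<close>
  have "PY K n t k j (bracketP l i p) \<oplus>\<^bsub>P\<^esub> bracketP l j (PY K n t k i p) = PY K n t k i (bracketP l j p) \<oplus>\<^bsub>P\<^esub> bracketP l i (PY K n t k j p)"
    unfolding PK_def by (rule S.bracket_swap) (use PY_klin PGY i j l p in auto)
  hence sw: "PY K n t k j (bracketP i l p) \<oplus>\<^bsub>P\<^esub> bracketP j l (PY K n t k i p) = PY K n t k i (bracketP j l p) \<oplus>\<^bsub>P\<^esub> bracketP i l (PY K n t k j p)"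
    unfolding PK_def by (simp add: S.bracket_sym[of l])
  have e: "PY K n t k i (PY K n t k j (PX K n l p)) = PX K n l (PY K n t k i (PY K n t k j p)) \<oplus>\<^bsub>P\<^esub> (PY K n t k i (bracketP j l p) \<oplus>\<^bsub>P\<^esub> bracketP i l (PY K n t k j p))" if "i < n" "j < n" for i j
    using l p that by (simp add: PYX klinD(2)[OF PY_klin] cl PP.M.a_ac)
  show "PY K n t k i (PY K n t k j (PX K n l p)) = PY K n t k j (PY K n t k i (PX K n l p))"
    unfolding e[OF i j] e[OF j i] IH sw ..
qed

sublocale PC: cherednik_operators K P n t k "PG K n" "PX K n" "PY K n t k"
proof
  show "PY K n t k i (PX K n j p) = PX K n j (PY K n t k i p) \<oplus>\<^bsub>P\<^esub> S.bracket i j p" if "i < n" "j < n" "p \<in> carrier P" for i j p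
    using PYX[OF that] by (simp add: PK_def)
qed (rule PX_klin PY_klin PGX PGY PXX PYY; assumption)+

end

section \<open>Maps out of the polynomial representation\<close>

text \<open>The image of x^a y^b is forced for a map of modules with 1 \<mapsto> v: first the
  y-operators, then the x-operators are applied to v.\<close>

fun ucol :: "(nat \<Rightarrow> 'n \<Rightarrow> 'n) \<Rightarrow> (nat \<Rightarrow> 'n \<Rightarrow> 'n) \<Rightarrow> 'n \<Rightarrow> bvec \<Rightarrow> 'n" where
  "ucol A B v (Tns (Tns (Mon a) (Mon b)) u) = mfold (\<lambda>z. A (gix z)) (mfold (\<lambda>z. B (gix z)) v b) a"
| "ucol A B v _ = v"

definition umap :: "'k ring \<Rightarrow> ('k, 'n) module \<Rightarrow> (nat \<Rightarrow> 'n \<Rightarrow> 'n) \<Rightarrow> (nat \<Rightarrow> 'n \<Rightarrow> 'n) \<Rightarrow> 'n \<Rightarrow> (bvec \<Rightarrow> 'k) \<Rightarrow> 'n" where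
  "umap K N A B v = lin K N (ucol A B v)"

lemma in_gens: "z \<in> Xv ` {..<n} \<Longrightarrow> gix z < n" "z \<in> Yv ` {..<n} \<Longrightarrow> gix z < n"
  by auto

locale universal_map = cherednik_operators K N n t k G Xo Yo + C: cherednik_data K n t k
  for K :: "'k ring" (structure) and N :: "('k, 'n) module" and n t k G Xo Yo
begin

abbreviation "P \<equiv> Pmod K n"
abbreviation "U \<equiv> umap K N Xo Yo"
abbreviation "uc \<equiv> ucol Xo Yo"

lemma uc_pm: "uc v (pm a b) = mfold (\<lambda>z. Xo (gix z)) (mfold (\<lambda>z. Yo (gix z)) v b) a"
  by (simp add: pm_def)

lemma yfold:
  assumes v: "v \<in> carrier N" and b: "set_mset b \<subseteq> Yv ` {..<n}"
  shows "mfold (\<lambda>z. Yo (gix z)) v b \<in> carrier N"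
    "i < n \<Longrightarrow> mfold (\<lambda>z. Yo (gix z)) v (add_mset (Yv i) b) = Yo i (mfold (\<lambda>z. Yo (gix z)) v b)"
proof -
  show "mfold (\<lambda>z. Yo (gix z)) v b \<in> carrier N"
    by (rule mfold_closed[where Z = "Yv ` {..<n}", OF _ v b]) (rule klinD(1)[OF Y[OF in_gens(2)]])
  show "mfold (\<lambda>z. Yo (gix z)) v (add_mset (Yv i) b) = Yo i (mfold (\<lambda>z. Yo (gix z)) v b)" if "i < n"
    using mfold_add[where Z = "Yv ` {..<n}" and S = "carrier N" and T = "\<lambda>z. Yo (gix z)" and z = "Yv i", OF _ _ v _ b]
      klinD(1)[OF Y[OF in_gens(2)]] YY[OF in_gens(2) in_gens(2)] that by simp
qed

lemma xfold:
  assumes v: "v \<in> carrier N" and b: "set_mset b \<subseteq> Xv ` {..<n}"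
  shows "mfold (\<lambda>z. Xo (gix z)) v b \<in> carrier N"
    "i < n \<Longrightarrow> mfold (\<lambda>z. Xo (gix z)) v (add_mset (Xv i) b) = Xo i (mfold (\<lambda>z. Xo (gix z)) v b)"
proof -
  show "mfold (\<lambda>z. Xo (gix z)) v b \<in> carrier N"
    by (rule mfold_closed[where Z = "Xv ` {..<n}", OF _ v b]) (rule klinD(1)[OF X[OF in_gens(1)]])
  show "mfold (\<lambda>z. Xo (gix z)) v (add_mset (Xv i) b) = Xo i (mfold (\<lambda>z. Xo (gix z)) v b)" if "i < n"
    using mfold_add[where Z = "Xv ` {..<n}" and S = "carrier N" and T = "\<lambda>z. Xo (gix z)" and z = "Xv i", OF _ _ v _ b]
      klinD(1)[OF X[OF in_gens(1)]] XX[OF in_gens(1) in_gens(1)] that by simp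
qed

lemma uc_simps:
  assumes v: "v \<in> carrier N" and b: "set_mset b \<subseteq> Yv ` {..<n}"
  shows "i < n \<Longrightarrow> uc v (pm {#} (add_mset (Yv i) b)) = Yo i (uc v (pm {#} b))"
    "i < n \<Longrightarrow> set_mset a \<subseteq> Xv ` {..<n} \<Longrightarrow> uc v (pm (add_mset (Xv i) a) b) = Xo i (uc v (pm a b))"
    "set_mset a \<subseteq> Xv ` {..<n} \<Longrightarrow> uc v (pm a b) \<in> carrier N"
  using v b by (simp_all add: uc_pm yfold xfold)

lemma uc_one: "uc v (pm {#} {#}) = v"
  by (simp add: uc_pm)

lemma uc_closed: "v \<in> carrier N \<Longrightarrow> c \<in> PB n \<Longrightarrow> uc v c \<in> carrier N"
  by (auto elim!: PB_cases simp: uc_simps)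

lemma U_klin: "v \<in> carrier N \<Longrightarrow> klin K P N (U v)"
  unfolding umap_def Pmod_def by (intro lin_klin module_N uc_closed)

lemma U_ve: "v \<in> carrier N \<Longrightarrow> c \<in> PB n \<Longrightarrow> U v (ve K c) = uc v c"
  unfolding umap_def by (rule lin_ve[OF module_N]) (rule uc_closed)

lemma U_one: "v \<in> carrier N \<Longrightarrow> U v (ve K (pm {#} {#})) = v"
  by (simp add: U_ve pm_PB uc_one)

lemma U_X:
  assumes v: "v \<in> carrier N" and i: "i < n" and p: "p \<in> carrier P"
  shows "U v (PX K n i p) = Xo i (U v p)"
  by (rule C.P_ext[OF module_N klin_comp[OF C.PX_klin[OF i] U_klin[OF v]] klin_comp[OF U_klin[OF v] X[OF i]] _ p])
    (use v i in \<open>auto elim!: PB_cases simp: C.PX_pm pm_PB U_ve uc_simps\<close>)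

text \<open>Here the invariance of v enters. On pure y-monomials the group permutes the operators
  and ends at v, which it fixes; factors x_j are then carried along by equivariance.\<close>

lemma U_G:
  assumes v: "v \<in> carrier N" and inv: "\<And>g. g permutes {..<n} \<Longrightarrow> G g v = v" and g: "g permutes {..<n}" and p: "p \<in> carrier P"
  shows "U v (PG K n g p) = G g (U v p)"
proof (rule C.P_ext_X[OF module_N klin_comp[OF C.PG_klin[OF g] U_klin[OF v]] klin_comp[OF U_klin[OF v] G[OF g]] _ _ p])
  have gi: "g i < n" if "i < n" for i using g that by (metis lessThan_iff permutes_in_image)
  fix b assume b: "set_mset b \<subseteq> Yv ` {..<n}"
  thus "U v (PG K n g (ve K (pm {#} b))) = G g (U v (ve K (pm {#} b)))"
  proof (induction b)
    case empty thus ?case using v inv[OF g] by (simp add: C.PG_ve[OF g] pm_PB bact_pm U_one)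
  next
    case (add z b)
    then obtain i where z: "z = Yv i" "i < n" and b: "set_mset b \<subseteq> Yv ` {..<n}" by auto
    have b': "set_mset (image_mset (gact g) b) \<subseteq> Yv ` {..<n}" using b gi by auto
    show ?case using add(1)[OF b] v z b b' gi GY[OF g z(2)]
      by (simp add: C.PG_ve[OF g] pm_PB bact_pm U_ve uc_simps)
  qed
next
  have gi: "g i < n" if "i < n" for i using g that by (metis lessThan_iff permutes_in_image)
  fix j p assume j: "j < n" and p: "p \<in> carrier P" and IH: "U v (PG K n g p) = G g (U v p)"
  show "U v (PG K n g (PX K n j p)) = G g (U v (PX K n j p))"
    using j p IH v gi by (simp add: C.PGX[OF g] U_X GX[OF g] klinD(1)[OF C.PG_klin[OF g]] klinD(1)[OF U_klin])
qed

lemma U_bracket: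
  assumes v: "v \<in> carrier N" and inv: "\<And>g. g permutes {..<n} \<Longrightarrow> G g v = v" and i: "i < n" "j < n" and p: "p \<in> carrier P"
  shows "U v (PK K n t k i j p) = bracket i j (U v p)"
proof -
  note cl = klinD(1)[OF C.PG_klin[OF permutes_transpose]]
  have f: "(\<lambda>m. PG K n (transpose i m) p) \<in> {..<n} - {i} \<rightarrow> carrier P" using i p cl by auto
  have "finsum N (\<lambda>m. U v (PG K n (transpose i m) p)) ({..<n} - {i}) = finsum N (\<lambda>m. G (transpose i m) (U v p)) ({..<n} - {i})"
    by (rule M.finsum_cong') (use i p v U_G[OF v inv permutes_transpose] klinD(1)[OF Gtr] klinD(1)[OF U_klin[OF v]] in auto)
  hence s: "U v (finsum P (\<lambda>m. PG K n (transpose i m) p) ({..<n} - {i})) = finsum N (\<lambda>m. G (transpose i m) (U v p)) ({..<n} - {i})"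
    by (simp add: klin_finsum[OF C.P_module module_N U_klin[OF v] f])
  show ?thesis
  proof (cases "i = j")
    case True
    show ?thesis unfolding True[symmetric] PK_def C.S.bracket_def bracket_def using p v i t k C.PP.M.finsum_closed[OF f]
      by (simp add: klin_minus[OF C.P_module module_N U_klin] klinD[OF U_klin] s)
  next
    case False
    thus ?thesis unfolding PK_def C.S.bracket_def bracket_def using p v i t k cl
      by (simp add: klinD[OF U_klin] U_G[OF v inv] permutes_transpose)
  qed
qed

text \<open>On pure y-monomials this is the definition of the map. Moving past a factor x_j costs a
  bracket, and the map respects brackets because it respects the group, again by invariance of
  v.\<close>

lemma U_Y:
  assumes v: "v \<in> carrier N" and inv: "\<And>g. g permutes {..<n} \<Longrightarrow> G g v = v" and i: "i < n" and p: "p \<in> carrier P"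
  shows "U v (PY K n t k i p) = Yo i (U v p)"
proof (rule C.P_ext_X[OF module_N klin_comp[OF C.PY_klin[OF i] U_klin[OF v]] klin_comp[OF U_klin[OF v] Y[OF i]] _ _ p])
  fix b assume b: "set_mset b \<subseteq> Yv ` {..<n}"
  thus "U v (PY K n t k i (ve K (pm {#} b))) = Yo i (U v (ve K (pm {#} b)))"
    using v i by (simp add: C.PY_ve C.PYcol_base U_ve pm_PB uc_simps)
next
  fix j p assume j: "j < n" and p: "p \<in> carrier P" and IH: "U v (PY K n t k i p) = Yo i (U v p)"
  show "U v (PY K n t k i (PX K n j p)) = Yo i (U v (PX K n j p))"
    using i j p v IH by (simp add: C.PYX klinD[OF U_klin] klinD(1)[OF C.PX_klin] klinD(1)[OF C.PY_klin]
      klinD(1)[OF C.PK_klin] U_X YX U_bracket[OF v inv])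
qed

text \<open>A family of columns is considered instead of a linear map, and the hypotheses are
  restricted to degree at most L. This matters in the ultraproduct, where for a given index the
  identities are available only up to some degree.\<close>

lemma col_uniq:
  assumes v: "v \<in> carrier N" and one: "T (pm {#} {#}) = v"
    and TX: "\<And>i c. i < n \<Longrightarrow> c \<in> PBL n L \<Longrightarrow> T (mult_x_map (Tns (Gen (Xv i)) c)) = Xo i (T c)"
    and TY: "\<And>i b. i < n \<Longrightarrow> pm {#} b \<in> PBL n L \<Longrightarrow> T (pm {#} (add_mset (Yv i) b)) = Yo i (T (pm {#} b))"
    and c: "c \<in> PBL n L"
  shows "T c = uc v c"
proof -
  have base: "T (pm {#} b) = uc v (pm {#} b)" if "set_mset b \<subseteq> Yv ` {..<n}" "size b \<le> L" for b
    using that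
  proof (induction b)
    case (add z b)
    then obtain i where z: "z = Yv i" "i < n" and b: "set_mset b \<subseteq> Yv ` {..<n}" by auto
    thus ?case using add v TY[of i b] by (simp add: pm_PBL uc_simps)
  qed (use one in \<open>simp add: uc_one\<close>)
  have "c \<in> PBL n L' \<Longrightarrow> L' \<le> L \<Longrightarrow> T c = uc v c" for L'
  proof (induction rule: PB_induct)
    case (X j a b L')
    hence "pm a b \<in> PBL n L" by (simp add: pm_PBL)
    thus ?case using X v TX[of j "pm a b"] by (simp add: C.mult_x_pm uc_simps)
  qed (use base in simp)
  thus ?thesis using c by simp
qed

lemma U_uniq:
  assumes v: "v \<in> carrier N" and f: "klin K P N f" and one: "f (ve K (pm {#} {#})) = v"
    and fX: "\<And>i p. i < n \<Longrightarrow> p \<in> carrier P \<Longrightarrow> f (PX K n i p) = Xo i (f p)"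
    and fY: "\<And>i p. i < n \<Longrightarrow> p \<in> carrier P \<Longrightarrow> f (PY K n t k i p) = Yo i (f p)"
    and p: "p \<in> carrier P"
  shows "f p = U v p"
proof (rule C.P_ext[OF module_N f U_klin[OF v] _ p])
  fix c assume c: "c \<in> PB n"
  then obtain L where "c \<in> PBL n L" using PBL_ex by blast
  hence "f (ve K c) = uc v c"
  proof (rule col_uniq[OF v, where T = "\<lambda>c. f (ve K c)", rotated -1])
    show "f (ve K (pm {#} {#})) = v" by fact
    show "f (ve K (mult_x_map (Tns (Gen (Xv i)) c))) = Xo i (f (ve K c))" if "i < n" "c \<in> PBL n L" for i c
      using fX[of i "ve K c"] that PB_PBL(1)[OF that(2)] by (simp add: C.PX_ve C.ve_P)
    show "f (ve K (pm {#} (add_mset (Yv i) b))) = Yo i (f (ve K (pm {#} b)))" if "i < n" "pm {#} b \<in> PBL n L" for i b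
      using fY[of i "ve K (pm {#} b)"] that PB_PBL(1)[OF that(2)] by (simp add: C.PY_ve C.PYcol_base C.ve_P)
  qed
  thus "f (ve K c) = U v (ve K c)" using c v by (simp add: U_ve)
qed

end

section \<open>The Cherednik algebra\<close>

lemma module_cong:
  assumes "module K M" "carrier M' = carrier M" "\<And>x y. x \<oplus>\<^bsub>M'\<^esub> y = x \<oplus>\<^bsub>M\<^esub> y" "\<zero>\<^bsub>M'\<^esub> = \<zero>\<^bsub>M\<^esub>" "\<And>a x. a \<odot>\<^bsub>M'\<^esub> x = a \<odot>\<^bsub>M\<^esub> x"
  shows "module K M'"
proof -
  interpret M: module K M by fact
  show ?thesis
  proof (rule moduleI)
    show "abelian_group M'"
      by (rule abelian_groupI) (auto simp: assms(2-5) M.M.add.m_ac intro: M.M.add.l_inv_ex)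
  qed (auto simp: assms(2-5) M.smult_l_distr M.smult_r_distr M.smult_assoc1 M.R.is_cring)
qed

lemma (in abelian_monoid) finsum_Sigma:
  assumes "finite A" "\<And>a. a \<in> A \<Longrightarrow> finite (B a)" "\<And>a b. a \<in> A \<Longrightarrow> b \<in> B a \<Longrightarrow> f a b \<in> carrier G"
  shows "(\<Oplus>a\<in>A. \<Oplus>b\<in>B a. f a b) = (\<Oplus>x\<in>Sigma A B. f (fst x) (snd x))"
  using assms
proof (induction A rule: finite_induct)
  case empty thus ?case by simp
next
  case (insert a A)
  have S: "Sigma (insert a A) B = Pair a ` B a \<union> Sigma A B" by auto
  have r: "(\<Oplus>x\<in>Pair a ` B a. f (fst x) (snd x)) = (\<Oplus>b\<in>B a. f a b)"
    by (subst add.finprod_reindex) (use insert in \<open>auto simp: inj_on_def\<close>)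
  have c: "(\<lambda>a. \<Oplus>b\<in>B a. f a b) \<in> A \<rightarrow> carrier G" "(\<Oplus>b\<in>B a. f a b) \<in> carrier G"
    using insert by (auto intro!: finsum_closed)
  have "(\<Oplus>x\<in>Sigma (insert a A) B. f (fst x) (snd x)) = (\<Oplus>x\<in>Pair a ` B a. f (fst x) (snd x)) \<oplus> (\<Oplus>x\<in>Sigma A B. f (fst x) (snd x))"
    unfolding S by (rule finsum_Un_disjoint) (use insert in \<open>auto intro!: finite_SigmaI\<close>)
  thus ?case using insert c r by simp
qed

lemma (in coeff_ring) lin_klin2:
  assumes M: "module K M" and N: "module K N" and T: "\<And>c. c \<in> B \<Longrightarrow> klin K M N (T c)" and v: "v \<in> carrier (vec K B)"
  shows "klin K M N (\<lambda>x. lin K N (\<lambda>c. T c x) v)"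
  unfolding lin_def by (rule klin_finsumf[OF M N klin_smult[OF N T]]) (use v in \<open>auto simp: vec_carrier\<close>)

lemma smono_mult_assoc: "smono_mult (smono_mult u v) w = smono_mult u (smono_mult v w)"
  by (simp add: smono_mult_def comp_assoc) (simp add: gact_comp)

lemma smono_mult_closed: "u \<in> smonos n \<Longrightarrow> v \<in> smonos n \<Longrightarrow> smono_mult u v \<in> smonos n"
proof -
  assume u: "u \<in> smonos n" and v: "v \<in> smonos n"
  obtain w g w' g' where e: "u = (w, g)" "v = (w', g')" by (cases u, cases v) auto
  have g: "g permutes {..<n}" "g' permutes {..<n}" using u v e by (auto simp: smonos_def)
  have "g i < n" if "i < n" for i using g that by (metis lessThan_iff permutes_in_image)
  hence "gact g z \<in> Xv ` {..<n} \<union> Yv ` {..<n}" if "z \<in> Xv ` {..<n} \<union> Yv ` {..<n}" for z using that by auto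
  moreover have "set w' \<subseteq> Xv ` {..<n} \<union> Yv ` {..<n}" using v by (simp add: e smonos_def)
  ultimately have "gact g ` set w' \<subseteq> Xv ` {..<n} \<union> Yv ` {..<n}" by blast
  thus ?thesis using u v g by (simp add: smonos_def smono_mult_def e permutes_compose)
qed

lemma smono_one: "smono_mult ([], id) u = u" "smono_mult u ([], id) = u" "([], id) \<in> smonos n"
proof -
  have "map (gact id) w = w" for w using gact_id by (induction w) auto
  thus "smono_mult ([], id) u = u" by (simp add: smono_mult_def)
qed (auto simp: smono_mult_def smonos_def permutes_id)

section \<open>The smash product as an associative algebra\<close>

context cherednik_data
begin

abbreviation "V \<equiv> vec K (smonos n)"
abbreviation "A \<equiv> smash K n"

lemma smash_simps: "carrier A = carrier V" "x \<oplus>\<^bsub>A\<^esub> y = x \<oplus>\<^bsub>V\<^esub> y" "\<zero>\<^bsub>A\<^esub> = \<zero>\<^bsub>V\<^esub>" "c \<odot>\<^bsub>A\<^esub> x = c \<odot>\<^bsub>V\<^esub> x" "\<one>\<^bsub>A\<^esub> = ve K ([], id)"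
  by (auto simp: smash_def vec_def ve_def smono_elt_def)

lemma A_module: "module K A"
  by (rule module_cong[OF vec_module[of "smonos n"]]) (simp_all add: smash_simps)

lemma klin_A: "klin K A N f \<longleftrightarrow> klin K V N f"
  by (simp add: klin_def smash_simps)

text \<open>Bilinear extension of the product of basis elements. For it, associativity and the unit
  laws reduce to basis elements; \<open>smash_mult\<close> identifies it with the convolution in the
  definition of \<open>smash\<close>.\<close>

definition smash_prod :: "(smono \<Rightarrow> 'k) \<Rightarrow> (smono \<Rightarrow> 'k) \<Rightarrow> smono \<Rightarrow> 'k" where
  "smash_prod f g = lin K V (\<lambda>u. lin K V (\<lambda>v. ve K (smono_mult u v)) g) f"

lemma sm_inner: "u \<in> smonos n \<Longrightarrow> klin K V V (lin K V (\<lambda>v. ve K (smono_mult u v)))"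
  by (intro lin_klin vec_module ve_carrier smono_mult_closed)

lemma sm_klin1: "g \<in> carrier V \<Longrightarrow> klin K V V (\<lambda>f. smash_prod f g)"
  unfolding smash_prod_def by (intro lin_klin vec_module klinD(1)[OF sm_inner])

lemma sm_klin2: "f \<in> carrier V \<Longrightarrow> klin K V V (smash_prod f)"
  unfolding smash_prod_def by (intro lin_klin2 vec_module sm_inner)

lemma sm_ve: "u \<in> smonos n \<Longrightarrow> v \<in> smonos n \<Longrightarrow> smash_prod (ve K u) (ve K v) = ve K (smono_mult u v)"
  unfolding smash_prod_def
  by (simp add: lin_ve[OF vec_module] klinD(1)[OF sm_inner] ve_carrier smono_mult_closed)

lemma sm_closed: "f \<in> carrier V \<Longrightarrow> g \<in> carrier V \<Longrightarrow> smash_prod f g \<in> carrier V"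
  by (rule klinD(1)[OF sm_klin2])

text \<open>The convolution runs over the pairs with a given product \<open>w\<close>, the bilinear
  extension over all pairs; the additional pairs contribute zero to the coefficient at
  \<open>w\<close>.\<close>

lemma smash_mult:
  assumes f: "f \<in> carrier V" and g: "g \<in> carrier V"
  shows "f \<otimes>\<^bsub>A\<^esub> g = smash_prod f g"
proof
  fix w :: smono
  let ?F = "{u. f u \<noteq> \<zero>}" and ?G = "{u. g u \<noteq> \<zero>}"
  have F: "finite ?F" "?F \<subseteq> smonos n" "\<And>u. f u \<in> carrier K" and G: "finite ?G" "?G \<subseteq> smonos n" "\<And>u. g u \<in> carrier K"
    using f g by (auto simp: vec_carrier)
  have vk: "ve K u w \<in> carrier K" for u by (simp add: ve_def)
  have i: "lin K V (\<lambda>v. ve K (smono_mult u v)) g w = (\<Oplus>v\<in>?G. g v \<otimes> ve K (smono_mult u v) w)" if "u \<in> ?F" for u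
    by (rule lin_vec) (use that F G in \<open>auto intro!: ve_carrier smono_mult_closed\<close>)
  have "smash_prod f g w = (\<Oplus>u\<in>?F. f u \<otimes> lin K V (\<lambda>v. ve K (smono_mult u v)) g w)"
    unfolding smash_prod_def by (rule lin_vec) (use F g in \<open>auto intro!: klinD(1)[OF sm_inner]\<close>)
  also have "\<dots> = (\<Oplus>u\<in>?F. \<Oplus>v\<in>?G. f u \<otimes> (g v \<otimes> ve K (smono_mult u v) w))"
    by (intro finsum_cong') (use F G vk i in \<open>auto simp: finsum_rdistr\<close>)
  also have "\<dots> = (\<Oplus>x\<in>?F \<times> ?G. f (fst x) \<otimes> (g (snd x) \<otimes> ve K (smono_mult (fst x) (snd x)) w))"
    by (rule finsum_Sigma) (use F G vk in auto)
  also have "\<dots> = (\<Oplus>x\<in>{(u, v). f u \<noteq> \<zero> \<and> g v \<noteq> \<zero> \<and> smono_mult u v = w}. (\<lambda>(u, v). f u \<otimes> g v) x)"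
  proof (rule add.finprod_mono_neutral_cong_right)
    fix x assume "x \<in> ?F \<times> ?G - {(u, v). f u \<noteq> \<zero> \<and> g v \<noteq> \<zero> \<and> smono_mult u v = w}"
    hence "smono_mult (fst x) (snd x) \<noteq> w" by (auto simp: split_beta mem_Times_iff)
    thus "f (fst x) \<otimes> (g (snd x) \<otimes> ve K (smono_mult (fst x) (snd x)) w) = \<zero>"
      using F(3) G(3) by (simp add: ve_cases)
  next
    fix x assume "x \<in> {(u, v). f u \<noteq> \<zero> \<and> g v \<noteq> \<zero> \<and> smono_mult u v = w}"
    thus "f (fst x) \<otimes> (g (snd x) \<otimes> ve K (smono_mult (fst x) (snd x)) w) = (\<lambda>(u, v). f u \<otimes> g v) x"
      using F(3) G(3) by (simp add: ve_cases split_beta)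
  qed (use F(1,3) G(1,3) vk in \<open>auto simp del: finite_Collect_conjI\<close>)
  also have "\<dots> = (f \<otimes>\<^bsub>A\<^esub> g) w" by (simp add: smash_def)
  finally show "(f \<otimes>\<^bsub>A\<^esub> g) w = smash_prod f g w" by simp
qed

lemma sm_assoc:
  assumes "f \<in> carrier V" "g \<in> carrier V" "h \<in> carrier V"
  shows "smash_prod (smash_prod f g) h = smash_prod f (smash_prod g h)"
proof -
  have 1: "smash_prod (smash_prod (ve K u) (ve K v)) h = smash_prod (ve K u) (smash_prod (ve K v) h)" if "u \<in> smonos n" "v \<in> smonos n" "h \<in> carrier V" for u v h
    by (rule klin_ext[OF vec_module sm_klin2 klin_comp[OF sm_klin2 sm_klin2] _ that(3)])
      (use that in \<open>auto simp: sm_ve ve_carrier sm_closed smono_mult_closed smono_mult_assoc\<close>)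
  have 2: "smash_prod (smash_prod (ve K u) g) h = smash_prod (ve K u) (smash_prod g h)" if "u \<in> smonos n" "g \<in> carrier V" "h \<in> carrier V" for u g h
    by (rule klin_ext[OF vec_module klin_comp[OF sm_klin2 sm_klin1] klin_comp[OF sm_klin1 sm_klin2] _ that(2)])
      (use that in \<open>auto simp: ve_carrier sm_closed 1\<close>)
  show ?thesis
    by (rule klin_ext[OF vec_module klin_comp[OF sm_klin1 sm_klin1] sm_klin1 _ assms(1)])
      (use assms in \<open>auto simp: ve_carrier sm_closed 2\<close>)
qed

lemma sm_one: "f \<in> carrier V \<Longrightarrow> smash_prod (ve K ([], id)) f = f" "f \<in> carrier V \<Longrightarrow> smash_prod f (ve K ([], id)) = f"
proof -
  assume f: "f \<in> carrier V"
  have c: "ve K ([], id) \<in> carrier V" by (simp add: ve_carrier smono_one)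
  show "smash_prod (ve K ([], id)) f = f"
    by (rule klin_ext[OF vec_module sm_klin2[OF c] klin_id _ f]) (simp add: sm_ve smono_one)
  show "smash_prod f (ve K ([], id)) = f"
    by (rule klin_ext[OF vec_module sm_klin1[OF c] klin_id _ f]) (simp add: sm_ve smono_one)
qed

lemma A_ring: "ring A"
proof -
  interpret A: module K A by (rule A_module)
  interpret V: module K V by (rule vec_module)
  show ?thesis
  proof (rule ringI)
    show "abelian_group A" ..
    show "Group.monoid A"
      by (rule monoidI) (auto simp: smash_simps smash_mult sm_closed sm_assoc sm_one ve_carrier smono_one)
  qed (auto simp: smash_simps smash_mult klinD(2)[OF sm_klin1] klinD(2)[OF sm_klin2])
qed

end

abbreviation ginv :: "(nat \<Rightarrow> nat) \<Rightarrow> nat \<Rightarrow> nat" where "ginv \<equiv> inv_into UNIV"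

text \<open>This is a right action: the first letter of a word acts first.\<close>

fun word_act :: "'k ring \<Rightarrow> nat \<Rightarrow> 'k \<Rightarrow> 'k \<Rightarrow> gen list \<Rightarrow> (bvec \<Rightarrow> 'k) \<Rightarrow> bvec \<Rightarrow> 'k" where
  "word_act K n t k [] p = p"
| "word_act K n t k (Xv i # w) p = word_act K n t k w (PY K n t k i p)"
| "word_act K n t k (Yv i # w) p = word_act K n t k w (PX K n i p)"

section \<open>The quotient by the relations and its right action on \<open>P\<close>\<close>

context cherednik_data
begin

interpretation A: ring A by (rule A_ring)
interpretation AM: module K A by (rule A_module)

lemma el_ve: "xel K i = ve K ([Xv i], id)" "yel K i = ve K ([Yv i], id)" "gel K g = ve K ([], g)"
  by (simp_all add: xel_def yel_def gel_def smono_elt_def ve_def)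

lemma ve_A: "u \<in> smonos n \<Longrightarrow> ve K u \<in> carrier A"
  by (simp add: smash_simps ve_carrier)

lemma el_A: "i < n \<Longrightarrow> xel K i \<in> carrier A" "i < n \<Longrightarrow> yel K i \<in> carrier A" "g permutes {..<n} \<Longrightarrow> gel K g \<in> carrier A"
  by (auto simp: el_ve smonos_def permutes_id intro!: ve_A)

lemma gel_tr_A: "i < n \<Longrightarrow> j < n \<Longrightarrow> gel K (transpose i j) \<in> carrier A"
  by (intro el_A permutes_transpose)

lemma ve_mult_A: "u \<in> smonos n \<Longrightarrow> v \<in> smonos n \<Longrightarrow> ve K u \<otimes>\<^bsub>A\<^esub> ve K v = ve K (smono_mult u v)"
  by (simp add: smash_mult ve_carrier sm_ve)

abbreviation "rhs \<equiv> cherednik_rhs K n t k"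

lemma rhs_A: "i < n \<Longrightarrow> j < n \<Longrightarrow> rhs i j \<in> carrier A"
  unfolding cherednik_rhs_def Let_def using t k
  by (auto intro!: A.minus_closed AM.smult_closed A.finsum_closed gel_tr_A)

lemma comm_A: "x \<in> carrier A \<Longrightarrow> y \<in> carrier A \<Longrightarrow> commutator A x y \<in> carrier A"
  by (simp add: commutator_def)

lemma rels_A: "cherednik_rels K n t k \<subseteq> carrier A"
  unfolding cherednik_rels_def Let_def by (auto intro!: A.minus_closed comm_A el_A rhs_A)

abbreviation "Ich \<equiv> cherednik_ideal K n t k"
abbreviation "H \<equiv> cherednik K n t k"
abbreviation "prj \<equiv> cherednik_proj K n t k"

lemma Ich_ideal: "ideal Ich A"
  unfolding cherednik_ideal_def by (rule A.genideal_ideal[OF rels_A])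

interpretation Ic: ideal Ich A by (rule Ich_ideal)

lemma H_simps: "carrier H = carrier (A Quot Ich)" "x \<otimes>\<^bsub>H\<^esub> y = x \<otimes>\<^bsub>A Quot Ich\<^esub> y" "x \<oplus>\<^bsub>H\<^esub> y = x \<oplus>\<^bsub>A Quot Ich\<^esub> y"
  "\<zero>\<^bsub>H\<^esub> = \<zero>\<^bsub>A Quot Ich\<^esub>" "\<one>\<^bsub>H\<^esub> = \<one>\<^bsub>A Quot Ich\<^esub>"
  by (simp_all add: cherednik_def Let_def)

interpretation QR: ring "A Quot Ich" by (rule Ic.quotient_is_ring)

lemma H_ring: "ring H"
proof (rule ringI)
  show "abelian_group H" by (rule abelian_groupI) (auto simp: H_simps QR.add.m_ac intro: QR.add.l_inv_ex)
  show "Group.monoid H" by (rule monoidI) (auto simp: H_simps QR.m_assoc)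
qed (auto simp: H_simps QR.l_distr QR.r_distr)

lemma prj_hom:
  shows "f \<in> carrier A \<Longrightarrow> prj f \<in> carrier H"
    "f \<in> carrier A \<Longrightarrow> g \<in> carrier A \<Longrightarrow> prj (f \<oplus>\<^bsub>A\<^esub> g) = prj f \<oplus>\<^bsub>H\<^esub> prj g"
    "f \<in> carrier A \<Longrightarrow> g \<in> carrier A \<Longrightarrow> prj (f \<otimes>\<^bsub>A\<^esub> g) = prj f \<otimes>\<^bsub>H\<^esub> prj g"
    "prj \<one>\<^bsub>A\<^esub> = \<one>\<^bsub>H\<^esub>"
  using ring_hom_memE[OF Ic.rcos_ring_hom] by (auto simp: cherednik_proj_def H_simps)

lemma prj_surj: assumes "h \<in> carrier H" obtains f where "f \<in> carrier A" "h = prj f"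
  using assms by (auto simp: H_simps FactRing_def A_RCOSETS_defs a_r_coset_def r_coset_def cherednik_proj_def)

lemma prj_zero: "f \<in> Ich \<Longrightarrow> prj f = \<zero>\<^bsub>H\<^esub>"
  by (simp add: cherednik_proj_def H_simps FactRing_def Ic.a_rcos_const)

lemma prj_eq:
  assumes "f \<in> carrier A" "g \<in> carrier A" "prj f = prj g"
  obtains i where "i \<in> Ich" "f = i \<oplus>\<^bsub>A\<^esub> g"
proof -
  have "f \<in> prj g" using Ic.a_rcos_self[OF assms(1)] assms(3) by (simp add: cherednik_proj_def)
  thus ?thesis using that by (auto simp: cherednik_proj_def a_r_coset_def r_coset_def)
qed

lemma Ich_A: "f \<in> Ich \<Longrightarrow> f \<in> carrier A"
  by (rule Ic.a_Hcarr)

lemma A_alg: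
  assumes "c \<in> carrier K" "f \<in> carrier A" "g \<in> carrier A"
  shows "(c \<odot>\<^bsub>A\<^esub> f) \<otimes>\<^bsub>A\<^esub> g = c \<odot>\<^bsub>A\<^esub> (f \<otimes>\<^bsub>A\<^esub> g)" "f \<otimes>\<^bsub>A\<^esub> (c \<odot>\<^bsub>A\<^esub> g) = c \<odot>\<^bsub>A\<^esub> (f \<otimes>\<^bsub>A\<^esub> g)"
proof -
  have V: "c \<odot>\<^bsub>V\<^esub> x \<in> carrier V" if "x \<in> carrier V" for x
    using AM.smult_closed[OF assms(1), of x] that by (simp add: smash_simps)
  show "(c \<odot>\<^bsub>A\<^esub> f) \<otimes>\<^bsub>A\<^esub> g = c \<odot>\<^bsub>A\<^esub> (f \<otimes>\<^bsub>A\<^esub> g)" "f \<otimes>\<^bsub>A\<^esub> (c \<odot>\<^bsub>A\<^esub> g) = c \<odot>\<^bsub>A\<^esub> (f \<otimes>\<^bsub>A\<^esub> g)"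
    using assms V by (simp_all add: smash_simps smash_mult klinD(3)[OF sm_klin1] klinD(3)[OF sm_klin2])
qed

text \<open>The ideal is generated as a ring ideal; a scalar c acts as left multiplication by c
  times the unit, so the ideal absorbs it.\<close>

lemma Ich_smult: "c \<in> carrier K \<Longrightarrow> f \<in> Ich \<Longrightarrow> c \<odot>\<^bsub>A\<^esub> f \<in> Ich"
  using Ic.I_l_closed[of f "c \<odot>\<^bsub>A\<^esub> \<one>\<^bsub>A\<^esub>"] A_alg(1)[of c "\<one>\<^bsub>A\<^esub>" f] by (simp add: Ich_A)

text \<open>Scalar multiplication on the quotient is a union over all representatives. They differ
  by elements of the ideal, which is stable under scalars, so the union is a single coset.\<close>

lemma prj_smult:
  assumes c: "c \<in> carrier K" and f: "f \<in> carrier A"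
  shows "prj (c \<odot>\<^bsub>A\<^esub> f) = c \<odot>\<^bsub>H\<^esub> prj f"
proof -
  have 1: "prj (c \<odot>\<^bsub>A\<^esub> f') = prj (c \<odot>\<^bsub>A\<^esub> f)" if f': "f' \<in> prj f" for f'
  proof -
    obtain i where i: "i \<in> Ich" "f' = i \<oplus>\<^bsub>A\<^esub> f" using f' by (auto simp: cherednik_proj_def a_r_coset_def r_coset_def)
    have "prj (c \<odot>\<^bsub>A\<^esub> f') = prj (c \<odot>\<^bsub>A\<^esub> i) \<oplus>\<^bsub>H\<^esub> prj (c \<odot>\<^bsub>A\<^esub> f)"
      using c f i Ich_A by (simp add: AM.smult_r_distr prj_hom)
    also have "\<dots> = prj (c \<odot>\<^bsub>A\<^esub> f)" using c f i prj_hom(1)[of "c \<odot>\<^bsub>A\<^esub> f"] by (simp add: prj_zero Ich_smult H_simps)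
    finally show ?thesis .
  qed
  have 2: "f \<in> prj f" using Ic.a_rcos_self[OF f] by (simp add: cherednik_proj_def)
  have "c \<odot>\<^bsub>H\<^esub> prj f = (\<Union>f'\<in>prj f. prj (c \<odot>\<^bsub>A\<^esub> f'))" by (simp add: cherednik_def Let_def)
  thus ?thesis using 1 2 by blast
qed

lemma H_module: "module K H"
proof -
  interpret H: ring H by (rule H_ring)
  show ?thesis
  proof (rule moduleI)
    show "cring K" by (rule is_cring)
    show "abelian_group H" ..
    fix a b x assume a: "a \<in> carrier K" and b: "b \<in> carrier K" and "x \<in> carrier H"
    then obtain f where f: "f \<in> carrier A" "x = prj f" using prj_surj by metis
    show "(a \<oplus> b) \<odot>\<^bsub>H\<^esub> x = a \<odot>\<^bsub>H\<^esub> x \<oplus>\<^bsub>H\<^esub> b \<odot>\<^bsub>H\<^esub> x"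
      using a b f by (simp add: prj_smult[symmetric] prj_hom(2)[symmetric] AM.smult_l_distr)
    show "(a \<otimes> b) \<odot>\<^bsub>H\<^esub> x = a \<odot>\<^bsub>H\<^esub> (b \<odot>\<^bsub>H\<^esub> x)" using a b f by (simp add: prj_smult[symmetric] AM.smult_assoc1)
  next
    fix a x assume a: "a \<in> carrier K" and "x \<in> carrier H"
    then obtain f where f: "f \<in> carrier A" "x = prj f" using prj_surj by metis
    show "a \<odot>\<^bsub>H\<^esub> x \<in> carrier H" using a f by (simp add: prj_smult[symmetric] prj_hom)
  next
    fix a x y assume a: "a \<in> carrier K" and "x \<in> carrier H" "y \<in> carrier H"
    then obtain f g where f: "f \<in> carrier A" "x = prj f" "g \<in> carrier A" "y = prj g" using prj_surj by metis
    show "a \<odot>\<^bsub>H\<^esub> (x \<oplus>\<^bsub>H\<^esub> y) = a \<odot>\<^bsub>H\<^esub> x \<oplus>\<^bsub>H\<^esub> a \<odot>\<^bsub>H\<^esub> y"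
      using a f by (simp add: prj_smult[symmetric] prj_hom(2)[symmetric] AM.smult_r_distr)
  next
    fix x assume "x \<in> carrier H"
    then obtain f where f: "f \<in> carrier A" "x = prj f" using prj_surj by metis
    show "\<one> \<odot>\<^bsub>H\<^esub> x = x" using f by (simp add: prj_smult[symmetric])
  qed
qed

lemma H_alg:
  assumes "c \<in> carrier K" "x \<in> carrier H" "y \<in> carrier H"
  shows "(c \<odot>\<^bsub>H\<^esub> x) \<otimes>\<^bsub>H\<^esub> y = c \<odot>\<^bsub>H\<^esub> (x \<otimes>\<^bsub>H\<^esub> y)" "x \<otimes>\<^bsub>H\<^esub> (c \<odot>\<^bsub>H\<^esub> y) = c \<odot>\<^bsub>H\<^esub> (x \<otimes>\<^bsub>H\<^esub> y)"
proof -
  obtain f g where f: "f \<in> carrier A" "x = prj f" "g \<in> carrier A" "y = prj g" using assms prj_surj by metis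
  show "(c \<odot>\<^bsub>H\<^esub> x) \<otimes>\<^bsub>H\<^esub> y = c \<odot>\<^bsub>H\<^esub> (x \<otimes>\<^bsub>H\<^esub> y)" "x \<otimes>\<^bsub>H\<^esub> (c \<odot>\<^bsub>H\<^esub> y) = c \<odot>\<^bsub>H\<^esub> (x \<otimes>\<^bsub>H\<^esub> y)"
    using assms f by (simp_all add: prj_smult[symmetric] prj_hom(3)[symmetric] A_alg)
qed

lemma prj_klin: "klin K A H prj"
  by (simp add: klin_def prj_hom prj_smult)

lemma H_mult_klin: "h \<in> carrier H \<Longrightarrow> klin K H H (\<lambda>x. x \<otimes>\<^bsub>H\<^esub> h)" "h \<in> carrier H \<Longrightarrow> klin K H H (\<lambda>x. h \<otimes>\<^bsub>H\<^esub> x)"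
proof -
  interpret H: ring H by (rule H_ring)
  show "h \<in> carrier H \<Longrightarrow> klin K H H (\<lambda>x. x \<otimes>\<^bsub>H\<^esub> h)" "h \<in> carrier H \<Longrightarrow> klin K H H (\<lambda>x. h \<otimes>\<^bsub>H\<^esub> x)"
    by (auto simp: klin_def H_alg H.l_distr H.r_distr)
qed

text \<open>\<open>P\<close> is a right module: \<open>Xv i\<close> acts by \<open>PY i\<close> and \<open>Yv i\<close> by \<open>PX i\<close>.\<close>

abbreviation "wa \<equiv> word_act K n t k"

text \<open>Inverting the permutation turns the left action of the group on \<open>P\<close> into a
  right one. For a basis element w g the word acts before the permutation, in the order of the
  factors.\<close>

definition right_act :: "(smono \<Rightarrow> 'k) \<Rightarrow> (bvec \<Rightarrow> 'k) \<Rightarrow> bvec \<Rightarrow> 'k" where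
  "right_act f p = lin K P (\<lambda>u. PG K n (ginv (snd u)) (wa (fst u) p)) f"

abbreviation "gens \<equiv> Xv ` {..<n} \<union> Yv ` {..<n}"

lemma wa_klin: "set w \<subseteq> gens \<Longrightarrow> klin K P P (wa w)"
proof (induction w)
  case (Cons z w)
  have e: "wa (z # w) = (\<lambda>p. wa w (wa [z] p))" by (cases z) auto
  have "wa [z] = (case z of Xv i \<Rightarrow> PY K n t k i | Yv i \<Rightarrow> PX K n i)" by (cases z) (auto simp: fun_eq_iff)
  hence z: "klin K P P (wa [z])" using Cons(2) PX_klin PY_klin by (cases z) auto
  show ?case unfolding e by (rule klin_comp[OF z]) (use Cons in auto)
qed (simp add: klin_def)

lemma wa_append: "wa (w @ w') p = wa w' (wa w p)"
proof (induction w arbitrary: p)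
  case (Cons z w) thus ?case by (cases z) auto
qed simp

text \<open>Right-module form of the smash relation: it lets the permutation of one factor of a
  product pass the word of the next factor.\<close>

lemma wa_gact:
  assumes g: "g permutes {..<n}"
  shows "set w \<subseteq> gens \<Longrightarrow> p \<in> carrier P \<Longrightarrow> PG K n (ginv g) (wa (map (gact g) w) p) = wa w (PG K n (ginv g) p)"
proof (induction w arbitrary: p)
  case (Cons z w)
  have g': "ginv g permutes {..<n}" using g by (rule permutes_inv)
  have gg: "ginv g (g i) = i" for i using g permutes_inverses(2) by metis
  have gi: "g i < n" if "i < n" for i using g that by (metis lessThan_iff permutes_in_image)
  show ?case using Cons gi by (auto simp: PGX[OF g'] PGY[OF g'] gg klinD(1)[OF PX_klin] klinD(1)[OF PY_klin])
qed simp

lemma smonosD: "u \<in> smonos n \<Longrightarrow> set (fst u) \<subseteq> gens" "u \<in> smonos n \<Longrightarrow> snd u permutes {..<n}"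
  by (auto simp: smonos_def)

lemma ractb_klin: "u \<in> smonos n \<Longrightarrow> klin K P P (\<lambda>p. PG K n (ginv (snd u)) (wa (fst u) p))"
  by (rule klin_comp[OF wa_klin PG_klin]) (auto dest: smonosD permutes_inv)

lemma right_act_klin1: "p \<in> carrier P \<Longrightarrow> klin K A P (\<lambda>f. right_act f p)"
  unfolding right_act_def klin_A by (rule lin_klin[OF P_module klinD(1)[OF ractb_klin]])

lemma right_act_klin2: "f \<in> carrier A \<Longrightarrow> klin K P P (right_act f)"
  unfolding right_act_def by (rule lin_klin2[OF P_module P_module ractb_klin]) (auto simp: smash_simps)

lemma right_act_ve: "u \<in> smonos n \<Longrightarrow> p \<in> carrier P \<Longrightarrow> right_act (ve K u) p = PG K n (ginv (snd u)) (wa (fst u) p)"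
  unfolding right_act_def by (rule lin_ve[OF P_module]) (rule klinD(1)[OF ractb_klin])

lemma right_act_el:
  assumes "p \<in> carrier P"
  shows "i < n \<Longrightarrow> right_act (xel K i) p = PY K n t k i p" "i < n \<Longrightarrow> right_act (yel K i) p = PX K n i p"
    "g permutes {..<n} \<Longrightarrow> right_act (gel K g) p = PG K n (ginv g) p"
proof -
  have idp: "PG K n (ginv id) q = q" if "q \<in> carrier P" for q using S.G_id[OF that] by simp
  show "i < n \<Longrightarrow> right_act (xel K i) p = PY K n t k i p" "i < n \<Longrightarrow> right_act (yel K i) p = PX K n i p"
    using idp assms klinD(1)[OF PX_klin] klinD(1)[OF PY_klin] by (auto simp: el_ve right_act_ve smonos_def permutes_id)
  show "g permutes {..<n} \<Longrightarrow> right_act (gel K g) p = PG K n (ginv g) p"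
    using assms by (simp add: el_ve right_act_ve smonos_def)
qed

lemma A_ext:
  assumes "module K N" "klin K A N f" "klin K A N g" "\<And>u. u \<in> smonos n \<Longrightarrow> f (ve K u) = g (ve K u)" "v \<in> carrier A"
  shows "f v = g v"
  by (rule klin_ext[OF assms(1), where B = "smonos n"]) (use assms in \<open>auto simp: klin_A smash_simps\<close>)

lemma A_mult_klin: "h \<in> carrier A \<Longrightarrow> klin K A A (\<lambda>x. x \<otimes>\<^bsub>A\<^esub> h)" "h \<in> carrier A \<Longrightarrow> klin K A A (\<lambda>x. h \<otimes>\<^bsub>A\<^esub> x)"
  by (auto simp: klin_def A_alg A.l_distr A.r_distr)

lemma right_act_mult:
  assumes f: "f \<in> carrier A" and g: "g \<in> carrier A" and p: "p \<in> carrier P"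
  shows "right_act (f \<otimes>\<^bsub>A\<^esub> g) p = right_act g (right_act f p)"
proof -
  have 1: "right_act (ve K u \<otimes>\<^bsub>A\<^esub> ve K v) p = right_act (ve K v) (right_act (ve K u) p)" if u: "u \<in> smonos n" and v: "v \<in> smonos n" for u v
  proof -
    obtain w h w' h' where e: "u = (w, h)" "v = (w', h')" by (cases u, cases v) auto
    have h: "h permutes {..<n}" "h' permutes {..<n}" "set w \<subseteq> gens" "set w' \<subseteq> gens" using u v by (auto simp: e smonos_def)
    have hi: "ginv h permutes {..<n}" "ginv h' permutes {..<n}" using h permutes_inv by auto
    have wp: "wa w p \<in> carrier P" using klinD(1)[OF wa_klin[OF h(3)]] p by auto
    have "set (map (gact h) w') \<subseteq> gens" using smono_mult_closed[OF u v] by (auto simp: e smonos_def smono_mult_def)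
    hence c: "wa (map (gact h) w') (wa w p) \<in> carrier P" using klinD(1)[OF wa_klin] wp by blast
    have oi: "ginv (h \<circ> h') = ginv h' \<circ> ginv h" using h permutes_bij by (metis o_inv_distrib)
    have "right_act (ve K u \<otimes>\<^bsub>A\<^esub> ve K v) p = PG K n (ginv (h \<circ> h')) (wa (map (gact h) w') (wa w p))"
      using smono_mult_closed[OF u v] u v p by (simp add: ve_mult_A right_act_ve) (simp add: e smono_mult_def wa_append)
    also have "\<dots> = PG K n (ginv h') (PG K n (ginv h) (wa (map (gact h) w') (wa w p)))"
      unfolding oi by (rule S.G_comp[OF hi(2,1) c])
    also have "\<dots> = right_act (ve K v) (right_act (ve K u) p)"
      using right_act_ve[OF u p] right_act_ve[OF v klinD(1)[OF PG_klin[OF hi(1)] wp]] wa_gact[OF h(1) h(4) wp] by (simp add: e)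
    finally show ?thesis .
  qed
  have 2: "right_act (ve K u \<otimes>\<^bsub>A\<^esub> g) p = right_act g (right_act (ve K u) p)" if u: "u \<in> smonos n" for u
    by (rule A_ext[OF P_module klin_comp[OF A_mult_klin(2)[OF ve_A[OF u]] right_act_klin1[OF p]] right_act_klin1 _ g])
      (use 1 u p klinD(1)[OF right_act_klin1] ve_A in auto)
  show ?thesis
    by (rule A_ext[OF P_module klin_comp[OF A_mult_klin(1)[OF g] right_act_klin1[OF p]] klin_comp[OF right_act_klin1[OF p] right_act_klin2[OF g]] _ f])
      (rule 2)
qed

lemma right_act_rhs:
  assumes i: "i < n" "j < n" and p: "p \<in> carrier P"
  shows "right_act (rhs i j) p = PK K n t k i j p"
proof -
  have one: "right_act \<one>\<^bsub>A\<^esub> p = p" using p S.G_id[OF p] by (simp add: smash_simps right_act_ve smono_one)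
  have tr: "ginv (transpose i m) = transpose i m" for i m :: nat by (simp add: inv_transpose_eq)
  have f: "(\<lambda>m. gel K (transpose i m)) \<in> {..<n} - {i} \<rightarrow> carrier A" using i gel_tr_A by auto
  have s: "right_act (finsum A (\<lambda>m. gel K (transpose i m)) ({..<n} - {i})) p = finsum P (\<lambda>m. PG K n (transpose i m) p) ({..<n} - {i})"
    unfolding klin_finsum[OF A_module P_module right_act_klin1[OF p] f]
    by (rule PP.M.finsum_cong') (use i p klinD(1)[OF PG_klin[OF permutes_transpose]] in \<open>auto simp: right_act_el permutes_transpose tr\<close>)
  show ?thesis
  proof (cases "i = j")
    case True
    show ?thesis unfolding True[symmetric] PK_def S.bracket_def cherednik_rhs_def Let_def
      using p t k A.finsum_closed[OF f] by (simp add: klin_minus[OF A_module P_module right_act_klin1] klinD[OF right_act_klin1] s one)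
  next
    case False
    thus ?thesis unfolding PK_def S.bracket_def cherednik_rhs_def Let_def
      using p t k i gel_tr_A by (simp add: klinD[OF right_act_klin1] right_act_el permutes_transpose tr)
  qed
qed

lemma right_act_comm:
  assumes "f \<in> carrier A" "g \<in> carrier A" "p \<in> carrier P"
  shows "right_act (commutator A f g) p = right_act g (right_act f p) \<ominus>\<^bsub>P\<^esub> right_act f (right_act g p)"
  unfolding commutator_def using assms by (simp add: klin_minus[OF A_module P_module right_act_klin1] right_act_mult)

lemma right_act_rels:
  assumes f: "f \<in> cherednik_rels K n t k" and p: "p \<in> carrier P"
  shows "right_act f p = \<zero>\<^bsub>P\<^esub>"
proof -
  note cl = klinD(1)[OF PX_klin] klinD(1)[OF PY_klin] klinD(1)[OF PK_klin]
  consider i j where "i < n" "j < n" "f = commutator A (xel K i) (xel K j)"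
    | i j where "i < n" "j < n" "f = commutator A (yel K i) (yel K j)"
    | i j where "i < n" "j < n" "f = commutator A (yel K i) (xel K j) \<ominus>\<^bsub>A\<^esub> rhs i j"
    using f unfolding cherednik_rels_def Let_def by blast
  thus ?thesis
  proof cases
    case (1 i j) thus ?thesis using p cl PYY[of i j p] by (simp add: right_act_comm el_A right_act_el a_minus_def PP.M.r_neg)
  next
    case (2 i j) thus ?thesis using p cl PXX[of i j p] by (simp add: right_act_comm el_A right_act_el a_minus_def PP.M.r_neg)
  next
    case (3 i j)
    \<comment> \<open>As y_i acts by \<open>PX\<close> and x_j by \<open>PY\<close>, the relation
      for the pair i, j becomes the commutation rule with the two indices exchanged.\<close>
    have e: "PK K n t k j i p = PK K n t k i j p" by (simp add: PK_def S.bracket_sym)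
    have "right_act f p = (PY K n t k j (PX K n i p) \<ominus>\<^bsub>P\<^esub> PX K n i (PY K n t k j p)) \<ominus>\<^bsub>P\<^esub> PK K n t k i j p"
      using 3 p cl by (simp add: klin_minus[OF A_module P_module right_act_klin1] comm_A el_A rhs_A right_act_comm right_act_el right_act_rhs)
    also have "\<dots> = \<zero>\<^bsub>P\<^esub>" using 3 p cl by (simp add: PYX e a_minus_def PP.M.a_ac PP.M.r_neg1 PP.M.r_neg)
    finally show ?thesis .
  qed
qed

text \<open>The annihilator of \<open>P\<close> is a two-sided ideal, and it contains the defining
  relations.\<close>

lemma right_act_Ich:
  assumes f: "f \<in> Ich" and p: "p \<in> carrier P"
  shows "right_act f p = \<zero>\<^bsub>P\<^esub>"
proof -
  define J where "J = {f \<in> carrier A. \<forall>p\<in>carrier P. right_act f p = \<zero>\<^bsub>P\<^esub>}"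
  have "ideal J A"
  proof (rule idealI[OF A_ring])
    show "subgroup J (add_monoid A)"
      by (rule A.add.subgroupI) (auto simp: J_def klinD(2)[OF right_act_klin1] klin_neg[OF A_module P_module right_act_klin1]
          klin_zero[OF A_module P_module right_act_klin1] intro!: exI[of _ "\<zero>\<^bsub>A\<^esub>"] simp flip: a_inv_def)
    show "x \<otimes>\<^bsub>A\<^esub> a \<in> J" "a \<otimes>\<^bsub>A\<^esub> x \<in> J" if "a \<in> J" "x \<in> carrier A" for a x
      using that klinD(1)[OF right_act_klin2] klin_zero[OF P_module P_module right_act_klin2]
      by (auto simp: J_def right_act_mult)
  qed
  moreover have "cherednik_rels K n t k \<subseteq> J" using rels_A right_act_rels by (auto simp: J_def)
  ultimately have "Ich \<subseteq> J" unfolding cherednik_ideal_def by (rule A.genideal_minimal)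
  thus ?thesis using f p by (auto simp: J_def)
qed

lemma right_act_prj:
  assumes f: "f \<in> carrier A" "g \<in> carrier A" and "prj f = prj g" and p: "p \<in> carrier P"
  shows "right_act f p = right_act g p"
proof -
  obtain i where i: "i \<in> Ich" "f = i \<oplus>\<^bsub>A\<^esub> g" using prj_eq[OF assms(1-3)] .
  show ?thesis using i f p klinD(1)[OF right_act_klin1[OF p] f(2)] by (simp add: klinD(2)[OF right_act_klin1] Ich_A right_act_Ich)
qed

end

section \<open>The spherical subalgebra\<close>

lemma permutes_gi: "g permutes {..<n::nat} \<Longrightarrow> i < n \<Longrightarrow> g i < n"
  by (metis lessThan_iff permutes_in_image)

lemma (in module) smult_nat: "x \<in> carrier M \<Longrightarrow> ([(m::nat)] \<cdot> \<one>) \<odot>\<^bsub>M\<^esub> x = [m] \<cdot>\<^bsub>M\<^esub> x"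
  by (induction m) (auto simp: smult_l_distr)

locale spherical_data = cherednik_data K n t k for K :: "'k ring" (structure) and n t k +
  assumes factU: "[(fact n :: nat)] \<cdot> \<one> \<in> Units K"
begin

interpretation A: ring A by (rule A_ring)
interpretation AM: module K A by (rule A_module)
interpretation H: ring H by (rule H_ring)
interpretation HM: module K H by (rule H_module)

definition "xh i = prj (xel K i)"
definition "yh i = prj (yel K i)"
definition "gh g = prj (gel K g)"

lemma el_H: "i < n \<Longrightarrow> xh i \<in> carrier H" "i < n \<Longrightarrow> yh i \<in> carrier H" "g permutes {..<n} \<Longrightarrow> gh g \<in> carrier H"
  by (simp_all add: xh_def yh_def gh_def prj_hom el_A)

lemma gh_mult: "g permutes {..<n} \<Longrightarrow> h permutes {..<n} \<Longrightarrow> gh g \<otimes>\<^bsub>H\<^esub> gh h = gh (g \<circ> h)"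
  unfolding gh_def by (simp add: prj_hom(3)[symmetric] el_A) (simp add: el_ve ve_mult_A smonos_def smono_mult_def)

lemma gh_id: "gh id = \<one>\<^bsub>H\<^esub>"
  by (simp add: gh_def el_ve prj_hom(4)[symmetric] smash_simps)

lemma gh_xy:
  assumes g: "g permutes {..<n}" and i: "i < n"
  shows "gh g \<otimes>\<^bsub>H\<^esub> xh i = xh (g i) \<otimes>\<^bsub>H\<^esub> gh g" "gh g \<otimes>\<^bsub>H\<^esub> yh i = yh (g i) \<otimes>\<^bsub>H\<^esub> gh g"
  using g i permutes_gi[OF g i] unfolding gh_def xh_def yh_def
  by (simp_all add: prj_hom(3)[symmetric] el_A) (simp_all add: el_ve ve_mult_A smonos_def permutes_id smono_mult_def)

lemma prj_comm:
  assumes "f \<in> carrier A" "g \<in> carrier A"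
  shows "prj (commutator A f g) = prj f \<otimes>\<^bsub>H\<^esub> prj g \<ominus>\<^bsub>H\<^esub> prj g \<otimes>\<^bsub>H\<^esub> prj f"
  unfolding commutator_def using assms by (simp add: klin_minus[OF A_module H_module prj_klin] prj_hom(3))

lemma prj_rel: "f \<in> cherednik_rels K n t k \<Longrightarrow> prj f = \<zero>\<^bsub>H\<^esub>"
  by (rule prj_zero) (use A.genideal_self[OF rels_A] in \<open>auto simp: cherednik_ideal_def\<close>)

lemma H_eqI: "x \<in> carrier H \<Longrightarrow> y \<in> carrier H \<Longrightarrow> x \<ominus>\<^bsub>H\<^esub> y = \<zero>\<^bsub>H\<^esub> \<Longrightarrow> x = y"
  by (metis H.add.inv_closed H.add.inv_inv H.minus_equality a_minus_def)

lemma xh_comm: "i < n \<Longrightarrow> j < n \<Longrightarrow> xh i \<otimes>\<^bsub>H\<^esub> xh j = xh j \<otimes>\<^bsub>H\<^esub> xh i"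
proof -
  assume i: "i < n" "j < n"
  have "commutator A (xel K i) (xel K j) \<in> cherednik_rels K n t k"
    unfolding cherednik_rels_def Let_def using i by blast
  from prj_rel[OF this] have "xh i \<otimes>\<^bsub>H\<^esub> xh j \<ominus>\<^bsub>H\<^esub> xh j \<otimes>\<^bsub>H\<^esub> xh i = \<zero>\<^bsub>H\<^esub>"
    using i by (simp add: prj_comm el_A xh_def)
  from H_eqI[OF _ _ this] show ?thesis using i el_H by simp
qed

lemma yh_comm: "i < n \<Longrightarrow> j < n \<Longrightarrow> yh i \<otimes>\<^bsub>H\<^esub> yh j = yh j \<otimes>\<^bsub>H\<^esub> yh i"
proof -
  assume i: "i < n" "j < n"
  have "commutator A (yel K i) (yel K j) \<in> cherednik_rels K n t k"
    unfolding cherednik_rels_def Let_def using i by blast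
  from prj_rel[OF this] have "yh i \<otimes>\<^bsub>H\<^esub> yh j \<ominus>\<^bsub>H\<^esub> yh j \<otimes>\<^bsub>H\<^esub> yh i = \<zero>\<^bsub>H\<^esub>"
    using i by (simp add: prj_comm el_A yh_def)
  from H_eqI[OF _ _ this] show ?thesis using i el_H by simp
qed

lemma yx_comm: "i < n \<Longrightarrow> j < n \<Longrightarrow> yh i \<otimes>\<^bsub>H\<^esub> xh j = xh j \<otimes>\<^bsub>H\<^esub> yh i \<oplus>\<^bsub>H\<^esub> prj (rhs i j)"
proof -
  assume i: "i < n" "j < n"
  have c: "yh i \<otimes>\<^bsub>H\<^esub> xh j \<in> carrier H" "xh j \<otimes>\<^bsub>H\<^esub> yh i \<in> carrier H" "prj (rhs i j) \<in> carrier H"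
    using i el_H by (auto intro: prj_hom rhs_A)
  have "commutator A (yel K i) (xel K j) \<ominus>\<^bsub>A\<^esub> rhs i j \<in> cherednik_rels K n t k"
    unfolding cherednik_rels_def Let_def using i by blast
  from prj_rel[OF this] have "(yh i \<otimes>\<^bsub>H\<^esub> xh j \<ominus>\<^bsub>H\<^esub> xh j \<otimes>\<^bsub>H\<^esub> yh i) \<ominus>\<^bsub>H\<^esub> prj (rhs i j) = \<zero>\<^bsub>H\<^esub>"
    using i by (simp add: klin_minus[OF A_module H_module prj_klin] comm_A el_A rhs_A prj_comm yh_def xh_def)
  hence "yh i \<otimes>\<^bsub>H\<^esub> xh j \<ominus>\<^bsub>H\<^esub> xh j \<otimes>\<^bsub>H\<^esub> yh i = prj (rhs i j)" by (rule H_eqI[OF H.minus_closed[OF c(1,2)] c(3)])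
  hence "(yh i \<otimes>\<^bsub>H\<^esub> xh j \<ominus>\<^bsub>H\<^esub> xh j \<otimes>\<^bsub>H\<^esub> yh i) \<oplus>\<^bsub>H\<^esub> xh j \<otimes>\<^bsub>H\<^esub> yh i = prj (rhs i j) \<oplus>\<^bsub>H\<^esub> xh j \<otimes>\<^bsub>H\<^esub> yh i" by simp
  thus ?thesis using c by (simp add: a_minus_def H.a_assoc H.l_neg) (simp add: H.a_comm)
qed

text \<open>Right multiplication reverses products, so \<open>x\<^sub>i\<close> and \<open>y\<^sub>i\<close> change roles.\<close>

definition "HX i h = h \<otimes>\<^bsub>H\<^esub> yh i"
definition "HY i h = h \<otimes>\<^bsub>H\<^esub> xh i"
definition "HG g h = h \<otimes>\<^bsub>H\<^esub> gh (ginv g)"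

lemma HXY_klin: "i < n \<Longrightarrow> klin K H H (HX i)" "i < n \<Longrightarrow> klin K H H (HY i)" "g permutes {..<n} \<Longrightarrow> klin K H H (HG g)"
  using H_mult_klin(1) el_H permutes_inv unfolding HX_def HY_def HG_def by blast+

sublocale HS: perm_group_module K H n t k HG
proof -
  interpret M: module K H by (rule H_module)
  show "perm_group_module K H n t k HG"
  proof
    show "t \<in> carrier K" "k \<in> carrier K" by (rule t k)+
    show "klin K H H (HG g)" if "g permutes {..<n}" for g using HXY_klin(3) that .
    show "HG (g \<circ> h) p = HG g (HG h p)" if "g permutes {..<n}" "h permutes {..<n}" "p \<in> carrier H" for g h p
    proof -
      have "ginv (g \<circ> h) = ginv h \<circ> ginv g" using that permutes_bij by (metis o_inv_distrib)
      thus ?thesis using that by (simp add: HG_def gh_mult[symmetric] permutes_inv H.m_assoc el_H)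
    qed
    show "HG id p = p" if "p \<in> carrier H" for p using that by (simp add: HG_def gh_id)
  qed
qed

lemma HS_bracket:
  assumes i: "i < n" "j < n" and h: "h \<in> carrier H"
  shows "HS.bracket i j h = h \<otimes>\<^bsub>H\<^esub> prj (rhs i j)"
proof -
  have tr: "ginv (transpose i m) = transpose i m" for i m :: nat by (simp add: inv_transpose_eq)
  have f: "(\<lambda>m. gel K (transpose i m)) \<in> {..<n} - {i} \<rightarrow> carrier A" using i gel_tr_A by auto
  have f': "(\<lambda>m. gh (transpose i m)) \<in> {..<n} - {i} \<rightarrow> carrier H" using i el_H(3)[OF permutes_transpose] by auto
  have s: "finsum H (\<lambda>m. HG (transpose i m) h) ({..<n} - {i}) = h \<otimes>\<^bsub>H\<^esub> prj (finsum A (\<lambda>m. gel K (transpose i m)) ({..<n} - {i}))"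
    using klin_finsum[OF H_module H_module H_mult_klin(2)[OF h] f']
    by (simp add: klin_finsum[OF A_module H_module prj_klin f] gh_def[symmetric] HG_def tr)
  have c: "prj (finsum A (\<lambda>m. gel K (transpose i m)) ({..<n} - {i})) \<in> carrier H" using f by (intro prj_hom A.finsum_closed)
  show ?thesis
  proof (cases "i = j")
    case True
    show ?thesis unfolding True[symmetric] HS.bracket_def cherednik_rhs_def Let_def
      using h t k c A.finsum_closed[OF f] prj_hom(4)
      by (simp add: klin_minus[OF A_module H_module prj_klin] klinD[OF prj_klin] s klin_minus[OF H_module H_module H_mult_klin(2)[OF h]] H_alg)
  next
    case False
    thus ?thesis unfolding HS.bracket_def cherednik_rhs_def Let_def
      using h t k i gel_tr_A el_H(3)[OF permutes_transpose] by (simp add: klinD[OF prj_klin] H_alg HG_def tr gh_def)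
  qed
qed

sublocale HC: universal_map K H n t k HG HX HY
proof -
  have gi: "ginv g (g i) = i" if "g permutes {..<n}" for g i using permutes_inverses(2)[OF that] .
  have c: "cherednik_operators K H n t k HG HX HY"
  proof
    show "klin K H H (HX i)" "klin K H H (HY i)" if "i < n" for i using HXY_klin that by auto
    show "HG g (HX i p) = HX (g i) (HG g p)" "HG g (HY i p) = HY (g i) (HG g p)" if "g permutes {..<n}" "i < n" "p \<in> carrier H" for g i p
      using that permutes_gi[OF that(1,2)] gh_xy[OF permutes_inv[OF that(1)], of "g i"]
      by (simp_all add: HG_def HX_def HY_def H.m_assoc el_H permutes_inv gi)
    show "HX i (HX j p) = HX j (HX i p)" "HY i (HY j p) = HY j (HY i p)" if "i < n" "j < n" "p \<in> carrier H" for i j p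
      using that by (simp_all add: HX_def HY_def H.m_assoc el_H yh_comm[of i j] xh_comm[of i j])
    show "HY i (HX j p) = HX j (HY i p) \<oplus>\<^bsub>H\<^esub> HS.bracket i j p" if "i < n" "j < n" "p \<in> carrier H" for i j p
    proof -
      \<comment> \<open>The left side is p y_j x_i, whose reordering produces the bracket of y_j and
        x_i, whereas the bracket of y_i and x_j is wanted; the two are equal.\<close>
      have "rhs j i = rhs i j" by (auto simp: cherednik_rhs_def Let_def transpose_commute)
      thus ?thesis using that prj_hom(1)[OF rhs_A[OF that(1,2)]]
        by (simp add: HX_def HY_def HS_bracket H.m_assoc el_H yx_comm H.r_distr)
    qed
  qed
  show "universal_map K H n t k HG HX HY" by (rule universal_map.intro[OF c]) (rule cherednik_data_axioms)
qed

sublocale PU: universal_map K P n t k "PG K n" "PX K n" "PY K n t k"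
  by (rule universal_map.intro) (rule PC.cherednik_operators_axioms cherednik_data_axioms)+

section \<open>The averaging idempotent\<close>

abbreviation "Sn \<equiv> {g. g permutes {..<n}}"
abbreviation "e \<equiv> avg_idem K n t k"
definition "fi = inv\<^bsub>K\<^esub> ([(fact n :: nat)] \<cdot> \<one>)"

lemma fi: "fi \<in> carrier K" "fi \<otimes> ([(fact n :: nat)] \<cdot> \<one>) = \<one>"
  using factU by (auto simp: fi_def)

lemma Sn: "finite Sn" "card Sn = fact n"
  using finite_permutations[of "{..<n}"] card_permutations[of "{..<n}" n] by auto

definition "a0 = fi \<odot>\<^bsub>A\<^esub> (finsum A (gel K) Sn)"

lemma gel_Sn: "gel K \<in> Sn \<rightarrow> carrier A" "gh \<in> Sn \<rightarrow> carrier H"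
  using el_A el_H by auto

lemma a0_A: "a0 \<in> carrier A"
  unfolding a0_def using fi A.finsum_closed[OF gel_Sn(1)] by simp

lemma e_prj: "e = prj a0"
  by (simp add: avg_idem_def a0_def fi_def)

lemma e_H: "e \<in> carrier H"
  by (simp add: e_prj prj_hom a0_A)

lemma e_sum: "e = fi \<odot>\<^bsub>H\<^esub> (finsum H gh Sn)"
  unfolding e_prj a0_def using fi A.finsum_closed[OF gel_Sn(1)]
  by (simp add: prj_smult klin_finsum[OF A_module H_module prj_klin gel_Sn(1)] gh_def[abs_def])

lemma e_gh:
  assumes h: "h permutes {..<n}"
  shows "e \<otimes>\<^bsub>H\<^esub> gh h = e" "gh h \<otimes>\<^bsub>H\<^esub> e = e"
proof -
  have gs: "finsum H gh Sn \<in> carrier H" by (rule H.finsum_closed[OF gel_Sn(2)])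
  have b: "h \<circ> ginv h = id" "ginv h \<circ> h = id" using permutes_inv_o[OF h] by auto
  have p: "g \<circ> h permutes {..<n}" "h \<circ> g permutes {..<n}" if "g permutes {..<n}" for g
    using that h permutes_compose by auto
  have i1: "inj_on (\<lambda>g. g \<circ> h) Sn" by (rule inj_on_inverseI[where g = "\<lambda>g. g \<circ> ginv h"]) (simp add: comp_assoc b)
  have i2: "inj_on (\<lambda>g. h \<circ> g) Sn" by (rule inj_on_inverseI[where g = "\<lambda>g. ginv h \<circ> g"]) (simp add: comp_assoc[symmetric] b)
  have "finsum H gh Sn \<otimes>\<^bsub>H\<^esub> gh h = finsum H (\<lambda>g. gh g \<otimes>\<^bsub>H\<^esub> gh h) Sn"
    by (rule klin_finsum[OF H_module H_module H_mult_klin(1)[OF el_H(3)[OF h]] gel_Sn(2)])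
  also have "\<dots> = finsum H (\<lambda>g. gh (g \<circ> h)) Sn"
    by (rule H.finsum_cong') (use h p in \<open>auto simp: gh_mult el_H(3) simp del: o_apply\<close>)
  also have "\<dots> = finsum H gh ((\<lambda>g. g \<circ> h) ` Sn)"
    by (rule H.add.finprod_reindex[OF _ i1, symmetric]) (use el_H(3) p in auto)
  also have "(\<lambda>g. g \<circ> h) ` Sn = Sn" using image_compose_permutations_right[OF h] by (simp only: image_Collect)
  finally show "e \<otimes>\<^bsub>H\<^esub> gh h = e" using gs fi el_H(3)[OF h] by (simp add: e_sum H_alg)
  have "gh h \<otimes>\<^bsub>H\<^esub> finsum H gh Sn = finsum H (\<lambda>g. gh h \<otimes>\<^bsub>H\<^esub> gh g) Sn"
    by (rule klin_finsum[OF H_module H_module H_mult_klin(2)[OF el_H(3)[OF h]] gel_Sn(2)])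
  also have "\<dots> = finsum H (\<lambda>g. gh (h \<circ> g)) Sn"
    by (rule H.finsum_cong') (use h p in \<open>auto simp: gh_mult el_H(3) simp del: o_apply\<close>)
  also have "\<dots> = finsum H gh ((\<lambda>g. h \<circ> g) ` Sn)"
    by (rule H.add.finprod_reindex[OF _ i2, symmetric]) (use el_H(3) p in auto)
  also have "(\<lambda>g. h \<circ> g) ` Sn = Sn" using image_compose_permutations_left[OF h] by (simp only: image_Collect)
  finally show "gh h \<otimes>\<^bsub>H\<^esub> e = e" using gs fi el_H(3)[OF h] by (simp add: e_sum H_alg)
qed

lemma avg_const:
  assumes N: "module K N" and x: "x \<in> carrier N"
  shows "fi \<odot>\<^bsub>N\<^esub> (finsum N (\<lambda>g. x) Sn) = x"
proof -
  interpret N: module K N by fact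
  have "finsum N (\<lambda>g. x) Sn = [(fact n :: nat)] \<cdot>\<^bsub>N\<^esub> x" unfolding Sn(2)[symmetric] by (rule N.M.add.finprod_const[OF x])
  also have "\<dots> = ([(fact n :: nat)] \<cdot> \<one>) \<odot>\<^bsub>N\<^esub> x" using x by (simp add: N.smult_nat)
  finally show ?thesis using x fi by (simp add: N.smult_assoc1[symmetric])
qed

lemma mult_e:
  assumes h: "h \<in> carrier H" and g: "\<And>g. g permutes {..<n} \<Longrightarrow> h \<otimes>\<^bsub>H\<^esub> gh g = h"
  shows "h \<otimes>\<^bsub>H\<^esub> e = h"
proof -
  have "h \<otimes>\<^bsub>H\<^esub> finsum H gh Sn = finsum H (\<lambda>g. h \<otimes>\<^bsub>H\<^esub> gh g) Sn"
    by (rule klin_finsum[OF H_module H_module H_mult_klin(2)[OF h] gel_Sn(2)])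
  also have "\<dots> = finsum H (\<lambda>g. h) Sn" by (rule H.finsum_cong') (use g h in auto)
  finally show ?thesis using h fi avg_const[OF H_module h] H.finsum_closed[OF gel_Sn(2)] by (simp add: e_sum H_alg)
qed

lemma e_idem: "e \<otimes>\<^bsub>H\<^esub> e = e"
  using mult_e[OF e_H] e_gh by auto

lemma HG_e: "g permutes {..<n} \<Longrightarrow> HG g e = e"
  by (simp add: HG_def e_gh permutes_inv)

section \<open>The map from \<open>P\<close> to eH and its inverse\<close>

definition "Psi = umap K H HX HY e"
abbreviation "uno \<equiv> ve K (pm {#} {#})"

lemma one_P: "uno \<in> carrier P" "uno \<in> PL 0"
  by (auto intro!: ve_P ve_carrier simp: pm_PB pm_PBL)

lemma PG_one: "g permutes {..<n} \<Longrightarrow> PG K n g uno = uno"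
  by (simp add: PG_ve pm_PB bact_pm)

lemma Psi_klin: "klin K P H Psi" unfolding Psi_def by (rule HC.U_klin[OF e_H])
lemma Psi_H: "p \<in> carrier P \<Longrightarrow> Psi p \<in> carrier H" by (rule klinD(1)[OF Psi_klin])
lemma Psi_one: "Psi uno = e" unfolding Psi_def by (rule HC.U_one[OF e_H])
lemma Psi_X: "i < n \<Longrightarrow> p \<in> carrier P \<Longrightarrow> Psi (PX K n i p) = Psi p \<otimes>\<^bsub>H\<^esub> yh i"
  unfolding Psi_def using HC.U_X[OF e_H] by (simp add: HX_def)
lemma Psi_Y: "i < n \<Longrightarrow> p \<in> carrier P \<Longrightarrow> Psi (PY K n t k i p) = Psi p \<otimes>\<^bsub>H\<^esub> xh i"
  unfolding Psi_def using HC.U_Y[OF e_H HG_e] by (simp add: HY_def)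
lemma Psi_G: "g permutes {..<n} \<Longrightarrow> p \<in> carrier P \<Longrightarrow> Psi (PG K n g p) = Psi p \<otimes>\<^bsub>H\<^esub> gh (ginv g)"
  unfolding Psi_def using HC.U_G[OF e_H HG_e] by (simp add: HG_def)

lemma Psi_uniq:
  assumes "klin K P H f" "f uno = h" "\<And>i p. i < n \<Longrightarrow> p \<in> carrier P \<Longrightarrow> f (PX K n i p) = f p \<otimes>\<^bsub>H\<^esub> yh i"
    "\<And>i p. i < n \<Longrightarrow> p \<in> carrier P \<Longrightarrow> f (PY K n t k i p) = f p \<otimes>\<^bsub>H\<^esub> xh i" "p \<in> carrier P"
  shows "f p = umap K H HX HY h p"
  by (rule HC.U_uniq) (use assms one_P klinD(1)[OF assms(1)] in \<open>auto simp: HX_def HY_def\<close>)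

text \<open>Left multiplication by h commutes with the operators, which multiply from the right.
  Both sides are thus maps of modules on \<open>P\<close> with the same value h e at 1.\<close>

lemma Psi_mult_umap: "h \<in> carrier H \<Longrightarrow> p \<in> carrier P \<Longrightarrow> h \<otimes>\<^bsub>H\<^esub> Psi p = umap K H HX HY (h \<otimes>\<^bsub>H\<^esub> e) p"
  by (rule Psi_uniq[OF klin_comp[OF Psi_klin H_mult_klin(2)]]) (auto simp: Psi_one Psi_X Psi_Y H.m_assoc el_H Psi_H)

lemma e_Psi: "p \<in> carrier P \<Longrightarrow> e \<otimes>\<^bsub>H\<^esub> Psi p = Psi p"
  by (simp add: Psi_mult_umap e_H e_idem) (simp add: Psi_def)

text \<open>The inverse on eH: h is applied to the vector 1 of the right module \<open>P\<close>. By
  \<open>right_act_prj\<close> the choice of the representative does not matter.\<close>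

definition "Phi h = right_act (SOME f. f \<in> carrier A \<and> prj f = h) uno"

lemma Phi_prj: assumes f: "f \<in> carrier A" shows "Phi (prj f) = right_act f uno"
proof -
  have "\<exists>f'. f' \<in> carrier A \<and> prj f' = prj f" using f by blast
  from someI_ex[OF this]
  show ?thesis unfolding Phi_def using right_act_prj[OF _ f _ one_P(1)] by auto
qed

lemma Phi_klin: "klin K H P Phi"
  unfolding klin_def
proof (intro conjI ballI)
  fix x assume "x \<in> carrier H" then obtain f where f: "f \<in> carrier A" "x = prj f" using prj_surj by metis
  show "Phi x \<in> carrier P" using f klinD(1)[OF right_act_klin1[OF one_P(1)]] by (simp add: Phi_prj)
  fix y assume "y \<in> carrier H" then obtain g where g: "g \<in> carrier A" "y = prj g" using prj_surj by metis
  show "Phi (x \<oplus>\<^bsub>H\<^esub> y) = Phi x \<oplus>\<^bsub>P\<^esub> Phi y" using f g by (simp add: prj_hom(2)[symmetric] Phi_prj klinD(2)[OF right_act_klin1[OF one_P(1)]])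
next
  fix a x assume a: "a \<in> carrier K" "x \<in> carrier H" then obtain f where f: "f \<in> carrier A" "x = prj f" using prj_surj by metis
  show "Phi (a \<odot>\<^bsub>H\<^esub> x) = a \<odot>\<^bsub>P\<^esub> Phi x" using f a by (simp add: prj_smult[symmetric] Phi_prj klinD(3)[OF right_act_klin1[OF one_P(1)]])
qed

lemma Phi_mult: assumes h: "h \<in> carrier H" and f: "f \<in> carrier A" shows "Phi (h \<otimes>\<^bsub>H\<^esub> prj f) = right_act f (Phi h)"
proof -
  obtain g where g: "g \<in> carrier A" "h = prj g" using prj_surj[OF h] .
  show ?thesis using f g one_P by (simp add: prj_hom(3)[symmetric] Phi_prj right_act_mult)
qed

lemma right_act_a0: "right_act a0 uno = uno"
proof -
  have "right_act (finsum A (gel K) Sn) uno = finsum P (\<lambda>g. right_act (gel K g) uno) Sn"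
    by (rule klin_finsum[OF A_module P_module right_act_klin1[OF one_P(1)] gel_Sn(1)])
  also have "\<dots> = finsum P (\<lambda>g. uno) Sn"
    by (rule PP.M.finsum_cong') (use one_P in \<open>auto simp: right_act_el PG_one permutes_inv\<close>)
  finally show ?thesis unfolding a0_def using fi A.finsum_closed[OF gel_Sn(1)] one_P avg_const[OF P_module one_P(1)]
    by (simp add: klinD(3)[OF right_act_klin1])
qed

text \<open>The composite and the identity are both maps of modules from \<open>P\<close> to itself
  that fix 1, so uniqueness applies. That 1 is fixed uses that averaging does not change the
  invariant vector 1.\<close>

lemma Phi_Psi: "p \<in> carrier P \<Longrightarrow> Phi (Psi p) = p"
proof -
  assume p: "p \<in> carrier P"
  have 1: "Phi (Psi uno) = uno" by (simp add: Psi_one e_prj Phi_prj a0_A right_act_a0)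
  have cl: "Phi (Psi p) \<in> carrier P" if "p \<in> carrier P" for p using klinD(1)[OF Phi_klin Psi_H[OF that]] .
  have "Phi (Psi p) = umap K P (PX K n) (PY K n t k) uno p"
    by (rule PU.U_uniq[OF one_P(1) klin_comp[OF Psi_klin Phi_klin] 1 _ _ p])
      (use cl in \<open>simp_all add: Psi_X Psi_Y yh_def xh_def Phi_mult Psi_H el_A right_act_el\<close>)
  moreover have "p = umap K P (PX K n) (PY K n t k) uno p"
    by (rule PU.U_uniq[OF one_P(1) klin_id _ _ _ p]) auto
  ultimately show ?thesis by simp
qed

lemma Psi_inj: "p \<in> carrier P \<Longrightarrow> q \<in> carrier P \<Longrightarrow> Psi p = Psi q \<Longrightarrow> p = q"
  using Phi_Psi by metis

lemma prj_Cons: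
  assumes "(z # w, g) \<in> smonos n"
  shows "prj (ve K (z # w, g)) = prj (ve K ([z], id)) \<otimes>\<^bsub>H\<^esub> prj (ve K (w, g))"
proof -
  have s: "([z], id) \<in> smonos n" "(w, g) \<in> smonos n" using assms by (auto simp: smonos_def permutes_id)
  have "map (gact id) w = w" using gact_id by (induction w) auto
  hence "ve K (z # w, g) = ve K ([z], id) \<otimes>\<^bsub>A\<^esub> ve K (w, g)" using s by (simp add: ve_mult_A smono_mult_def)
  thus ?thesis using s by (simp add: prj_hom(3) ve_A)
qed

text \<open>\<open>Psi\<close> intertwines the right actions because it does so for the generators.
  Evaluated at the vector 1, this exhibits every e h as a value of \<open>Psi\<close>.\<close>

lemma Psi_right_act:
  assumes f: "f \<in> carrier A" and p: "p \<in> carrier P"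
  shows "Psi (right_act f p) = Psi p \<otimes>\<^bsub>H\<^esub> prj f"
proof (rule A_ext[OF H_module klin_comp[OF right_act_klin1[OF p] Psi_klin] klin_comp[OF prj_klin H_mult_klin(2)[OF Psi_H[OF p]]] _ f])
  fix u assume u: "u \<in> smonos n"
  obtain w g where e: "u = (w, g)" by (cases u)
  have "(w, g) \<in> smonos n \<Longrightarrow> p \<in> carrier P \<Longrightarrow> Psi (PG K n (ginv g) (wa w p)) = Psi p \<otimes>\<^bsub>H\<^esub> prj (ve K (w, g))" for w p
  proof (induction w arbitrary: p)
    case Nil
    hence g: "g permutes {..<n}" by (simp add: smonos_def)
    show ?case using Psi_G[OF permutes_inv[OF g] Nil(2)] permutes_inv_inv[OF g] by (simp add: gh_def el_ve)
  next
    case (Cons z w)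
    have s: "(w, g) \<in> smonos n" "([z], id) \<in> smonos n" using Cons(2) by (auto simp: smonos_def permutes_id)
    have H: "prj (ve K (w, g)) \<in> carrier H" "prj (ve K ([z], id)) \<in> carrier H" using s by (simp_all add: prj_hom ve_A)
    show ?case
    proof (cases z)
      case (Xv i)
      hence i: "i < n" using s by (auto simp: smonos_def)
      show ?thesis using Cons(1)[OF s(1) klinD(1)[OF PY_klin[OF i] Cons(3)]] i Cons(3) H Xv
        by (simp add: prj_Cons[OF Cons(2)[unfolded Xv]] Psi_Y xh_def el_ve H.m_assoc Psi_H)
    next
      case (Yv i)
      hence i: "i < n" using s by (auto simp: smonos_def)
      show ?thesis using Cons(1)[OF s(1) klinD(1)[OF PX_klin[OF i] Cons(3)]] i Cons(3) H Yv
        by (simp add: prj_Cons[OF Cons(2)[unfolded Yv]] Psi_X yh_def el_ve H.m_assoc Psi_H)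
    qed
  qed
  thus "Psi (right_act (ve K u) p) = Psi p \<otimes>\<^bsub>H\<^esub> prj (ve K u)" using u p by (simp add: right_act_ve e)
qed

lemma e_prj_right_act: "f \<in> carrier A \<Longrightarrow> e \<otimes>\<^bsub>H\<^esub> prj f = Psi (right_act f uno)"
  using Psi_right_act[OF _ one_P(1)] Psi_one by simp

section \<open>Comparison of the filtrations\<close>

abbreviation "Fl \<equiv> cherednik_filt K n t k"
definition "AL L = {f \<in> carrier A. \<forall>w g. f (w, g) \<noteq> \<zero> \<longrightarrow> length w \<le> L}"

lemma Fl_AL: "Fl L = prj ` AL L"
  by (simp add: cherednik_filt_def AL_def)

definition "sml L = {u \<in> smonos n. length (fst u) \<le> L}"

lemma AL_vec: "AL L = carrier (vec K (sml L))"
  unfolding AL_def smash_simps by (auto simp: vec_carrier sml_def subset_iff)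

lemma AL_A: "f \<in> AL L \<Longrightarrow> f \<in> carrier A" by (simp add: AL_def)

lemma Fl_add: "x \<in> Fl L \<Longrightarrow> y \<in> Fl L \<Longrightarrow> x \<oplus>\<^bsub>H\<^esub> y \<in> Fl L"
proof -
  interpret W: module K "vec K (sml L)" by (rule vec_module)
  assume "x \<in> Fl L" "y \<in> Fl L"
  then obtain f g where f: "f \<in> AL L" "x = prj f" "g \<in> AL L" "y = prj g" by (auto simp: Fl_AL)
  have "f \<oplus>\<^bsub>A\<^esub> g \<in> AL L" using f W.M.a_closed[of f g] by (simp add: AL_vec smash_simps vec_simps)
  thus ?thesis using f by (auto simp: Fl_AL AL_A prj_hom(2)[symmetric])
qed

lemma Fl_smult: "x \<in> Fl L \<Longrightarrow> c \<in> carrier K \<Longrightarrow> c \<odot>\<^bsub>H\<^esub> x \<in> Fl L"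
proof -
  interpret W: module K "vec K (sml L)" by (rule vec_module)
  assume "x \<in> Fl L" and c: "c \<in> carrier K"
  then obtain f where f: "f \<in> AL L" "x = prj f" by (auto simp: Fl_AL)
  have "c \<odot>\<^bsub>A\<^esub> f \<in> AL L" using f c W.smult_closed[of c f] by (simp add: AL_vec smash_simps vec_simps)
  thus ?thesis using f c by (auto simp: Fl_AL AL_A prj_smult[symmetric])
qed

lemma Fl_zero: "\<zero>\<^bsub>H\<^esub> \<in> Fl L"
proof -
  interpret W: module K "vec K (sml L)" by (rule vec_module)
  have "\<zero>\<^bsub>A\<^esub> \<in> AL L" using W.M.zero_closed by (simp add: AL_vec smash_simps vec_simps)
  thus ?thesis using klin_zero[OF A_module H_module prj_klin] by (auto simp: Fl_AL intro!: image_eqI[of _ _ "\<zero>\<^bsub>A\<^esub>"])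
qed

lemma Fl_mono: "L \<le> L' \<Longrightarrow> x \<in> Fl L \<Longrightarrow> x \<in> Fl L'"
  by (fastforce simp: Fl_AL AL_def)

lemma Fl_mult:
  assumes x: "x \<in> Fl L" and u: "u \<in> sml M"
  shows "x \<otimes>\<^bsub>H\<^esub> prj (ve K u) \<in> Fl (L + M)"
proof -
  obtain f where f: "f \<in> AL L" "x = prj f" using x by (auto simp: Fl_AL)
  have us: "u \<in> smonos n" using u by (simp add: sml_def)
  have V: "ve K u \<in> carrier V" using ve_A[OF us] by (simp add: smash_simps)
  have fv: "f \<in> carrier (vec K (sml L))" using f AL_vec by simp
  have "smash_prod f (ve K u) \<in> carrier (vec K (sml (L + M)))"
    using fv
  proof (induction f rule: vec_induct)
    case zero
    interpret W: module K "vec K (sml (L + M))" by (rule vec_module)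
    have "smash_prod (\<lambda>u. \<zero>) (ve K u) = (\<lambda>u. \<zero>)" using klin_zero[OF vec_module vec_module sm_klin1[OF V]] by (simp add: vec_simps)
    thus ?case using W.M.zero_closed by (simp add: vec_simps)
  next
    case (step a c v)
    interpret W: module K "vec K (sml (L + M))" by (rule vec_module)
    have c: "c \<in> smonos n" "sml L \<subseteq> smonos n" using step by (auto simp: sml_def)
    have v: "v \<in> carrier V" using vec_mono[OF step(1) c(2)] .
    have "smono_mult c u \<in> sml (L + M)" using step(3) u smono_mult_closed[OF c(1) us] by (simp add: sml_def smono_mult_def)
    hence 1: "ve K (smono_mult c u) \<in> carrier (vec K (sml (L + M)))" by (rule ve_carrier)
    have "smash_prod ((a \<odot>\<^bsub>vec K (sml L)\<^esub> ve K c) \<oplus>\<^bsub>vec K (sml L)\<^esub> v) (ve K u) = smash_prod (a \<odot>\<^bsub>V\<^esub> ve K c \<oplus>\<^bsub>V\<^esub> v) (ve K u)"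
      by (simp add: vec_simps)
    also have "\<dots> = a \<odot>\<^bsub>V\<^esub> ve K (smono_mult c u) \<oplus>\<^bsub>V\<^esub> smash_prod v (ve K u)"
      using step(2) c v us V module.smult_closed[OF vec_module step(2), of "ve K c" "smonos n"] ve_carrier[OF c(1)]
      by (simp add: klinD(2,3)[OF sm_klin1[OF V]] sm_ve)
    also have "\<dots> = a \<odot>\<^bsub>vec K (sml (L + M))\<^esub> ve K (smono_mult c u) \<oplus>\<^bsub>vec K (sml (L + M))\<^esub> smash_prod v (ve K u)"
      by (simp add: vec_simps)
    finally show ?case using 1 step(2,5) by simp
  qed
  hence "f \<otimes>\<^bsub>A\<^esub> ve K u \<in> AL (L + M)" using AL_A[OF f(1)] V by (simp add: AL_vec smash_mult smash_simps)
  moreover have "x \<otimes>\<^bsub>H\<^esub> prj (ve K u) = prj (f \<otimes>\<^bsub>A\<^esub> ve K u)" using f AL_A[OF f(1)] ve_A[OF us] by (simp add: prj_hom(3))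
  ultimately show ?thesis by (auto simp: Fl_AL)
qed

lemma e_Fl: "e \<in> Fl 0"
proof -
  interpret W: module K "vec K (sml 0)" by (rule vec_module)
  have g: "gel K \<in> Sn \<rightarrow> carrier (vec K (sml 0))"
    by (auto simp: el_ve sml_def smonos_def intro!: ve_carrier)
  have "finsum A (gel K) Sn u = finsum (vec K (sml 0)) (gel K) Sn u" for u
  proof -
    have g': "gel K \<in> Sn \<rightarrow> carrier V" using gel_Sn(1) by (simp add: smash_simps)
    have "finsum A (gel K) Sn = finsum V (gel K) Sn"
      using klin_finsum[OF A_module vec_module _ gel_Sn(1), of "smonos n" "\<lambda>x. x"] klin_A[of V "\<lambda>x. x"] klin_id[of K V] by simp
    thus ?thesis by (simp add: vec_finsum[OF g] vec_finsum[OF g'])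
  qed
  hence "finsum A (gel K) Sn \<in> carrier (vec K (sml 0))" using W.M.finsum_closed[OF g] by (metis ext)
  hence "a0 \<in> AL 0" unfolding a0_def using fi W.smult_closed[of fi "finsum A (gel K) Sn"] by (simp add: AL_vec smash_simps vec_simps)
  thus ?thesis by (auto simp: Fl_AL e_prj)
qed

lemma Psi_Fl: assumes p: "p \<in> PL L" shows "Psi p \<in> Fl L"
proof -
  have xy: "x \<otimes>\<^bsub>H\<^esub> xh i \<in> Fl (Suc L)" "x \<otimes>\<^bsub>H\<^esub> yh i \<in> Fl (Suc L)" if "i < n" "x \<in> Fl L" for x i L
    using Fl_mult[OF that(2), of "([Xv i], id)" 1] Fl_mult[OF that(2), of "([Yv i], id)" 1] that(1)
    by (simp_all add: xh_def yh_def el_ve sml_def smonos_def permutes_id)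
  have b: "Psi (ve K c) \<in> Fl L" if "c \<in> PBL n L" for c L
    using that
  proof (induction rule: PB_induct)
    case (base b L)
    thus ?case
    proof (induction b arbitrary: L)
      case empty thus ?case using Fl_mono[OF _ e_Fl] by (simp add: Psi_one)
    next
      case (add z b)
      then obtain i L' where z: "z = Yv i" "i < n" "L = Suc L'" by (cases L) auto
      have "Psi (ve K (pm {#} (add_mset z b))) = Psi (ve K (pm {#} b)) \<otimes>\<^bsub>H\<^esub> xh i"
        using Psi_Y[of i "ve K (pm {#} b)"] add(2) z by (simp add: PY_ve PYcol_base pm_PB ve_P)
      thus ?case using add z xy(1)[OF z(2), of _ L'] by simp
    qed
  next
    case (X j a b L)
    have "Psi (ve K (pm (add_mset (Xv j) a) b)) = Psi (ve K (pm a b)) \<otimes>\<^bsub>H\<^esub> yh j"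
      using Psi_X[of j "ve K (pm a b)"] X by (simp add: PX_pm pm_PB ve_P)
    thus ?case using X xy(2)[of j] by simp
  qed
  show ?thesis using p
  proof (induction p rule: vec_induct)
    case zero show ?case using klin_zero[OF P_module H_module Psi_klin] Fl_zero by (simp add: Pmod_def vec_simps)
  next
    case (step a c v)
    have "Psi (a \<odot>\<^bsub>P\<^esub> ve K c \<oplus>\<^bsub>P\<^esub> v) = a \<odot>\<^bsub>H\<^esub> Psi (ve K c) \<oplus>\<^bsub>H\<^esub> Psi v"
      using step(1,2) PL_P ve_P'[OF step(3)] by (simp add: klinD[OF Psi_klin])
    moreover have "a \<odot>\<^bsub>vec K (PBL n L)\<^esub> ve K c \<oplus>\<^bsub>vec K (PBL n L)\<^esub> v = a \<odot>\<^bsub>P\<^esub> ve K c \<oplus>\<^bsub>P\<^esub> v"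
      by (simp add: Pmod_def vec_simps)
    ultimately show ?case using step b[OF step(3)] by (simp add: Fl_add Fl_smult)
  qed
qed

lemma wa_PL: "set w \<subseteq> gens \<Longrightarrow> p \<in> PL L \<Longrightarrow> wa w p \<in> PL (L + length w)"
proof (induction w arbitrary: p L)
  case (Cons z w)
  show ?case
  proof (cases z)
    case (Xv i)
    hence "wa w (PY K n t k i p) \<in> PL (Suc L + length w)" by (intro Cons(1) PY_PL) (use Cons in auto)
    thus ?thesis using Xv by simp
  next
    case (Yv i)
    hence "wa w (PX K n i p) \<in> PL (Suc L + length w)" by (intro Cons(1) PX_PL) (use Cons in auto)
    thus ?thesis using Yv by simp
  qed
qed simp

text \<open>Each letter raises the degree by at most one and 1 has degree 0. Together with
  \<open>Psi_Fl\<close> this makes \<open>Psi\<close> strict for the filtrations: an element with a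
  representative of degree at most L has its preimage in degree at most L.\<close>

lemma right_act_PL: assumes f: "f \<in> AL L" shows "right_act f uno \<in> PL L"
  unfolding right_act_def
proof -
  have s: "PG K n (ginv (snd u)) (wa (fst u) uno) \<in> PL L" if "u \<in> sml L" for u
    using that wa_PL[of "fst u" uno 0] one_P(2) smonosD[of u] by (auto simp: sml_def intro!: PG_PL permutes_inv intro: PL_mono)
  have "lin K P (\<lambda>u. PG K n (ginv (snd u)) (wa (fst u) uno)) f = lin K (vec K (PBL n L)) (\<lambda>u. PG K n (ginv (snd u)) (wa (fst u) uno)) f"
    unfolding Pmod_def by (rule lin_vec_irrel[of f "sml L"]) (use f s PL_P in \<open>auto simp: AL_vec Pmod_def\<close>)
  also have "\<dots> \<in> PL L" by (rule klinD(1)[OF lin_klin[OF vec_module s]]) (use f AL_vec in auto)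
  finally show "lin K P (\<lambda>u. PG K n (ginv (snd u)) (wa (fst u) uno)) f \<in> PL L" .
qed

definition "Inv L = {v \<in> PL L. \<forall>g. g permutes {..<n} \<longrightarrow> PG K n g v = v}"

abbreviation "Sph \<equiv> spherical K n t k"
abbreviation "SF \<equiv> spherical_filt K n t k"

lemma Sph_simps: "carrier Sph = {e \<otimes>\<^bsub>H\<^esub> a \<otimes>\<^bsub>H\<^esub> e | a. a \<in> carrier H}" "x \<otimes>\<^bsub>Sph\<^esub> y = x \<otimes>\<^bsub>H\<^esub> y"
  "x \<oplus>\<^bsub>Sph\<^esub> y = x \<oplus>\<^bsub>H\<^esub> y" "\<one>\<^bsub>Sph\<^esub> = e" "\<zero>\<^bsub>Sph\<^esub> = \<zero>\<^bsub>H\<^esub>" "c \<odot>\<^bsub>Sph\<^esub> x = c \<odot>\<^bsub>H\<^esub> x"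
  by (simp_all add: spherical_def Let_def)

lemma Inv_P: "v \<in> Inv L \<Longrightarrow> v \<in> carrier P" "v \<in> Inv L \<Longrightarrow> g permutes {..<n} \<Longrightarrow> PG K n g v = v" "v \<in> Inv L \<Longrightarrow> v \<in> PL L"
  using PL_P by (auto simp: Inv_def)

lemma Inv_e: assumes v: "v \<in> Inv L" shows "Psi v \<otimes>\<^bsub>H\<^esub> e = Psi v"
proof (rule mult_e[OF Psi_H[OF Inv_P(1)[OF v]]])
  fix g assume g: "g permutes {..<n}"
  show "Psi v \<otimes>\<^bsub>H\<^esub> gh g = Psi v"
    using Psi_G[OF permutes_inv[OF g] Inv_P(1)[OF v]] Inv_P(2)[OF v permutes_inv[OF g]] permutes_inv_inv[OF g] by simp
qed

lemma Psi_bij: "bij_betw Psi (Inv L) (SF L)"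
proof (rule bij_betwI')
  show "Psi x = Psi y \<longleftrightarrow> x = y" if "x \<in> Inv L" "y \<in> Inv L" for x y using Psi_inj Inv_P(1) that by blast
  show "Psi v \<in> SF L" if v: "v \<in> Inv L" for v
  proof -
    have "Psi v = e \<otimes>\<^bsub>H\<^esub> Psi v \<otimes>\<^bsub>H\<^esub> e" using e_Psi[OF Inv_P(1)[OF v]] Inv_e[OF v] by simp
    thus ?thesis using Psi_Fl[OF Inv_P(3)[OF v]] Psi_H[OF Inv_P(1)[OF v]] by (auto simp: spherical_filt_def Sph_simps)
  qed
  show "\<exists>v\<in>Inv L. h = Psi v" if h: "h \<in> SF L" for h
  proof -
    obtain a where a: "a \<in> carrier H" "h = e \<otimes>\<^bsub>H\<^esub> a \<otimes>\<^bsub>H\<^esub> e" using h by (auto simp: spherical_filt_def Sph_simps)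
    obtain f where f: "f \<in> AL L" "h = prj f" using h by (auto simp: spherical_filt_def Fl_AL)
    have hH: "h \<in> carrier H" using a e_H by simp
    have eh: "e \<otimes>\<^bsub>H\<^esub> h = h" unfolding a(2) using a(1) e_H by (simp add: H.m_assoc[symmetric] e_idem)
    have hg: "h \<otimes>\<^bsub>H\<^esub> gh g = h" if "g permutes {..<n}" for g
      unfolding a(2) using a(1) e_H that by (simp add: H.m_assoc el_H e_gh)
    \<comment> \<open>A representative of degree at most L is applied to 1. Because e h = h, the
      result is a preimage of h; its invariance is then read off from the injectivity of
      \<open>Psi\<close>, as h absorbs permutations on the right.\<close>
    define v where "v = right_act f uno"
    have v: "v \<in> PL L" unfolding v_def by (rule right_act_PL[OF f(1)])
    have hv: "h = Psi v" using e_prj_right_act[OF AL_A[OF f(1)]] eh f(2) by (simp add: v_def)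
    have "PG K n g v = v" if g: "g permutes {..<n}" for g
      by (rule Psi_inj) (use v PL_P klinD(1)[OF PG_klin[OF g]] Psi_G[OF g PL_P[OF v]] hg[OF permutes_inv[OF g]] hv in auto)
    thus ?thesis using v hv by (auto simp: Inv_def)
  qed
qed

text \<open>Composing with \<open>Psi\<close> gives a map of modules with value \<open>Psi v\<close>
  at 1, and left multiplication by \<open>Psi v\<close> gives the same since \<open>Psi v\<close>
  absorbs e. As endomorphisms of \<open>P\<close> compose by applying the map of v to the vector of
  the other one, their order agrees with the order of the product.\<close>

lemma Psi_hom:
  assumes v: "v \<in> Inv L" and u: "u \<in> carrier P"
  shows "Psi (umap K P (PX K n) (PY K n t k) v u) = Psi v \<otimes>\<^bsub>H\<^esub> Psi u"
proof -
  note vP = Inv_P(1)[OF v]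
  have cl: "umap K P (PX K n) (PY K n t k) v p \<in> carrier P" if "p \<in> carrier P" for p
    by (rule klinD(1)[OF PU.U_klin[OF vP] that])
  have "Psi (umap K P (PX K n) (PY K n t k) v u) = umap K H HX HY (Psi v) u"
    by (rule Psi_uniq[OF klin_comp[OF PU.U_klin[OF vP] Psi_klin]])
      (use vP cl u in \<open>simp_all add: PU.U_one PU.U_X PU.U_Y[OF vP Inv_P(2)[OF v]] Psi_X Psi_Y\<close>)
  thus ?thesis using Psi_mult_umap[OF Psi_H[OF vP] u] Inv_e[OF v] by simp
qed

end

section \<open>Ultraproducts of permutation representations\<close>

text \<open>Matrices are handled as families of columns: \<open>T c r\<close> is the entry in column \<open>c\<close> and row \<open>r\<close>.\<close>

definition pstab :: "nat \<Rightarrow> bvec set \<Rightarrow> bool" where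
  "pstab m S \<longleftrightarrow> finite S \<and> (\<forall>g. g permutes {..<m} \<longrightarrow> bact g ` S \<subseteq> S)"

text \<open>The family \<open>T\<close> is cut off outside the columns in \<open>S\<close> only
  here, so one and the same family can be used for many sources.\<close>

definition pmor :: "'k ring \<Rightarrow> bvec set \<Rightarrow> bvec set \<Rightarrow> (bvec \<Rightarrow> bvec \<Rightarrow> 'k) \<Rightarrow> 'k rmor" where
  "pmor K S S' T = \<lparr> rsrc = perm_rep K S, rtgt = perm_rep K S', rmat = (\<lambda>r c. if c \<in> S then T c r else \<zero>\<^bsub>K\<^esub>) \<rparr>"

text \<open>The group acts by permuting basis vectors. A matrix therefore commutes with the group
  precisely when its entries are invariant under simultaneous permutation of rows and
  columns.\<close>

definition pgood :: "'k ring \<Rightarrow> nat \<Rightarrow> bvec set \<Rightarrow> bvec set \<Rightarrow> (bvec \<Rightarrow> bvec \<Rightarrow> 'k) \<Rightarrow> bool" where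
  "pgood K m S S' T \<longleftrightarrow> (\<forall>c\<in>S. T c \<in> carrier (vec K S')
     \<and> (\<forall>g. g permutes {..<m} \<longrightarrow> (\<forall>r. T (bact g c) (bact g r) = T c r)))"

text \<open>The sum runs over the support of a column, inside the module on all basis vectors, so
  the composite can be written without naming the intermediate object.\<close>

definition ccomp :: "'k ring \<Rightarrow> (bvec \<Rightarrow> bvec \<Rightarrow> 'k) \<Rightarrow> (bvec \<Rightarrow> bvec \<Rightarrow> 'k) \<Rightarrow> bvec \<Rightarrow> bvec \<Rightarrow> 'k" where
  "ccomp K B A c = lin K (vec K UNIV) B (A c)"

definition tset :: "bvec set \<Rightarrow> bvec set \<Rightarrow> bvec set" where
  "tset S S' = {Tns u v | u v. u \<in> S \<and> v \<in> S'}"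

definition tens :: "'k ring \<Rightarrow> (bvec \<Rightarrow> bvec \<Rightarrow> 'k) \<Rightarrow> (bvec \<Rightarrow> bvec \<Rightarrow> 'k) \<Rightarrow> bvec \<Rightarrow> bvec \<Rightarrow> 'k" where
  "tens K A B c r = kronecker K (\<lambda>r c. A c r) (\<lambda>r c. B c r) r c"

lemma bact_inv:
  assumes "g permutes S" shows "bact (ginv g) (bact g c) = c" "bact g (bact (ginv g) c) = c"
  using permutes_inv_o[OF assms] bact_comp[of g "ginv g" c] bact_comp[of "ginv g" g c] by (simp_all add: bact_id)

lemma bact_inj: "g permutes S \<Longrightarrow> bact g c = bact g d \<longleftrightarrow> c = d"
  by (metis bact_inv(1))

lemma pstab_iff: "pstab m S \<Longrightarrow> g permutes {..<m} \<Longrightarrow> bact g c \<in> S \<longleftrightarrow> c \<in> S"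
proof
  assume S: "pstab m S" and g: "g permutes {..<m}"
  show "c \<in> S \<Longrightarrow> bact g c \<in> S" using S g unfolding pstab_def by blast
  assume "bact g c \<in> S"
  hence "bact (ginv g) (bact g c) \<in> S" using S permutes_inv[OF g] unfolding pstab_def by blast
  thus "c \<in> S" by (simp add: bact_inv[OF g])
qed

lemma pstab_image: "pstab m S \<Longrightarrow> g permutes {..<m} \<Longrightarrow> bact g ` S = S"
proof -
  assume S: "pstab m S" and g: "g permutes {..<m}"
  have "c \<in> bact g ` S" if "c \<in> S" for c
    using pstab_iff[OF S permutes_inv[OF g]] that bact_inv(2)[OF g, of c] by (metis image_eqI)
  thus ?thesis using pstab_iff[OF S g] by auto
qed

lemma pstab_fin: "pstab m S \<Longrightarrow> finite S" by (simp add: pstab_def)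

lemma tset_iff: "Tns u v \<in> tset S S' \<longleftrightarrow> u \<in> S \<and> v \<in> S'" by (auto simp: tset_def)

lemma tset_cases: assumes "c \<in> tset S S'" obtains u v where "c = Tns u v" "u \<in> S" "v \<in> S'"
  using assms by (auto simp: tset_def)

lemma pstab_tset: "pstab m S \<Longrightarrow> pstab m S' \<Longrightarrow> pstab m (tset S S')"
proof -
  assume a: "pstab m S" "pstab m S'"
  have "tset S S' = (\<lambda>(u, v). Tns u v) ` (S \<times> S')" by (auto simp: tset_def)
  thus ?thesis using a unfolding pstab_def by (auto simp: tset_def) blast+
qed

lemma pmor_sel [simp]: "rsrc (pmor K S S' T) = perm_rep K S" "rtgt (pmor K S S' T) = perm_rep K S'"
  "rmat (pmor K S S' T) = (\<lambda>r c. if c \<in> S then T c r else \<zero>\<^bsub>K\<^esub>)"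
  by (simp_all add: pmor_def)

lemma perm_rep_sel [simp]: "basis (perm_rep K S) = S" "act (perm_rep K S) g = map_mtx K S (bact g)"
  by (simp_all add: perm_rep_def)

lemma pmor_eq: "pmor K S S' T = pmor K S S' T' \<longleftrightarrow> (\<forall>c\<in>S. T c = T' c)"
  by (auto simp: pmor_def fun_eq_iff split: if_splits)

lemma map_mor_pmor: "map_mor K (perm_rep K S) (perm_rep K S') \<phi> = pmor K S S' (\<lambda>c. ve K (\<phi> c))"
  by (auto simp: map_mor_def pmor_def map_mtx_def ve_def fun_eq_iff)

text \<open>This is an equality and not only an isomorphism, because pairs of basis vectors are
  again basis vectors and the group acts on them factor by factor.\<close>

lemma rep_tensor_perm:
  assumes "cring K"
  shows "rep_tensor K (perm_rep K S) (perm_rep K S') = perm_rep K (tset S S')"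
proof -
  interpret cring K by fact
  have "kronecker K (map_mtx K S (bact g)) (map_mtx K S' (bact g)) r c = map_mtx K (tset S S') (bact g) r c" for g r c
    by (cases r; cases c) (auto simp: map_mtx_def tset_iff, auto simp: tset_def)
  thus ?thesis by (simp add: rep_tensor_def perm_rep_def tset_def fun_eq_iff)
qed

lemma rep_cat_sel [simp]: "obs (rep_cat K m) = {V. is_rep K m V}" "ars (rep_cat K m) = {f. is_rmor K m f}"
  "src (rep_cat K m) = rsrc" "tgt (rep_cat K m) = rtgt"
  by (simp_all add: rep_cat_def Let_def)

lemma hom_rep: "hom_set (rep_cat K m) V W = {f. is_rmor K m f \<and> rsrc f = V \<and> rtgt f = W}"
  by (auto simp: hom_set_def)

context coeff_ring
begin

lemma mult_act_r:
  assumes "pstab m S" "g permutes {..<m}" "\<And>r c. A r c \<in> carrier K"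
  shows "mtx_mult K S A (map_mtx K S (bact g)) = (\<lambda>r c. if c \<in> S then A r (bact g c) else \<zero>)"
proof (intro ext)
  fix r c
  show "mtx_mult K S A (map_mtx K S (bact g)) r c = (if c \<in> S then A r (bact g c) else \<zero>)"
  proof (cases "c \<in> S")
    case True
    hence gc: "bact g c \<in> S" using pstab_iff[OF assms(1,2)] by simp
    have "mtx_mult K S A (map_mtx K S (bact g)) r c = (\<Oplus>b\<in>S. if bact g c = b then A r b else \<zero>)"
      unfolding mtx_mult_def using True assms(3) by (intro finsum_cong') (auto simp: map_mtx_def)
    also have "\<dots> = A r (bact g c)" using gc pstab_fin[OF assms(1)] assms(3) by (intro add.finprod_singleton) auto
    finally show ?thesis using True by simp
  qed (use assms(3) in \<open>simp add: mtx_mult_def map_mtx_def\<close>)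
qed

lemma mult_act_l:
  assumes "pstab m S" "g permutes {..<m}" "\<And>r c. A r c \<in> carrier K" "\<And>r c. r \<notin> S \<Longrightarrow> A r c = \<zero>"
  shows "mtx_mult K S (map_mtx K S (bact g)) A = (\<lambda>r c. A (bact (ginv g) r) c)"
proof (intro ext)
  fix r c
  let ?r = "bact (ginv g) r"
  have e: "r = bact g b \<longleftrightarrow> ?r = b" for b using bact_inv[OF assms(2)] by metis
  have "mtx_mult K S (map_mtx K S (bact g)) A r c = (\<Oplus>b\<in>S. if ?r = b then A b c else \<zero>)"
    unfolding mtx_mult_def using assms(3) by (intro finsum_cong') (auto simp: map_mtx_def e)
  also have "\<dots> = A ?r c"
  proof (cases "?r \<in> S")
    case True thus ?thesis using pstab_fin[OF assms(1)] assms(3) by (intro add.finprod_singleton) auto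
  next
    case False
    hence "(\<Oplus>b\<in>S. if ?r = b then A b c else \<zero>) = (\<Oplus>b\<in>S. \<zero>)" by (intro finsum_cong') auto
    thus ?thesis using False assms(4) by simp
  qed
  finally show "mtx_mult K S (map_mtx K S (bact g)) A r c = A ?r c" .
qed

lemma is_rep_perm: assumes S: "pstab m S" shows "is_rep K m (perm_rep K S)"
  unfolding is_rep_def perm_rep_sel
proof (intro conjI allI impI)
  show "finite S" by (rule pstab_fin[OF S])
  show "map_mtx K S (bact g) \<in> mtxs K S S" if "g permutes {..<m}" for g
    using pstab_iff[OF S that] by (auto simp: mtxs_def map_mtx_def)
  show "map_mtx K S (bact id) = map_mtx K S id" by (auto simp: map_mtx_def fun_eq_iff bact_id)
  show "map_mtx K S (bact (g \<circ> g')) = mtx_mult K S (map_mtx K S (bact g)) (map_mtx K S (bact g'))"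
    if g: "g permutes {..<m} \<and> g' permutes {..<m}" for g g'
  proof -
    have "mtx_mult K S (map_mtx K S (bact g)) (map_mtx K S (bact g')) = (\<lambda>r c. map_mtx K S (bact g') (bact (ginv g) r) c)"
      by (rule mult_act_l[OF S]) (use g pstab_iff[OF S, of g'] in \<open>auto simp: map_mtx_def\<close>)
    moreover have "bact (ginv g) r = bact g' c \<longleftrightarrow> r = bact (g \<circ> g') c" for r c
      using bact_inv[of g "{..<m}"] g bact_comp[of g g' c] by metis
    ultimately show ?thesis by (auto simp: map_mtx_def fun_eq_iff)
  qed
qed

lemma pgoodD: "pgood K m S S' T \<Longrightarrow> c \<in> S \<Longrightarrow> T c \<in> carrier (vec K S')"
  "pgood K m S S' T \<Longrightarrow> c \<in> S \<Longrightarrow> g permutes {..<m} \<Longrightarrow> T (bact g c) (bact g r) = T c r"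
  by (simp_all add: pgood_def)

lemma pgood_hom:
  assumes S: "pstab m S" "pstab m S'"
  shows "pmor K S S' T \<in> hom_set (rep_cat K m) (perm_rep K S) (perm_rep K S') \<longleftrightarrow> pgood K m S S' T"
proof -
  let ?A = "\<lambda>r c. if c \<in> S then T c r else \<zero>"
  have mt: "?A \<in> mtxs K S' S \<longleftrightarrow> (\<forall>c\<in>S. T c \<in> carrier (vec K S'))"
  proof
    assume "?A \<in> mtxs K S' S"
    hence a: "T c r \<in> carrier K" "T c r \<noteq> \<zero> \<Longrightarrow> r \<in> S'" if "c \<in> S" for c r using that by (auto simp: mtxs_def split: if_splits)
    have "finite {u. T c u \<noteq> \<zero>}" if "c \<in> S" for c by (rule finite_subset[OF _ pstab_fin[OF S(2)]]) (use a that in auto)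
    thus "\<forall>c\<in>S. T c \<in> carrier (vec K S')" using a by (auto simp: vec_carrier)
  qed (auto simp: mtxs_def vec_carrier)
  have eq: "mtx_mult K S ?A (map_mtx K S (bact g)) = mtx_mult K S' (map_mtx K S' (bact g)) ?A \<longleftrightarrow>
     (\<forall>c\<in>S. \<forall>r. T (bact g c) (bact g r) = T c r)" if g: "g permutes {..<m}" and m: "\<forall>c\<in>S. T c \<in> carrier (vec K S')" for g
  proof -
    have l: "mtx_mult K S ?A (map_mtx K S (bact g)) = (\<lambda>r c. if c \<in> S then ?A r (bact g c) else \<zero>)"
      by (rule mult_act_r[OF S(1) g]) (use m in \<open>auto simp: vec_carrier\<close>)
    have r: "mtx_mult K S' (map_mtx K S' (bact g)) ?A = (\<lambda>r c. ?A (bact (ginv g) r) c)"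
      by (rule mult_act_l[OF S(2) g]) (use m in \<open>auto simp: vec_carrier\<close>)
    have "(\<forall>r. T (bact g c) r = T c (bact (ginv g) r)) \<longleftrightarrow> (\<forall>r. T (bact g c) (bact g r) = T c r)" for c
      by (metis bact_inv[OF g])
    thus ?thesis unfolding l r using pstab_iff[OF S(1) g] by (auto simp: fun_eq_iff)
  qed
  show ?thesis unfolding hom_rep is_rmor_def pgood_def
    using mt eq is_rep_perm[OF S(1)] is_rep_perm[OF S(2)] by auto
qed

lemma hom_pmor:
  assumes S: "pstab m S" "pstab m S'" and f: "f \<in> hom_set (rep_cat K m) (perm_rep K S) (perm_rep K S')"
  shows "f = pmor K S S' (\<lambda>c r. rmat f r c)" "pgood K m S S' (\<lambda>c r. rmat f r c)"
proof -
  show e: "f = pmor K S S' (\<lambda>c r. rmat f r c)" using f unfolding hom_rep is_rmor_def pmor_def mtxs_def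
    by (cases f) (auto simp: fun_eq_iff)
  show "pgood K m S S' (\<lambda>c r. rmat f r c)" using f e pgood_hom[OF S] by metis
qed

lemma ccomp_vec:
  assumes "A c \<in> carrier (vec K S')" "\<And>b. b \<in> S' \<Longrightarrow> B b \<in> carrier (vec K S'')"
  shows "ccomp K B A c \<in> carrier (vec K S'')"
proof -
  have "ccomp K B A c = lin K (vec K S'') B (A c)" unfolding ccomp_def
    by (rule lin_vec_irrel[OF assms(1)]) (use assms(2) vec_mono in blast)+
  thus ?thesis using klinD(1)[OF lin_klin[OF vec_module assms(2)] assms(1)] by simp
qed

lemma ccomp_sum:
  assumes "finite S'" "A c \<in> carrier (vec K S')" "\<And>b. b \<in> S' \<Longrightarrow> B b \<in> carrier (vec K S'')"
  shows "ccomp K B A c r = (\<Oplus>b\<in>S'. A c b \<otimes> B b r)"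
  unfolding ccomp_def by (rule lin_vec[OF assms(1)]) (use assms vec_mono in \<open>auto simp: vec_carrier\<close>)

lemma pgood_comp:
  assumes S: "pstab m S" "pstab m S'" and A: "pgood K m S S' A" and B: "pgood K m S' S'' B"
  shows "pgood K m S S'' (ccomp K B A)"
  unfolding pgood_def
proof (intro ballI conjI allI impI)
  fix c assume c: "c \<in> S"
  show "ccomp K B A c \<in> carrier (vec K S'')" by (rule ccomp_vec[where S' = S']) (use pgoodD(1)[OF A c] pgoodD(1)[OF B] in auto)
  fix g r assume g: "g permutes {..<m}"
  have gc: "bact g c \<in> S" using c pstab_iff[OF S(1) g] by simp
  have cs: "ccomp K B A c r = (\<Oplus>b\<in>S'. A c b \<otimes> B b r)" if "c \<in> S" for c r
    by (rule ccomp_sum[OF pstab_fin[OF S(2)]]) (use pgoodD(1)[OF A that] pgoodD(1)[OF B] in auto)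
  have cl: "A d b \<otimes> B b r \<in> carrier K" if "d \<in> S" "b \<in> S'" for d b r
    using pgoodD(1)[OF A that(1)] pgoodD(1)[OF B that(2)] by (auto simp: vec_carrier)
  have "ccomp K B A (bact g c) (bact g r) = (\<Oplus>b\<in>bact g ` S'. A (bact g c) b \<otimes> B b (bact g r))"
    using cs[OF gc] pstab_image[OF S(2) g] by simp
  also have "\<dots> = (\<Oplus>b\<in>S'. A (bact g c) (bact g b) \<otimes> B (bact g b) (bact g r))"
    by (rule add.finprod_reindex) (use cl[OF gc] bact_inj[OF g] pstab_iff[OF S(2) g] in \<open>auto simp: inj_on_def\<close>)
  also have "\<dots> = (\<Oplus>b\<in>S'. A c b \<otimes> B b r)"
    by (intro finsum_cong') (use pgoodD(2)[OF A c g] pgoodD(2)[OF B _ g] cl[OF c] in auto)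
  finally show "ccomp K B A (bact g c) (bact g r) = ccomp K B A c r" using cs[OF c] by simp
qed

lemma cmp_pmor:
  assumes S: "pstab m S" "pstab m S'" and A: "pgood K m S S' A" and B: "pgood K m S' S'' B"
  shows "cmp (rep_cat K m) (pmor K S' S'' B) (pmor K S S' A) = pmor K S S'' (ccomp K B A)"
proof -
  have cs: "ccomp K B A c r = (\<Oplus>b\<in>S'. A c b \<otimes> B b r)" if "c \<in> S" for c r
    by (rule ccomp_sum[OF pstab_fin[OF S(2)]]) (use pgoodD(1)[OF A that] pgoodD(1)[OF B] in auto)
  have cl: "A d b \<in> carrier K" "B b r \<in> carrier K" if "d \<in> S" "b \<in> S'" for d b r
    using pgoodD(1)[OF A that(1)] pgoodD(1)[OF B that(2)] by (auto simp: vec_carrier)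
  have "mtx_mult K S' (rmat (pmor K S' S'' B)) (rmat (pmor K S S' A)) r c = (if c \<in> S then ccomp K B A c r else \<zero>)" for r c
  proof (cases "c \<in> S")
    case True
    have "mtx_mult K S' (rmat (pmor K S' S'' B)) (rmat (pmor K S S' A)) r c = (\<Oplus>b\<in>S'. A c b \<otimes> B b r)"
      unfolding mtx_mult_def by (intro finsum_cong') (use True cl in \<open>auto simp: m_comm\<close>)
    thus ?thesis using True cs[OF True] by simp
  next
    case False
    have "mtx_mult K S' (rmat (pmor K S' S'' B)) (rmat (pmor K S S' A)) r c = (\<Oplus>b\<in>S'. \<zero>)"
      unfolding mtx_mult_def by (intro finsum_cong') (use False in \<open>auto simp: vec_carrier dest!: pgoodD(1)[OF B]\<close>)
    thus ?thesis using False by simp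
  qed
  thus ?thesis by (simp add: rep_cat_def Let_def pmor_def fun_eq_iff)
qed

lemma pgood_map:
  assumes "\<And>c. c \<in> S \<Longrightarrow> \<phi> c \<in> S'" "\<And>g c. g permutes {..<m} \<Longrightarrow> c \<in> S \<Longrightarrow> \<phi> (bact g c) = bact g (\<phi> c)"
  shows "pgood K m S S' (\<lambda>c. ve K (\<phi> c))"
  unfolding pgood_def using assms by (auto intro!: ve_carrier simp: ve_cases bact_inj)

lemma pgood_zero: "pgood K m S S' (\<lambda>c r. \<zero>)"
  using abelian_monoid.zero_closed[of "vec K S'"] module.axioms(2)[OF vec_module]
  by (auto simp: pgood_def vec_simps abelian_group_def)

lemma pgood_add: "pgood K m S S' A \<Longrightarrow> pgood K m S S' B \<Longrightarrow> pgood K m S S' (\<lambda>c r. A c r \<oplus> B c r)"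
proof -
  interpret V: module K "vec K S'" by (rule vec_module)
  show "pgood K m S S' A \<Longrightarrow> pgood K m S S' B \<Longrightarrow> pgood K m S S' (\<lambda>c r. A c r \<oplus> B c r)"
    using V.M.a_closed unfolding pgood_def by (auto simp: vec_simps)
qed

lemma pgood_smult: "a \<in> carrier K \<Longrightarrow> pgood K m S S' A \<Longrightarrow> pgood K m S S' (\<lambda>c r. a \<otimes> A c r)"
proof -
  interpret V: module K "vec K S'" by (rule vec_module)
  show "a \<in> carrier K \<Longrightarrow> pgood K m S S' A \<Longrightarrow> pgood K m S S' (\<lambda>c r. a \<otimes> A c r)"
    using V.smult_closed unfolding pgood_def by (auto simp: vec_simps)
qed

lemma rep_cat_pmor:
  "zer (rep_cat K m) (perm_rep K S) (perm_rep K S') = pmor K S S' (\<lambda>c r. \<zero>)"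
  "idn (rep_cat K m) (perm_rep K S) = pmor K S S (ve K)"
  "pls (rep_cat K m) (pmor K S S' A) (pmor K S S' B) = pmor K S S' (\<lambda>c r. A c r \<oplus> B c r)"
  "a \<in> carrier K \<Longrightarrow> scl (rep_cat K m) a (pmor K S S' A) = pmor K S S' (\<lambda>c r. a \<otimes> A c r)"
  "unt (rep_cat K m) = perm_rep K {Unt}"
  "tno (rep_cat K m) (perm_rep K S) (perm_rep K S') = perm_rep K (tset S S')"
  by (auto simp: rep_cat_def Let_def pmor_def fun_eq_iff map_mor_def map_mtx_def ve_def rep_tensor_perm[OF is_cring])

lemma rep_cat_struct:
  "asc (rep_cat K m) (perm_rep K S) (perm_rep K S') (perm_rep K S'') = pmor K (tset (tset S S') S'') (tset S (tset S' S'')) (\<lambda>c. ve K (assoc_map c))"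
  "asci (rep_cat K m) (perm_rep K S) (perm_rep K S') (perm_rep K S'') = pmor K (tset S (tset S' S'')) (tset (tset S S') S'') (\<lambda>c. ve K (assoc_inv_map c))"
  "lun (rep_cat K m) (perm_rep K S) = pmor K (tset {Unt} S) S (\<lambda>c. ve K (lunit_map c))"
  "swp (rep_cat K m) (perm_rep K S) (perm_rep K S') = pmor K (tset S S') (tset S' S) (\<lambda>c. ve K (swap_map c))"
  by (simp_all add: rep_cat_def Let_def rep_tensor_perm[OF is_cring] map_mor_pmor)

lemma tens_Tns: "tens K A B (Tns u v) = (\<lambda>r. case r of Tns r1 r2 \<Rightarrow> A u r1 \<otimes> B v r2 | _ \<Rightarrow> \<zero>)"
  by (auto simp: fun_eq_iff tens_def split: bvec.split)

lemma tens_vec: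
  assumes "A u \<in> carrier (vec K S)" "B v \<in> carrier (vec K S')"
  shows "tens K A B (Tns u v) \<in> carrier (vec K (tset S S'))"
proof -
  have s: "{r. tens K A B (Tns u v) r \<noteq> \<zero>} \<subseteq> (\<lambda>(a, b). Tns a b) ` ({a. A u a \<noteq> \<zero>} \<times> {b. B v b \<noteq> \<zero>})"
  proof
    fix r assume "r \<in> {r. tens K A B (Tns u v) r \<noteq> \<zero>}"
    thus "r \<in> (\<lambda>(a, b). Tns a b) ` ({a. A u a \<noteq> \<zero>} \<times> {b. B v b \<noteq> \<zero>})"
      using assms by (cases r) (auto simp: tens_Tns vec_carrier)
  qed
  have f: "finite {r. tens K A B (Tns u v) r \<noteq> \<zero>}" by (rule finite_subset[OF s]) (use assms in \<open>auto simp: vec_carrier\<close>)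
  have "(\<lambda>(a, b). Tns a b) ` ({a. A u a \<noteq> \<zero>} \<times> {b. B v b \<noteq> \<zero>}) \<subseteq> tset S S'" using assms by (auto simp: vec_carrier tset_iff)
  thus ?thesis using f s assms by (auto simp: vec_carrier tens_Tns split: bvec.split)
qed

lemma pgood_tens:
  assumes A: "pgood K m S S' A" and B: "pgood K m Q Q' B"
  shows "pgood K m (tset S Q) (tset S' Q') (tens K A B)"
  unfolding pgood_def
proof (intro ballI conjI allI impI)
  fix c assume "c \<in> tset S Q"
  then obtain u v where c: "c = Tns u v" "u \<in> S" "v \<in> Q" by (rule tset_cases)
  show "tens K A B c \<in> carrier (vec K (tset S' Q'))" unfolding c(1)
    by (rule tens_vec) (use c A B pgoodD in blast)+
  fix g r assume g: "g permutes {..<m}"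
  show "tens K A B (bact g c) (bact g r) = tens K A B c r"
    using pgoodD(2)[OF A c(2) g] pgoodD(2)[OF B c(3) g] by (cases r) (simp_all add: c(1) tens_Tns)
qed

lemma tna_pmor:
  assumes "pgood K m S S' A" "pgood K m Q Q' B"
  shows "tna (rep_cat K m) (pmor K S S' A) (pmor K Q Q' B) = pmor K (tset S Q) (tset S' Q') (tens K A B)"
proof -
  have "kronecker K (\<lambda>r c. if c \<in> S then A c r else \<zero>) (\<lambda>r c. if c \<in> Q then B c r else \<zero>) r c = (if c \<in> tset S Q then tens K A B c r else \<zero>)" for r c
  proof (cases c)
    case (Tns u v)
    thus ?thesis using pgoodD(1)[OF assms(1), of u] pgoodD(1)[OF assms(2), of v]
      by (cases r) (auto simp: tens_Tns tset_iff vec_carrier)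
  qed (cases r; auto simp: tset_def)+
  thus ?thesis by (simp add: rep_cat_def Let_def pmor_def fun_eq_iff rep_tensor_perm[OF is_cring])
qed

end

section \<open>Hom-sets of the ultraproduct category as classes of column families\<close>

lemma UN_eq_const: "A \<noteq> {} \<Longrightarrow> (\<And>a. a \<in> A \<Longrightarrow> f a = c) \<Longrightarrow> (\<Union>a\<in>A. f a) = c"
  by auto

lemma uclass_cong: "\<forall>\<^sub>F n in F. s n = s' n \<Longrightarrow> uclass F A s = uclass F A s'"
proof -
  assume a: "\<forall>\<^sub>F n in F. s n = s' n"
  have "(\<forall>\<^sub>F n in F. f n = s n) \<longleftrightarrow> (\<forall>\<^sub>F n in F. f n = s' n)" for f
    by (safe; (rule eventually_elim2[OF a], assumption, simp))
  thus ?thesis by (simp add: uclass_def)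
qed

lemma uclass_self: "s \<in> Pi UNIV A \<Longrightarrow> s \<in> uclass F A s"
  by (simp add: uclass_def)

lemma uclass_eq: "s \<in> Pi UNIV A \<Longrightarrow> uclass F A s = uclass F A s' \<longleftrightarrow> (\<forall>\<^sub>F n in F. s n = s' n)"
proof
  assume "s \<in> Pi UNIV A" "uclass F A s = uclass F A s'"
  hence "s \<in> uclass F A s'" using uclass_self by blast
  thus "\<forall>\<^sub>F n in F. s n = s' n" by (simp add: uclass_def)
qed (rule uclass_cong)

text \<open>Operations on classes are defined as unions over representatives. Changing
  representatives changes the result on a null set only, so all classes in the union
  coincide.\<close>

lemma UN_uclass2:
  assumes "s \<in> Pi UNIV A" "s' \<in> Pi UNIV B"
  shows "(\<Union>p\<in>uclass F A s. \<Union>q\<in>uclass F B s'. uclass F D (\<lambda>n. f n (p n) (q n))) = uclass F D (\<lambda>n. f n (s n) (s' n))"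
proof (rule UN_eq_const, goal_cases)
  case 1 show ?case using uclass_self[OF assms(1)] by blast
next
  case (2 p)
  show ?case
  proof (rule UN_eq_const, goal_cases)
    case 1 show ?case using uclass_self[OF assms(2)] by blast
  next
    case (2 q)
    have "\<forall>\<^sub>F n in F. p n = s n" "\<forall>\<^sub>F n in F. q n = s' n" using 2 \<open>p \<in> uclass F A s\<close> by (auto simp: uclass_def)
    hence "\<forall>\<^sub>F n in F. f n (p n) (q n) = f n (s n) (s' n)" by eventually_elim simp
    thus ?case by (rule uclass_cong)
  qed
qed

locale ultra_setting =
  fixes F :: "nat filter" and K :: "nat \<Rightarrow> 'k ring" and m :: "nat \<Rightarrow> nat"
    and \<psi> :: "(nat \<Rightarrow> 'k) set \<Rightarrow> complex" and t k :: complex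
  assumes F: "nonprincipal_ultrafilter F" and K: "\<And>n. coeff_ring (K n)"
    and psi: "\<psi> \<in> ring_iso (uprod_ring F K) complex_ring"
begin

definition "RC = (\<lambda>n. rep_cat (K n) (m n))"
definition "UC = uprod_cat F RC"
definition "pr S = (\<lambda>n. perm_rep (K n) (S n))"
definition "stab S \<longleftrightarrow> (\<forall>n. pstab (m n) (S n))"
text \<open>This is demanded at every index, since a representing sequence has to lie in the product
  of the hom-sets. Properties valid only almost everywhere are expressed by \<open>ae\<close>
  together with a good family.\<close>

definition "good S S' T \<longleftrightarrow> (\<forall>n. pgood (K n) (m n) (S n) (S' n) (T n))"
definition "rmm S S' T = (\<lambda>n. pmor (K n) (S n) (S' n) (T n))"
definition "cm S S' T = uclass F (\<lambda>n. hom_set (RC n) (pr S n) (pr S' n)) (rmm S S' T)"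
definition "ae S A B \<longleftrightarrow> (\<forall>\<^sub>F n in F. \<forall>c\<in>S n. A n c = B n c)"

lemma ae_refl: "ae S A A" by (simp add: ae_def)
lemma ae_sym: "ae S A B \<Longrightarrow> ae S B A" unfolding ae_def by (erule eventually_mono) simp
lemma ae_trans: "ae S A B \<Longrightarrow> ae S B C \<Longrightarrow> ae S A C" unfolding ae_def by (erule (1) eventually_elim2) simp
lemma ae_mono: "ae S A B \<Longrightarrow> (\<And>n. S' n \<subseteq> S n) \<Longrightarrow> ae S' A B" unfolding ae_def by (erule eventually_mono) blast

lemma rmm_Pi: "stab S \<Longrightarrow> stab S' \<Longrightarrow> rmm S S' T \<in> Pi UNIV (\<lambda>n. hom_set (RC n) (pr S n) (pr S' n)) \<longleftrightarrow> good S S' T"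
  using coeff_ring.pgood_hom[OF K] by (auto simp: rmm_def RC_def pr_def good_def stab_def)

lemma cm_self: "stab S \<Longrightarrow> stab S' \<Longrightarrow> good S S' T \<Longrightarrow> rmm S S' T \<in> cm S S' T"
  unfolding cm_def by (rule uclass_self) (simp add: rmm_Pi)

lemma cm_mem:
  assumes S: "stab S" "stab S'" and p: "p \<in> cm S S' T"
  obtains T' where "p = rmm S S' T'" "good S S' T'" "ae S T' T"
proof -
  let ?T = "\<lambda>n c r. rmat (p n) r c"
  have h: "p n \<in> hom_set (rep_cat (K n) (m n)) (perm_rep (K n) (S n)) (perm_rep (K n) (S' n))" for n
    using p by (auto simp: cm_def uclass_def RC_def pr_def)
  have s: "pstab (m n) (S n)" "pstab (m n) (S' n)" for n using S by (auto simp: stab_def)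
  have 1: "p = rmm S S' ?T" unfolding rmm_def by (rule ext) (rule coeff_ring.hom_pmor(1)[OF K s h])
  have 2: "good S S' ?T" unfolding good_def using coeff_ring.hom_pmor(2)[OF K s h] by simp
  have "\<forall>\<^sub>F n in F. rmm S S' ?T n = rmm S S' T n" using p 1 by (auto simp: cm_def uclass_def)
  hence 3: "ae S ?T T" unfolding ae_def by eventually_elim (simp add: rmm_def pmor_eq)
  show ?thesis by (rule that[OF 1 2 3])
qed

lemma cm_cong: "ae S T T' \<Longrightarrow> cm S S' T = cm S S' T'"
  unfolding cm_def ae_def by (rule uclass_cong, erule eventually_mono) (simp add: rmm_def pmor_eq)

lemma cm_eq: "stab S \<Longrightarrow> stab S' \<Longrightarrow> good S S' T \<Longrightarrow> cm S S' T = cm S S' T' \<longleftrightarrow> ae S T T'"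
  unfolding cm_def using uclass_eq[of "rmm S S' T" "\<lambda>n. hom_set (RC n) (pr S n) (pr S' n)" F "rmm S S' T'"]
  by (simp add: rmm_Pi) (simp add: ae_def rmm_def pmor_eq)

lemma pr_obs: "stab S \<Longrightarrow> pr S \<in> obs UC"
  by (auto simp: UC_def uprod_cat_def RC_def pr_def stab_def coeff_ring.is_rep_perm[OF K])

lemma ucls_rmm: "ucls F RC (rmm S S' T) = cm S S' T"
  by (simp add: ucls_def cm_def RC_def rmm_def pr_def)

lemma cm_st:
  assumes S: "stab S" "stab S'" "good S S' T"
  shows "src UC (cm S S' T) = pr S" "tgt UC (cm S S' T) = pr S'"
proof -
  have "(SOME p. p \<in> cm S S' T) \<in> cm S S' T" using cm_self[OF S] by (rule someI[where P = "\<lambda>p. p \<in> cm S S' T"])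
  then obtain T' where "(SOME p. p \<in> cm S S' T) = rmm S S' T'" by (rule cm_mem[OF S(1,2)])
  thus "src UC (cm S S' T) = pr S" "tgt UC (cm S S' T) = pr S'"
    by (simp_all add: UC_def uprod_cat_def RC_def rmm_def pr_def)
qed

lemma hom_UC:
  assumes S: "stab S" "stab S'"
  shows "hom_set UC (pr S) (pr S') = {cm S S' T | T. good S S' T}"
proof (rule subset_antisym; rule subsetI)
  fix f assume f: "f \<in> hom_set UC (pr S) (pr S')"
  then obtain V W p where p: "p \<in> Pi UNIV (\<lambda>n. hom_set (RC n) (V n) (W n))" "f = uclass F (\<lambda>n. hom_set (RC n) (V n) (W n)) p"
    by (auto simp: hom_set_def UC_def uprod_cat_def uprod_def)
  have "p \<in> f" using p uclass_self by auto
  \<comment> \<open>Source and target of an arrow are defined through a chosen representative. Every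
    representative lies in the product of the hom-sets, so all of them have the same source and
    target at every index.\<close>
  hence "(SOME p. p \<in> f) \<in> f" by (rule someI[where P = "\<lambda>p. p \<in> f"])
  hence q: "(SOME p. p \<in> f) n \<in> hom_set (RC n) (V n) (W n)" for n using p by (auto simp: uclass_def)
  have "V = pr S" "W = pr S'" using f q by (auto simp: hom_set_def UC_def uprod_cat_def fun_eq_iff)
  hence p': "p \<in> Pi UNIV (\<lambda>n. hom_set (RC n) (pr S n) (pr S' n))" "f = uclass F (\<lambda>n. hom_set (RC n) (pr S n) (pr S' n)) p" using p by auto
  have h: "p n \<in> hom_set (rep_cat (K n) (m n)) (perm_rep (K n) (S n)) (perm_rep (K n) (S' n))" for n
    using p' by (auto simp: RC_def pr_def)
  have s: "pstab (m n) (S n)" "pstab (m n) (S' n)" for n using S by (auto simp: stab_def)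
  define T where "T = (\<lambda>n c r. rmat (p n) r c)"
  have "p = rmm S S' T" unfolding rmm_def T_def by (rule ext) (rule coeff_ring.hom_pmor(1)[OF K s h])
  moreover have "good S S' T" unfolding good_def T_def using coeff_ring.hom_pmor(2)[OF K s h] by simp
  ultimately show "f \<in> {cm S S' T | T. good S S' T}" using p'(2) by (auto simp: cm_def)
next
  fix f assume "f \<in> {cm S S' T | T. good S S' T}"
  then obtain T where T: "f = cm S S' T" "good S S' T" by auto
  have "f \<in> uprod F (\<lambda>n. hom_set (RC n) (pr S n) (pr S' n))"
    unfolding uprod_def T cm_def using T S by (intro imageI) (simp add: rmm_Pi)
  hence "f \<in> ars UC" using pr_obs[OF S(1)] pr_obs[OF S(2)] by (auto simp: UC_def uprod_cat_def)
  thus "f \<in> hom_set UC (pr S) (pr S')" using cm_st[OF S T(2)] T by (simp add: hom_set_def)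
qed

definition "tS S S' = (\<lambda>n. tset (S n) (S' n))"
definition "kcmp B A = (\<lambda>n. ccomp (K n) (B n) (A n))"
definition "tn A B = (\<lambda>n. tens (K n) (A n) (B n))"
definition "vee = (\<lambda>n. ve (K n))"

lemma stab_tS: "stab S \<Longrightarrow> stab S' \<Longrightarrow> stab (tS S S')"
  by (simp add: stab_def tS_def pstab_tset)

lemma good_comp: "stab S \<Longrightarrow> stab S' \<Longrightarrow> good S S' A \<Longrightarrow> good S' S'' B \<Longrightarrow> good S S'' (kcmp B A)"
  by (auto simp: good_def kcmp_def stab_def intro: coeff_ring.pgood_comp[OF K])

lemma good_tn: "good S S' A \<Longrightarrow> good Q Q' B \<Longrightarrow> good (tS S Q) (tS S' Q') (tn A B)"
  by (auto simp: good_def tn_def tS_def intro: coeff_ring.pgood_tens[OF K])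

lemma goodD: "good S S' T \<Longrightarrow> c \<in> S n \<Longrightarrow> T n c \<in> carrier (vec (K n) (S' n))"
  by (auto simp: good_def pgood_def)

lemma good_vee: "(\<And>n. S n \<subseteq> S' n) \<Longrightarrow> good S S' vee"
  unfolding good_def vee_def by (intro allI coeff_ring.pgood_map[OF K, where \<phi> = "\<lambda>c. c"]) auto

text \<open>A column of the composite involves only those columns of \<open>B\<close> that lie in
  the support of the corresponding column of \<open>A\<close>, hence in \<open>S'\<close>. Agreement
  on \<open>S\<close> and on \<open>S'\<close> is therefore enough.\<close>

lemma comp_cong:
  assumes A: "ae S A A'" and B: "ae S' B B'" and g: "good S S' A" "good S' S'' B"
  shows "ae S (kcmp B A) (kcmp B' A')"
  using A B unfolding ae_def
proof eventually_elim
  case (elim n)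
  show ?case
  proof
    fix c assume c: "c \<in> S n"
    interpret coeff_ring "K n" by (rule K)
    have "{b. A n c b \<noteq> \<zero>\<^bsub>K n\<^esub>} \<subseteq> S' n" using goodD[OF g(1) c] by (auto simp: vec_carrier)
    hence e: "B n b = B' n b" if "A n c b \<noteq> \<zero>\<^bsub>K n\<^esub>" for b using elim that by auto
    have "lin (K n) (vec (K n) UNIV) (B n) (A n c) = lin (K n) (vec (K n) UNIV) (B' n) (A n c)"
    proof (rule lin_cong[OF e _ vec_module])
      fix b assume "A n c b \<noteq> \<zero>\<^bsub>K n\<^esub>"
      hence b: "b \<in> S' n" and a: "A n c b \<in> carrier (K n)" using goodD[OF g(1) c] by (auto simp: vec_carrier)
      have B: "B n b \<in> carrier (vec (K n) UNIV)" using goodD[OF g(2) b] by (rule vec_mono) simp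
      show "A n c b \<odot>\<^bsub>vec (K n) UNIV\<^esub> B n b \<in> carrier (vec (K n) UNIV)"
        by (rule module.smult_closed[OF vec_module a B])
    qed
    thus "kcmp B A n c = kcmp B' A' n c" using elim(1) c by (simp add: kcmp_def ccomp_def)
  qed
qed

end

section \<open>Operations of the ultraproduct category on column families\<close>

context ultra_setting
begin

lemma UC_sel:
  "cmp UC = (\<lambda>Q P. \<Union>q\<in>Q. \<Union>p\<in>P. ucls F RC (\<lambda>n. q n \<bullet>\<^bsub>RC n\<^esub> p n))"
  "pls UC = (\<lambda>P Q. \<Union>p\<in>P. \<Union>q\<in>Q. ucls F RC (\<lambda>n. pls (RC n) (p n) (q n)))"
  "scl UC = (\<lambda>A P. \<Union>a\<in>A. \<Union>p\<in>P. ucls F RC (\<lambda>n. scl (RC n) (a n) (p n)))"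
  "tna UC = (\<lambda>P Q. \<Union>p\<in>P. \<Union>q\<in>Q. ucls F RC (\<lambda>n. tna (RC n) (p n) (q n)))"
  "idn UC = (\<lambda>V. ucls F RC (\<lambda>n. idn (RC n) (V n)))"
  "zer UC = (\<lambda>V W. ucls F RC (\<lambda>n. zer (RC n) (V n) (W n)))"
  "unt UC = (\<lambda>n. unt (RC n))" "tno UC = (\<lambda>V W n. tno (RC n) (V n) (W n))"
  "asc UC = (\<lambda>U V W. ucls F RC (\<lambda>n. asc (RC n) (U n) (V n) (W n)))"
  "asci UC = (\<lambda>U V W. ucls F RC (\<lambda>n. asci (RC n) (U n) (V n) (W n)))"
  "lun UC = (\<lambda>V. ucls F RC (\<lambda>n. lun (RC n) (V n)))"
  "swp UC = (\<lambda>V W. ucls F RC (\<lambda>n. swp (RC n) (V n) (W n)))"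
  by (simp_all add: UC_def uprod_cat_def)

definition "UT = (\<lambda>n::nat. {Unt})"
definition "zef = (\<lambda>n (c::bvec) (r::bvec). \<zero>\<^bsub>K n\<^esub>)"
definition "addf A B = (\<lambda>n (c::bvec) (r::bvec). A n c r \<oplus>\<^bsub>K n\<^esub> B n c r)"
definition "sclf s A = (\<lambda>n (c::bvec) (r::bvec). s n \<otimes>\<^bsub>K n\<^esub> A n c r)"
definition "mapf \<phi> = (\<lambda>n (c::bvec). ve (K n) (\<phi> c :: bvec))"

lemma UC_pr:
  "idn UC (pr S) = cm S S vee" "zer UC (pr S) (pr S') = cm S S' zef" "unt UC = pr UT"
  "tno UC (pr S) (pr S') = pr (tS S S')"
  "asc UC (pr S) (pr S') (pr S'') = cm (tS (tS S S') S'') (tS S (tS S' S'')) (mapf assoc_map)"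
  "asci UC (pr S) (pr S') (pr S'') = cm (tS S (tS S' S'')) (tS (tS S S') S'') (mapf assoc_inv_map)"
  "lun UC (pr S) = cm (tS UT S) S (mapf lunit_map)"
  "swp UC (pr S) (pr S') = cm (tS S S') (tS S' S) (mapf swap_map)"
  unfolding UC_sel ucls_rmm[symmetric]
  by (simp_all add: RC_def pr_def rmm_def tS_def UT_def zef_def mapf_def vee_def coeff_ring.rep_cat_pmor[OF K] coeff_ring.rep_cat_struct[OF K])

lemma UC_cmp:
  assumes S: "stab S" "stab S'" "stab S''" and A: "good S S' A" and B: "good S' S'' B"
  shows "cm S' S'' B \<bullet>\<^bsub>UC\<^esub> cm S S' A = cm S S'' (kcmp B A)"
  unfolding UC_sel
proof (rule UN_eq_const, goal_cases)
  case 1 show ?case using cm_self[OF S(2,3) B] by auto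
next
  case (2 q)
  obtain B' where B': "q = rmm S' S'' B'" "good S' S'' B'" "ae S' B' B" using cm_mem[OF S(2,3) 2] .
  show ?case
  proof (rule UN_eq_const, goal_cases)
    case 1 show ?case using cm_self[OF S(1,2) A] by auto
  next
    case (2 p)
    obtain A' where A': "p = rmm S S' A'" "good S S' A'" "ae S A' A" using cm_mem[OF S(1,2) 2] .
    have "(\<lambda>n. q n \<bullet>\<^bsub>RC n\<^esub> p n) = rmm S S'' (kcmp B' A')"
      unfolding B' A' rmm_def kcmp_def RC_def using S A' B' by (auto simp: stab_def good_def intro!: ext coeff_ring.cmp_pmor[OF K])
    thus ?case using cm_cong[OF comp_cong[OF A'(3) B'(3) A'(2) B'(2)]] by (simp add: ucls_rmm)
  qed
qed

lemma addf_cong: "ae S A A' \<Longrightarrow> ae S B B' \<Longrightarrow> ae S (addf A B) (addf A' B')"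
  unfolding ae_def by (erule (1) eventually_elim2) (simp add: addf_def)

lemma sclf_cong: "ae S A A' \<Longrightarrow> \<forall>\<^sub>F n in F. s n = s' n \<Longrightarrow> ae S (sclf s A) (sclf s' A')"
  unfolding ae_def by (erule (1) eventually_elim2) (simp add: sclf_def)

lemma tn_cong: "ae S A A' \<Longrightarrow> ae Q B B' \<Longrightarrow> ae (tS S Q) (tn A B) (tn A' B')"
  unfolding ae_def by (erule (1) eventually_elim2) (auto simp: tn_def tS_def elim!: tset_cases simp: coeff_ring.tens_Tns[OF K])

lemma good_add: "good S S' A \<Longrightarrow> good S S' B \<Longrightarrow> good S S' (addf A B)"
  unfolding good_def addf_def using coeff_ring.pgood_add[OF K] by simp

lemma good_zef: "good S S' zef"
  unfolding good_def zef_def using coeff_ring.pgood_zero[OF K] by simp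

lemma good_scl: "s \<in> Pi UNIV (\<lambda>n. carrier (K n)) \<Longrightarrow> good S S' A \<Longrightarrow> good S S' (sclf s A)"
  unfolding good_def sclf_def using coeff_ring.pgood_smult[OF K] by (simp add: Pi_iff)

lemma good_mapf:
  assumes "\<And>n c. c \<in> S n \<Longrightarrow> \<phi> c \<in> S' n" "\<And>g n c. c \<in> S n \<Longrightarrow> \<phi> (bact g c) = bact g (\<phi> c)"
  shows "good S S' (mapf \<phi>)"
  unfolding good_def mapf_def using assms by (intro allI coeff_ring.pgood_map[OF K]) auto

lemma UC_pls:
  assumes S: "stab S" "stab S'" and A: "good S S' A" and B: "good S S' B"
  shows "pls UC (cm S S' A) (cm S S' B) = cm S S' (addf A B)"
  unfolding UC_sel
proof (rule UN_eq_const, goal_cases)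
  case 1 show ?case using cm_self[OF S A] by auto
next
  case (2 p)
  obtain A' where A': "p = rmm S S' A'" "good S S' A'" "ae S A' A" using cm_mem[OF S 2] .
  show ?case
  proof (rule UN_eq_const, goal_cases)
    case 1 show ?case using cm_self[OF S B] by auto
  next
    case (2 q)
    obtain B' where B': "q = rmm S S' B'" "good S S' B'" "ae S B' B" using cm_mem[OF S 2] .
    have "(\<lambda>n. pls (RC n) (p n) (q n)) = rmm S S' (addf A' B')"
      unfolding B' A' rmm_def addf_def RC_def by (simp add: coeff_ring.rep_cat_pmor[OF K])
    thus ?case using cm_cong[OF addf_cong[OF A'(3) B'(3)]] by (simp add: ucls_rmm)
  qed
qed

lemma UC_tna:
  assumes S: "stab S" "stab S'" and A: "good S S' A" and Q: "stab Q" "stab Q'" and B: "good Q Q' B"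
  shows "tna UC (cm S S' A) (cm Q Q' B) = cm (tS S Q) (tS S' Q') (tn A B)"
  unfolding UC_sel
proof (rule UN_eq_const, goal_cases)
  case 1 show ?case using cm_self[OF S A] by auto
next
  case (2 p)
  obtain A' where A': "p = rmm S S' A'" "good S S' A'" "ae S A' A" using cm_mem[OF S 2] .
  show ?case
  proof (rule UN_eq_const, goal_cases)
    case 1 show ?case using cm_self[OF Q B] by auto
  next
    case (2 q)
    obtain B' where B': "q = rmm Q Q' B'" "good Q Q' B'" "ae Q B' B" using cm_mem[OF Q 2] .
    have "(\<lambda>n. tna (RC n) (p n) (q n)) = rmm (tS S Q) (tS S' Q') (tn A' B')"
      unfolding B' A' rmm_def tn_def RC_def tS_def using A' B' by (auto simp: good_def intro!: ext coeff_ring.tna_pmor[OF K])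
    thus ?case using cm_cong[OF tn_cong[OF A'(3) B'(3)]] by (simp add: ucls_rmm)
  qed
qed

section \<open>Complex numbers as sequences of scalars\<close>

definition "ucar = uclass F (\<lambda>n. carrier (K n))"

lemma UC_scl:
  assumes S: "stab S" "stab S'" and A: "good S S' A" and s: "s \<in> Pi UNIV (\<lambda>n. carrier (K n))"
  shows "scl UC (ucar s) (cm S S' A) = cm S S' (sclf s A)"
  unfolding UC_sel
proof (rule UN_eq_const, goal_cases)
  case 1 show ?case using uclass_self[OF s] by (auto simp: ucar_def)
next
  case (2 a)
  hence a: "a \<in> Pi UNIV (\<lambda>n. carrier (K n))" "\<forall>\<^sub>F n in F. a n = s n" by (auto simp: ucar_def uclass_def)
  show ?case
  proof (rule UN_eq_const, goal_cases)
    case 1 show ?case using cm_self[OF S A] by auto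
  next
    case (2 p)
    obtain A' where A': "p = rmm S S' A'" "good S S' A'" "ae S A' A" using cm_mem[OF S 2] .
    have "(\<lambda>n. scl (RC n) (a n) (p n)) = rmm S S' (sclf a A')"
      unfolding A' rmm_def sclf_def RC_def using a by (auto simp: coeff_ring.rep_cat_pmor[OF K] Pi_iff)
    thus ?case using cm_cong[OF sclf_cong[OF A'(3) a(2)]] by (simp add: ucls_rmm)
  qed
qed

lemma ucar_eq: "s \<in> Pi UNIV (\<lambda>n. carrier (K n)) \<Longrightarrow> ucar s = ucar s' \<longleftrightarrow> (\<forall>\<^sub>F n in F. s n = s' n)"
  unfolding ucar_def by (rule uclass_eq)

abbreviation "PiK \<equiv> Pi UNIV (\<lambda>n. carrier (K n))"

lemma UR: "carrier (uprod_ring F K) = ucar ` PiK"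
  by (simp add: uprod_ring_def Let_def uprod_def ucar_def)

lemma psi_bij: "bij_betw \<psi> (ucar ` PiK) UNIV"
  using psi UR by (simp add: ring_iso_def ring_of_type_algebra_def)

definition "sq c = (SOME s. s \<in> PiK \<and> \<psi> (ucar s) = c)"

lemma sq: "sq c \<in> PiK" "\<psi> (ucar (sq c)) = c"
proof -
  have "c \<in> \<psi> ` ucar ` PiK" using psi_bij by (simp add: bij_betw_def)
  hence "\<exists>s. s \<in> PiK \<and> \<psi> (ucar s) = c" by blast
  from someI_ex[OF this] show "sq c \<in> PiK" "\<psi> (ucar (sq c)) = c" by (auto simp: sq_def)
qed

lemma uscalar_sq: "uscalar F K \<psi> c = ucar (sq c)"
  unfolding uscalar_def UR using psi_bij sq[of c] by (metis bij_betw_def imageI inv_into_f_eq)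

lemma sq_ae: "s \<in> PiK \<Longrightarrow> \<psi> (ucar s) = c \<Longrightarrow> \<forall>\<^sub>F n in F. sq c n = s n"
proof -
  assume s: "s \<in> PiK" "\<psi> (ucar s) = c"
  have "ucar (sq c) = ucar s" using psi_bij sq[of c] s unfolding bij_betw_def inj_on_def by blast
  thus ?thesis using ucar_eq[OF sq(1)] by simp
qed

lemma ucar_add:
  assumes "a \<in> PiK" "b \<in> PiK"
  shows "\<psi> (ucar (\<lambda>n. a n \<oplus>\<^bsub>K n\<^esub> b n)) = \<psi> (ucar a) + \<psi> (ucar b)"
proof -
  have "ucar a \<oplus>\<^bsub>uprod_ring F K\<^esub> ucar b = (\<Union>p\<in>ucar a. \<Union>q\<in>ucar b. ucar (\<lambda>n. p n \<oplus>\<^bsub>K n\<^esub> q n))"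
    by (simp add: uprod_ring_def Let_def ucar_def)
  also have "\<dots> = ucar (\<lambda>n. a n \<oplus>\<^bsub>K n\<^esub> b n)" using UN_uclass2[OF assms] by (simp add: ucar_def)
  finally have "\<psi> (ucar (\<lambda>n. a n \<oplus>\<^bsub>K n\<^esub> b n)) = \<psi> (ucar a \<oplus>\<^bsub>uprod_ring F K\<^esub> ucar b)" by simp
  also have "\<dots> = \<psi> (ucar a) \<oplus>\<^bsub>complex_ring\<^esub> \<psi> (ucar b)"
    using psi UR assms by (auto simp: ring_iso_def ring_hom_def)
  finally show ?thesis by (simp add: ring_of_type_algebra_def)
qed

lemma ucar_zero: "\<psi> (ucar (\<lambda>n. \<zero>\<^bsub>K n\<^esub>)) = 0"
proof -
  have z: "(\<lambda>n. \<zero>\<^bsub>K n\<^esub>) \<in> PiK" using K by (auto simp: coeff_ring_def cring_def intro: ring.ring_simprules)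
  have "(\<lambda>n. \<zero>\<^bsub>K n\<^esub> \<oplus>\<^bsub>K n\<^esub> \<zero>\<^bsub>K n\<^esub>) = (\<lambda>n. \<zero>\<^bsub>K n\<^esub>)"
  proof
    fix n interpret coeff_ring "K n" by (rule K)
    show "\<zero>\<^bsub>K n\<^esub> \<oplus>\<^bsub>K n\<^esub> \<zero>\<^bsub>K n\<^esub> = \<zero>\<^bsub>K n\<^esub>" by simp
  qed
  thus ?thesis using ucar_add[OF z z] by simp
qed

lemma ucar_one: "\<psi> (ucar (\<lambda>n. \<one>\<^bsub>K n\<^esub>)) = 1"
proof -
  have "\<one>\<^bsub>uprod_ring F K\<^esub> = ucar (\<lambda>n. \<one>\<^bsub>K n\<^esub>)" by (simp add: uprod_ring_def Let_def ucar_def)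
  thus ?thesis using psi by (auto simp: ring_iso_def ring_hom_def ring_of_type_algebra_def)
qed

lemma K_ops: "(\<lambda>n. \<one>\<^bsub>K n\<^esub>) \<in> PiK" "(\<lambda>n. \<zero>\<^bsub>K n\<^esub>) \<in> PiK" "s \<in> PiK \<Longrightarrow> (\<lambda>n. \<ominus>\<^bsub>K n\<^esub> s n) \<in> PiK"
proof -
  have "\<one>\<^bsub>K n\<^esub> \<in> carrier (K n)" "\<zero>\<^bsub>K n\<^esub> \<in> carrier (K n)" "x \<in> carrier (K n) \<Longrightarrow> \<ominus>\<^bsub>K n\<^esub> x \<in> carrier (K n)" for n x
  proof -
    interpret coeff_ring "K n" by (rule K)
    show "\<one>\<^bsub>K n\<^esub> \<in> carrier (K n)" "\<zero>\<^bsub>K n\<^esub> \<in> carrier (K n)" "x \<in> carrier (K n) \<Longrightarrow> \<ominus>\<^bsub>K n\<^esub> x \<in> carrier (K n)" by auto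
  qed
  thus "(\<lambda>n. \<one>\<^bsub>K n\<^esub>) \<in> PiK" "(\<lambda>n. \<zero>\<^bsub>K n\<^esub>) \<in> PiK" "s \<in> PiK \<Longrightarrow> (\<lambda>n. \<ominus>\<^bsub>K n\<^esub> s n) \<in> PiK" by (auto simp: Pi_iff)
qed

text \<open>Differences of ind-morphisms are formed with the complex scalar -1, and a sequence
  representing it is known only up to a null set. Identities involving a minus sign therefore hold
  almost everywhere even if the matrices are explicit.\<close>

lemma sq_minus1: "\<forall>\<^sub>F n in F. sq (- 1) n = \<ominus>\<^bsub>K n\<^esub> \<one>\<^bsub>K n\<^esub>"
proof (rule sq_ae[OF K_ops(3)[OF K_ops(1)]])
  have "(\<lambda>n. \<one>\<^bsub>K n\<^esub> \<oplus>\<^bsub>K n\<^esub> \<ominus>\<^bsub>K n\<^esub> \<one>\<^bsub>K n\<^esub>) = (\<lambda>n. \<zero>\<^bsub>K n\<^esub>)"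
  proof
    fix n interpret coeff_ring "K n" by (rule K)
    show "\<one>\<^bsub>K n\<^esub> \<oplus>\<^bsub>K n\<^esub> \<ominus>\<^bsub>K n\<^esub> \<one>\<^bsub>K n\<^esub> = \<zero>\<^bsub>K n\<^esub>" by (simp add: r_neg)
  qed
  hence "\<psi> (ucar (\<lambda>n. \<one>\<^bsub>K n\<^esub>)) + \<psi> (ucar (\<lambda>n. \<ominus>\<^bsub>K n\<^esub> \<one>\<^bsub>K n\<^esub>)) = 0"
    using ucar_add[OF K_ops(1) K_ops(3)[OF K_ops(1)]] ucar_zero by simp
  thus "\<psi> (ucar (\<lambda>n. \<ominus>\<^bsub>K n\<^esub> \<one>\<^bsub>K n\<^esub>)) = - 1" by (simp add: ucar_one add_eq_0_iff)
qed

section \<open>The Deligne category and its distinguished morphisms\<close>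

abbreviation "C \<equiv> deligne_ccat F K m \<psi> t k"
definition "HY = (\<lambda>n. Gen ` Yv ` {..<m n})"
definition "HX = (\<lambda>n. Gen ` Xv ` {..<m n})"
definition "OB = generated_obs UC (pr HY)"

lemma C_sel: "obs C = OB" "ars C = {f \<in> ars UC. src UC f \<in> OB \<and> tgt UC f \<in> OB}" "src C = src UC" "tgt C = tgt UC"
  "idn C = idn UC" "cmp C = cmp UC" "zer C = zer UC" "pls C = pls UC" "scl C c = scl UC (uscalar F K \<psi> c)" "unt C = unt UC" "tno C = tno UC"
  "tna C = tna UC" "asc C = asc UC" "asci C = asci UC" "lun C = lun UC" "swp C = swp UC"
  "hob C = pr HY" "hdob C = pr HX" "tpar C = t" "kpar C = k"
  by (simp_all add: deligne_ccat_def Let_def tcat.extend_def ccat.fields_def deligne_cat_def full_subcat_def UC_def RC_def OB_def pr_def HY_def HX_def h_rep_def hd_rep_def)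

definition "evf = (\<lambda>n c (r::bvec). if r = Unt \<and> (\<exists>i<m n. c = Tns (Gen (Yv i)) (Gen (Xv i))) then \<one>\<^bsub>K n\<^esub> else \<zero>\<^bsub>K n\<^esub>)"
text \<open>The sum of all transpositions, applied to a basis vector. It refers to no object, so a
  single family represents \<Omega> on all permutation representations.\<close>

definition "omf = (\<lambda>n (c::bvec) r. finsum (K n) (\<lambda>(i, j). ve (K n) (bact (transpose i j) c) r) {(i, j). i < j \<and> j < m n})"

lemma C_ev: "evm C = cm (tS HY HX) UT evf"
proof -
  have "ev_mor (K n) (m n) = pmor (K n) (tset (HY n) (HX n)) {Unt} (evf n)" for n
    by (auto simp: ev_mor_def pmor_def h_rep_def hd_rep_def HY_def HX_def evf_def fun_eq_iff tset_iff
        coeff_ring.axioms[OF K, THEN rep_tensor_perm])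
  hence "evm C = ucls F RC (rmm (tS HY HX) UT evf)"
    by (simp add: deligne_ccat_def Let_def tcat.extend_def ccat.fields_def RC_def rmm_def tS_def UT_def)
  thus ?thesis by (simp add: ucls_rmm)
qed

lemma C_omg: "omg C (pr S) = cm S S omf"
proof -
  have "omega_mor (K n) (m n) (perm_rep (K n) (S n)) = pmor (K n) (S n) (S n) (omf n)" for n
  proof -
    interpret coeff_ring "K n" by (rule K)
    have "finsum (K n) (\<lambda>(i, j). map_mtx (K n) (S n) (bact (transpose i j)) r c) {(i, j). i < j \<and> j < m n} = (if c \<in> S n then omf n c r else \<zero>\<^bsub>K n\<^esub>)" for r c
    proof (cases "c \<in> S n")
      case True thus ?thesis by (simp add: omf_def map_mtx_def ve_def)
    next
      case False
      hence "finsum (K n) (\<lambda>(i, j). map_mtx (K n) (S n) (bact (transpose i j)) r c) {(i, j). i < j \<and> j < m n} = finsum (K n) (\<lambda>x. \<zero>\<^bsub>K n\<^esub>) {(i, j). i < j \<and> j < m n}"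
        by (intro finsum_cong') (auto simp: map_mtx_def)
      thus ?thesis using False by simp
    qed
    thus ?thesis by (simp add: omega_mor_def pmor_def fun_eq_iff)
  qed
  hence "omg C (pr S) = ucls F RC (rmm S S omf)"
    by (simp add: deligne_ccat_def Let_def tcat.extend_def ccat.fields_def RC_def rmm_def pr_def)
  thus ?thesis by (simp add: ucls_rmm)
qed

end

section \<open>Morphisms of ind-objects as column families\<close>

lemma (in coeff_ring) lin_ve_id: "v \<in> carrier (vec K B) \<Longrightarrow> lin K (vec K UNIV) (ve K) v = v"
proof -
  assume v: "v \<in> carrier (vec K B)"
  hence v: "v \<in> carrier (vec K UNIV)" by (rule vec_mono) simp
  show ?thesis using klin_lin[OF vec_module klin_id v] by simp
qed

lemma (in coeff_ring) lin_ve_U: "T c \<in> carrier (vec K B) \<Longrightarrow> lin K (vec K UNIV) T (ve K c) = T c"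
  by (rule lin_ve[OF vec_module]) (erule vec_mono, simp)

context ultra_setting
begin

text \<open>All ind-objects that occur are increasing unions of permutation representations indexed
  by degree, with inclusions as transition maps. The inclusions hold at every index, so on column
  families the transition maps are invisible.\<close>

definition "tower D \<longleftrightarrow> (\<forall>L::nat. stab (D L) \<and> pr (D L) \<in> OB) \<and> (\<forall>L L' n. L \<le> L' \<longrightarrow> D L n \<subseteq> D L' n)"

definition is_tower :: "(nat, nat \<Rightarrow> 'k rep, (nat \<Rightarrow> 'k rmor) set) indob \<Rightarrow> (nat \<Rightarrow> nat \<Rightarrow> bvec set) \<Rightarrow> bool" where
  "is_tower M D \<longleftrightarrow> tower D \<and> idx M = UNIV \<and> idle M = (\<le>) \<and> lev M = (\<lambda>L. pr (D L)) \<and> (\<forall>L L'. L \<le> L' \<longrightarrow> trn M L L' = cm (D L) (D L') vee)"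

lemma is_towerD:
  assumes "is_tower M D"
  shows "stab (D L)" "pr (D L) \<in> OB" "L \<le> L' \<Longrightarrow> D L n \<subseteq> D L' n" "idx M = UNIV" "idle M = (\<le>)" "lev M = (\<lambda>L. pr (D L))"
    "L \<le> L' \<Longrightarrow> trn M L L' = cm (D L) (D L') vee"
  using assms by (auto simp: is_tower_def tower_def)

lemma hom_C:
  assumes "stab S" "stab S'" "pr S \<in> OB" "pr S' \<in> OB"
  shows "hom_set C (pr S) (pr S') = {cm S S' T | T. good S S' T}"
proof -
  have "hom_set C (pr S) (pr S') = hom_set UC (pr S) (pr S')" using assms(3,4) by (auto simp: hom_set_def C_sel)
  thus ?thesis using hom_UC[OF assms(1,2)] by simp
qed

lemma good_mono: "good S S' T \<Longrightarrow> (\<And>n. S' n \<subseteq> S'' n) \<Longrightarrow> good S S'' T"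
  unfolding good_def pgood_def by (blast intro: coeff_ring.vec_mono[OF K])

lemma good_sub: "good S S' T \<Longrightarrow> (\<And>n. S'' n \<subseteq> S n) \<Longrightarrow> good S'' S' T"
  unfolding good_def pgood_def by blast

lemma kcmp_vee: "good S S' T \<Longrightarrow> ae S (kcmp vee T) T"
  unfolding ae_def kcmp_def ccomp_def vee_def by (intro always_eventually allI ballI coeff_ring.lin_ve_id[OF K]) (erule (1) goodD)

lemma kcmp_vee_r: "good S S' T \<Longrightarrow> ae S (kcmp T vee) T"
  unfolding ae_def kcmp_def ccomp_def vee_def by (intro always_eventually allI ballI coeff_ring.lin_ve_U[OF K]) (erule (1) goodD)

definition "CL S E T = {(L'::nat, cm S (E L') A) | L' A. good S (E L') A \<and> ae S A T}"

lemma CL_cong: "ae S T T' \<Longrightarrow> CL S E T = CL S E T'"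
  unfolding CL_def using ae_trans ae_sym by blast

lemma trn_cm:
  assumes N: "is_tower N E" and S: "stab S" and A: "good S (E L) A" and L: "L \<le> L'"
  shows "trn N L L' \<bullet>\<^bsub>C\<^esub> cm S (E L) A = cm S (E L') A"
  using UC_cmp[OF S is_towerD(1)[OF N] is_towerD(1)[OF N] A good_vee[OF is_towerD(3)[OF N L]]] is_towerD(7)[OF N L] cm_cong[OF kcmp_vee[OF A]]
  by (simp add: C_sel)

text \<open>Transition maps are inclusions and do not alter columns. Two representatives at
  different levels thus become equal at a common level exactly when their families agree almost
  everywhere on \<open>S\<close>.\<close>

lemma colim:
  assumes N: "is_tower N E" and S: "stab S" "pr S \<in> OB" and A: "good S (E L) A"
  shows "colim_cls C (pr S) N (L, cm S (E L) A) = CL S E A"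
proof (rule subset_antisym; rule subsetI)
  note st = is_towerD(1)[OF N]
  fix x assume "x \<in> colim_cls C (pr S) N (L, cm S (E L) A)"
  then obtain j f l where x: "x = (j, f)" "f \<in> hom_set C (pr S) (pr (E j))" "L \<le> l" "j \<le> l"
    "trn N L l \<bullet>\<^bsub>C\<^esub> cm S (E L) A = trn N j l \<bullet>\<^bsub>C\<^esub> f" by (auto simp: colim_cls_def is_towerD[OF N])
  obtain B where B: "f = cm S (E j) B" "good S (E j) B" using x(2) hom_C[OF S(1) st S(2) is_towerD(2)[OF N]] by auto
  have "cm S (E l) A = cm S (E l) B" using x(5) trn_cm[OF N S(1) A x(3)] trn_cm[OF N S(1) B(2) x(4)] B(1) by simp
  hence "ae S A B" using cm_eq[OF S(1) st good_mono[OF A is_towerD(3)[OF N x(3)]]] by simp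
  thus "x \<in> CL S E A" using B x(1) ae_sym by (auto simp: CL_def)
next
  note st = is_towerD(1)[OF N]
  fix x assume "x \<in> CL S E A"
  then obtain j B where x: "x = (j, cm S (E j) B)" "good S (E j) B" "ae S B A" by (auto simp: CL_def)
  have "trn N L (max L j) \<bullet>\<^bsub>C\<^esub> cm S (E L) A = trn N j (max L j) \<bullet>\<^bsub>C\<^esub> cm S (E j) B"
    using trn_cm[OF N S(1) A, of "max L j"] trn_cm[OF N S(1) x(2), of "max L j"] cm_cong[OF x(3)] by simp
  moreover have "cm S (E j) B \<in> hom_set C (pr S) (pr (E j))" using x(2) hom_C[OF S(1) st S(2) is_towerD(2)[OF N]] by auto
  ultimately show "x \<in> colim_cls C (pr S) N (L, cm S (E L) A)"
    unfolding x(1) colim_cls_def by (auto simp: is_towerD[OF N] intro!: exI[of _ "max L j"])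
qed

text \<open>The family itself need not be good at any index: in each degree it only has to agree
  almost everywhere with a good family. The exceptional set may depend on the degree, which is what
  a diagonal sequence can provide; the target level may depend on it too.\<close>

definition admissible :: "(nat \<Rightarrow> nat \<Rightarrow> bvec set) \<Rightarrow> (nat \<Rightarrow> nat \<Rightarrow> bvec set) \<Rightarrow> (nat \<Rightarrow> bvec \<Rightarrow> bvec \<Rightarrow> 'k) \<Rightarrow> bool" where
  "admissible D E T \<longleftrightarrow> (\<forall>L. \<exists>L' A. good (D L) (E L') A \<and> ae (D L) A T)"

definition mk_indmor :: "(nat, nat \<Rightarrow> 'k rep, (nat \<Rightarrow> 'k rmor) set) indob \<Rightarrow> (nat \<Rightarrow> nat \<Rightarrow> bvec set)
  \<Rightarrow> (nat, nat \<Rightarrow> 'k rep, (nat \<Rightarrow> 'k rmor) set) indob \<Rightarrow> (nat \<Rightarrow> nat \<Rightarrow> bvec set) \<Rightarrow> (nat \<Rightarrow> bvec \<Rightarrow> bvec \<Rightarrow> 'k)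
  \<Rightarrow> (nat, nat, nat \<Rightarrow> 'k rep, (nat \<Rightarrow> 'k rmor) set) indmor" where
  "mk_indmor M D N E T = \<lparr> isrc = M, itgt = N, cpt = (\<lambda>L. CL (D L) E T) \<rparr>"

lemma mk_indmor_sel [simp]: "isrc (mk_indmor M D N E T) = M" "itgt (mk_indmor M D N E T) = N" "cpt (mk_indmor M D N E T) L = CL (D L) E T"
  by (simp_all add: mk_indmor_def)

lemma mk_indmor_cong: "(\<And>L. ae (D L) T T') \<Longrightarrow> mk_indmor M D N E T = mk_indmor M D N E T'"
  using CL_cong by (fastforce simp: mk_indmor_def)

lemma admissibleE: assumes "admissible D E T" obtains L' A where "good (D L) (E L') A" "ae (D L) A T"
  using assms unfolding admissible_def by blast

lemma CL_ex: "admissible D E T \<Longrightarrow> CL (D L) E T \<noteq> {}"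
  unfolding admissible_def CL_def by blast

lemma CL_memE:
  assumes "x \<in> CL S E T" obtains j A where "x = (j, cm S (E j) A)" "good S (E j) A" "ae S A T"
  using assms by (auto simp: CL_def)

lemma mk_indmor_eq:
  assumes M: "is_tower M D" and N: "is_tower N E" and T: "admissible D E T"
  shows "mk_indmor M D N E T = mk_indmor M D N E T' \<longleftrightarrow> (\<forall>L. ae (D L) T T')"
proof
  assume e: "mk_indmor M D N E T = mk_indmor M D N E T'"
  show "\<forall>L. ae (D L) T T'"
  proof
    fix L
    obtain L' A where A: "good (D L) (E L') A" "ae (D L) A T" using admissibleE[OF T] .
    have "(L', cm (D L) (E L') A) \<in> CL (D L) E T" using A by (auto simp: CL_def)
    moreover have "CL (D L) E T = CL (D L) E T'" using e by (simp add: mk_indmor_def fun_eq_iff)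
    ultimately have "(L', cm (D L) (E L') A) \<in> CL (D L) E T'" by simp
    then obtain j B where "(L', cm (D L) (E L') A) = (j, cm (D L) (E j) B)" "ae (D L) B T'" by (rule CL_memE)
    hence B: "cm (D L) (E L') A = cm (D L) (E L') B" "ae (D L) B T'" by auto
    hence "ae (D L) A B" using cm_eq[OF is_towerD(1)[OF M] is_towerD(1)[OF N] A(1)] by simp
    thus "ae (D L) T T'" using A(2) B(2) ae_trans ae_sym by blast
  qed
qed (auto intro: mk_indmor_cong)

lemma cm_hom:
  assumes M: "is_tower M D" and N: "is_tower N E" and A: "good (D L) (E L') A"
  shows "cm (D L) (E L') A \<in> hom_set C (pr (D L)) (pr (E L'))"
  using A hom_C[OF is_towerD(1)[OF M] is_towerD(1)[OF N] is_towerD(2)[OF M] is_towerD(2)[OF N]] by auto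

lemma mk_indmor_hom:
  assumes M: "is_tower M D" and N: "is_tower N E" and T: "admissible D E T"
  shows "mk_indmor M D N E T \<in> ind_hom C M N"
proof -
  have 1: "CL (D L) E T \<in> colim_hom C (pr (D L)) N" for L
  proof -
    obtain L' A where A: "good (D L) (E L') A" "ae (D L) A T" using admissibleE[OF T] .
    have "CL (D L) E T = colim_cls C (pr (D L)) N (L', cm (D L) (E L') A)"
      using colim[OF N is_towerD(1,2)[OF M] A(1)] CL_cong[OF A(2)] by simp
    thus ?thesis unfolding colim_hom_def using cm_hom[OF M N A(1)] by (auto simp: is_towerD[OF N])
  qed
  have 2: "(j, a \<bullet>\<^bsub>C\<^esub> trn M i i') \<in> CL (D i) E T" if ij: "i \<le> i'" "(j, a) \<in> CL (D i') E T" for i i' j a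
  proof -
    obtain A where A: "a = cm (D i') (E j) A" "good (D i') (E j) A" "ae (D i') A T" using ij(2) by (auto elim: CL_memE)
    have s: "D i n \<subseteq> D i' n" for n by (rule is_towerD(3)[OF M that(1)])
    have "a \<bullet>\<^bsub>C\<^esub> trn M i i' = cm (D i) (E j) (kcmp A vee)"
      using UC_cmp[OF is_towerD(1)[OF M] is_towerD(1)[OF M] is_towerD(1)[OF N] good_vee[OF s] A(2)] by (simp add: C_sel A(1) is_towerD(7)[OF M that(1)])
    also have "\<dots> = cm (D i) (E j) A" by (rule cm_cong[OF ae_mono[OF kcmp_vee_r[OF A(2)] s]])
    finally show ?thesis using good_sub[OF A(2) s] ae_mono[OF A(3) s] by (auto simp: CL_def)
  qed
  show ?thesis unfolding ind_hom_def using 1 2 by (auto simp: is_towerD[OF M])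
qed

lemma ev_ball_fin: "finite A \<Longrightarrow> (\<And>a. a \<in> A \<Longrightarrow> \<forall>\<^sub>F n in F. P a n) \<Longrightarrow> \<forall>\<^sub>F n in F. \<forall>a\<in>A. P a n"
  by (simp add: eventually_ball_finite)

text \<open>Finite sets of indices are null because the ultrafilter is not principal.\<close>

lemma ev_ge: "\<forall>\<^sub>F n in F. L \<le> n"
proof -
  have "\<forall>\<^sub>F n in F. \<forall>a\<in>{..<L}. n \<noteq> a" by (rule ev_ball_fin) (use F in \<open>auto simp: nonprincipal_ultrafilter_def\<close>)
  thus ?thesis by eventually_elim (metis lessThan_iff not_le)
qed

text \<open>A diagonal sequence: countably many compatible families are represented by a single one,
  because the ultrafilter is not principal.\<close>

lemma diagonal:
  fixes D :: "nat \<Rightarrow> nat \<Rightarrow> bvec set" and A :: "nat \<Rightarrow> nat \<Rightarrow> bvec \<Rightarrow> bvec \<Rightarrow> 'k"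
  assumes c: "\<And>L L'. L \<le> L' \<Longrightarrow> ae (D L) (A L') (A L)"
  shows "\<exists>T. \<forall>L. ae (D L) T (A L)"
proof -
  define Q where "Q l n \<longleftrightarrow> (\<forall>L\<le>l. \<forall>c\<in>D L n. A l n c = A L n c)" for l n :: nat
  \<comment> \<open>At index n the family of the largest level that is still compatible with all
    lower ones is used. The bound l \<le> n keeps the set finite; since almost all n are at least L,
    level L is eventually among the candidates.\<close>
  define h where "h n = Max {l. l \<le> n \<and> Q l n}" for n :: nat
  have Q: "\<forall>\<^sub>F n in F. Q l n" for l
  proof -
    have "\<forall>\<^sub>F n in F. \<forall>L\<in>{..l}. \<forall>c\<in>D L n. A l n c = A L n c" by (rule ev_ball_fin) (use c in \<open>auto simp: ae_def\<close>)
    thus ?thesis by eventually_elim (auto simp: Q_def)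
  qed
  have "ae (D L) (\<lambda>n. A (h n) n) (A L)" for L
    unfolding ae_def using Q[of L] ev_ge[of L]
  proof eventually_elim
    case (elim n)
    have f: "finite {l. l \<le> n \<and> Q l n}" by (rule finite_subset[of _ "{..n}"]) auto
    have "L \<le> h n" unfolding h_def by (rule Max_ge[OF f]) (use elim in auto)
    moreover have "h n \<in> {l. l \<le> n \<and> Q l n}" unfolding h_def by (rule Max_in[OF f]) (use elim in auto)
    ultimately show ?case by (auto simp: Q_def)
  qed
  thus ?thesis by blast
qed

lemma hom_mk_indmor:
  assumes M: "is_tower M D" and N: "is_tower N E" and f: "f \<in> ind_hom C M N"
  obtains T where "admissible D E T" "f = mk_indmor M D N E T"
proof -
  have "\<exists>L' A. good (D L) (E L') A \<and> cpt f L = CL (D L) E A" for L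
  proof -
    have "cpt f L \<in> colim_hom C (pr (D L)) N" using f by (auto simp: ind_hom_def is_towerD[OF M])
    then obtain j a where a: "cpt f L = colim_cls C (pr (D L)) N (j, a)" "a \<in> hom_set C (pr (D L)) (pr (E j))"
      by (auto simp: colim_hom_def is_towerD[OF N])
    obtain A where A: "a = cm (D L) (E j) A" "good (D L) (E j) A"
      using a(2) hom_C[OF is_towerD(1)[OF M] is_towerD(1)[OF N] is_towerD(2)[OF M] is_towerD(2)[OF N]] by auto
    thus ?thesis using colim[OF N is_towerD(1,2)[OF M] A(2)] a(1) by auto
  qed
  then obtain h A where A: "\<And>L. good (D L) (E (h L)) (A L)" "\<And>L. cpt f L = CL (D L) E (A L)" by metis
  \<comment> \<open>Restricting the component at the higher level along the inclusion must give the
    component at the lower level; this is the compatibility that the diagonal argument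
    needs.\<close>
  have "ae (D L) (A L') (A L)" if L: "L \<le> L'" for L L'
  proof -
    have s: "D L n \<subseteq> D L' n" for n by (rule is_towerD(3)[OF M L])
    have "(h L', cm (D L') (E (h L')) (A L')) \<in> cpt f L'" using A(1)[of L'] ae_refl by (auto simp: A(2) CL_def)
    hence "(h L', cm (D L') (E (h L')) (A L') \<bullet>\<^bsub>C\<^esub> trn M L L') \<in> cpt f L"
      using f L by (fastforce simp: ind_hom_def is_towerD[OF M])
    moreover have "cm (D L') (E (h L')) (A L') \<bullet>\<^bsub>C\<^esub> trn M L L' = cm (D L) (E (h L')) (kcmp (A L') vee)"
      using UC_cmp[OF is_towerD(1)[OF M] is_towerD(1)[OF M] is_towerD(1)[OF N] good_vee[OF s] A(1)[of L']] by (simp add: C_sel is_towerD(7)[OF M L])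
    moreover have "\<dots> = cm (D L) (E (h L')) (A L')" by (rule cm_cong[OF ae_mono[OF kcmp_vee_r[OF A(1)] s]])
    ultimately obtain B where B: "cm (D L) (E (h L')) (A L') = cm (D L) (E (h L')) B" "ae (D L) B (A L)"
      by (auto simp: A(2) CL_def)
    have "ae (D L) (A L') B" using B(1) cm_eq[OF is_towerD(1)[OF M] is_towerD(1)[OF N] good_sub[OF A(1)[of L'] s]] by simp
    thus ?thesis using B(2) ae_trans by blast
  qed
  from diagonal[of D A, OF this] obtain T where T: "\<And>L. ae (D L) T (A L)" by blast
  have "admissible D E T" unfolding admissible_def using A(1) T ae_sym by blast
  moreover have "f = mk_indmor M D N E T" using f A(2) CL_cong[OF T] by (cases f) (auto simp: ind_hom_def mk_indmor_def fun_eq_iff)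
  ultimately show ?thesis by (rule that)
qed

text \<open>The common evaluation rule for all constructions on ind-morphisms. They are unions over
  classes of representatives, and all representatives with the same family almost everywhere give
  the same class.\<close>

lemma ind_mk_mk_indmor:
  assumes M: "is_tower M D" and N: "is_tower N E"
    and S: "\<And>L x. x \<in> S L \<Longrightarrow> \<exists>j A. x = (j, cm (D L) (E j) A) \<and> good (D L) (E j) A \<and> ae (D L) A T" and ne: "\<And>L. S L \<noteq> {}"
  shows "ind_mk C M N S = mk_indmor M D N E T" "admissible D E T"
proof -
  have "(\<Union>r\<in>S L. colim_cls C (pr (D L)) N r) = CL (D L) E T" for L
  proof (rule UN_eq_const[OF ne])
    fix r assume "r \<in> S L"
    then obtain j A where A: "r = (j, cm (D L) (E j) A)" "good (D L) (E j) A" "ae (D L) A T" using S by blast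
    show "colim_cls C (pr (D L)) N r = CL (D L) E T"
      using colim[OF N is_towerD(1,2)[OF M] A(2)] CL_cong[OF A(3)] A(1) by simp
  qed
  thus "ind_mk C M N S = mk_indmor M D N E T" by (simp add: ind_mk_def mk_indmor_def is_towerD[OF M])
  show "admissible D E T" unfolding admissible_def using S ne by blast
qed

lemma ind_lev_mk_indmor:
  assumes M: "is_tower M D" and N: "is_tower N E"
    and a: "\<And>L. a L = cm (D L) (E L) T" "\<And>L. good (D L) (E L) T"
  shows "ind_lev C M N a = mk_indmor M D N E T" "admissible D E T"
proof -
  show "ind_lev C M N a = mk_indmor M D N E T"
    unfolding ind_lev_def by (rule ind_mk_mk_indmor(1)[OF M N]) (use a ae_refl in blast)+
  show "admissible D E T" unfolding admissible_def using a ae_refl by blast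
qed

lemma ind_id_mk_indmor: assumes M: "is_tower M D" shows "ind_id C M = mk_indmor M D M D vee" "admissible D D vee"
proof -
  show "ind_id C M = mk_indmor M D M D vee"
    unfolding ind_id_def by (rule ind_lev_mk_indmor(1)[OF M M]) (simp_all add: is_towerD[OF M] C_sel UC_pr good_vee)
  show "admissible D D vee" unfolding admissible_def using good_vee ae_refl by blast
qed

lemma admissible_cmp:
  assumes M: "is_tower M D" and N: "is_tower N E" and A: "admissible D E A" and B: "admissible E G B"
  shows "admissible D G (kcmp B A)"
  unfolding admissible_def
proof
  fix L
  obtain L' A' where A': "good (D L) (E L') A'" "ae (D L) A' A" using admissibleE[OF A] .
  obtain L'' B' where B': "good (E L') (G L'') B'" "ae (E L') B' B" using admissibleE[OF B] .
  have "good (D L) (G L'') (kcmp B' A')" by (rule good_comp[OF is_towerD(1)[OF M] is_towerD(1)[OF N] A'(1) B'(1)])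
  moreover have "ae (D L) (kcmp B' A') (kcmp B A)" by (rule comp_cong[OF A'(2) B'(2) A'(1) B'(1)])
  ultimately show "\<exists>L' A'. good (D L) (G L') A' \<and> ae (D L) A' (kcmp B A)" by blast
qed

lemma ind_cmp_mk_indmor:
  assumes M: "is_tower M D" and N: "is_tower N E" and Q: "is_tower Q G" and A: "admissible D E A" and B: "admissible E G B"
  shows "mk_indmor N E Q G B \<star>\<^bsub>C\<^esub> mk_indmor M D N E A = mk_indmor M D Q G (kcmp B A)"
  unfolding ind_cmp_def mk_indmor_sel
proof (rule ind_mk_mk_indmor(1)[OF M Q])
  fix L x assume "x \<in> {(l, b \<bullet>\<^bsub>C\<^esub> a) | j l a b. (j, a) \<in> CL (D L) E A \<and> (l, b) \<in> CL (E j) G B}"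
  then obtain j l a b where x: "x = (l, b \<bullet>\<^bsub>C\<^esub> a)" "(j, a) \<in> CL (D L) E A" "(l, b) \<in> CL (E j) G B" by blast
  obtain A' where A': "a = cm (D L) (E j) A'" "good (D L) (E j) A'" "ae (D L) A' A" using x(2) by (auto elim: CL_memE)
  obtain B' where B': "b = cm (E j) (G l) B'" "good (E j) (G l) B'" "ae (E j) B' B" using x(3) by (auto elim: CL_memE)
  have "x = (l, cm (D L) (G l) (kcmp B' A'))"
    using UC_cmp[OF is_towerD(1)[OF M] is_towerD(1)[OF N] is_towerD(1)[OF Q] A'(2) B'(2)] x(1) A'(1) B'(1) by (simp add: C_sel)
  moreover have "good (D L) (G l) (kcmp B' A')" by (rule good_comp[OF is_towerD(1)[OF M] is_towerD(1)[OF N] A'(2) B'(2)])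
  moreover have "ae (D L) (kcmp B' A') (kcmp B A)" by (rule comp_cong[OF A'(3) B'(3) A'(2) B'(2)])
  ultimately show "\<exists>j A'. x = (j, cm (D L) (G j) A') \<and> good (D L) (G j) A' \<and> ae (D L) A' (kcmp B A)" by blast
next
  fix L
  obtain j a where a: "(j, a) \<in> CL (D L) E A" using CL_ex[OF A] by fastforce
  obtain l b where "(l, b) \<in> CL (E j) G B" using CL_ex[OF B] by fastforce
  thus "{(l, b \<bullet>\<^bsub>C\<^esub> a) | j l a b. (j, a) \<in> CL (D L) E A \<and> (l, b) \<in> CL (E j) G B} \<noteq> {}" using a by blast
qed

lemma admissible_add: assumes N: "is_tower N E" and A: "admissible D E A" and B: "admissible D E B" shows "admissible D E (addf A B)"
  unfolding admissible_def
proof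
  fix L
  obtain L' A' where A': "good (D L) (E L') A'" "ae (D L) A' A" using admissibleE[OF A] .
  obtain L'' B' where B': "good (D L) (E L'') B'" "ae (D L) B' B" using admissibleE[OF B] .
  have "good (D L) (E (max L' L'')) (addf A' B')"
    by (rule good_add[OF good_mono[OF A'(1) is_towerD(3)[OF N]] good_mono[OF B'(1) is_towerD(3)[OF N]]]) auto
  thus "\<exists>L' A'. good (D L) (E L') A' \<and> ae (D L) A' (addf A B)" using addf_cong[OF A'(2) B'(2)] by blast
qed

lemma ind_pls_mk_indmor:
  assumes M: "is_tower M D" and N: "is_tower N E" and A: "admissible D E A" and B: "admissible D E B"
  shows "mk_indmor M D N E A \<boxplus>\<^bsub>C\<^esub> mk_indmor M D N E B = mk_indmor M D N E (addf A B)"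
  unfolding ind_pls_def mk_indmor_sel
proof (rule ind_mk_mk_indmor(1)[OF M N])
  fix L x assume "x \<in> {(j, pls C a b) | j a b. (j, a) \<in> CL (D L) E A \<and> (j, b) \<in> CL (D L) E B}"
  then obtain j a b where x: "x = (j, pls C a b)" "(j, a) \<in> CL (D L) E A" "(j, b) \<in> CL (D L) E B" by blast
  obtain A' where A': "a = cm (D L) (E j) A'" "good (D L) (E j) A'" "ae (D L) A' A" using x(2) by (auto elim: CL_memE)
  obtain B' where B': "b = cm (D L) (E j) B'" "good (D L) (E j) B'" "ae (D L) B' B" using x(3) by (auto elim: CL_memE)
  show "\<exists>j A'. x = (j, cm (D L) (E j) A') \<and> good (D L) (E j) A' \<and> ae (D L) A' (addf A B)"
    using UC_pls[OF is_towerD(1)[OF M] is_towerD(1)[OF N] A'(2) B'(2)] x(1) A'(1) B'(1) good_add[OF A'(2) B'(2)] addf_cong[OF A'(3) B'(3)] by (auto simp: C_sel)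
next
  fix L
  obtain L' A' where A': "good (D L) (E L') A'" "ae (D L) A' A" using admissibleE[OF A] .
  obtain L'' B' where B': "good (D L) (E L'') B'" "ae (D L) B' B" using admissibleE[OF B] .
  \<comment> \<open>Morphisms are added at a common level of the target, so both representatives are
    first raised to the larger level.\<close>
  have "good (D L) (E (max L' L'')) A'" "good (D L) (E (max L' L'')) B'"
    using good_mono[OF A'(1) is_towerD(3)[OF N]] good_mono[OF B'(1) is_towerD(3)[OF N]] by auto
  thus "{(j, pls C a b) | j a b. (j, a) \<in> CL (D L) E A \<and> (j, b) \<in> CL (D L) E B} \<noteq> {}" using A' B' unfolding CL_def by blast
qed

lemma admissible_scl: assumes A: "admissible D E A" and s: "s \<in> PiK" shows "admissible D E (sclf s A)"
  using A good_scl[OF s] sclf_cong[OF _ always_eventually, of _ _ _ s s] unfolding admissible_def by blast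

lemma ind_scl_mk_indmor:
  assumes M: "is_tower M D" and N: "is_tower N E" and A: "admissible D E A" and s: "s \<in> PiK" "\<psi> (ucar s) = c"
  shows "ind_scl C c (mk_indmor M D N E A) = mk_indmor M D N E (sclf s A)"
  unfolding ind_scl_def mk_indmor_sel
proof (rule ind_mk_mk_indmor(1)[OF M N])
  have us: "uscalar F K \<psi> c = ucar s" unfolding uscalar_sq using ucar_eq[OF sq(1)] sq_ae[OF s] by simp
  fix L x assume "x \<in> {(j, scl C c a) | j a. (j, a) \<in> CL (D L) E A}"
  then obtain j a where x: "x = (j, scl C c a)" "(j, a) \<in> CL (D L) E A" by blast
  obtain A' where A': "a = cm (D L) (E j) A'" "good (D L) (E j) A'" "ae (D L) A' A" using x(2) by (auto elim: CL_memE)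
  show "\<exists>j A'. x = (j, cm (D L) (E j) A') \<and> good (D L) (E j) A' \<and> ae (D L) A' (sclf s A)"
    using UC_scl[OF is_towerD(1)[OF M] is_towerD(1)[OF N] A'(2) s(1)] x(1) A'(1) good_scl[OF s(1) A'(2)] sclf_cong[OF A'(3), of s s]
    by (auto simp: C_sel us)
next
  fix L show "{(j, scl C c a) | j a. (j, a) \<in> CL (D L) E A} \<noteq> {}" using CL_ex[OF A] by fastforce
qed

lemma ind_zer_mk_indmor:
  assumes M: "is_tower M D" and N: "is_tower N E" shows "ind_zer C M N = mk_indmor M D N E zef" "admissible D E zef"
proof -
  show "ind_zer C M N = mk_indmor M D N E zef" unfolding ind_zer_def
  proof (rule ind_mk_mk_indmor(1)[OF M N])
    fix L x assume "x \<in> {(j, zer C (lev M L) (lev N j)) | j. j \<in> idx N}"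
    then obtain j where "x = (j, cm (D L) (E j) zef)" by (auto simp: is_towerD[OF M] is_towerD[OF N] C_sel UC_pr)
    thus "\<exists>j A. x = (j, cm (D L) (E j) A) \<and> good (D L) (E j) A \<and> ae (D L) A zef" using good_zef ae_refl by blast
  qed (simp add: is_towerD[OF N])
  show "admissible D E zef" unfolding admissible_def using good_zef ae_refl by blast
qed

lemma OB_tensor: "pr S \<in> OB \<Longrightarrow> pr S' \<in> OB \<Longrightarrow> pr (tS S S') \<in> OB"
  unfolding OB_def using generated_obs.tensor[of "pr S" UC "pr HY" "pr S'"] by (simp add: UC_pr)

lemma is_tower_tno:
  assumes M: "is_tower M D" and S: "stab S" "pr S \<in> OB"
  shows "is_tower (ind_tno C (pr S) M) (\<lambda>L. tS S (D L))"
proof -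
  have tv: "tn vee vee n c = vee n c" if cc: "c \<in> tset B B'" for n c B B'
  proof -
    interpret coeff_ring "K n" by (rule K)
    obtain u v where c: "c = Tns u v" using cc by (rule tset_cases)
    have "tn vee vee n c r = vee n c r" for r by (cases r) (auto simp: c tn_def vee_def tens_Tns ve_def)
    thus ?thesis by (rule ext)
  qed
  have "tna C (idn C (pr S)) (trn M L L') = cm (tS S (D L)) (tS S (D L')) vee" if L: "L \<le> L'" for L L'
  proof -
    have "tna C (idn C (pr S)) (trn M L L') = cm (tS S (D L)) (tS S (D L')) (tn vee vee)"
      using UC_tna[OF S(1) S(1) good_vee is_towerD(1)[OF M] is_towerD(1)[OF M] good_vee[OF is_towerD(3)[OF M L]]]
      by (simp add: C_sel UC_pr is_towerD(7)[OF M L])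
    also have "\<dots> = cm (tS S (D L)) (tS S (D L')) vee"
      by (rule cm_cong) (auto simp: ae_def tS_def tv intro!: always_eventually)
    finally show ?thesis .
  qed
  moreover have "tS S (D L) n \<subseteq> tS S (D L') n" if "L \<le> L'" for L L' n
    using is_towerD(3)[OF M that] by (auto simp: tS_def tset_def)
  ultimately show ?thesis using stab_tS[OF S(1) is_towerD(1)[OF M]] OB_tensor[OF S(2) is_towerD(2)[OF M]]
    by (simp add: is_tower_def tower_def ind_tno_def is_towerD(4-6)[OF M] C_sel UC_pr)
qed

lemma ind_tna_mk_indmor:
  assumes M: "is_tower M D" and N: "is_tower N E" and S: "stab S" "pr S \<in> OB" "stab S'" "pr S' \<in> OB" and A: "good S S' A" and B: "admissible D E B"
  shows "cm S S' A \<boxtimes>\<^bsub>C\<^esub> mk_indmor M D N E B = mk_indmor (ind_tno C (pr S) M) (\<lambda>L. tS S (D L)) (ind_tno C (pr S') N) (\<lambda>L. tS S' (E L)) (tn A B)"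
    "admissible (\<lambda>L. tS S (D L)) (\<lambda>L. tS S' (E L)) (tn A B)"
proof -
  have r: "\<exists>j A'. x = (j, cm (tS S (D L)) (tS S' (E j)) A') \<and> good (tS S (D L)) (tS S' (E j)) A' \<and> ae (tS S (D L)) A' (tn A B)"
    if xx: "x \<in> {(j, tna C (cm S S' A) b) | j b. (j, b) \<in> CL (D L) E B}" for L x
  proof -
    obtain j b where x: "x = (j, tna C (cm S S' A) b)" "(j, b) \<in> CL (D L) E B" using xx by blast
    obtain B' where B': "b = cm (D L) (E j) B'" "good (D L) (E j) B'" "ae (D L) B' B" using x(2) by (auto elim: CL_memE)
    show ?thesis using UC_tna[OF S(1,3) A is_towerD(1)[OF M] is_towerD(1)[OF N] B'(2)] x(1) B'(1) good_tn[OF A B'(2)] tn_cong[OF ae_refl B'(3)]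
      by (auto simp: C_sel)
  qed
  have ne: "{(j, tna C (cm S S' A) b) | j b. (j, b) \<in> CL (D L) E B} \<noteq> {}" for L using CL_ex[OF B] by fastforce
  note i = ind_mk_mk_indmor[OF is_tower_tno[OF M S(1,2)] is_tower_tno[OF N S(3,4)] r ne]
  show "cm S S' A \<boxtimes>\<^bsub>C\<^esub> mk_indmor M D N E B = mk_indmor (ind_tno C (pr S) M) (\<lambda>L. tS S (D L)) (ind_tno C (pr S') N) (\<lambda>L. tS S' (E L)) (tn A B)"
    unfolding ind_tna_def using i(1) cm_st[OF S(1,3) A] by (simp add: C_sel)
  show "admissible (\<lambda>L. tS S (D L)) (\<lambda>L. tS S' (E L)) (tn A B)" by (rule i(2))
qed

lemma is_tower_obs: assumes M: "is_tower M D" shows "M \<in> ind_obs C"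
proof -
  have "trn M j l \<bullet>\<^bsub>C\<^esub> trn M i j = trn M i l" if "i \<le> j" "j \<le> l" for i j l
    using trn_cm[OF M is_towerD(1)[OF M] good_vee[OF is_towerD(3)[OF M that(1)]] that(2)] that by (simp add: is_towerD(7)[OF M])
  moreover have "trn M i i = idn C (pr (D i))" for i by (simp add: is_towerD(7)[OF M] C_sel UC_pr)
  moreover have "trn M i j \<in> hom_set C (pr (D i)) (pr (D j))" if "i \<le> j" for i j
    using cm_hom[OF M M good_vee[OF is_towerD(3)[OF M that]]] by (simp add: is_towerD(7)[OF M that])
  moreover have "\<exists>l::nat. i \<le> l \<and> j \<le> l" for i j :: nat by (rule exI[of _ "max i j"]) simp
  ultimately show ?thesis by (auto simp: ind_obs_def is_towerD(4-6)[OF M] is_towerD(2)[OF M] C_sel(1))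
qed

end

section \<open>Symmetric powers in the Deligne category\<close>

text \<open>On basis vectors, the multiplication V \<otimes> S^i V \<rightarrow> S^(i+1) V.\<close>

fun symp_map :: "bvec \<Rightarrow> bvec" where
  "symp_map (Tns (Gen z) (Mon b)) = Mon (add_mset z b)"
| "symp_map c = c"

definition PD :: "nat \<Rightarrow> (nat \<times> nat) set \<Rightarrow> bvec set" where
  "PD n D = {pm a b | a b. set_mset a \<subseteq> Xv ` {..<n} \<and> set_mset b \<subseteq> Yv ` {..<n} \<and> (size a, size b) \<in> D}"

lemma pm_PD: "pm a b \<in> PD n D \<longleftrightarrow> set_mset a \<subseteq> Xv ` {..<n} \<and> set_mset b \<subseteq> Yv ` {..<n} \<and> (size a, size b) \<in> D"
  by (auto simp: PD_def pm_def)

lemma PD_tset: "PD n D = tset (\<Union>(i, j)\<in>D. tset (sym_basis (Xv ` {..<n}) i) (sym_basis (Yv ` {..<n}) j)) {Unt}"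
proof (rule subset_antisym; rule subsetI)
  fix c assume "c \<in> PD n D"
  then obtain a b where c: "c = pm a b" "set_mset a \<subseteq> Xv ` {..<n}" "set_mset b \<subseteq> Yv ` {..<n}" "(size a, size b) \<in> D"
    by (auto simp: PD_def)
  have "Mon a \<in> sym_basis (Xv ` {..<n}) (size a)" "Mon b \<in> sym_basis (Yv ` {..<n}) (size b)" using c by (auto simp: sym_basis_def)
  hence "Tns (Mon a) (Mon b) \<in> (\<Union>(i, j)\<in>D. tset (sym_basis (Xv ` {..<n}) i) (sym_basis (Yv ` {..<n}) j))"
    using c(4) by (auto simp: tset_iff intro!: bexI[of _ "(size a, size b)"])
  thus "c \<in> tset (\<Union>(i, j)\<in>D. tset (sym_basis (Xv ` {..<n}) i) (sym_basis (Yv ` {..<n}) j)) {Unt}"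
    by (simp add: c(1) pm_def tset_iff)
next
  fix c assume "c \<in> tset (\<Union>(i, j)\<in>D. tset (sym_basis (Xv ` {..<n}) i) (sym_basis (Yv ` {..<n}) j)) {Unt}"
  then obtain i j u v where "c = Tns (Tns u v) Unt" "(i, j) \<in> D" "u \<in> sym_basis (Xv ` {..<n}) i" "v \<in> sym_basis (Yv ` {..<n}) j"
    by (auto elim!: tset_cases)
  thus "c \<in> PD n D" by (auto simp: sym_basis_def pm_def[symmetric] pm_PD)
qed

lemma PD_all: "PD n (all_deg L) = PBL n L"
  by (simp add: PD_def PBL_def all_deg_def)

lemma finite_size_mset: "finite A \<Longrightarrow> finite {a. set_mset a \<subseteq> A \<and> size a = i}"
proof (induction i)
  case 0
  have "{a. set_mset a \<subseteq> A \<and> size a = 0} \<subseteq> {{#}}" by auto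
  thus ?case by (rule finite_subset) simp
next
  case (Suc i)
  have "{a. set_mset a \<subseteq> A \<and> size a = Suc i} \<subseteq> (\<lambda>(z, a). add_mset z a) ` (A \<times> {a. set_mset a \<subseteq> A \<and> size a = i})"
  proof
    fix a assume a: "a \<in> {a. set_mset a \<subseteq> A \<and> size a = Suc i}"
    then obtain z b where "a = add_mset z b" by (auto dest: size_eq_Suc_imp_eq_union)
    thus "a \<in> (\<lambda>(z, a). add_mset z a) ` (A \<times> {a. set_mset a \<subseteq> A \<and> size a = i})" using a by auto
  qed
  from finite_subset[OF this] show ?case using Suc by simp
qed

text \<open>The exceptional set may depend on the integer. This is enough, because splitting off one
  symmetric power from the product with the preceding one divides by a single integer.\<close>

locale ultra_setting_units = ultra_setting +
  assumes inv: "\<And>j::nat. \<forall>\<^sub>F n in F. [Suc j] \<cdot>\<^bsub>K n\<^esub> \<one>\<^bsub>K n\<^esub> \<in> Units (K n)"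
begin

lemma OB_summand:
  assumes S: "stab S" "stab S'" and O: "pr S \<in> OB" and I: "good S' S I" and P: "good S S' P" and e: "ae S' (kcmp P I) vee"
  shows "pr S' \<in> OB"
  unfolding OB_def
proof (rule generated_obs.summand)
  show "pr S \<in> generated_obs UC (pr HY)" using O by (simp add: OB_def)
  show "pr S' \<in> obs UC" by (rule pr_obs[OF S(2)])
  have "cm S S' P \<bullet>\<^bsub>UC\<^esub> cm S' S I = idn UC (pr S')"
    unfolding UC_cmp[OF S(2,1,2) I P] UC_pr by (rule cm_cong[OF e])
  thus "is_summand UC (pr S') (pr S)" unfolding is_summand_def
    using I P hom_UC[OF S(2,1)] hom_UC[OF S] by blast
qed


lemma kcmp_mapf_vee:
  assumes "\<And>n c. c \<in> S n \<Longrightarrow> \<phi> c \<in> S' n" "good S' S'' T"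
  shows "ae S (kcmp T (mapf \<phi>)) (\<lambda>n c. T n (\<phi> c))"
  unfolding ae_def kcmp_def ccomp_def mapf_def
  by (intro always_eventually allI ballI coeff_ring.lin_ve_U[OF K]) (rule goodD[OF assms(2) assms(1)])

text \<open>An isomorphic copy is a direct summand, so closure under summands gives closure under
  isomorphism; a one-sided inverse suffices for the argument.\<close>

lemma OB_iso:
  assumes S: "stab S" "stab S'" and O: "pr S \<in> OB"
    and f: "\<And>n c. c \<in> S' n \<Longrightarrow> \<phi> c \<in> S n" "\<And>g n c. c \<in> S' n \<Longrightarrow> \<phi> (bact g c) = bact g (\<phi> c)"
    and f': "\<And>n c. c \<in> S n \<Longrightarrow> \<phi>' c \<in> S' n" "\<And>g n c. c \<in> S n \<Longrightarrow> \<phi>' (bact g c) = bact g (\<phi>' c)"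
    and id: "\<And>n c. c \<in> S' n \<Longrightarrow> \<phi>' (\<phi> c) = c"
  shows "pr S' \<in> OB"
proof (rule OB_summand[OF S O])
  show "good S' S (mapf \<phi>)" by (rule good_mapf) (use f in auto)
  show g: "good S S' (mapf \<phi>')" by (rule good_mapf) (use f' in auto)
  have "ae S' (kcmp (mapf \<phi>') (mapf \<phi>)) (\<lambda>n c. mapf \<phi>' n (\<phi> c))" by (rule kcmp_mapf_vee[OF f(1) g])
  moreover have "ae S' (\<lambda>n c. mapf \<phi>' n (\<phi> c)) vee" unfolding ae_def by (intro always_eventually) (simp add: mapf_def vee_def id)
  ultimately show "ae S' (kcmp (mapf \<phi>') (mapf \<phi>)) vee" by (rule ae_trans)
qed

lemma gact_lt: "g permutes {..<n::nat} \<Longrightarrow> gact g ` (Xv ` {..<n}) \<subseteq> Xv ` {..<n}" "g permutes {..<n::nat} \<Longrightarrow> gact g ` (Yv ` {..<n}) \<subseteq> Yv ` {..<n}"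
  using permutes_gi by auto

lemma stab_H: "stab HX" "stab HY" "stab UT"
  using gact_lt unfolding stab_def pstab_def HX_def HY_def UT_def by (auto simp: image_image) (metis permutes_gi imageI lessThan_iff)+

lemma OB_HY: "pr HY \<in> OB" unfolding OB_def by (rule generated_obs.base)

lemma OB_UT: "pr UT \<in> OB" unfolding OB_def using generated_obs.unit[of UC "pr HY"] by (simp add: UC_pr)

text \<open>The permutation representation is self-dual: exchanging the labels x_i and y_i is
  equivariant.\<close>

lemma OB_HX: "pr HX \<in> OB"
  by (rule OB_iso[OF stab_H(2,1) OB_HY, where \<phi> = "\<lambda>c. case c of Gen z \<Rightarrow> Gen (Yv (gix z)) | _ \<Rightarrow> c" and \<phi>' = "\<lambda>c. case c of Gen z \<Rightarrow> Gen (Xv (gix z)) | _ \<Rightarrow> c"])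
    (auto simp: HX_def HY_def)

text \<open>The zero object, a summand of h, starts the induction over finite sets of bidegrees in
  \<open>PD_OB\<close>.\<close>

lemma OB_empty: "pr (\<lambda>n. {}) \<in> OB"
proof (rule OB_summand[OF stab_H(2) _ OB_HY])
  show "stab (\<lambda>n. {})" by (simp add: stab_def pstab_def)
  show "good (\<lambda>n. {}) HY zef" "good HY (\<lambda>n. {}) zef" by (rule good_zef)+
  show "ae (\<lambda>n. {}) (kcmp zef zef) vee" by (simp add: ae_def)
qed

definition "prj_to S = (\<lambda>n c (r::bvec). if c \<in> S n then ve (K n) c r else \<zero>\<^bsub>K n\<^esub>)"

lemma good_prj: "stab S \<Longrightarrow> good S' S (prj_to S)"
  unfolding good_def
proof
  fix n assume "stab S"
  hence S: "pstab (m n) (S n)" by (simp add: stab_def)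
  interpret coeff_ring "K n" by (rule K)
  show "pgood (K n) (m n) (S' n) (S n) (prj_to S n)"
    unfolding pgood_def prj_to_def using pstab_iff[OF S] bact_inj by (auto simp: vec_carrier ve_def)
qed

lemma OB_sum:
  assumes S: "stab S" "stab S'" and O: "pr S \<in> OB" "pr S' \<in> OB" and d: "\<And>n. S n \<inter> S' n = {}"
  shows "stab (\<lambda>n. S n \<union> S' n)" "pr (\<lambda>n. S n \<union> S' n) \<in> OB"
proof -
  let ?Z = "\<lambda>n. S n \<union> S' n"
  show Z: "stab ?Z" using S unfolding stab_def pstab_def by (auto simp: image_Un) blast+
  have g: "good S ?Z vee" "good S' ?Z vee" by (rule good_vee, blast)+
  note p = good_prj[OF S(1), of ?Z] good_prj[OF S(2), of ?Z]
  have kv: "kcmp T vee n c = T n c" if "good ?Z B T" "c \<in> ?Z n" for T n c B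
    unfolding kcmp_def ccomp_def vee_def by (rule coeff_ring.lin_ve_U[OF K]) (rule goodD[OF that])
  have kv': "kcmp vee T n c = T n c" if "good ?Z B T" "c \<in> ?Z n" for T n c B
    unfolding kcmp_def ccomp_def vee_def by (rule coeff_ring.lin_ve_id[OF K]) (rule goodD[OF that])
  have z: "(\<lambda>u. \<zero>\<^bsub>K n\<^esub>) = zef n c" for n c by (simp add: zef_def)
  have 1: "cm ?Z S (prj_to S) \<bullet>\<^bsub>UC\<^esub> cm S ?Z vee = idn UC (pr S)"
    unfolding UC_cmp[OF S(1) Z S(1) g(1) p(1)] UC_pr
    by (rule cm_cong) (simp add: ae_def kv[OF p(1)], simp add: prj_to_def vee_def)
  have 2: "cm ?Z S' (prj_to S') \<bullet>\<^bsub>UC\<^esub> cm S' ?Z vee = idn UC (pr S')"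
    unfolding UC_cmp[OF S(2) Z S(2) g(2) p(2)] UC_pr
    by (rule cm_cong) (simp add: ae_def kv[OF p(2)], simp add: prj_to_def vee_def)
  have 3: "cm ?Z S (prj_to S) \<bullet>\<^bsub>UC\<^esub> cm S' ?Z vee = zer UC (pr S') (pr S)"
    unfolding UC_cmp[OF S(2) Z S(1) g(2) p(1)] UC_pr
    by (rule cm_cong) (simp add: ae_def kv[OF p(1)], use d in \<open>auto simp: prj_to_def zef_def fun_eq_iff intro!: always_eventually\<close>)
  have 4: "cm ?Z S' (prj_to S') \<bullet>\<^bsub>UC\<^esub> cm S ?Z vee = zer UC (pr S) (pr S')"
    unfolding UC_cmp[OF S(1) Z S(2) g(1) p(2)] UC_pr
    by (rule cm_cong) (simp add: ae_def kv[OF p(2)], use d in \<open>auto simp: prj_to_def zef_def fun_eq_iff intro!: always_eventually\<close>)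
  have 5: "pls UC (cm S ?Z vee \<bullet>\<^bsub>UC\<^esub> cm ?Z S (prj_to S)) (cm S' ?Z vee \<bullet>\<^bsub>UC\<^esub> cm ?Z S' (prj_to S')) = idn UC (pr ?Z)"
    unfolding UC_cmp[OF Z S(1) Z p(1) g(1)] UC_cmp[OF Z S(2) Z p(2) g(2)] UC_pls[OF Z Z good_comp[OF Z S(1) p(1) g(1)] good_comp[OF Z S(2) p(2) g(2)]] UC_pr
  proof (rule cm_cong, unfold ae_def, intro always_eventually allI ballI ext)
    fix n c r assume c: "c \<in> ?Z n"
    interpret coeff_ring "K n" by (rule K)
    show "addf (kcmp vee (prj_to S)) (kcmp vee (prj_to S')) n c r = vee n c r"
      unfolding addf_def kv'[OF p(1) c] kv'[OF p(2) c] using c d[of n] by (auto simp: prj_to_def vee_def ve_def)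
  qed
  have "is_biproduct UC (pr S) (pr S') (pr ?Z)"
    unfolding is_biproduct_def
  proof (intro bexI conjI)
    show "cm S ?Z vee \<in> hom_set UC (pr S) (pr ?Z)" using hom_UC[OF S(1) Z] g by auto
    show "cm S' ?Z vee \<in> hom_set UC (pr S') (pr ?Z)" using hom_UC[OF S(2) Z] g by auto
    show "cm ?Z S (prj_to S) \<in> hom_set UC (pr ?Z) (pr S)" using hom_UC[OF Z S(1)] p by auto
    show "cm ?Z S' (prj_to S') \<in> hom_set UC (pr ?Z) (pr S')" using hom_UC[OF Z S(2)] p by auto
  qed (fact 1 2 3 4 5)+
  thus "pr ?Z \<in> OB" using O pr_obs[OF Z] unfolding OB_def by (rule generated_obs.sum[rotated 3])
qed

text \<open>Up to the scalar w, the polarization S^(i+1) V \<rightarrow> V \<otimes> S^i V: a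
  monomial is sent to the sum of z \<otimes> (monomial divided by z), weighted with the multiplicity
  of z. Following it by multiplication is multiplication by w times the degree i + 1.\<close>

definition "symc w = (\<lambda>n c r. case c of Mon a \<Rightarrow> (case r of Tns u v \<Rightarrow> (case u of Gen z \<Rightarrow> (case v of Mon b \<Rightarrow>
   if a = add_mset z b then w n \<otimes>\<^bsub>K n\<^esub> ([count a z] \<cdot>\<^bsub>K n\<^esub> \<one>\<^bsub>K n\<^esub>) else \<zero>\<^bsub>K n\<^esub>
   | _ \<Rightarrow> \<zero>\<^bsub>K n\<^esub>) | _ \<Rightarrow> \<zero>\<^bsub>K n\<^esub>) | _ \<Rightarrow> \<zero>\<^bsub>K n\<^esub>) | _ \<Rightarrow> \<zero>\<^bsub>K n\<^esub>)"

definition "SB Z i = (\<lambda>n. sym_basis (Z n) i)"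
definition "GZ Z = (\<lambda>n. Gen ` Z n)"

lemma (in coeff_ring) finsum_nat_one: "finite A \<Longrightarrow> (\<Oplus>z\<in>A. [f z] \<cdot> \<one>) = [(sum f A :: nat)] \<cdot> \<one>"
  by (induction A rule: finite_induct) (auto simp: add.nat_pow_mult)

lemma symc_cases:
  assumes "symc w n (Mon a) r \<noteq> \<zero>\<^bsub>K n\<^esub>" obtains z b where "r = Tns (Gen z) (Mon b)" "a = add_mset z b"
  using assms by (auto simp: symc_def split: bvec.splits if_splits)

context
  fixes Z :: "nat \<Rightarrow> gen set"
  assumes Zf: "\<And>n. finite (Z n)" and Zg: "\<And>g n. g permutes {..<m n} \<Longrightarrow> gact g ` Z n \<subseteq> Z n"
begin

lemma SB_stab: "stab (SB Z i)"
proof -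
  have "bact g c \<in> sym_basis (Z n) i" if g: "g permutes {..<m n}" and c: "c \<in> sym_basis (Z n) i" for g n c
    using c Zg[OF g] by (fastforce simp: sym_basis_def)
  moreover have "finite (sym_basis (Z n) i)" for n
  proof -
    have "sym_basis (Z n) i \<subseteq> Mon ` {a. set_mset a \<subseteq> Z n \<and> size a = i}" by (auto simp: sym_basis_def)
    thus ?thesis by (rule finite_subset) (simp add: finite_size_mset[OF Zf])
  qed
  ultimately show ?thesis by (auto simp: stab_def pstab_def SB_def)
qed

lemma GZ_stab: "stab (GZ Z)"
  using Zf Zg by (auto simp: stab_def pstab_def GZ_def) blast

lemma SB_0: "pr (SB Z 0) \<in> OB"
  by (rule OB_iso[OF stab_H(3) SB_stab OB_UT, where \<phi> = "\<lambda>c. Unt" and \<phi>' = "\<lambda>c. Mon {#}"])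
    (auto simp: SB_def UT_def sym_basis_def)

lemma symc_good:
  assumes "w \<in> PiK" shows "good (SB Z (Suc i)) (tS (GZ Z) (SB Z i)) (symc w)"
  unfolding good_def
proof
  fix n
  interpret coeff_ring "K n" by (rule K)
  have w: "w n \<in> carrier (K n)" using assms by auto
  have f: "finite (tS (GZ Z) (SB Z i) n)" using stab_tS[OF GZ_stab SB_stab] by (auto simp: stab_def pstab_def)
  show "pgood (K n) (m n) (SB Z (Suc i) n) (tS (GZ Z) (SB Z i) n) (symc w n)"
    unfolding pgood_def
  proof (intro ballI conjI allI impI)
    fix c assume "c \<in> SB Z (Suc i) n"
    then obtain a where a: "c = Mon a" "size a = Suc i" "set_mset a \<subseteq> Z n" by (auto simp: SB_def sym_basis_def)
    have sub: "{r. symc w n c r \<noteq> \<zero>\<^bsub>K n\<^esub>} \<subseteq> tS (GZ Z) (SB Z i) n"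
      using a by (auto simp: tS_def tset_iff GZ_def SB_def sym_basis_def elim!: symc_cases)
    moreover have "symc w n c r \<in> carrier (K n)" for r using w by (auto simp: symc_def split: bvec.split)
    ultimately show "symc w n c \<in> carrier (vec (K n) (tS (GZ Z) (SB Z i) n))"
      using finite_subset[OF sub f] by (simp add: vec_carrier)
    fix g r assume g: "g permutes {..<m n}"
    have inj: "inj (gact g)" using gact_comp[of "ginv g" g] permutes_inv_o(2)[OF g] gact_id by (metis injI)
    have ie: "image_mset (gact g) a = add_mset (gact g z) (image_mset (gact g) b) \<longleftrightarrow> a = add_mset z b" for z b
      using inj_eq[OF multiset.inj_map[OF inj], of a "add_mset z b"] by simp
    have ct: "count (image_mset (gact g) b) (gact g z) = count b z" for b z
    proof -
      have "{x. x \<in># b \<and> gact g z = gact g x} = (if z \<in># b then {z} else {})" using inj by (auto dest: injD)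
      thus ?thesis by (simp add: count_image_mset' not_in_iff)
    qed
    show "symc w n (bact g c) (bact g r) = symc w n c r"
      unfolding a(1) symc_def by (auto split: bvec.split simp: ie ct)
  qed
qed

text \<open>Polarization divided by the degree is a section of multiplication almost everywhere, so
  S^(i+1) V is a direct summand of V \<otimes> S^i V in the ultraproduct.\<close>

lemma SB_Suc:
  assumes H: "pr (GZ Z) \<in> OB" and O: "pr (SB Z i) \<in> OB"
  shows "pr (SB Z (Suc i)) \<in> OB"
proof -
  \<comment> \<open>The inverse of the degree i + 1. The value zero at the indices where i + 1 is
    not a unit only keeps the sequence inside the fields; these indices form a null set.\<close>
  define w where "w = (\<lambda>n. if [Suc i] \<cdot>\<^bsub>K n\<^esub> \<one>\<^bsub>K n\<^esub> \<in> Units (K n) then m_inv (K n) ([Suc i] \<cdot>\<^bsub>K n\<^esub> \<one>\<^bsub>K n\<^esub>) else \<zero>\<^bsub>K n\<^esub>)"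
  have w: "w \<in> PiK"
  proof
    fix n interpret coeff_ring "K n" by (rule K)
    show "w n \<in> carrier (K n)" by (simp add: w_def)
  qed
  note st = stab_tS[OF GZ_stab SB_stab]
  have gP: "good (tS (GZ Z) (SB Z i)) (SB Z (Suc i)) (mapf symp_map)"
    by (rule good_mapf) (auto simp: tS_def tset_def GZ_def SB_def sym_basis_def)
  have "ae (SB Z (Suc i)) (kcmp (mapf symp_map) (symc w)) vee"
    unfolding ae_def using inv[of i]
  proof eventually_elim
    case (elim n)
    interpret coeff_ring "K n" by (rule K)
    show ?case
    proof (intro ballI ext)
      fix c r assume c: "c \<in> SB Z (Suc i) n"
      then obtain a where a: "c = Mon a" "size a = Suc i" "set_mset a \<subseteq> Z n" by (auto simp: SB_def sym_basis_def)
      let ?\<phi> = "\<lambda>z. Tns (Gen z) (Mon (a - {#z#}))"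
      have wn: "w n \<in> carrier (K n)" using w by auto
      have i: "inj_on ?\<phi> (set_mset a)" by (auto simp: inj_on_def)
      have sc: "symc w n (Mon a) (?\<phi> z) = w n \<otimes>\<^bsub>K n\<^esub> ([count a z] \<cdot>\<^bsub>K n\<^esub> \<one>\<^bsub>K n\<^esub>)" if "z \<in># a" for z
        using that by (simp add: symc_def)
      have mp: "mapf symp_map n (?\<phi> z) = ve (K n) (Mon a)" if "z \<in># a" for z using that by (simp add: mapf_def)
      have "kcmp (mapf symp_map) (symc w) n c r = (\<Oplus>\<^bsub>K n\<^esub>b\<in>?\<phi> ` set_mset a. symc w n (Mon a) b \<otimes>\<^bsub>K n\<^esub> mapf symp_map n b r)"
        unfolding kcmp_def ccomp_def a(1)
      proof (rule lin_vec)
        show "{b. symc w n (Mon a) b \<noteq> \<zero>\<^bsub>K n\<^esub>} \<subseteq> ?\<phi> ` set_mset a" by (auto elim!: symc_cases)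
        show "symc w n (Mon a) b \<in> carrier (K n)" for b using wn by (auto simp: symc_def split: bvec.split)
      qed (auto simp: mapf_def intro!: ve_carrier)
      also have "\<dots> = (\<Oplus>\<^bsub>K n\<^esub>z\<in>set_mset a. symc w n (Mon a) (?\<phi> z) \<otimes>\<^bsub>K n\<^esub> mapf symp_map n (?\<phi> z) r)"
        by (rule add.finprod_reindex[OF _ i]) (use wn in \<open>auto simp: sc mp ve_def\<close>)
      also have "\<dots> = (\<Oplus>\<^bsub>K n\<^esub>z\<in>set_mset a. (w n \<otimes>\<^bsub>K n\<^esub> ve (K n) (Mon a) r) \<otimes>\<^bsub>K n\<^esub> ([count a z] \<cdot>\<^bsub>K n\<^esub> \<one>\<^bsub>K n\<^esub>))"
        by (rule finsum_cong') (use wn in \<open>auto simp: sc mp ve_def\<close>)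
      also have "\<dots> = (w n \<otimes>\<^bsub>K n\<^esub> ve (K n) (Mon a) r) \<otimes>\<^bsub>K n\<^esub> (\<Oplus>\<^bsub>K n\<^esub>z\<in>set_mset a. ([count a z] \<cdot>\<^bsub>K n\<^esub> \<one>\<^bsub>K n\<^esub>))"
        by (rule finsum_rdistr[symmetric]) (use wn in \<open>auto simp: ve_def\<close>)
      \<comment> \<open>The multiplicities of the monomial add up to its degree i + 1, which
        \<open>w\<close> cancels.\<close>
      also have "(\<Oplus>\<^bsub>K n\<^esub>z\<in>set_mset a. ([count a z] \<cdot>\<^bsub>K n\<^esub> \<one>\<^bsub>K n\<^esub>)) = [Suc i] \<cdot>\<^bsub>K n\<^esub> \<one>\<^bsub>K n\<^esub>"
        using finsum_nat_one[of "set_mset a" "count a"] a(2) by (simp add: size_multiset_overloaded_eq)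
      also have "(w n \<otimes>\<^bsub>K n\<^esub> ve (K n) (Mon a) r) \<otimes>\<^bsub>K n\<^esub> ([Suc i] \<cdot>\<^bsub>K n\<^esub> \<one>\<^bsub>K n\<^esub>) = ve (K n) (Mon a) r"
        using elim by (simp add: w_def ve_def del: add.nat_pow_Suc)
      finally show "kcmp (mapf symp_map) (symc w) n c r = vee n c r" by (simp add: vee_def a(1))
    qed
  qed
  thus ?thesis by (rule OB_summand[OF st SB_stab OB_tensor[OF H O] symc_good[OF w] gP])
qed

lemma SB_OB: "pr (GZ Z) \<in> OB \<Longrightarrow> pr (SB Z i) \<in> OB"
  by (induction i) (auto intro: SB_0 SB_Suc)

end

definition "XZ = (\<lambda>n. Xv ` {..<m n})"
definition "YZ = (\<lambda>n. Yv ` {..<m n})"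

lemma XYZ: "finite (XZ n)" "finite (YZ n)" "g permutes {..<m n} \<Longrightarrow> gact g ` XZ n \<subseteq> XZ n" "g permutes {..<m n} \<Longrightarrow> gact g ` YZ n \<subseteq> YZ n"
  using gact_lt by (simp_all add: XZ_def YZ_def)

lemma SBX: "stab (SB XZ i)" "pr (SB XZ i) \<in> OB"
proof -
  show "stab (SB XZ i)" using SB_stab XYZ by blast
  have "GZ XZ = HX" by (simp add: GZ_def XZ_def HX_def)
  thus "pr (SB XZ i) \<in> OB" using SB_OB[of XZ] XYZ OB_HX by simp
qed

lemma SBY: "stab (SB YZ i)" "pr (SB YZ i) \<in> OB"
proof -
  show "stab (SB YZ i)" using SB_stab XYZ by blast
  have "GZ YZ = HY" by (simp add: GZ_def YZ_def HY_def)
  thus "pr (SB YZ i) \<in> OB" using SB_OB[of YZ] XYZ OB_HY by simp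
qed

lemma PD_single: "(\<lambda>n. PD (m n) {(i, j)}) = tS (tS (SB XZ i) (SB YZ j)) UT"
  by (simp add: PD_tset tS_def SB_def XZ_def YZ_def UT_def fun_eq_iff)

text \<open>A monomial determines its bidegree, so the pieces for different bidegrees have disjoint
  bases and their union is a direct sum. Each piece is a tensor product of symmetric powers.\<close>

lemma PD_OB: "finite D \<Longrightarrow> stab (\<lambda>n. PD (m n) D) \<and> pr (\<lambda>n. PD (m n) D) \<in> OB"
proof (induction D rule: finite_induct)
  case empty
  have "(\<lambda>n. PD (m n) {}) = (\<lambda>n. {})" by (simp add: PD_def)
  thus ?case using OB_empty by (simp add: stab_def pstab_def)
next
  case (insert x D)
  obtain i j where x: "x = (i, j)" by (cases x)
  have s: "stab (\<lambda>n. PD (m n) {x})" "pr (\<lambda>n. PD (m n) {x}) \<in> OB"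
    unfolding x PD_single by (intro stab_tS OB_tensor SBX SBY stab_H OB_UT)+
  have d: "PD (m n) {x} \<inter> PD (m n) D = {}" for n using insert(2) by (auto simp: PD_def pm_def)
  have e: "(\<lambda>n. PD (m n) (insert x D)) = (\<lambda>n. PD (m n) {x} \<union> PD (m n) D)" by (auto simp: PD_def fun_eq_iff)
  show ?case unfolding e using OB_sum[OF s(1) _ s(2) _ d] insert by blast
qed

lemma sym_lev_pr: "sym_lev K m D (unt C) = pr (\<lambda>n. PD (m n) D)"
proof -
  show ?thesis by (simp add: PD_tset sym_lev_def sym_part_def tset_def[of "sym_basis _ _", symmetric] C_sel UC_pr pr_def UT_def rep_tensor_perm[OF coeff_ring.axioms[OF K]] fun_eq_iff)
qed

lemma sym_incl_cm: "sym_incl F K m D D' (unt C) = cm (\<lambda>n. PD (m n) D) (\<lambda>n. PD (m n) D') vee"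
proof -
  have "sym_incl F K m D D' (unt C) = ucls F RC (rmm (\<lambda>n. PD (m n) D) (\<lambda>n. PD (m n) D') vee)"
    unfolding sym_incl_def sym_lev_pr by (simp add: pr_def RC_def rmm_def map_mor_pmor vee_def)
  thus ?thesis by (simp add: ucls_rmm)
qed

lemma is_tower_sym:
  assumes "\<And>L. finite (D L)" "\<And>L L'. L \<le> L' \<Longrightarrow> D L \<subseteq> D L'"
  shows "is_tower (sym_ind F K m D (unt C)) (\<lambda>L n. PD (m n) (D L))"
proof -
  have "PD (m n) (D L) \<subseteq> PD (m n) (D L')" if "L \<le> L'" for n L L' using assms(2)[OF that] by (auto simp: PD_def)
  thus ?thesis using PD_OB[OF assms(1)] by (auto simp: is_tower_def tower_def sym_ind_def sym_lev_pr sym_incl_cm)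
qed

lemma degs: "finite (all_deg L)" "finite (y_deg L)" "L \<le> L' \<Longrightarrow> all_deg L \<subseteq> all_deg L'" "L \<le> L' \<Longrightarrow> y_deg L \<subseteq> y_deg L'"
proof -
  show "finite (all_deg L)" by (rule finite_subset[of _ "{..L} \<times> {..L}"]) (auto simp: all_deg_def)
  show "finite (y_deg L)" by (rule finite_subset[of _ "{..L} \<times> {..L}"]) (auto simp: y_deg_def)
qed (auto simp: all_deg_def y_deg_def)

definition "MM = sym_ind F K m all_deg (unt C)"
definition "MY = sym_ind F K m y_deg (unt C)"
definition "DM = (\<lambda>L n. PBL (m n) L)"
definition "DY = (\<lambda>L n. PD (m n) (y_deg L))"

lemma is_tower_M: "is_tower MM DM" and is_tower_Y: "is_tower MY DY"
  using is_tower_sym[OF degs(1,3)] is_tower_sym[OF degs(2,4)] by (simp_all add: DM_def DY_def PD_all MM_def MY_def)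

end

section \<open>The induced object\<close>

lemma (in abelian_group) ag_cancel3:
  assumes "a \<in> carrier G" "b \<in> carrier G" shows "a \<oplus> b \<ominus> a = b"
proof -
  have "a \<oplus> b \<ominus> a = b \<oplus> (a \<oplus> \<ominus> a)" using assms by (simp only: a_minus_def a_ac a_closed a_inv_closed)
  thus ?thesis using assms by (simp add: r_neg)
qed

definition prs :: "nat \<Rightarrow> (nat \<times> nat) set" where
  "prs n = {(i, j). i < j \<and> j < n}"

context coeff_ring
begin

interpretation VU: module K "vec K (UNIV :: bvec set)" by (rule vec_module)

abbreviation "VU \<equiv> vec K (UNIV :: bvec set)"

lemma ve_VU: "ve K c \<in> carrier VU" by (rule ve_carrier) simp

lemma lin_VU: "(\<And>c. T c \<in> carrier VU) \<Longrightarrow> klin K VU VU (lin K VU T)"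
  by (rule lin_klin[OF vec_module])

lemma ccomp_ve: "A c = ve K d \<Longrightarrow> B d \<in> carrier VU \<Longrightarrow> ccomp K B A c = B d"
  by (simp add: ccomp_def lin_ve[OF vec_module])

lemma tens_ve_col:
  assumes "T v \<in> carrier VU"
  shows "tens K (ve K) T (Tns u v) = lin K VU (\<lambda>b. ve K (Tns u b)) (T v)"
proof
  fix r
  have T: "finite {b. T v b \<noteq> \<zero>}" "\<And>b. T v b \<in> carrier K" using assms by (auto simp: vec_carrier)
  have l: "lin K VU (\<lambda>b. ve K (Tns u b)) (T v) r = (\<Oplus>b\<in>{b. T v b \<noteq> \<zero>}. T v b \<otimes> ve K (Tns u b) r)"
    by (rule lin_vec[OF T(1)]) (auto simp: T(2) ve_VU)
  show "tens K (ve K) T (Tns u v) r = lin K VU (\<lambda>b. ve K (Tns u b)) (T v) r"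
  proof (cases "\<exists>b. r = Tns u b \<and> T v b \<noteq> \<zero>")
    case True
    then obtain b where b: "r = Tns u b" "T v b \<noteq> \<zero>" by blast
    have "(\<Oplus>b'\<in>{b. T v b \<noteq> \<zero>}. T v b' \<otimes> ve K (Tns u b') r) = (\<Oplus>b'\<in>{b. T v b \<noteq> \<zero>}. if b = b' then T v b' else \<zero>)"
      by (rule finsum_cong') (use T in \<open>auto simp: b ve_def\<close>)
    also have "\<dots> = T v b" by (rule add.finprod_singleton) (use T b in auto)
    finally have 1: "lin K VU (\<lambda>b. ve K (Tns u b)) (T v) r = T v b" using l by simp
    have "tens K (ve K) T (Tns u v) r = T v b" using T by (simp add: b tens_Tns ve_cases)
    thus ?thesis using 1 by simp
  next
    case False
    have "(\<Oplus>b'\<in>{b. T v b \<noteq> \<zero>}. T v b' \<otimes> ve K (Tns u b') r) = (\<Oplus>b'\<in>{b. T v b \<noteq> \<zero>}. \<zero>)"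
      by (rule finsum_cong') (use T False in \<open>auto simp: ve_def\<close>)
    hence 1: "lin K VU (\<lambda>b. ve K (Tns u b)) (T v) r = \<zero>" using l by simp
    have "tens K (ve K) T (Tns u v) r = \<zero>" using T False by (cases r) (auto simp: tens_Tns ve_cases)
    thus ?thesis using 1 by simp
  qed
qed

lemma lin_tl:
  assumes w: "w \<in> carrier VU" and B: "\<And>b. w b \<noteq> \<zero> \<Longrightarrow> B (Tns u b) \<in> carrier VU"
  shows "lin K VU B (lin K VU (\<lambda>b. ve K (Tns u b)) w) = lin K VU (\<lambda>b. B (Tns u b)) w"
proof -
  let ?S = "{b. w b \<noteq> \<zero>}"
  have wS: "w \<in> carrier (vec K ?S)" using w by (auto simp: vec_carrier)
  have k1: "klin K (vec K ?S) (vec K (Tns u ` ?S)) (lin K VU (\<lambda>b. ve K (Tns u b)))"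
  proof -
    have e: "lin K VU (\<lambda>b. ve K (Tns u b)) x = lin K (vec K (Tns u ` ?S)) (\<lambda>b. ve K (Tns u b)) x" if "x \<in> carrier (vec K ?S)" for x
      by (rule lin_vec_irrel[OF that]) (auto intro!: ve_carrier)
    show ?thesis by (rule klin_cong[OF vec_module lin_klin[OF vec_module] e]) (auto intro!: ve_carrier)
  qed
  have k2: "klin K (vec K (Tns u ` ?S)) VU (lin K VU B)" by (rule lin_klin[OF vec_module]) (use B in auto)
  have k3: "klin K (vec K ?S) VU (lin K VU (\<lambda>b. B (Tns u b)))" by (rule lin_klin[OF vec_module]) (use B in auto)
  show ?thesis
    by (rule klin_ext[OF vec_module klin_comp[OF k1 k2] k3 _ wS]) (use B in \<open>auto simp: lin_ve[OF vec_module] ve_VU\<close>)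
qed

lemma tens_map_ve: "tens K (\<lambda>c. ve K (\<phi> c)) (ve K) (Tns u v) = ve K (Tns (\<phi> u) v)"
proof
  fix r show "tens K (\<lambda>c. ve K (\<phi> c)) (ve K) (Tns u v) r = ve K (Tns (\<phi> u) v) r"
    by (cases r) (auto simp: tens_Tns ve_def)
qed

lemma prs_fin: "finite (prs n)"
  by (rule finite_subset[of _ "{..<n} \<times> {..<n}"]) (auto simp: prs_def)

definition "omv n c = finsum VU (\<lambda>x. ve K (bact (transpose (fst x) (snd x)) c)) (prs n)"

lemma omv_VU: "omv n c \<in> carrier VU"
  unfolding omv_def by (rule VU.M.finsum_closed) (simp add: ve_VU)

lemma omv_eval: "omv n c r = finsum K (\<lambda>(i, j). ve K (bact (transpose i j) c) r) {(i, j). i < j \<and> j < n}"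
proof -
  have "(\<lambda>(i, j). ve K (bact (transpose i j) c) r) = (\<lambda>x. ve K (bact (transpose (fst x) (snd x)) c) r)" by auto
  thus ?thesis unfolding omv_def prs_def by (subst vec_finsum) (simp_all add: ve_VU)
qed

text \<open>The sum of all transpositions is central: conjugation by g only permutes the
  summands.\<close>

lemma omv_good:
  assumes S: "pstab n S" shows "pgood K n S S (omv n)"
  unfolding pgood_def
proof (intro ballI conjI allI impI)
  fix c assume c: "c \<in> S"
  have "(\<lambda>x. ve K (bact (transpose (fst x) (snd x)) c)) \<in> prs n \<rightarrow> carrier (vec K S)"
    by (auto simp: prs_def intro!: ve_carrier) (subst pstab_iff[OF S permutes_transpose]; use c in auto)
  note f = this
  have "omv n c = finsum (vec K S) (\<lambda>x. ve K (bact (transpose (fst x) (snd x)) c)) (prs n)"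
    unfolding omv_def by (rule ext) (subst (1 2) vec_finsum; use f in \<open>simp add: ve_VU\<close>)
  note oe = this
  interpret W: module K "vec K S" by (rule vec_module)
  show "omv n c \<in> carrier (vec K S)" unfolding oe by (rule W.M.finsum_closed[OF f])
next
  fix c g r assume g: "g permutes {..<n}"
  \<comment> \<open>Summands are indexed by increasing pairs, so the image of a pair under g has to
    be put back in order.\<close>
  define h where "h = (\<lambda>x. if g (fst x) < g (snd x) then (g (fst x), g (snd x)) else (g (snd x), g (fst x)))"
  have gi: "g i = g j \<longleftrightarrow> i = j" for i j using permutes_inj[OF g] by (auto dest: injD)
  have i: "inj_on h (prs n)" by (auto simp: inj_on_def h_def prs_def gi split: if_splits)
  have sub: "h ` prs n \<subseteq> prs n"
  proof (rule image_subsetI)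
    fix x assume x: "x \<in> prs n"
    hence "g (fst x) < n" "g (snd x) < n" "g (fst x) \<noteq> g (snd x)" using permutes_gi[OF g] gi by (auto simp: prs_def)
    thus "h x \<in> prs n" by (simp add: h_def prs_def)
  qed
  have im: "h ` prs n = prs n" by (rule endo_inj_surj[OF prs_fin sub i])
  have b: "bact (transpose (fst (h x)) (snd (h x))) (bact g c) = bact g (bact (transpose (fst x) (snd x)) c)" for x
    using transpose_conj[OF permutes_bij[OF g], of "fst x" "snd x"]
    by (auto simp: h_def bact_comp[symmetric] transpose_commute[of "g (snd x)"])
  have vk: "ve K d r \<in> carrier K" for d r :: bvec by (simp add: ve_def)
  have ev: "omv n c r = (\<Oplus>x\<in>prs n. ve K (bact (transpose (fst x) (snd x)) c) r)" for c r
    unfolding omv_def by (subst vec_finsum) (simp_all add: ve_VU)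
  have "omv n (bact g c) (bact g r) = (\<Oplus>x\<in>h ` prs n. ve K (bact (transpose (fst x) (snd x)) (bact g c)) (bact g r))"
    by (simp add: ev im)
  also have "\<dots> = (\<Oplus>x\<in>prs n. ve K (bact (transpose (fst (h x)) (snd (h x))) (bact g c)) (bact g r))"
    by (rule add.finprod_reindex[OF _ i]) (simp add: vk)
  also have "\<dots> = omv n c r" by (simp add: b ev ve_cases bact_inj[OF g])
  finally show "omv n (bact g c) (bact g r) = omv n c r" .
qed

end

section \<open>The brackets expressed by sums over all transpositions\<close>

context cherednik_data
begin

interpretation VU: module K VU by (rule vec_module)

lemma Pmod_ops: "x \<oplus>\<^bsub>P\<^esub> y = x \<oplus>\<^bsub>VU\<^esub> y" "a \<odot>\<^bsub>P\<^esub> x = a \<odot>\<^bsub>VU\<^esub> x" "\<zero>\<^bsub>P\<^esub> = \<zero>\<^bsub>VU\<^esub>"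
  by (simp_all add: Pmod_def vec_simps)

lemma P_VU: "x \<in> carrier P \<Longrightarrow> x \<in> carrier VU"
  unfolding Pmod_def by (erule vec_mono) simp

lemma PX_lin: "i < n \<Longrightarrow> v \<in> carrier P \<Longrightarrow> PX K n i v = lin K VU (\<lambda>b. ve K (mult_x_map (Tns (Gen (Xv i)) b))) v"
  unfolding PX_def Pmod_def by (rule lin_vec_irrel) (auto intro!: ve_carrier mult_x_PB)

lemma PY_lin: "i < n \<Longrightarrow> v \<in> carrier P \<Longrightarrow> PY K n t k i v = lin K VU (PYcol K n t k i) v"
  unfolding PY_def Pmod_def by (rule lin_vec_irrel) (use PYcol_P P_VU in \<open>auto simp: Pmod_def\<close>)

lemma P_minus: "x \<in> carrier P \<Longrightarrow> y \<in> carrier P \<Longrightarrow> x \<ominus>\<^bsub>P\<^esub> y = x \<ominus>\<^bsub>VU\<^esub> y"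
proof -
  assume x: "x \<in> carrier P" "y \<in> carrier P"
  have "x \<ominus>\<^bsub>P\<^esub> y = x \<oplus>\<^bsub>P\<^esub> (\<ominus> \<one>) \<odot>\<^bsub>P\<^esub> y" using x by (simp add: a_minus_def PP.smult_l_minus)
  also have "\<dots> = x \<ominus>\<^bsub>VU\<^esub> y" using P_VU x by (simp add: Pmod_ops a_minus_def VU.smult_l_minus)
  finally show ?thesis .
qed

lemma P_finsum: "f \<in> J \<rightarrow> carrier P \<Longrightarrow> finsum P f J = finsum VU f J"
  unfolding Pmod_def by (rule ext) (subst (1 2) vec_finsum; auto intro: vec_mono)

text \<open>The right-hand side of the categorical commutation relation, evaluated on
  \<open>y\<^sub>i \<otimes> x\<^sub>j \<otimes> c\<close>: the two sums come from \<open>\<Omega>\<^sup>3\<close> and \<open>\<Omega>\<^sup>1\<^sup>,\<^sup>3\<close>.\<close>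

lemma bracket_omega:
  assumes i: "i < n" "j < n" and c: "c \<in> PB n"
  shows "PK K n t k i j (ve K c) = (if i = j then t \<odot>\<^bsub>VU\<^esub> ve K c else \<zero>\<^bsub>VU\<^esub>) \<ominus>\<^bsub>VU\<^esub>
    k \<odot>\<^bsub>VU\<^esub> (finsum VU (\<lambda>x. if i = j then ve K (bact (transpose (fst x) (snd x)) c) else \<zero>\<^bsub>VU\<^esub>) (prs n)
      \<ominus>\<^bsub>VU\<^esub> finsum VU (\<lambda>x. if transpose (fst x) (snd x) i = j then ve K (bact (transpose (fst x) (snd x)) c) else \<zero>\<^bsub>VU\<^esub>) (prs n))"
proof (cases "i = j")
  case True
  let ?f = "\<lambda>x. ve K (bact (transpose (fst x) (snd x)) c)"
  \<comment> \<open>For i = j the transpositions that fix i occur in both sums and cancel. Those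
    that move i remain; they are listed by their other index, which recovers the sum in the diagonal
    bracket.\<close>
  let ?A = "{x\<in>prs n. transpose (fst x) (snd x) i = i}" and ?B = "{x\<in>prs n. transpose (fst x) (snd x) i \<noteq> i}"
  have fin: "finite ?A" "finite ?B" using prs_fin by auto
  have f: "?f \<in> Q \<rightarrow> carrier VU" for Q by (simp add: ve_VU)
  have cl: "finsum VU ?f Q \<in> carrier VU" for Q by (rule VU.M.finsum_closed[OF f])
  have u: "prs n = ?A \<union> ?B" by auto
  have 1: "finsum VU ?f (prs n) = finsum VU ?f ?A \<oplus>\<^bsub>VU\<^esub> finsum VU ?f ?B"
    by (subst u) (rule VU.M.finsum_Un_disjoint[OF fin]; auto simp: ve_VU)
  have 2: "finsum VU (\<lambda>x. if transpose (fst x) (snd x) i = i then ?f x else \<zero>\<^bsub>VU\<^esub>) (prs n) = finsum VU ?f ?A"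
    by (rule VU.M.add.finprod_mono_neutral_cong_right[OF prs_fin]) (auto simp: ve_VU)
  let ?h = "\<lambda>s. if i < s then (i, s) else (s, i)"
  have B: "?B = ?h ` ({..<n} - {i})"
  proof (rule subset_antisym; rule subsetI)
    fix x assume "x \<in> ?B"
    then obtain a b where x: "x = (a, b)" "a < b" "b < n" "i = a \<or> i = b" by (cases x) (auto simp: prs_def transpose_def split: if_splits)
    thus "x \<in> ?h ` ({..<n} - {i})" by (auto intro: image_eqI[of _ _ b] image_eqI[of _ _ a])
  next
    fix x assume "x \<in> ?h ` ({..<n} - {i})"
    thus "x \<in> ?B" by (rule imageE) (use i(1) in \<open>auto simp: prs_def transpose_def split: if_splits\<close>)
  qed
  have 3: "finsum VU ?f ?B = finsum VU (\<lambda>s. ve K (bact (transpose i s) c)) ({..<n} - {i})"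
  proof -
    have "finsum VU ?f ?B = finsum VU (\<lambda>s. ?f (?h s)) ({..<n} - {i})"
      unfolding B by (rule VU.M.add.finprod_reindex) (auto simp: inj_on_def ve_VU split: if_splits)
    also have "\<dots> = finsum VU (\<lambda>s. ve K (bact (transpose i s) c)) ({..<n} - {i})"
      by (rule VU.M.finsum_cong') (auto simp: ve_VU transpose_commute)
    finally show ?thesis .
  qed
  have g: "(\<lambda>s. PG K n (transpose i s) (ve K c)) \<in> {..<n} - {i} \<rightarrow> carrier P"
    using i klinD(1)[OF PG_klin[OF permutes_transpose] ve_P[OF c]] by auto
  have "finsum P (\<lambda>s. PG K n (transpose i s) (ve K c)) ({..<n} - {i}) = finsum VU (\<lambda>s. ve K (bact (transpose i s) c)) ({..<n} - {i})"
    unfolding P_finsum[OF g] by (rule VU.M.finsum_cong') (use i c in \<open>auto simp: PG_ve permutes_transpose ve_VU\<close>)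
  hence "PK K n t k i j (ve K c) = t \<odot>\<^bsub>VU\<^esub> ve K c \<ominus>\<^bsub>VU\<^esub> k \<odot>\<^bsub>VU\<^esub> finsum VU ?f ?B"
    unfolding 3 True[symmetric] using ve_P[OF c] t k PP.M.finsum_closed[OF g] by (simp add: PK_def S.bracket_def P_minus Pmod_ops(2)[symmetric])
  moreover have "finsum VU ?f ?A \<oplus>\<^bsub>VU\<^esub> finsum VU ?f ?B \<ominus>\<^bsub>VU\<^esub> finsum VU ?f ?A = finsum VU ?f ?B"
    by (rule VU.M.ag_cancel3[OF cl cl])
  ultimately show ?thesis using True 1 2 by simp
next
  case False
  let ?f = "\<lambda>x. ve K (bact (transpose (fst x) (snd x)) c)"
  \<comment> \<open>For distinct i and j the first sum vanishes, and only the transposition of i and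
    j contributes to the second. The two minus signs give the coefficient +k.\<close>
  let ?x = "if i < j then (i, j) else (j, i)"
  have e: "transpose (fst x) (snd x) i = j \<longleftrightarrow> ?x = x" if "x \<in> prs n" for x
    using that False by (cases x) (auto simp: prs_def transpose_def)
  have "finsum VU (\<lambda>x. if transpose (fst x) (snd x) i = j then ?f x else \<zero>\<^bsub>VU\<^esub>) (prs n) = finsum VU (\<lambda>x. if ?x = x then ?f x else \<zero>\<^bsub>VU\<^esub>) (prs n)"
    by (rule VU.M.finsum_cong') (auto simp: e ve_VU)
  also have "\<dots> = ?f ?x" by (rule VU.M.add.finprod_singleton[OF _ prs_fin]) (use i False in \<open>auto simp: prs_def ve_VU\<close>)
  also have "\<dots> = ve K (bact (transpose i j) c)" by (simp add: transpose_commute)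
  finally have 1: "finsum VU (\<lambda>x. if transpose (fst x) (snd x) i = j then ?f x else \<zero>\<^bsub>VU\<^esub>) (prs n) = ve K (bact (transpose i j) c)" .
  have 2: "finsum VU (\<lambda>x. if i = j then ?f x else \<zero>\<^bsub>VU\<^esub>) (prs n) = \<zero>\<^bsub>VU\<^esub>" using False by simp
  have "PK K n t k i j (ve K c) = k \<odot>\<^bsub>VU\<^esub> ve K (bact (transpose i j) c)"
    using False i c by (simp add: PK_def S.bracket_def PG_ve permutes_transpose Pmod_ops)
  thus ?thesis using False k unfolding 1 2
    by (simp add: a_minus_def ve_VU VU.smult_r_minus)
qed

end

lemma (in coeff_ring) lin_fsum_ve:
  assumes "\<And>c. B c \<in> carrier VU"
  shows "lin K VU B (finsum VU (\<lambda>x. ve K (d x)) J) = finsum VU (\<lambda>x. B (d x)) J"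
  using klin_finsum[OF vec_module vec_module lin_VU[of B], of "\<lambda>x. ve K (d x)" J] assms
  by (simp add: ve_VU lin_ve[OF vec_module])

lemma (in coeff_ring) tens_VU:
  assumes "\<And>c. A c \<in> carrier VU" "\<And>c. B c \<in> carrier VU"
  shows "tens K A B c \<in> carrier VU"
proof (cases c)
  case (Tns u v) thus ?thesis using vec_mono[OF tens_vec[OF assms]] by simp
next
  case (Gen z)
  have "tens K A B (Gen z) r = \<zero>" for r by (cases r) (simp_all add: tens_def)
  thus ?thesis using Gen by (simp add: vec_carrier)
next
  case Unt
  have "tens K A B Unt r = \<zero>" for r by (cases r) (simp_all add: tens_def)
  thus ?thesis using Unt by (simp add: vec_carrier)
next
  case (Mon a)
  have "tens K A B (Mon a) r = \<zero>" for r by (cases r) (simp_all add: tens_def)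
  thus ?thesis using Mon by (simp add: vec_carrier)
qed

lemma (in coeff_ring) ccomp_VU: "A c \<in> carrier VU \<Longrightarrow> (\<And>d. B d \<in> carrier VU) \<Longrightarrow> ccomp K B A c \<in> carrier VU"
  by (rule ccomp_vec)

locale ultra_setting_params = ultra_setting_units F K m \<psi> t k for F :: "nat filter" and K :: "nat \<Rightarrow> 'k ring" and m \<psi> t k +
  fixes ts ks :: "nat \<Rightarrow> 'k"
  assumes ts: "ts \<in> PiK" "\<psi> (ucar ts) = t" and ks: "ks \<in> PiK" "\<psi> (ucar ks) = k"
begin

lemma chr: "cherednik_data (K n) (ts n) (ks n)"
  unfolding cherednik_data_def cherednik_data_axioms_def using K ts ks by auto

section \<open>Structure morphisms between ind-objects as column families\<close>

abbreviation "V1 S \<equiv> ind_tno C (pr S) MM"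
abbreviation "D1 S \<equiv> (\<lambda>L. tS S (DM L))"
abbreviation "V2 S S' \<equiv> ind_tno C (pr S) (V1 S')"
abbreviation "D2 S S' \<equiv> (\<lambda>L. tS S (tS S' (DM L)))"

definition "ob S \<longleftrightarrow> stab S \<and> pr S \<in> OB"

lemma obs_H: "ob HX" "ob HY" "ob UT" using stab_H OB_HX OB_HY OB_UT by (auto simp: ob_def)
lemma ob_tS: "ob S \<Longrightarrow> ob S' \<Longrightarrow> ob (tS S S')" using stab_tS OB_tensor by (auto simp: ob_def)

lemma tw1: "ob S \<Longrightarrow> is_tower (V1 S) (D1 S)" by (rule is_tower_tno[OF is_tower_M]) (auto simp: ob_def)
lemma tw2: "ob S \<Longrightarrow> ob S' \<Longrightarrow> is_tower (V2 S S') (D2 S S')" by (rule is_tower_tno[OF tw1]) (auto simp: ob_def)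

lemma tS_cases: assumes "c \<in> tS S S' n" obtains u v where "c = Tns u v" "u \<in> S n" "v \<in> S' n"
  using assms unfolding tS_def by (rule tset_cases)

lemma tS_iff: "Tns u v \<in> tS S S' n \<longleftrightarrow> u \<in> S n \<and> v \<in> S' n" by (simp add: tS_def tset_iff)

lemma g_swap: "good (tS S S') (tS S' S) (mapf swap_map)" by (rule good_mapf) (auto elim!: tS_cases simp: tS_iff)
lemma g_asc: "good (tS (tS S S') S'') (tS S (tS S' S'')) (mapf assoc_map)" by (rule good_mapf) (auto elim!: tS_cases simp: tS_iff)
lemma g_asci: "good (tS S (tS S' S'')) (tS (tS S S') S'') (mapf assoc_inv_map)" by (rule good_mapf) (auto elim!: tS_cases simp: tS_iff)
lemma g_lun: "good (tS UT S) S (mapf lunit_map)" by (rule good_mapf) (auto elim!: tS_cases simp: tS_iff UT_def)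

lemma ind_asc_mk_indmor:
  assumes "ob S" "ob S'"
  shows "ind_asc C (pr S) (pr S') MM = mk_indmor (V1 (tS S S')) (D1 (tS S S')) (V2 S S') (D2 S S') (mapf assoc_map)"
    "admissible (D1 (tS S S')) (D2 S S') (mapf assoc_map)"
proof -
  note l = ind_lev_mk_indmor[OF tw1[OF ob_tS[OF assms]] tw2[OF assms], of "\<lambda>i. asc C (pr S) (pr S') (lev MM i)" "mapf assoc_map"]
  show "ind_asc C (pr S) (pr S') MM = mk_indmor (V1 (tS S S')) (D1 (tS S S')) (V2 S S') (D2 S S') (mapf assoc_map)"
    using l(1) by (simp add: ind_asc_def C_sel UC_pr is_towerD(6)[OF is_tower_M] g_asc)
  show "admissible (D1 (tS S S')) (D2 S S') (mapf assoc_map)"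
    using l(2) by (simp add: C_sel UC_pr is_towerD(6)[OF is_tower_M] g_asc)
qed

lemma ind_asci_mk_indmor:
  assumes "ob S" "ob S'"
  shows "ind_asci C (pr S) (pr S') MM = mk_indmor (V2 S S') (D2 S S') (V1 (tS S S')) (D1 (tS S S')) (mapf assoc_inv_map)"
    "admissible (D2 S S') (D1 (tS S S')) (mapf assoc_inv_map)"
proof -
  note l = ind_lev_mk_indmor[OF tw2[OF assms] tw1[OF ob_tS[OF assms]], of "\<lambda>i. asci C (pr S) (pr S') (lev MM i)" "mapf assoc_inv_map"]
  show "ind_asci C (pr S) (pr S') MM = mk_indmor (V2 S S') (D2 S S') (V1 (tS S S')) (D1 (tS S S')) (mapf assoc_inv_map)"
    using l(1) by (simp add: ind_asci_def C_sel UC_pr is_towerD(6)[OF is_tower_M] g_asci)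
  show "admissible (D2 S S') (D1 (tS S S')) (mapf assoc_inv_map)"
    using l(2) by (simp add: C_sel UC_pr is_towerD(6)[OF is_tower_M] g_asci)
qed

lemma ind_tna_id_mk_indmor:
  assumes S: "ob S" "ob S'" and A: "good S S' A"
  shows "cm S S' A \<boxtimes>\<^bsub>C\<^esub> ind_id C MM = mk_indmor (V1 S) (D1 S) (V1 S') (D1 S') (tn A vee)" "admissible (D1 S) (D1 S') (tn A vee)"
proof -
  have s: "stab S" "pr S \<in> OB" "stab S'" "pr S' \<in> OB" using S by (auto simp: ob_def)
  note i = ind_tna_mk_indmor[OF is_tower_M is_tower_M s A ind_id_mk_indmor(2)[OF is_tower_M]]
  show "cm S S' A \<boxtimes>\<^bsub>C\<^esub> ind_id C MM = mk_indmor (V1 S) (D1 S) (V1 S') (D1 S') (tn A vee)" "admissible (D1 S) (D1 S') (tn A vee)"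
    unfolding ind_id_mk_indmor(1)[OF is_tower_M] by (rule i)+
qed

lemma ind_swp_mk_indmor:
  assumes S: "ob S" "ob S'"
  shows "swp C (pr S) (pr S') \<boxtimes>\<^bsub>C\<^esub> ind_id C MM = mk_indmor (V1 (tS S S')) (D1 (tS S S')) (V1 (tS S' S)) (D1 (tS S' S)) (tn (mapf swap_map) vee)"
    "admissible (D1 (tS S S')) (D1 (tS S' S)) (tn (mapf swap_map) vee)"
  using ind_tna_id_mk_indmor[OF ob_tS[OF S] ob_tS[OF S(2,1)] g_swap] by (simp_all add: C_sel UC_pr)

lemma idn_tna_mk_indmor:
  assumes S: "ob S" "ob S'" and N: "is_tower N E" and Q: "is_tower Q G" and T: "admissible E G T"
  shows "idn C (pr S) \<boxtimes>\<^bsub>C\<^esub> mk_indmor N E Q G T = mk_indmor (ind_tno C (pr S) N) (\<lambda>L. tS S (E L)) (ind_tno C (pr S) Q) (\<lambda>L. tS S (G L)) (tn vee T)"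
    "admissible (\<lambda>L. tS S (E L)) (\<lambda>L. tS S (G L)) (tn vee T)"
proof -
  have s: "stab S" "pr S \<in> OB" using S by (auto simp: ob_def)
  note i = ind_tna_mk_indmor[OF N Q s s good_vee T]
  show "idn C (pr S) \<boxtimes>\<^bsub>C\<^esub> mk_indmor N E Q G T = mk_indmor (ind_tno C (pr S) N) (\<lambda>L. tS S (E L)) (ind_tno C (pr S) Q) (\<lambda>L. tS S (G L)) (tn vee T)"
    using i(1) by (simp add: C_sel UC_pr)
  show "admissible (\<lambda>L. tS S (E L)) (\<lambda>L. tS S (G L)) (tn vee T)" using i(2) by simp
qed

lemma g_ev: "good (tS HY HX) UT evf"
  unfolding good_def
proof
  fix n interpret coeff_ring "K n" by (rule K)
  show "pgood (K n) (m n) (tS HY HX n) (UT n) (evf n)"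
    unfolding pgood_def
  proof (intro ballI conjI allI impI)
    fix c assume "c \<in> tS HY HX n"
    then obtain i j where c: "c = Tns (Gen (Yv i)) (Gen (Xv j))" "i < m n" "j < m n" by (auto elim!: tS_cases simp: HX_def HY_def)
    have "{u. evf n c u \<noteq> \<zero>\<^bsub>K n\<^esub>} \<subseteq> {Unt}" by (auto simp: evf_def)
    thus "evf n c \<in> carrier (vec (K n) (UT n))" using finite_subset[of _ "{Unt}"] by (auto simp: vec_carrier UT_def evf_def)
    fix g r assume g: "g permutes {..<m n}"
    have "g i = g j \<longleftrightarrow> i = j" using permutes_inj[OF g] by (auto dest: injD)
    moreover have "bact g r = Unt \<longleftrightarrow> r = Unt" by (cases r) auto
    ultimately show "evf n (bact g c) (bact g r) = evf n c r" using c permutes_gi[OF g] by (auto simp: evf_def)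
  qed
qed

definition "evT = kcmp (mapf lunit_map) (tn evf vee)"

lemma ind_ev_mk_indmor:
  "ind_lun C MM \<star>\<^bsub>C\<^esub> (evm C \<boxtimes>\<^bsub>C\<^esub> ind_id C MM) = mk_indmor (V1 (tS HY HX)) (D1 (tS HY HX)) MM DM evT" "admissible (D1 (tS HY HX)) DM evT"
proof -
  have l: "ind_lun C MM = mk_indmor (V1 UT) (D1 UT) MM DM (mapf lunit_map)" "admissible (D1 UT) DM (mapf lunit_map)"
  proof -
    note l = ind_lev_mk_indmor[OF tw1[OF obs_H(3)] is_tower_M, of "\<lambda>i. lun C (lev MM i)" "mapf lunit_map"]
    show "ind_lun C MM = mk_indmor (V1 UT) (D1 UT) MM DM (mapf lunit_map)"
      using l(1) by (simp add: ind_lun_def C_sel UC_pr is_towerD(6)[OF is_tower_M] g_lun)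
    show "admissible (D1 UT) DM (mapf lunit_map)"
      using l(2) by (simp add: C_sel UC_pr is_towerD(6)[OF is_tower_M] g_lun)
  qed
  have H: "ob (tS HY HX)" by (intro ob_tS obs_H)
  note e = ind_tna_id_mk_indmor[OF H obs_H(3) g_ev]
  show "ind_lun C MM \<star>\<^bsub>C\<^esub> (evm C \<boxtimes>\<^bsub>C\<^esub> ind_id C MM) = mk_indmor (V1 (tS HY HX)) (D1 (tS HY HX)) MM DM evT"
    unfolding evT_def l(1) C_ev e(1) by (rule ind_cmp_mk_indmor[OF tw1[OF H] tw1[OF obs_H(3)] is_tower_M e(2) l(2)])
  show "admissible (D1 (tS HY HX)) DM evT" unfolding evT_def by (rule admissible_cmp[OF tw1[OF H] tw1[OF obs_H(3)] e(2) l(2)])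
qed

lemma omf_omv: "omf n = coeff_ring.omv (K n) (m n)"
  using coeff_ring.omv_eval[OF K] by (simp add: omf_def fun_eq_iff)

lemma g_omf: "stab S \<Longrightarrow> good S S omf"
  by (simp add: good_def omf_omv coeff_ring.omv_good[OF K] stab_def)

lemma ind_omg_mk_indmor: assumes M: "is_tower M D" shows "ind_omg C M = mk_indmor M D M D omf" "admissible D D omf"
proof -
  note l = ind_lev_mk_indmor[OF M M, of "\<lambda>i. omg C (lev M i)" omf]
  show "ind_omg C M = mk_indmor M D M D omf" using l(1) by (simp add: ind_omg_def is_towerD(6)[OF M] C_omg g_omf[OF is_towerD(1)[OF M]])
  show "admissible D D omf" using l(2) by (simp add: is_towerD(6)[OF M] C_omg g_omf[OF is_towerD(1)[OF M]])
qed

lemma omega3_mk_indmor: "omega3 C MM = mk_indmor (V1 (tS HY HX)) (D1 (tS HY HX)) (V1 (tS HY HX)) (D1 (tS HY HX)) (tn vee omf)"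
  "admissible (D1 (tS HY HX)) (D1 (tS HY HX)) (tn vee omf)"
proof -
  have H: "ob (tS HY HX)" by (intro ob_tS obs_H)
  note i = idn_tna_mk_indmor[OF H H is_tower_M is_tower_M ind_omg_mk_indmor(2)[OF is_tower_M]]
  show "omega3 C MM = mk_indmor (V1 (tS HY HX)) (D1 (tS HY HX)) (V1 (tS HY HX)) (D1 (tS HY HX)) (tn vee omf)"
    using i(1) by (simp add: omega3_def ind_omg_mk_indmor(1)[OF is_tower_M] C_sel UC_pr)
  show "admissible (D1 (tS HY HX)) (D1 (tS HY HX)) (tn vee omf)" by (rule i(2))
qed

definition "om13 = kcmp (tn (mapf swap_map) vee) (kcmp (mapf assoc_inv_map) (kcmp (tn vee omf) (kcmp (mapf assoc_map) (tn (mapf swap_map) vee))))"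

lemma omega13_mk_indmor: "omega13 C MM = mk_indmor (V1 (tS HY HX)) (D1 (tS HY HX)) (V1 (tS HY HX)) (D1 (tS HY HX)) om13"
  "admissible (D1 (tS HY HX)) (D1 (tS HY HX)) om13"
proof -
  note H = obs_H(2,1)
  note YX = ob_tS[OF H] and XY = ob_tS[OF H(2,1)]
  note s1 = ind_swp_mk_indmor[OF H] and a1 = ind_asc_mk_indmor[OF H(2,1)] and o1 = idn_tna_mk_indmor[OF H(2,2) tw1[OF H(1)] tw1[OF H(1)] ind_omg_mk_indmor(2)[OF tw1[OF H(1)]]]
    and a2 = ind_asci_mk_indmor[OF H(2,1)] and s2 = ind_swp_mk_indmor[OF H(2,1)]
  note t1 = tw1[OF YX] and t2 = tw1[OF XY] and t3 = tw2[OF H(2,1)]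
  note c1 = ind_cmp_mk_indmor[OF t1 t2 t3 s1(2) a1(2)] admissible_cmp[OF t1 t2 s1(2) a1(2)]
  note c2 = ind_cmp_mk_indmor[OF t1 t3 t3 c1(2) o1(2)] admissible_cmp[OF t1 t3 c1(2) o1(2)]
  note c3 = ind_cmp_mk_indmor[OF t1 t3 t2 c2(2) a2(2)] admissible_cmp[OF t1 t3 c2(2) a2(2)]
  note c4 = ind_cmp_mk_indmor[OF t1 t2 t1 c3(2) s2(2)] admissible_cmp[OF t1 t2 c3(2) s2(2)]
  show "omega13 C MM = mk_indmor (V1 (tS HY HX)) (D1 (tS HY HX)) (V1 (tS HY HX)) (D1 (tS HY HX)) om13"
    unfolding om13_def omega13_def Let_def C_sel(17,18) ind_omg_mk_indmor(1)[OF tw1[OF H(1)]]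
    unfolding s1(1) a1(1) o1(1) a2(1) s2(1) c1(1) c2(1) c3(1) c4(1) ..
  show "admissible (D1 (tS HY HX)) (D1 (tS HY HX)) om13" unfolding om13_def by (rule c4(2))
qed

lemma mns_mk_indmor:
  assumes M: "is_tower M D" and N: "is_tower N E" and A: "admissible D E A" and B: "admissible D E B"
  shows "mk_indmor M D N E A \<boxminus>\<^bsub>C\<^esub> mk_indmor M D N E B = mk_indmor M D N E (addf A (sclf (sq (- 1)) B))" "admissible D E (addf A (sclf (sq (- 1)) B))"
  unfolding ind_mns_def ind_scl_mk_indmor[OF M N B sq]
  by (rule ind_pls_mk_indmor[OF M N A admissible_scl[OF B sq(1)]] admissible_add[OF N A admissible_scl[OF B sq(1)]])+

definition "XT = mapf mult_x_map"

lemma g_XT: "good (D1 HX L) (DM (Suc L)) XT"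
  unfolding XT_def
proof (rule good_mapf)
  fix n c assume "c \<in> D1 HX L n"
  then obtain i d where d: "c = Tns (Gen (Xv i)) d" "i < m n" "d \<in> PBL (m n) L"
    by (auto elim!: tS_cases simp: HX_def DM_def)
  obtain a b where "d = pm a b" using d(3) by (rule PBL_cases)
  note c = d[unfolded this]
  show "mult_x_map c \<in> DM (Suc L) n" using c by (simp add: DM_def pm_def[of a b] ) (simp add: pm_def[symmetric] pm_PBL)
  fix g show "mult_x_map (bact g c) = bact g (mult_x_map c)" by (simp add: c(1) pm_def)
qed

lemma mult_x_mk_indmor: "mult_x F K m C (unt C) = mk_indmor (V1 HX) (D1 HX) MM DM XT" "admissible (D1 HX) DM XT"
proof -
  have u: "ucls F (\<lambda>n. rep_cat (K n) (m n)) (\<lambda>n. map_mor (K n) (tno C (hdob C) (lev MM L) n) (lev MM (Suc L) n) mult_x_map) = cm (D1 HX L) (DM (Suc L)) XT" for L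
  proof -
    have "(\<lambda>n. map_mor (K n) (tno C (hdob C) (lev MM L) n) (lev MM (Suc L) n) mult_x_map) = rmm (D1 HX L) (DM (Suc L)) XT"
      by (simp add: C_sel UC_pr is_towerD(6)[OF is_tower_M] rmm_def) (simp add: pr_def map_mor_pmor XT_def mapf_def)
    thus ?thesis using ucls_rmm by (simp add: RC_def)
  qed
  note i = ind_mk_mk_indmor[OF tw1[OF obs_H(1)] is_tower_M, of "\<lambda>L. {(Suc L, cm (D1 HX L) (DM (Suc L)) XT)}" XT]
  have x: "\<exists>j A. x = (j, cm (D1 HX L) (DM j) A) \<and> good (D1 HX L) (DM j) A \<and> ae (D1 HX L) A XT"
    if "x \<in> {(Suc L, cm (D1 HX L) (DM (Suc L)) XT)}" for L x using that g_XT ae_refl by blast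
  show "mult_x F K m C (unt C) = mk_indmor (V1 HX) (D1 HX) MM DM XT"
    unfolding mult_x_def Let_def MM_def[symmetric] u using i(1)[OF x] by (simp add: C_sel(18))
  show "admissible (D1 HX) DM XT" using i(2)[OF x] by simp
qed

end

lemma (in coeff_ring) lin_ve_inj:
  assumes i: "inj \<phi>" and v: "v \<in> carrier VU"
  shows "lin K VU (\<lambda>c. ve K (\<phi> c)) v (\<phi> r) = v r"
proof -
  have T: "finite {b. v b \<noteq> \<zero>}" "\<And>b. v b \<in> carrier K" using v by (auto simp: vec_carrier)
  have "lin K VU (\<lambda>c. ve K (\<phi> c)) v (\<phi> r) = (\<Oplus>b\<in>{b. v b \<noteq> \<zero>}. v b \<otimes> ve K (\<phi> b) (\<phi> r))"
    by (rule lin_vec[OF T(1)]) (auto simp: T(2) ve_VU)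
  also have "\<dots> = (\<Oplus>b\<in>{b. v b \<noteq> \<zero>}. if r = b then v b else \<zero>)"
    by (rule finsum_cong') (use T in \<open>auto simp: ve_def inj_eq[OF i]\<close>)
  also have "\<dots> = v r"
  proof (cases "v r = \<zero>")
    case True
    hence "(\<Oplus>b\<in>{b. v b \<noteq> \<zero>}. if r = b then v b else \<zero>) = (\<Oplus>b\<in>{b. v b \<noteq> \<zero>}. \<zero>)" by (intro finsum_cong') auto
    thus ?thesis using True by simp
  next
    case False thus ?thesis using T by (intro add.finprod_singleton) auto
  qed
  finally show ?thesis .
qed

lemma (in cherednik_data) PG_eval:
  assumes g: "g permutes {..<n}" and v: "v \<in> carrier P"
  shows "PG K n g v (bact g r) = v r"
proof -
  have "PG K n g v = lin K VU (\<lambda>c. ve K (bact g c)) v" unfolding PG_def Pmod_def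
    by (rule lin_vec_irrel) (use v bact_PB[OF g] in \<open>auto simp: Pmod_def intro!: ve_carrier\<close>)
  thus ?thesis using lin_ve_inj[of "bact g" v r] bact_inj[OF g] P_VU[OF v] by (simp add: inj_def)
qed

lemma (in cherednik_data) PYcol_equiv:
  assumes g: "g permutes {..<n}" and i: "i < n" and c: "c \<in> PB n"
  shows "PYcol K n t k (g i) (bact g c) (bact g r) = PYcol K n t k i c r"
proof -
  have "PYcol K n t k (g i) (bact g c) = PG K n g (PYcol K n t k i c)"
    using PGY[OF g i ve_P[OF c]] permutes_gi[OF g i] bact_PB[OF g c] i c by (simp add: PY_ve PG_ve[OF g])
  thus ?thesis using PG_eval[OF g PYcol_P[OF i c]] by simp
qed

lemma (in abelian_group) ag_move:
  assumes "a \<in> carrier G" "b \<in> carrier G" "c \<in> carrier G"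
  shows "a \<ominus> b = c \<longleftrightarrow> a = b \<oplus> c"
proof
  assume "a \<ominus> b = c"
  hence "b \<oplus> c = b \<oplus> (a \<oplus> \<ominus> b)" by (simp add: a_minus_def)
  also have "\<dots> = a \<oplus> (b \<oplus> \<ominus> b)" using assms by (simp only: a_ac a_closed a_inv_closed)
  finally show "a = b \<oplus> c" using assms by (simp add: r_neg)
qed (use assms ag_cancel3 in auto)

section \<open>Both sides of the commutation relation on basis vectors\<close>

context ultra_setting_params
begin

abbreviation "VK n \<equiv> vec (K n) (UNIV :: bvec set)"
abbreviation "PK' n \<equiv> Pmod (K n) (m n)"
abbreviation "yy i \<equiv> Gen (Yv i)"
abbreviation "xx i \<equiv> Gen (Xv i)"
abbreviation "mx i p \<equiv> mult_x_map (Tns (xx i) p)"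

lemma VK_module: "module (K n) (VK n)" by (rule coeff_ring.vec_module[OF K])

lemma kcmp_ve: "A n c = ve (K n) d \<Longrightarrow> B n d \<in> carrier (VK n) \<Longrightarrow> kcmp B A n c = B n d"
  unfolding kcmp_def by (rule coeff_ring.ccomp_ve[OF K])

lemma kcmp_lin: "kcmp B A n c = lin (K n) (VK n) (B n) (A n c)"
  by (simp add: kcmp_def ccomp_def)

lemma tn_vee: "T n v \<in> carrier (VK n) \<Longrightarrow> tn vee T n (Tns u v) = lin (K n) (VK n) (\<lambda>b. ve (K n) (Tns u b)) (T n v)"
  unfolding tn_def vee_def by (rule coeff_ring.tens_ve_col[OF K])

lemma ve_VK: "ve (K n) c \<in> carrier (VK n)" by (rule coeff_ring.ve_VU[OF K])

lemma lin_ve_VK: "B d \<in> carrier (VK n) \<Longrightarrow> lin (K n) (VK n) B (ve (K n) d) = B d"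
  by (rule coeff_ring.lin_ve[OF K VK_module])

lemma tn_vee_ve: "T n v = ve (K n) d \<Longrightarrow> tn vee T n (Tns u v) = ve (K n) (Tns u d)"
  using tn_vee[of T n v u] by (simp add: ve_VK lin_ve_VK)

lemma mapf_VK: "mapf \<phi> n c \<in> carrier (VK n)" by (simp add: mapf_def ve_VK)
lemma vee_VK: "vee n c \<in> carrier (VK n)" by (simp add: vee_def ve_VK)
lemma omf_VK: "omf n c \<in> carrier (VK n)" by (simp add: omf_omv coeff_ring.omv_VU[OF K])
lemma tn_VK: "(\<And>c. A n c \<in> carrier (VK n)) \<Longrightarrow> (\<And>c. B n c \<in> carrier (VK n)) \<Longrightarrow> tn A B n c \<in> carrier (VK n)"
  unfolding tn_def by (rule coeff_ring.tens_VU[OF K])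
lemma kcmp_VK: "A n c \<in> carrier (VK n) \<Longrightarrow> (\<And>c. B n c \<in> carrier (VK n)) \<Longrightarrow> kcmp B A n c \<in> carrier (VK n)"
  unfolding kcmp_def by (rule coeff_ring.ccomp_VU[OF K])

lemma evf_VK: "evf n c \<in> carrier (VK n)"
proof -
  interpret coeff_ring "K n" by (rule K)
  have "{u. evf n c u \<noteq> \<zero>\<^bsub>K n\<^esub>} \<subseteq> {Unt}" by (auto simp: evf_def)
  thus ?thesis using finite_subset[of _ "{Unt}"] by (auto simp: vec_carrier evf_def)
qed

lemma evT_VK: "evT n c \<in> carrier (VK n)"
  unfolding evT_def by (intro kcmp_VK tn_VK evf_VK vee_VK mapf_VK)

lemma tn_swap: "tn (mapf \<phi>) vee n (Tns u v) = ve (K n) (Tns (\<phi> u) v)"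
  unfolding tn_def mapf_def vee_def by (rule coeff_ring.tens_map_ve[OF K])

lemma evT_eval:
  assumes i: "i < m n"
  shows "evT n (Tns (Tns (yy i) (xx j)) p) = (if i = j then ve (K n) p else \<zero>\<^bsub>VK n\<^esub>)"
proof -
  interpret coeff_ring "K n" by (rule K)
  have 1: "tn evf vee n (Tns (Tns (yy i) (xx j)) p) r = (if i = j then ve (K n) (Tns Unt p) r else \<zero>\<^bsub>K n\<^esub>)" for r
    using i by (cases r) (auto simp: tn_def vee_def tens_Tns evf_def ve_def)
  show ?thesis
  proof (cases "i = j")
    case True
    have "tn evf vee n (Tns (Tns (yy i) (xx j)) p) = ve (K n) (Tns Unt p)" using 1 True by auto
    from kcmp_ve[of "tn evf vee" n _ _ "mapf lunit_map", OF this mapf_VK] show ?thesis using True by (simp add: evT_def mapf_def)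
  next
    case False
    have "tn evf vee n (Tns (Tns (yy i) (xx j)) p) = \<zero>\<^bsub>VK n\<^esub>" using 1 False by (auto simp: vec_simps)
    moreover have "lin (K n) (VK n) (mapf lunit_map n) \<zero>\<^bsub>VK n\<^esub> = \<zero>\<^bsub>VK n\<^esub>"
      by (rule klin_zero[OF VK_module VK_module lin_VU]) (rule mapf_VK)
    ultimately show ?thesis using False by (simp add: evT_def kcmp_lin)
  qed
qed

lemma lin_fsum: "(\<And>c. B c \<in> carrier (VK n)) \<Longrightarrow> lin (K n) (VK n) B (finsum (VK n) (\<lambda>x. ve (K n) (d x)) J) = finsum (VK n) (\<lambda>x. B (d x)) J"
  by (rule coeff_ring.lin_fsum_ve[OF K])

abbreviation "tau x \<equiv> transpose (fst x) (snd x)"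

lemma omf_fsum: "omf n c = finsum (VK n) (\<lambda>x. ve (K n) (bact (tau x) c)) (prs (m n))"
  by (simp add: omf_omv coeff_ring.omv_def[OF K])

lemma tn_omf: "tn vee omf n (Tns d p) = finsum (VK n) (\<lambda>x. ve (K n) (Tns d (bact (tau x) p))) (prs (m n))"
proof -
  have "tn vee omf n (Tns d p) = lin (K n) (VK n) (\<lambda>b. ve (K n) (Tns d b)) (omf n p)" by (rule tn_vee) (rule omf_VK)
  also have "\<dots> = finsum (VK n) (\<lambda>x. ve (K n) (Tns d (bact (tau x) p))) (prs (m n))"
    unfolding omf_fsum by (rule lin_fsum) (rule ve_VK)
  finally show ?thesis .
qed

text \<open>Swapping brings the factor x_j to the outside, and \<Omega> acts on the remaining
  product y_i \<otimes> p diagonally. Each transposition therefore moves i and p together and leaves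
  j alone.\<close>

lemma om13_eval: "om13 n (Tns (Tns (yy i) (xx j)) p) = finsum (VK n) (\<lambda>x. ve (K n) (Tns (Tns (yy (tau x i)) (xx j)) (bact (tau x) p))) (prs (m n))"
proof -
  have 1: "kcmp (mapf assoc_map) (tn (mapf swap_map) vee) n (Tns (Tns (yy i) (xx j)) p) = ve (K n) (Tns (xx j) (Tns (yy i) p))"
    using kcmp_ve[of "tn (mapf swap_map) vee" n "Tns (Tns (yy i) (xx j)) p" _ "mapf assoc_map", OF tn_swap] mapf_VK by (simp add: mapf_def)
  have 2: "kcmp (tn vee omf) (kcmp (mapf assoc_map) (tn (mapf swap_map) vee)) n (Tns (Tns (yy i) (xx j)) p) =
     finsum (VK n) (\<lambda>x. ve (K n) (Tns (xx j) (Tns (yy (tau x i)) (bact (tau x) p)))) (prs (m n))"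
    using kcmp_ve[of "kcmp (mapf assoc_map) (tn (mapf swap_map) vee)" n _ _ "tn vee omf", OF 1 tn_VK[of vee n omf, OF vee_VK omf_VK]] by (simp add: tn_omf)
  have 3: "kcmp (mapf assoc_inv_map) (kcmp (tn vee omf) (kcmp (mapf assoc_map) (tn (mapf swap_map) vee))) n (Tns (Tns (yy i) (xx j)) p) =
     finsum (VK n) (\<lambda>x. ve (K n) (Tns (Tns (xx j) (yy (tau x i))) (bact (tau x) p))) (prs (m n))"
    unfolding kcmp_lin[of "mapf assoc_inv_map"] 2 by (subst lin_fsum) (simp_all add: mapf_VK, simp add: mapf_def)
  show ?thesis unfolding om13_def kcmp_lin[of "tn (mapf swap_map) vee" "kcmp (mapf assoc_inv_map) _"] 3
    by (subst lin_fsum) (simp_all add: tn_VK mapf_VK vee_VK, simp add: tn_swap)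
qed

lemma addf_minus:
  assumes "sq (- 1) n = \<ominus>\<^bsub>K n\<^esub> \<one>\<^bsub>K n\<^esub>" "A n c \<in> carrier (VK n)" "B n c \<in> carrier (VK n)"
  shows "addf A (sclf (sq (- 1)) B) n c = A n c \<ominus>\<^bsub>VK n\<^esub> B n c"
proof -
  interpret V: module "K n" "VK n" by (rule VK_module)
  interpret coeff_ring "K n" by (rule K)
  have "addf A (sclf (sq (- 1)) B) n c = A n c \<oplus>\<^bsub>VK n\<^esub> (\<ominus>\<^bsub>K n\<^esub> \<one>\<^bsub>K n\<^esub>) \<odot>\<^bsub>VK n\<^esub> B n c"
    by (simp add: addf_def sclf_def assms(1) vec_simps)
  thus ?thesis using assms by (simp add: a_minus_def V.smult_l_minus)
qed

definition "relR = addf (sclf ts evT) (sclf (sq (- 1)) (sclf ks (kcmp evT (addf (tn vee omf) (sclf (sq (- 1)) om13)))))"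

lemma om13_VK: "om13 n c \<in> carrier (VK n)"
  unfolding om13_def by (intro kcmp_VK tn_VK mapf_VK vee_VK omf_VK)

lemma relR_eval:
  assumes s: "sq (- 1) n = \<ominus>\<^bsub>K n\<^esub> \<one>\<^bsub>K n\<^esub>" and i: "i < m n" "j < m n" and p: "p \<in> PB (m n)"
  shows "relR n (Tns (Tns (yy i) (xx j)) p) = PK (K n) (m n) (ts n) (ks n) i j (ve (K n) p)"
proof -
  interpret c: cherednik_data "K n" "m n" "ts n" "ks n" by (rule chr)
  interpret V: module "K n" "VK n" by (rule VK_module)
  let ?c = "Tns (Tns (yy i) (xx j)) p"
  let ?W = "addf (tn vee omf) (sclf (sq (- 1)) om13)"
  have W: "?W n ?c = tn vee omf n ?c \<ominus>\<^bsub>VK n\<^esub> om13 n ?c" by (rule addf_minus[OF s]) (intro tn_VK vee_VK omf_VK om13_VK)+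
  note kl = c.lin_VU[of "evT n", OF evT_VK]
  have f3: "lin (K n) (VK n) (evT n) (tn vee omf n ?c) = finsum (VK n) (\<lambda>x. if i = j then ve (K n) (bact (tau x) p) else \<zero>\<^bsub>VK n\<^esub>) (prs (m n))"
    unfolding tn_omf using i(1) by (subst lin_fsum) (simp_all add: evT_VK, simp add: evT_eval)
  have ti: "tau x i < m n" if "x \<in> prs (m n)" for x using that i by (auto simp: prs_def transpose_def)
  have f13: "lin (K n) (VK n) (evT n) (om13 n ?c) = finsum (VK n) (\<lambda>x. if tau x i = j then ve (K n) (bact (tau x) p) else \<zero>\<^bsub>VK n\<^esub>) (prs (m n))"
    unfolding om13_eval by (subst lin_fsum) (simp add: evT_VK, rule V.M.finsum_cong', auto simp: evT_eval ti ve_VK)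
  have k: "kcmp evT ?W n ?c = finsum (VK n) (\<lambda>x. if i = j then ve (K n) (bact (tau x) p) else \<zero>\<^bsub>VK n\<^esub>) (prs (m n)) \<ominus>\<^bsub>VK n\<^esub>
     finsum (VK n) (\<lambda>x. if tau x i = j then ve (K n) (bact (tau x) p) else \<zero>\<^bsub>VK n\<^esub>) (prs (m n))"
    unfolding kcmp_lin W using klin_minus[OF VK_module VK_module kl tn_VK[of vee n omf, OF vee_VK omf_VK] om13_VK] by (simp only: f3 f13)
  have sc: "sclf s T n d = s n \<odot>\<^bsub>VK n\<^esub> T n d" for s T d by (simp add: sclf_def c.vec_simps)
  have tk: "ts n \<in> carrier (K n)" "ks n \<in> carrier (K n)" using ts ks by auto
  have WV: "kcmp evT ?W n ?c \<in> carrier (VK n)" unfolding k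
    by (rule V.M.minus_closed; rule V.M.finsum_closed) (auto simp: ve_VK)
  have "relR n ?c = ts n \<odot>\<^bsub>VK n\<^esub> evT n ?c \<ominus>\<^bsub>VK n\<^esub> ks n \<odot>\<^bsub>VK n\<^esub> kcmp evT ?W n ?c"
    unfolding relR_def by (subst addf_minus[OF s]) (simp_all add: sc tk evT_VK WV)
  also have "\<dots> = PK (K n) (m n) (ts n) (ks n) i j (ve (K n) p)"
    unfolding c.bracket_omega[OF i p] k evT_eval[OF i(1)] using tk by simp
  finally show ?thesis .
qed

definition "relL T = addf (kcmp T (kcmp (tn vee XT) (mapf assoc_map))) (sclf (sq (- 1)) (kcmp XT (kcmp (tn vee T) (kcmp (mapf assoc_map) (tn (mapf swap_map) vee)))))"

lemma XT_VK: "XT n c \<in> carrier (VK n)" by (simp add: XT_def mapf_VK)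

lemma relL_eval:
  assumes s: "sq (- 1) n = \<ominus>\<^bsub>K n\<^esub> \<one>\<^bsub>K n\<^esub>" and j: "j < m n"
    and T: "T n (Tns (yy i) p) \<in> carrier (PK' n)" "T n (Tns (yy i) (mx j p)) \<in> carrier (PK' n)"
  shows "relL T n (Tns (Tns (yy i) (xx j)) p) = T n (Tns (yy i) (mx j p)) \<ominus>\<^bsub>PK' n\<^esub> PX (K n) (m n) j (T n (Tns (yy i) p))"
proof -
  interpret c: cherednik_data "K n" "m n" "ts n" "ks n" by (rule chr)
  let ?c = "Tns (Tns (yy i) (xx j)) p"
  note TV = c.P_VU[OF T(1)] c.P_VU[OF T(2)]
  have a: "mapf assoc_map n ?c = ve (K n) (Tns (yy i) (Tns (xx j) p))" by (simp add: mapf_def)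
  have "kcmp (tn vee XT) (mapf assoc_map) n ?c = tn vee XT n (Tns (yy i) (Tns (xx j) p))" by (rule kcmp_ve, rule a, intro tn_VK vee_VK XT_VK)
  also have "\<dots> = ve (K n) (Tns (yy i) (mx j p))" by (rule tn_vee_ve) (simp add: XT_def mapf_def)
  finally have 1: "kcmp T (kcmp (tn vee XT) (mapf assoc_map)) n ?c = T n (Tns (yy i) (mx j p))" by (rule kcmp_ve) (rule TV(2))
  have b: "kcmp (mapf assoc_map) (tn (mapf swap_map) vee) n ?c = ve (K n) (Tns (xx j) (Tns (yy i) p))"
    using kcmp_ve[of "tn (mapf swap_map) vee" n "Tns (Tns (yy i) (xx j)) p" _ "mapf assoc_map", OF tn_swap] mapf_VK by (simp add: mapf_def)
  have tv: "tn vee T n (Tns (xx j) (Tns (yy i) p)) = lin (K n) (VK n) (\<lambda>b. ve (K n) (Tns (xx j) b)) (T n (Tns (yy i) p))"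
    by (rule tn_vee[of T n "Tns (yy i) p", OF TV(1)])
  have tvV: "tn vee T n (Tns (xx j) (Tns (yy i) p)) \<in> carrier (VK n)"
    unfolding tv by (rule klinD(1)[OF c.lin_VU TV(1)]) (rule ve_VK)
  have "kcmp (tn vee T) (kcmp (mapf assoc_map) (tn (mapf swap_map) vee)) n ?c = tn vee T n (Tns (xx j) (Tns (yy i) p))"
    by (rule kcmp_ve, rule b, rule tvV)
  hence "kcmp XT (kcmp (tn vee T) (kcmp (mapf assoc_map) (tn (mapf swap_map) vee))) n ?c = lin (K n) (VK n) (\<lambda>b. XT n (Tns (xx j) b)) (T n (Tns (yy i) p))"
    unfolding kcmp_lin[of XT] tv by (simp add: c.lin_tl[OF TV(1) XT_VK])
  also have "\<dots> = PX (K n) (m n) j (T n (Tns (yy i) p))"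
    unfolding c.PX_lin[OF j T(1)] by (simp add: XT_def mapf_def)
  finally have 2: "kcmp XT (kcmp (tn vee T) (kcmp (mapf assoc_map) (tn (mapf swap_map) vee))) n ?c = PX (K n) (m n) j (T n (Tns (yy i) p))" .
  have PXP: "PX (K n) (m n) j (T n (Tns (yy i) p)) \<in> carrier (PK' n)" by (rule klinD(1)[OF c.PX_klin[OF j] T(1)])
  show ?thesis unfolding relL_def
    by (subst addf_minus[OF s]) (simp_all add: 1 2 TV c.P_VU[OF PXP] c.P_minus[OF T(2) PXP])
qed

lemma admissible_P:
  assumes "admissible D DM T" shows "\<forall>\<^sub>F n in F. \<forall>c\<in>D L n. T n c \<in> carrier (PK' n)"
proof -
  obtain L' A where A: "good (D L) (DM L') A" "ae (D L) A T" using admissibleE[OF assms] .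
  show ?thesis using A(2) unfolding ae_def
  proof eventually_elim
    case (elim n)
    have "A n c \<in> carrier (PK' n)" if "c \<in> D L n" for c
      using coeff_ring.vec_mono[OF K goodD[OF A(1) that], of "PB (m n)"] PB_PBL(2) by (simp add: Pmod_def DM_def)
    thus ?case using elim by auto
  qed
qed

text \<open>Every composite in the relation is again given by a column family, so the relation is an
  equality of families almost everywhere in each degree. With the term \<open>PX\<close> moved to
  the right it becomes a recursion that determines y on a product with x_j from y on the other
  factor.\<close>

lemma cherednik_relation_iff:
  assumes T: "admissible (D1 HY) DM T"
  shows "cherednik_relation C MM (mk_indmor (V1 HX) (D1 HX) MM DM XT) (mk_indmor (V1 HY) (D1 HY) MM DM T) \<longleftrightarrow>
    (\<forall>L. \<forall>\<^sub>F n in F. \<forall>i<m n. \<forall>j<m n. \<forall>p\<in>DM L n. T n (Tns (yy i) (mx j p)) =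
       PX (K n) (m n) j (T n (Tns (yy i) p)) \<oplus>\<^bsub>PK' n\<^esub> PK (K n) (m n) (ts n) (ks n) i j (ve (K n) p))"
proof -
  note H = obs_H(2,1)
  note YX = ob_tS[OF H] and XY = ob_tS[OF H(2,1)]
  note t1 = tw1[OF YX] and t2 = tw1[OF XY] and t3 = tw2[OF H(2,1)] and t4 = tw2[OF H] and ty = tw1[OF H(1)] and tx = tw1[OF H(2)]
  note M = is_tower_M
  note s1 = ind_swp_mk_indmor[OF H] and a1 = ind_asc_mk_indmor[OF H(2,1)] and a2 = ind_asc_mk_indmor[OF H]
  note ix = idn_tna_mk_indmor[OF H(1,1) tx M mult_x_mk_indmor(2)] and iy = idn_tna_mk_indmor[OF H(2,2) ty M T]
  note l1 = ind_cmp_mk_indmor[OF t1 t4 ty a2(2) ix(2)] admissible_cmp[OF t1 t4 a2(2) ix(2)]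
  note l2 = ind_cmp_mk_indmor[OF t1 ty M l1(2) T] admissible_cmp[OF t1 ty l1(2) T]
  note r1 = ind_cmp_mk_indmor[OF t1 t2 t3 s1(2) a1(2)] admissible_cmp[OF t1 t2 s1(2) a1(2)]
  note r2 = ind_cmp_mk_indmor[OF t1 t3 tx r1(2) iy(2)] admissible_cmp[OF t1 t3 r1(2) iy(2)]
  note r3 = ind_cmp_mk_indmor[OF t1 tx M r2(2) mult_x_mk_indmor(2)] admissible_cmp[OF t1 tx r2(2) mult_x_mk_indmor(2)]
  note lhs = mns_mk_indmor[OF t1 M l2(2) r3(2), folded relL_def]
  note om = mns_mk_indmor[OF t1 t1 omega3_mk_indmor(2) omega13_mk_indmor(2)]
  note e1 = ind_cmp_mk_indmor[OF t1 t1 M om(2) ind_ev_mk_indmor(2)] admissible_cmp[OF t1 t1 om(2) ind_ev_mk_indmor(2)]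
  note e2 = ind_scl_mk_indmor[OF t1 M e1(2) ks] admissible_scl[OF e1(2) ks(1)]
  note e3 = ind_scl_mk_indmor[OF t1 M ind_ev_mk_indmor(2) ts] admissible_scl[OF ind_ev_mk_indmor(2) ts(1)]
  note rhs = mns_mk_indmor[OF t1 M e3(2) e2(2), folded relR_def]
  have "cherednik_relation C MM (mk_indmor (V1 HX) (D1 HX) MM DM XT) (mk_indmor (V1 HY) (D1 HY) MM DM T) \<longleftrightarrow>
     mk_indmor (V1 (tS HY HX)) (D1 (tS HY HX)) MM DM (relL T) = mk_indmor (V1 (tS HY HX)) (D1 (tS HY HX)) MM DM relR"
    unfolding cherednik_relation_def Let_def C_sel(17-20) omega3_mk_indmor(1) omega13_mk_indmor(1) om(1) ind_ev_mk_indmor(1) e1(1) e2(1) e3(1) rhs(1)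
      a2(1) ix(1) l1(1) l2(1) s1(1) a1(1) r1(1) iy(1) r2(1) r3(1) lhs(1) ..
  also have "\<dots> \<longleftrightarrow> (\<forall>L. ae (D1 (tS HY HX) L) (relL T) relR)" by (rule mk_indmor_eq[OF t1 M lhs(2)])
  also have "\<dots> \<longleftrightarrow> (\<forall>L. \<forall>\<^sub>F n in F. \<forall>i<m n. \<forall>j<m n. \<forall>p\<in>DM L n. T n (Tns (yy i) (mx j p)) =
       PX (K n) (m n) j (T n (Tns (yy i) p)) \<oplus>\<^bsub>PK' n\<^esub> PK (K n) (m n) (ts n) (ks n) i j (ve (K n) p))"
  proof (rule all_cong1)
    fix L
    show "ae (D1 (tS HY HX) L) (relL T) relR \<longleftrightarrow> (\<forall>\<^sub>F n in F. \<forall>i<m n. \<forall>j<m n. \<forall>p\<in>DM L n. T n (Tns (yy i) (mx j p)) =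
       PX (K n) (m n) j (T n (Tns (yy i) p)) \<oplus>\<^bsub>PK' n\<^esub> PK (K n) (m n) (ts n) (ks n) i j (ve (K n) p))"
      unfolding ae_def
    proof (rule eventually_subst)
      show "\<forall>\<^sub>F n in F. (\<forall>c\<in>D1 (tS HY HX) L n. relL T n c = relR n c) \<longleftrightarrow> (\<forall>i<m n. \<forall>j<m n. \<forall>p\<in>DM L n. T n (Tns (yy i) (mx j p)) =
       PX (K n) (m n) j (T n (Tns (yy i) p)) \<oplus>\<^bsub>PK' n\<^esub> PK (K n) (m n) (ts n) (ks n) i j (ve (K n) p))"
        \<comment> \<open>Multiplication by x_j raises the degree, so the columns of
          \<open>T\<close> have to lie in the polynomial space in degree L + 1 as well.\<close>
        using sq_minus1 admissible_P[OF T, of L] admissible_P[OF T, of "Suc L"]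
      proof eventually_elim
        case (elim n)
        interpret c: cherednik_data "K n" "m n" "ts n" "ks n" by (rule chr)
        have "relL T n (Tns (Tns (yy i) (xx j)) p) = relR n (Tns (Tns (yy i) (xx j)) p) \<longleftrightarrow> T n (Tns (yy i) (mx j p)) =
           PX (K n) (m n) j (T n (Tns (yy i) p)) \<oplus>\<^bsub>PK' n\<^esub> PK (K n) (m n) (ts n) (ks n) i j (ve (K n) p)"
          if i: "i < m n" "j < m n" and p: "p \<in> DM L n" for i j p
        proof -
          have pB: "p \<in> PBL (m n) L" "p \<in> PB (m n)" using p PB_PBL by (auto simp: DM_def)
          have T1: "T n (Tns (yy i) p) \<in> carrier (PK' n)" using elim(2) i p by (auto simp: tS_iff HY_def)
          have T2: "T n (Tns (yy i) (mx j p)) \<in> carrier (PK' n)"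
            using elim(3) i c.mult_x_PBL[OF i(2) pB(1)] by (auto simp: tS_iff HY_def DM_def)
          have X: "PX (K n) (m n) j (T n (Tns (yy i) p)) \<in> carrier (PK' n)" by (rule klinD(1)[OF c.PX_klin[OF i(2)] T1])
          have Kp: "PK (K n) (m n) (ts n) (ks n) i j (ve (K n) p) \<in> carrier (PK' n)" by (rule klinD(1)[OF c.PK_klin[OF i] c.ve_P[OF pB(2)]])
          show ?thesis unfolding relL_eval[of n j T i p, OF elim(1) i(2) T1 T2] relR_eval[OF elim(1) i pB(2)]
            using c.PP.M.ag_move[OF T2 X Kp] .
        qed
        moreover have "D1 (tS HY HX) L n = {Tns (Tns (yy i) (xx j)) p | i j p. i < m n \<and> j < m n \<and> p \<in> DM L n}"
          by (auto simp: tS_def tset_def HX_def HY_def)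
        ultimately show ?case by fastforce
      qed
    qed
  qed
  finally show ?thesis .
qed

end

section \<open>The action of y on the induced object and the module axioms\<close>

context ultra_setting_params
begin

lemma ball_Collect_Tns: "(\<forall>c\<in>{Tns (z i) p | i p. i < N \<and> p \<in> D}. Q c) \<longleftrightarrow> (\<forall>i<N. \<forall>p\<in>D. Q (Tns (z i) p))"
  by blast

text \<open>Off the basis vectors y_i \<otimes> p the columns are set to zero, so that all of them
  are finitely supported and linear extension is defined without side conditions.\<close>

definition "YT = (\<lambda>n c. case c of Tns u p \<Rightarrow> (case u of Gen z \<Rightarrow>
   if p \<in> PB (m n) \<and> gix z < m n then PYcol (K n) (m n) (ts n) (ks n) (gix z) p else (\<lambda>_. \<zero>\<^bsub>K n\<^esub>) | _ \<Rightarrow> (\<lambda>_. \<zero>\<^bsub>K n\<^esub>)) | _ \<Rightarrow> (\<lambda>_. \<zero>\<^bsub>K n\<^esub>))"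

lemma YT_yy: "i < m n \<Longrightarrow> p \<in> PB (m n) \<Longrightarrow> YT n (Tns (yy i) p) = PYcol (K n) (m n) (ts n) (ks n) i p"
  by (simp add: YT_def)

lemma YT_VK: "YT n c \<in> carrier (VK n)"
proof -
  interpret c: cherednik_data "K n" "m n" "ts n" "ks n" by (rule chr)
  have z: "(\<lambda>_. \<zero>\<^bsub>K n\<^esub>) \<in> carrier (VK n)" by (simp add: c.vec_carrier)
  show ?thesis unfolding YT_def using z c.P_VU[OF c.PYcol_P] by (auto split: bvec.split)
qed

lemma g_YT: "good (D1 HY L) (DM (Suc L)) YT"
  unfolding good_def
proof
  fix n interpret c: cherednik_data "K n" "m n" "ts n" "ks n" by (rule chr)
  show "pgood (K n) (m n) (D1 HY L n) (DM (Suc L) n) (YT n)"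
    unfolding pgood_def
  proof (intro ballI conjI allI impI)
    fix c assume "c \<in> D1 HY L n"
    then obtain i p where c: "c = Tns (yy i) p" "i < m n" "p \<in> PBL (m n) L" by (auto elim!: tS_cases simp: HY_def DM_def)
    note pB = PB_PBL(1)[OF c(3)]
    show "YT n c \<in> carrier (vec (K n) (DM (Suc L) n))"
      using c.PYcol_PL[OF c(2,3)] c pB by (simp add: YT_yy DM_def)
    fix g r assume g: "g permutes {..<m n}"
    show "YT n (bact g c) (bact g r) = YT n c r"
      using c.PYcol_equiv[OF g c(2) pB] c pB permutes_gi[OF g c(2)] bact_PB[OF g pB] by (simp add: YT_yy)
  qed
qed

lemma admissible_YT: "admissible (D1 HY) DM YT"
  unfolding admissible_def using g_YT ae_refl by blast

abbreviation "XM \<equiv> mk_indmor (V1 HX) (D1 HX) MM DM XT"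
abbreviation "YM \<equiv> mk_indmor (V1 HY) (D1 HY) MM DM YT"

definition "W1 = (\<lambda>L. tS HY (DY L))"

lemma twW: "is_tower (ind_tno C (pr HY) MY) W1"
  unfolding W1_def by (rule is_tower_tno[OF is_tower_Y stab_H(2) OB_HY])

lemma DY_DM: "DY L n \<subseteq> DM L n"
  by (auto simp: DY_def PD_def y_deg_def DM_def pm_PBL)

lemma DY_cases: assumes "p \<in> DY L n" obtains b where "p = pm {#} b" "set_mset b \<subseteq> Yv ` {..<m n}" "size b \<le> L"
  using assms by (auto simp: DY_def PD_def y_deg_def)

abbreviation "my i p \<equiv> mult_y_map (Tns (yy i) p)"

lemma my_pm: "my i (pm a b) = pm a (add_mset (Yv i) b)"
  by (simp add: pm_def)

lemma mult_y0_mk_indmor: "mult_y0 F K m C (unt C) = mk_indmor (ind_tno C (pr HY) MY) W1 MM DM (mapf mult_y_map)" "admissible W1 DM (mapf mult_y_map)"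
proof -
  have g: "good (W1 L) (DM (Suc L)) (mapf mult_y_map)" for L
  proof (rule good_mapf)
    fix n c assume "c \<in> W1 L n"
    then obtain i d where d: "c = Tns (yy i) d" "i < m n" "d \<in> DY L n" by (auto elim!: tS_cases simp: HY_def W1_def)
    obtain b where b: "d = pm {#} b" "set_mset b \<subseteq> Yv ` {..<m n}" "size b \<le> L" using d(3) by (rule DY_cases)
    show "mult_y_map c \<in> DM (Suc L) n" using d b by (simp add: my_pm DM_def pm_PBL)
    fix g show "mult_y_map (bact g c) = bact g (mult_y_map c)" by (simp add: d(1) b(1) pm_def)
  qed
  have u: "ucls F (\<lambda>n. rep_cat (K n) (m n)) (\<lambda>n. map_mor (K n) (tno C (hob C) (lev MY L) n) (lev MM (Suc L) n) mult_y_map) = cm (W1 L) (DM (Suc L)) (mapf mult_y_map)" for L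
  proof -
    have "(\<lambda>n. map_mor (K n) (tno C (hob C) (lev MY L) n) (lev MM (Suc L) n) mult_y_map) = rmm (W1 L) (DM (Suc L)) (mapf mult_y_map)"
      by (simp add: C_sel UC_pr is_towerD(6)[OF is_tower_M] is_towerD(6)[OF is_tower_Y] rmm_def W1_def) (simp add: pr_def map_mor_pmor mapf_def)
    thus ?thesis using ucls_rmm by (simp add: RC_def)
  qed
  note i = ind_mk_mk_indmor[OF twW is_tower_M, of "\<lambda>L. {(Suc L, cm (W1 L) (DM (Suc L)) (mapf mult_y_map))}" "mapf mult_y_map"]
  have x: "\<exists>j A. x = (j, cm (W1 L) (DM j) A) \<and> good (W1 L) (DM j) A \<and> ae (W1 L) A (mapf mult_y_map)"
    if "x \<in> {(Suc L, cm (W1 L) (DM (Suc L)) (mapf mult_y_map))}" for L x using that g ae_refl by blast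
  show "mult_y0 F K m C (unt C) = mk_indmor (ind_tno C (pr HY) MY) W1 MM DM (mapf mult_y_map)"
    unfolding mult_y0_def Let_def MM_def[symmetric] MY_def[symmetric] u using i(1)[OF x] by (simp add: C_sel(17))
  show "admissible W1 DM (mapf mult_y_map)" using i(2)[OF x] by simp
qed

lemma y0_incl_mk_indmor: "y0_incl F K m C (unt C) = mk_indmor MY DY MM DM vee" "admissible DY DM vee"
proof -
  note i = ind_lev_mk_indmor[OF is_tower_Y is_tower_M, of "\<lambda>L. cm (DY L) (DM L) vee" vee, OF refl good_vee[OF DY_DM]]
  have "sym_incl F K m (y_deg L) (all_deg L) (unt C) = cm (DY L) (DM L) vee" for L
    unfolding sym_incl_cm DY_def DM_def PD_all ..
  thus "y0_incl F K m C (unt C) = mk_indmor MY DY MM DM vee" unfolding y0_incl_def MM_def[symmetric] MY_def[symmetric] using i(1) by simp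
  show "admissible DY DM vee" by (rule i(2))
qed

lemma tn_vee_vee: "tn vee vee n (Tns u v) = ve (K n) (Tns u v)"
  by (rule tn_vee_ve) (simp add: vee_def)

lemma y0_restriction_iff:
  assumes T: "admissible (D1 HY) DM T"
  shows "mk_indmor (V1 HY) (D1 HY) MM DM T \<star>\<^bsub>C\<^esub> (idn C (hob C) \<boxtimes>\<^bsub>C\<^esub> y0_incl F K m C (unt C)) = mult_y0 F K m C (unt C)
    \<longleftrightarrow> (\<forall>L. \<forall>\<^sub>F n in F. \<forall>i<m n. \<forall>p\<in>DY L n. T n (Tns (yy i) p) = ve (K n) (my i p))"
proof -
  note i = idn_tna_mk_indmor[OF obs_H(2,2) is_tower_Y is_tower_M y0_incl_mk_indmor(2), folded W1_def]
  note c = ind_cmp_mk_indmor[OF twW tw1[OF obs_H(2)] is_tower_M i(2) T] admissible_cmp[OF twW tw1[OF obs_H(2)] i(2) T]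
  have "mk_indmor (V1 HY) (D1 HY) MM DM T \<star>\<^bsub>C\<^esub> (idn C (hob C) \<boxtimes>\<^bsub>C\<^esub> y0_incl F K m C (unt C)) = mult_y0 F K m C (unt C)
    \<longleftrightarrow> mk_indmor (ind_tno C (pr HY) MY) W1 MM DM (kcmp T (tn vee vee)) = mk_indmor (ind_tno C (pr HY) MY) W1 MM DM (mapf mult_y_map)"
    unfolding C_sel(17) y0_incl_mk_indmor(1) mult_y0_mk_indmor(1) i(1) c(1) ..
  also have "\<dots> \<longleftrightarrow> (\<forall>L. ae (W1 L) (kcmp T (tn vee vee)) (mapf mult_y_map))" by (rule mk_indmor_eq[OF twW is_tower_M c(2)])
  also have "\<dots> \<longleftrightarrow> (\<forall>L. \<forall>\<^sub>F n in F. \<forall>i<m n. \<forall>p\<in>DY L n. T n (Tns (yy i) p) = ve (K n) (my i p))"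
  proof (rule all_cong1)
    fix L
    show "ae (W1 L) (kcmp T (tn vee vee)) (mapf mult_y_map) \<longleftrightarrow> (\<forall>\<^sub>F n in F. \<forall>i<m n. \<forall>p\<in>DY L n. T n (Tns (yy i) p) = ve (K n) (my i p))"
      unfolding ae_def
    proof (rule eventually_subst)
      show "\<forall>\<^sub>F n in F. (\<forall>c\<in>W1 L n. kcmp T (tn vee vee) n c = mapf mult_y_map n c) = (\<forall>i<m n. \<forall>p\<in>DY L n. T n (Tns (yy i) p) = ve (K n) (my i p))"
        using admissible_P[OF T, of L]
      proof eventually_elim
        case (elim n)
        interpret c: cherednik_data "K n" "m n" "ts n" "ks n" by (rule chr)
        have "kcmp T (tn vee vee) n (Tns (yy i) p) = T n (Tns (yy i) p)" if "i < m n" "p \<in> DY L n" for i p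
        proof (rule kcmp_ve[of "tn vee vee" n _ _ T, OF tn_vee_vee])
          show "T n (Tns (yy i) p) \<in> carrier (VK n)"
          proof -
            have "Tns (yy i) p \<in> D1 HY L n" using that DY_DM[of L n] by (auto simp: tS_iff HY_def)
            thus ?thesis using elim c.P_VU by blast
          qed
        qed
        moreover have "W1 L n = {Tns (yy i) p | i p. i < m n \<and> p \<in> DY L n}" by (auto simp: W1_def tS_def tset_def HY_def)
        ultimately show ?case by (simp only: ball_Collect_Tns) (auto simp: mapf_def)
      qed
    qed
  qed
  finally show ?thesis .
qed

lemma YM_props:
  "YM \<in> ind_hom C (V1 HY) MM"
  "YM \<star>\<^bsub>C\<^esub> (idn C (hob C) \<boxtimes>\<^bsub>C\<^esub> y0_incl F K m C (unt C)) = mult_y0 F K m C (unt C)"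
  "cherednik_relation C MM XM YM"
proof -
  show "YM \<in> ind_hom C (V1 HY) MM" by (rule mk_indmor_hom[OF tw1[OF obs_H(2)] is_tower_M admissible_YT])
  have "YT n (Tns (yy i) p) = ve (K n) (my i p)" if i: "i < m n" and p: "p \<in> DY L n" for n i p L
  proof -
    interpret c: cherednik_data "K n" "m n" "ts n" "ks n" by (rule chr)
    obtain b where b: "p = pm {#} b" "set_mset b \<subseteq> Yv ` {..<m n}" using p by (rule DY_cases)
    thus ?thesis using i by (simp add: YT_yy pm_PB my_pm c.PYcol_base)
  qed
  thus "YM \<star>\<^bsub>C\<^esub> (idn C (hob C) \<boxtimes>\<^bsub>C\<^esub> y0_incl F K m C (unt C)) = mult_y0 F K m C (unt C)"
    unfolding y0_restriction_iff[OF admissible_YT] by (intro allI always_eventually impI ballI) blast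
  have "YT n (Tns (yy i) (mx j p)) = PX (K n) (m n) j (YT n (Tns (yy i) p)) \<oplus>\<^bsub>PK' n\<^esub> PK (K n) (m n) (ts n) (ks n) i j (ve (K n) p)"
    if i: "i < m n" "j < m n" and p: "p \<in> DM L n" for n i j p L
  proof -
    interpret c: cherednik_data "K n" "m n" "ts n" "ks n" by (rule chr)
    have pB: "p \<in> PB (m n)" using p PB_PBL by (auto simp: DM_def)
    thus ?thesis using c.PYX[OF i c.ve_P[OF pB]] i by (simp add: YT_yy c.mult_x_PB c.PX_ve c.PY_ve)
  qed
  thus "cherednik_relation C MM XM YM" unfolding cherednik_relation_iff[OF admissible_YT] by (intro allI always_eventually impI ballI) blast
qed

text \<open>Outside a null set, both conditions hold at a given index in all degrees up to L. At
  such an index the restriction to the y-part starts the recursion and the commutation relation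
  continues it, which forces the columns of \<open>PYcol\<close>.\<close>

lemma YM_unique:
  assumes y: "y \<in> ind_hom C (V1 HY) MM" and b: "y \<star>\<^bsub>C\<^esub> (idn C (hob C) \<boxtimes>\<^bsub>C\<^esub> y0_incl F K m C (unt C)) = mult_y0 F K m C (unt C)"
    and r: "cherednik_relation C MM XM y"
  shows "y = YM"
proof -
  obtain T where T: "admissible (D1 HY) DM T" "y = mk_indmor (V1 HY) (D1 HY) MM DM T" by (rule hom_mk_indmor[OF tw1[OF obs_H(2)] is_tower_M y])
  have "ae (D1 HY L) T YT" for L
    unfolding ae_def using b[unfolded T(2) y0_restriction_iff[OF T(1)], rule_format, of L] r[unfolded T(2) cherednik_relation_iff[OF T(1)], rule_format, of L]
  proof eventually_elim
    case (elim n)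
    interpret c: cherednik_data "K n" "m n" "ts n" "ks n" by (rule chr)
    have "T n (Tns (yy i) p) = PYcol (K n) (m n) (ts n) (ks n) i p" if i: "i < m n" and p: "p \<in> PBL (m n) L'" "L' \<le> L" for i p L'
      using p
    proof (induction rule: PB_induct)
      case (base b L')
      hence "pm {#} b \<in> DY L n" by (simp add: DY_def pm_PD y_deg_def)
      thus ?case using elim(1) i by (simp add: c.PYcol_base my_pm)
    next
      case (X j a b L')
      hence "pm a b \<in> DM L n" by (simp add: DM_def pm_PBL)
      hence "T n (Tns (yy i) (mx j (pm a b))) = PX (K n) (m n) j (T n (Tns (yy i) (pm a b))) \<oplus>\<^bsub>PK' n\<^esub> PK (K n) (m n) (ts n) (ks n) i j (ve (K n) (pm a b))"
        using elim(2) i X(1) by blast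
      thus ?case using X i by (simp add: c.mult_x_pm c.PYcol_X_aux)
    qed
    thus ?case using PB_PBL(1) by (auto elim!: tS_cases simp: HY_def DM_def YT_yy)
  qed
  thus ?thesis unfolding T(2) by (rule mk_indmor_cong)
qed

lemma ind_y_YM: "ind_y F K m C (unt C) = YM"
  unfolding ind_y_def Let_def MM_def[symmetric] mult_x_mk_indmor(1) C_sel(17)
proof (rule the_equality, goal_cases)
  case 1 show ?case using YM_props by (simp add: C_sel(17))
next
  case (2 y) thus ?case using YM_unique[of y] by (simp add: C_sel(17))
qed

text \<open>The categorical condition evaluates, column by column, to a difference of two composites
  with the first two tensor factors exchanged. Commuting operators at each index make it vanish
  wherever the scalar -1 is represented correctly.\<close>

lemma commuting_action_mk_indmor:
  assumes S: "ob S" and T: "admissible (D1 S) DM T" and TV: "\<And>n c. T n c \<in> carrier (VK n)"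
    and com: "\<And>L n u u' p. u \<in> S n \<Longrightarrow> u' \<in> S n \<Longrightarrow> p \<in> DM L n \<Longrightarrow>
      lin (K n) (VK n) (\<lambda>b. T n (Tns u b)) (T n (Tns u' p)) = lin (K n) (VK n) (\<lambda>b. T n (Tns u' b)) (T n (Tns u p))"
  shows "commuting_action C (pr S) MM (mk_indmor (V1 S) (D1 S) MM DM T)"
proof -
  \<comment> \<open>The column family of 1 - \<sigma>.\<close>
  define CO where "CO = addf vee (sclf (sq (- 1)) (mapf swap_map))"
  note SS = ob_tS[OF S S] and st = S[unfolded ob_def, THEN conjunct1]
  note stS = stab_tS[OF st st]
  note gs = good_scl[OF sq(1)[of "- 1"] g_swap[of S S]]
  have gv: "good (tS S S) (tS S S) vee" by (rule good_vee) simp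
  note gC = good_add[OF gv gs, folded CO_def]
  have sc: "scl C (- 1) (cm (tS S S) (tS S S) (mapf swap_map)) = cm (tS S S) (tS S S) (sclf (sq (- 1)) (mapf swap_map))"
    unfolding C_sel uscalar_sq by (rule UC_scl[OF stS stS g_swap sq(1)])
  have co: "pls C (idn C (tno C (pr S) (pr S))) (scl C (- 1) (swp C (pr S) (pr S))) = cm (tS S S) (tS S S) CO"
    using sc UC_pls[OF stS stS gv gs] by (simp add: C_sel(5,8,11,16) UC_pr CO_def)
  note i1 = ind_tna_id_mk_indmor[OF SS SS gC] and a1 = ind_asc_mk_indmor[OF S S] and i2 = idn_tna_mk_indmor[OF S S tw1[OF S] is_tower_M T]
  note t1 = tw1[OF SS] and t2 = tw2[OF S S] and t3 = tw1[OF S]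
  note c1 = ind_cmp_mk_indmor[OF t1 t1 t2 i1(2) a1(2)] admissible_cmp[OF t1 t1 i1(2) a1(2)]
  note c2 = ind_cmp_mk_indmor[OF t1 t2 t3 c1(2) i2(2)] admissible_cmp[OF t1 t2 c1(2) i2(2)]
  note c3 = ind_cmp_mk_indmor[OF t1 t3 is_tower_M c2(2) T] admissible_cmp[OF t1 t3 c2(2) T]
  have "mk_indmor (V1 (tS S S)) (D1 (tS S S)) MM DM (kcmp T (kcmp (tn vee T) (kcmp (mapf assoc_map) (tn CO vee)))) = mk_indmor (V1 (tS S S)) (D1 (tS S S)) MM DM zef"
  proof (rule mk_indmor_cong, unfold ae_def)
    fix L
    show "\<forall>\<^sub>F n in F. \<forall>c\<in>D1 (tS S S) L n. kcmp T (kcmp (tn vee T) (kcmp (mapf assoc_map) (tn CO vee))) n c = zef n c"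
      using sq_minus1
    proof eventually_elim
      case (elim n)
      interpret c: cherednik_data "K n" "m n" "ts n" "ks n" by (rule chr)
      interpret V: module "K n" "VK n" by (rule VK_module)
      show ?case
      proof
        fix c assume "c \<in> D1 (tS S S) L n"
        then obtain u u' p where c: "c = Tns (Tns u u') p" "u \<in> S n" "u' \<in> S n" "p \<in> DM L n" by (auto elim!: tS_cases)
        have 1: "tn CO vee n c = ve (K n) (Tns (Tns u u') p) \<ominus>\<^bsub>VK n\<^esub> ve (K n) (Tns (Tns u' u) p)"
        proof -
          have "CO n (Tns u u') r = ve (K n) (Tns u u') r \<oplus>\<^bsub>K n\<^esub> (\<ominus>\<^bsub>K n\<^esub> \<one>\<^bsub>K n\<^esub>) \<otimes>\<^bsub>K n\<^esub> ve (K n) (Tns u' u) r" for r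
            using elim by (simp add: CO_def addf_def sclf_def vee_def mapf_def)
          hence "tn CO vee n c r = ve (K n) (Tns (Tns u u') p) r \<oplus>\<^bsub>K n\<^esub> (\<ominus>\<^bsub>K n\<^esub> \<one>\<^bsub>K n\<^esub>) \<otimes>\<^bsub>K n\<^esub> ve (K n) (Tns (Tns u' u) p) r" for r
            by (cases r) (auto simp: c(1) tn_def vee_def c.tens_Tns ve_def)
          hence "tn CO vee n c = ve (K n) (Tns (Tns u u') p) \<oplus>\<^bsub>VK n\<^esub> (\<ominus>\<^bsub>K n\<^esub> \<one>\<^bsub>K n\<^esub>) \<odot>\<^bsub>VK n\<^esub> ve (K n) (Tns (Tns u' u) p)"
            by (simp add: c.vec_simps fun_eq_iff)
          thus ?thesis by (simp add: a_minus_def V.smult_l_minus ve_VK)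
        qed
        have l: "lin (K n) (VK n) B (x \<ominus>\<^bsub>VK n\<^esub> y) = lin (K n) (VK n) B x \<ominus>\<^bsub>VK n\<^esub> lin (K n) (VK n) B y"
          if "\<And>c. B c \<in> carrier (VK n)" "x \<in> carrier (VK n)" "y \<in> carrier (VK n)" for B x y
          by (rule klin_minus[OF VK_module VK_module c.lin_VU[OF that(1)] that(2,3)])
        have tT: "tn vee T n d \<in> carrier (VK n)" for d by (rule tn_VK) (rule vee_VK TV)+
        have 2: "kcmp (mapf assoc_map) (tn CO vee) n c = ve (K n) (Tns u (Tns u' p)) \<ominus>\<^bsub>VK n\<^esub> ve (K n) (Tns u' (Tns u p))"
          unfolding kcmp_lin 1 by (subst l) (simp_all add: mapf_VK ve_VK lin_ve_VK, simp add: mapf_def)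
        have 3: "kcmp (tn vee T) (kcmp (mapf assoc_map) (tn CO vee)) n c =
           lin (K n) (VK n) (\<lambda>b. ve (K n) (Tns u b)) (T n (Tns u' p)) \<ominus>\<^bsub>VK n\<^esub> lin (K n) (VK n) (\<lambda>b. ve (K n) (Tns u' b)) (T n (Tns u p))"
        proof -
          have "lin (K n) (VK n) (tn vee T n) (ve (K n) (Tns u (Tns u' p))) = lin (K n) (VK n) (\<lambda>b. ve (K n) (Tns u b)) (T n (Tns u' p))" for u u'
            using lin_ve_VK[of "tn vee T n" "Tns u (Tns u' p)" n, OF tT] tn_vee[of T n "Tns u' p" u, OF TV] by simp
          thus ?thesis unfolding kcmp_lin[of "tn vee T"] 2 by (subst l[OF tT ve_VK ve_VK]) simp
        qed
        have lv: "lin (K n) (VK n) (\<lambda>b. ve (K n) (Tns u b)) (T n q) \<in> carrier (VK n)" for u q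
          by (rule klinD(1)[OF c.lin_VU TV]) (rule ve_VK)
        have lT: "lin (K n) (VK n) (\<lambda>b. T n (Tns u b)) (T n q) \<in> carrier (VK n)" for u q
          by (rule klinD(1)[OF c.lin_VU TV]) (rule TV)
        have "kcmp T (kcmp (tn vee T) (kcmp (mapf assoc_map) (tn CO vee))) n c =
           lin (K n) (VK n) (\<lambda>b. T n (Tns u b)) (T n (Tns u' p)) \<ominus>\<^bsub>VK n\<^esub> lin (K n) (VK n) (\<lambda>b. T n (Tns u' b)) (T n (Tns u p))"
          unfolding kcmp_lin[of T] 3 by (subst l) (simp_all add: TV lv c.lin_tl[OF TV TV])
        also have "\<dots> = \<zero>\<^bsub>VK n\<^esub>" unfolding com[OF c(2,3,4)] using lT by (simp add: a_minus_def V.M.r_neg)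
        finally show "kcmp T (kcmp (tn vee T) (kcmp (mapf assoc_map) (tn CO vee))) n c = zef n c"
          by (simp add: c.vec_simps zef_def)
      qed
    qed
  qed
  moreover have "ind_zer C (ind_tno C (tno C (pr S) (pr S)) MM) MM = mk_indmor (V1 (tS S S)) (D1 (tS S S)) MM DM zef"
    using ind_zer_mk_indmor(1)[OF t1 is_tower_M] by (simp add: C_sel UC_pr)
  ultimately show ?thesis
    unfolding commuting_action_def co i1(1) a1(1) i2(1) c1(1) c2(1) c3(1) by simp
qed

lemma XT_lin:
  assumes "i < m n" "v \<in> carrier (PK' n)"
  shows "lin (K n) (VK n) (\<lambda>b. XT n (Tns (xx i) b)) v = PX (K n) (m n) i v"
proof -
  interpret c: cherednik_data "K n" "m n" "ts n" "ks n" by (rule chr)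
  show ?thesis unfolding c.PX_lin[OF assms] by (simp add: XT_def mapf_def)
qed

lemma YT_lin:
  assumes i: "i < m n" and v: "v \<in> carrier (PK' n)"
  shows "lin (K n) (VK n) (\<lambda>b. YT n (Tns (yy i) b)) v = PY (K n) (m n) (ts n) (ks n) i v"
proof -
  interpret c: cherednik_data "K n" "m n" "ts n" "ks n" by (rule chr)
  have b: "b \<in> PB (m n)" if "v b \<noteq> \<zero>\<^bsub>K n\<^esub>" for b using v that by (auto simp: Pmod_def c.vec_carrier)
  have vb: "v b \<in> carrier (K n)" for b using v by (auto simp: Pmod_def c.vec_carrier)
  show ?thesis unfolding c.PY_lin[OF i v]
    by (rule c.lin_cong[OF _ _ VK_module])
      (use b i module.smult_closed[OF VK_module vb YT_VK] module.smult_closed[OF VK_module vb c.P_VU[OF c.PYcol_P[OF i b]]] in \<open>simp_all add: YT_yy\<close>)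
qed

lemma RepH_obj: "(MM, XM, YM) \<in> RepH_obs C"
proof -
  have x: "commuting_action C (pr HX) MM XM"
  proof (rule commuting_action_mk_indmor[OF obs_H(1) mult_x_mk_indmor(2) XT_VK])
    fix L n u u' p assume u: "u \<in> HX n" "u' \<in> HX n" and p: "p \<in> DM L n"
    interpret c: cherednik_data "K n" "m n" "ts n" "ks n" by (rule chr)
    obtain i j where i: "u = xx i" "u' = xx j" "i < m n" "j < m n" using u by (auto simp: HX_def)
    have pB: "p \<in> PB (m n)" using p PB_PBL by (auto simp: DM_def)
    have e: "XT n (Tns (xx i) p) = PX (K n) (m n) i (ve (K n) p)" if "i < m n" for i
      using pB that by (simp add: XT_def mapf_def c.PX_ve)
    show "lin (K n) (VK n) (\<lambda>b. XT n (Tns u b)) (XT n (Tns u' p)) = lin (K n) (VK n) (\<lambda>b. XT n (Tns u' b)) (XT n (Tns u p))"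
      using i c.ve_P[OF pB] by (simp add: e XT_lin klinD(1)[OF c.PX_klin] c.PXX[of i j])
  qed
  have y: "commuting_action C (pr HY) MM YM"
  proof (rule commuting_action_mk_indmor[OF obs_H(2) admissible_YT YT_VK])
    fix L n u u' p assume u: "u \<in> HY n" "u' \<in> HY n" and p: "p \<in> DM L n"
    interpret c: cherednik_data "K n" "m n" "ts n" "ks n" by (rule chr)
    obtain i j where i: "u = yy i" "u' = yy j" "i < m n" "j < m n" using u by (auto simp: HY_def)
    have pB: "p \<in> PB (m n)" using p PB_PBL by (auto simp: DM_def)
    have e: "YT n (Tns (yy i) p) = PY (K n) (m n) (ts n) (ks n) i (ve (K n) p)" if "i < m n" for i
      using pB that by (simp add: YT_yy c.PY_ve)
    show "lin (K n) (VK n) (\<lambda>b. YT n (Tns u b)) (YT n (Tns u' p)) = lin (K n) (VK n) (\<lambda>b. YT n (Tns u' b)) (YT n (Tns u p))"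
      using i c.ve_P[OF pB] by (simp add: e YT_lin klinD(1)[OF c.PY_klin] c.PYY[of i j])
  qed
  have "XM \<in> ind_hom C (V1 HX) MM" by (rule mk_indmor_hom[OF tw1[OF obs_H(1)] is_tower_M mult_x_mk_indmor(2)])
  thus ?thesis using x y YM_props is_tower_obs[OF is_tower_M] by (simp add: RepH_obs_def C_sel(17,18))
qed

text \<open>The two conditions have different shapes because x sends basis vectors to basis vectors,
  while y sends them to combinations on which \<open>T\<close> has to be extended linearly.\<close>

lemma RepH_hom_iff:
  assumes T: "admissible DM DM T"
  shows "mk_indmor MM DM MM DM T \<in> RepH_hom C (MM, XM, YM) (MM, XM, YM) \<longleftrightarrow>
    (\<forall>L. \<forall>\<^sub>F n in F. \<forall>i<m n. \<forall>p\<in>DM L n. T n (mx i p) = PX (K n) (m n) i (T n p) \<and>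
        lin (K n) (VK n) (T n) (PYcol (K n) (m n) (ts n) (ks n) i p) = PY (K n) (m n) (ts n) (ks n) i (T n p))"
proof -
  note M = is_tower_M and x = tw1[OF obs_H(1)] and y = tw1[OF obs_H(2)]
  note ix = idn_tna_mk_indmor[OF obs_H(1,1) M M T] and iy = idn_tna_mk_indmor[OF obs_H(2,2) M M T]
  note l1 = ind_cmp_mk_indmor[OF x M M mult_x_mk_indmor(2) T] admissible_cmp[OF x M mult_x_mk_indmor(2) T]
  note l2 = ind_cmp_mk_indmor[OF y M M admissible_YT T] admissible_cmp[OF y M admissible_YT T]
  note r1 = ind_cmp_mk_indmor[OF x x M ix(2) mult_x_mk_indmor(2)]
  note r2 = ind_cmp_mk_indmor[OF y y M iy(2) admissible_YT]
  have pB: "p \<in> PB (m n)" if "p \<in> DM L n" for p L n using that PB_PBL by (auto simp: DM_def)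
  have e1: "ae (D1 HX L) (kcmp T XT) (kcmp XT (tn vee T)) \<longleftrightarrow> (\<forall>\<^sub>F n in F. \<forall>i<m n. \<forall>p\<in>DM L n. T n (mx i p) = PX (K n) (m n) i (T n p))" for L
    unfolding ae_def
  proof (rule eventually_subst)
    show "\<forall>\<^sub>F n in F. (\<forall>c\<in>D1 HX L n. kcmp T XT n c = kcmp XT (tn vee T) n c) = (\<forall>i<m n. \<forall>p\<in>DM L n. T n (mx i p) = PX (K n) (m n) i (T n p))"
      using admissible_P[OF T, of L] admissible_P[OF T, of "Suc L"]
    proof eventually_elim
      case (elim n)
      interpret c: cherednik_data "K n" "m n" "ts n" "ks n" by (rule chr)
      have "kcmp T XT n (Tns (xx i) p) = T n (mx i p) \<and> kcmp XT (tn vee T) n (Tns (xx i) p) = PX (K n) (m n) i (T n p)" if i: "i < m n" and p: "p \<in> DM L n" for i p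
      proof
        have "mx i p \<in> DM (Suc L) n" using c.mult_x_PBL[OF i] p by (simp add: DM_def)
        hence T2: "T n (mx i p) \<in> carrier (VK n)" using elim(2) c.P_VU by blast
        show "kcmp T XT n (Tns (xx i) p) = T n (mx i p)"
          by (rule kcmp_ve[of XT n "Tns (xx i) p" "mx i p" T]) (simp_all add: XT_def mapf_def T2)
        have T1: "T n p \<in> carrier (PK' n)" using elim(1) p by blast
        have "kcmp XT (tn vee T) n (Tns (xx i) p) = lin (K n) (VK n) (XT n) (lin (K n) (VK n) (\<lambda>b. ve (K n) (Tns (xx i) b)) (T n p))"
          unfolding kcmp_lin using tn_vee[of T n p "xx i", OF c.P_VU[OF T1]] by simp
        also have "\<dots> = PX (K n) (m n) i (T n p)" unfolding c.lin_tl[OF c.P_VU[OF T1] XT_VK] by (rule XT_lin[OF i T1])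
        finally show "kcmp XT (tn vee T) n (Tns (xx i) p) = PX (K n) (m n) i (T n p)" .
      qed
      moreover have "D1 HX L n = {Tns (xx i) p | i p. i < m n \<and> p \<in> DM L n}" by (auto simp: tS_def tset_def HX_def)
      ultimately show ?case by (simp only: ball_Collect_Tns) auto
    qed
  qed
  have e2: "ae (D1 HY L) (kcmp T YT) (kcmp YT (tn vee T)) \<longleftrightarrow> (\<forall>\<^sub>F n in F. \<forall>i<m n. \<forall>p\<in>DM L n. lin (K n) (VK n) (T n) (PYcol (K n) (m n) (ts n) (ks n) i p) = PY (K n) (m n) (ts n) (ks n) i (T n p))" for L
    unfolding ae_def
  proof (rule eventually_subst)
    show "\<forall>\<^sub>F n in F. (\<forall>c\<in>D1 HY L n. kcmp T YT n c = kcmp YT (tn vee T) n c) = (\<forall>i<m n. \<forall>p\<in>DM L n. lin (K n) (VK n) (T n) (PYcol (K n) (m n) (ts n) (ks n) i p) = PY (K n) (m n) (ts n) (ks n) i (T n p))"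
      using admissible_P[OF T, of L]
    proof eventually_elim
      case (elim n)
      interpret c: cherednik_data "K n" "m n" "ts n" "ks n" by (rule chr)
      have "kcmp T YT n (Tns (yy i) p) = lin (K n) (VK n) (T n) (PYcol (K n) (m n) (ts n) (ks n) i p) \<and> kcmp YT (tn vee T) n (Tns (yy i) p) = PY (K n) (m n) (ts n) (ks n) i (T n p)" if i: "i < m n" and p: "p \<in> DM L n" for i p
      proof
        show "kcmp T YT n (Tns (yy i) p) = lin (K n) (VK n) (T n) (PYcol (K n) (m n) (ts n) (ks n) i p)"
          unfolding kcmp_lin using i pB[OF p] by (simp add: YT_yy)
        have T1: "T n p \<in> carrier (PK' n)" using elim(1) p by blast
        have "kcmp YT (tn vee T) n (Tns (yy i) p) = lin (K n) (VK n) (YT n) (lin (K n) (VK n) (\<lambda>b. ve (K n) (Tns (yy i) b)) (T n p))"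
          unfolding kcmp_lin using tn_vee[of T n p "yy i", OF c.P_VU[OF T1]] by simp
        also have "\<dots> = PY (K n) (m n) (ts n) (ks n) i (T n p)" unfolding c.lin_tl[OF c.P_VU[OF T1] YT_VK] by (rule YT_lin[OF i T1])
        finally show "kcmp YT (tn vee T) n (Tns (yy i) p) = PY (K n) (m n) (ts n) (ks n) i (T n p)" .
      qed
      moreover have "D1 HY L n = {Tns (yy i) p | i p. i < m n \<and> p \<in> DM L n}" by (auto simp: tS_def tset_def HY_def)
      ultimately show ?case by (simp only: ball_Collect_Tns) auto
    qed
  qed
  have "mk_indmor MM DM MM DM T \<in> RepH_hom C (MM, XM, YM) (MM, XM, YM) \<longleftrightarrow>
     mk_indmor (V1 HX) (D1 HX) MM DM (kcmp T XT) = mk_indmor (V1 HX) (D1 HX) MM DM (kcmp XT (tn vee T)) \<and>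
     mk_indmor (V1 HY) (D1 HY) MM DM (kcmp T YT) = mk_indmor (V1 HY) (D1 HY) MM DM (kcmp YT (tn vee T))"
    unfolding RepH_hom_def by (simp add: RepH_obj mk_indmor_hom[OF M M T] C_sel(17,18) ix(1) iy(1) l1(1) l2(1) r1 r2)
  also have "\<dots> \<longleftrightarrow> (\<forall>L. ae (D1 HX L) (kcmp T XT) (kcmp XT (tn vee T))) \<and> (\<forall>L. ae (D1 HY L) (kcmp T YT) (kcmp YT (tn vee T)))"
    unfolding mk_indmor_eq[OF x M l1(2)] mk_indmor_eq[OF y M l2(2)] ..
  also have "\<dots> \<longleftrightarrow> (\<forall>L. \<forall>\<^sub>F n in F. \<forall>i<m n. \<forall>p\<in>DM L n. T n (mx i p) = PX (K n) (m n) i (T n p) \<and>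
        lin (K n) (VK n) (T n) (PYcol (K n) (m n) (ts n) (ks n) i p) = PY (K n) (m n) (ts n) (ks n) i (T n p))"
    unfolding e1 e2 all_conj_distrib[symmetric] eventually_conj_iff[symmetric]
    by (intro all_cong1 eventually_subst always_eventually allI) blast
  finally show ?thesis .
qed

end

section \<open>Endomorphisms of the induced object\<close>

context spherical_data
begin

lemma Inv_mono: "v \<in> Inv L \<Longrightarrow> L \<le> L' \<Longrightarrow> v \<in> Inv L'"
  using PL_mono by (auto simp: Inv_def)

lemma Inv_add: "v \<in> Inv L \<Longrightarrow> w \<in> Inv L \<Longrightarrow> v \<oplus>\<^bsub>P\<^esub> w \<in> Inv L"
  using PL_ops(1)[of v L w] PL_P[of v L] PL_P[of w L] klinD(2)[OF PG_klin] by (simp add: Inv_def)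

lemma Inv_smult: "v \<in> Inv L \<Longrightarrow> a \<in> carrier K \<Longrightarrow> a \<odot>\<^bsub>P\<^esub> v \<in> Inv L"
  using PL_ops(3)[of v L] PL_P[of v L] klinD(3)[OF PG_klin] by (simp add: Inv_def)

lemma Inv_uno: "uno \<in> Inv 0"
  using one_P PG_one by (simp add: Inv_def)

text \<open>Each factor of a monomial raises the degree by at most one. The shift d is that of v
  alone and does not depend on L.\<close>

lemma uc_PL:
  assumes v: "v \<in> Inv d" and c: "c \<in> PBL n L"
  shows "PU.uc v c \<in> PL (L + d)"
  using c
proof (induction rule: PB_induct)
  case (base b L)
  have "PU.uc v (pm {#} b) \<in> PL (size b + d)"
    using base(1)
  proof (induction b)
    case empty thus ?case using Inv_P(3)[OF v] by (simp add: PU.uc_one)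
  next
    case (add z b)
    then obtain i where "z = Yv i" "i < n" by auto
    thus ?case using add PY_PL PU.uc_simps(1)[OF Inv_P(1)[OF v]] by simp
  qed
  thus ?case using PL_mono base(2) by simp
next
  case (X j a b L)
  thus ?case using PX_PL PU.uc_simps(2)[OF Inv_P(1)[OF v]] by simp
qed

lemma uc_G:
  assumes v: "v \<in> Inv d" and c: "c \<in> PB n" and g: "g permutes {..<n}"
  shows "PU.uc v (bact g c) (bact g r) = PU.uc v c r"
proof -
  note vP = Inv_P(1)[OF v]
  have "PU.uc v (bact g c) = PG K n g (PU.uc v c)"
    using PU.U_G[OF vP Inv_P(2)[OF v] g ve_P[OF c]] by (simp add: PG_ve[OF g c] PU.U_ve[OF vP] bact_PB[OF g] c)
  thus ?thesis using PG_eval[OF g PU.uc_closed[OF vP c]] by simp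
qed

lemma U_Inv:
  assumes v: "v \<in> Inv d" and w: "w \<in> Inv L"
  shows "PU.U v w \<in> Inv (L + d)"
proof -
  note vP = Inv_P(1)[OF v] and wP = Inv_P(1)[OF w]
  have "PU.U v w \<in> PL (L + d)" unfolding umap_def
    by (rule lin_PL[OF uc_PL[OF v] Inv_P(3)[OF w] PB_PBL(2) PU.uc_closed[OF vP]])
  moreover have "PG K n g (PU.U v w) = PU.U v w" if "g permutes {..<n}" for g
    using PU.U_G[OF vP Inv_P(2)[OF v] that wP] Inv_P(2)[OF w that] by simp
  ultimately show ?thesis by (simp add: Inv_def)
qed

lemma U_VU:
  assumes v: "v \<in> carrier P" and x: "x \<in> carrier P"
  shows "lin K VU (PU.uc v) x = PU.U v x"
  unfolding umap_def Pmod_def using x PU.uc_closed[OF v] P_VU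
  by (intro lin_vec_irrel) (auto simp: Pmod_def)

text \<open>Both sides come from maps of modules on \<open>P\<close> that send 1 to the image of w
  under the map of v, so uniqueness identifies them. Sums, scalar multiples and the identity are
  treated in the same way below.\<close>

lemma uc_cmp:
  assumes v: "v \<in> Inv d" and w: "w \<in> Inv L" and c: "c \<in> PB n"
  shows "lin K VU (PU.uc v) (PU.uc w c) = PU.uc (PU.U v w) c"
proof -
  note vP = Inv_P(1)[OF v] and wP = Inv_P(1)[OF w]
  note cl = klinD(1)[OF PU.U_klin[OF wP]]
  have "PU.U v (PU.U w p) = PU.U (PU.U v w) p" if "p \<in> carrier P" for p
    by (rule PU.U_uniq[OF klinD(1)[OF PU.U_klin[OF vP] wP] klin_comp[OF PU.U_klin[OF wP] PU.U_klin[OF vP]] _ _ _ that])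
      (use vP wP cl in \<open>simp_all add: PU.U_one PU.U_X PU.U_Y[OF wP Inv_P(2)[OF w]] PU.U_Y[OF vP Inv_P(2)[OF v]]\<close>)
  from this[OF ve_P[OF c]] show ?thesis
    by (simp add: U_VU[OF vP PU.uc_closed[OF wP c]] PU.U_ve wP c klinD(1)[OF PU.U_klin[OF vP] wP])
qed

lemma uc_add:
  assumes v: "v \<in> Inv d" and w: "w \<in> Inv L" and c: "c \<in> PB n"
  shows "PU.uc (v \<oplus>\<^bsub>P\<^esub> w) c = PU.uc v c \<oplus>\<^bsub>P\<^esub> PU.uc w c"
proof -
  note vP = Inv_P(1)[OF v] and wP = Inv_P(1)[OF w]
  note cl = klinD(1)[OF PU.U_klin[OF wP]] klinD(1)[OF PU.U_klin[OF vP]]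
  have "PU.U v p \<oplus>\<^bsub>P\<^esub> PU.U w p = PU.U (v \<oplus>\<^bsub>P\<^esub> w) p" if "p \<in> carrier P" for p
    by (rule PU.U_uniq[OF _ klin_add[OF P_module PU.U_klin[OF vP] PU.U_klin[OF wP]] _ _ _ that])
      (use vP wP cl klinD(2)[OF PX_klin] klinD(2)[OF PY_klin] in \<open>simp_all add: PU.U_one PU.U_X PU.U_Y[OF wP Inv_P(2)[OF w]] PU.U_Y[OF vP Inv_P(2)[OF v]]\<close>)
  from this[OF ve_P[OF c]] show ?thesis using vP wP c by (simp add: PU.U_ve)
qed

lemma uc_smult:
  assumes v: "v \<in> Inv d" and a: "a \<in> carrier K" and c: "c \<in> PB n"
  shows "PU.uc (a \<odot>\<^bsub>P\<^esub> v) c = a \<odot>\<^bsub>P\<^esub> PU.uc v c"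
proof -
  note vP = Inv_P(1)[OF v]
  note cl = klinD(1)[OF PU.U_klin[OF vP]]
  have "a \<odot>\<^bsub>P\<^esub> PU.U v p = PU.U (a \<odot>\<^bsub>P\<^esub> v) p" if "p \<in> carrier P" for p
    by (rule PU.U_uniq[OF _ klin_smult[OF P_module PU.U_klin[OF vP] a] _ _ _ that])
      (use vP a cl klinD(3)[OF PX_klin] klinD(3)[OF PY_klin] in \<open>simp_all add: PU.U_one PU.U_X PU.U_Y[OF vP Inv_P(2)[OF v]]\<close>)
  from this[OF ve_P[OF c]] show ?thesis using vP a c by (simp add: PU.U_ve)
qed

lemma uc_uno:
  assumes c: "c \<in> PB n"
  shows "PU.uc uno c = ve K c"
proof -
  have "p = PU.U uno p" if "p \<in> carrier P" for p
    by (rule PU.U_uniq[OF one_P(1) klin_id _ _ _ that]) simp_all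
  from this[OF ve_P[OF c]] show ?thesis using c one_P by (simp add: PU.U_ve)
qed

lemma Psi_Sph: "v \<in> Inv L \<Longrightarrow> Psi v \<in> carrier Sph"
  using Psi_bij by (auto simp: bij_betw_def spherical_filt_def)

end

locale ultra_setting_spherical = ultra_setting_params F K m \<psi> t k ts ks for F :: "nat filter" and K :: "nat \<Rightarrow> 'k ring" and m \<psi> t k ts ks +
  assumes sph: "\<And>n. spherical_data (K n) (m n) (ts n) (ks n)"
begin

abbreviation "Iv n \<equiv> spherical_data.Inv (K n) (m n)"
abbreviation "Ps n \<equiv> spherical_data.Psi (K n) (m n) (ts n) (ks n)"
abbreviation "uu n \<equiv> umap (K n) (PK' n) (PX (K n) (m n)) (PY (K n) (m n) (ts n) (ks n))"
abbreviation "on \<equiv> pm {#} {#}"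
definition "ut v = (\<lambda>n. ucol (PX (K n) (m n)) (PY (K n) (m n) (ts n) (ks n)) (v n))"
text \<open>One degree bound serves all indices, as in the restricted ultraproduct.\<close>

definition "inv_seqs_at L = {v. \<forall>n. v n \<in> Iv n L}"
definition "inv_seqs = (\<Union>L. inv_seqs_at L)"
abbreviation "Sp n \<equiv> spherical (K n) (m n) (ts n) (ks n)"
abbreviation "cl \<equiv> uclass F (\<lambda>n. carrier (Sp n))"
definition "endo v = mk_indmor MM DM MM DM (ut v)"
definition "theta v = cl (\<lambda>n. Ps n (v n))"
abbreviation "RR \<equiv> restricted_uprod F K \<psi> Sp (\<lambda>n. spherical_filt (K n) (m n) (ts n) (ks n))"

lemma inv_seqsI: "v \<in> inv_seqs_at L \<Longrightarrow> v \<in> inv_seqs" by (auto simp: inv_seqs_def)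
lemma inv_seqsE: assumes "v \<in> inv_seqs" obtains L where "v \<in> inv_seqs_at L" using assms by (auto simp: inv_seqs_def)
lemma inv_seqs_atD: "v \<in> inv_seqs_at L \<Longrightarrow> v n \<in> Iv n L" by (simp add: inv_seqs_at_def)

lemma DM_PB: "p \<in> DM L n \<Longrightarrow> p \<in> PB (m n)" using PB_PBL by (auto simp: DM_def)

lemma inv_seqs_common:
  assumes "v \<in> inv_seqs" "w \<in> inv_seqs" obtains L where "v \<in> inv_seqs_at L" "w \<in> inv_seqs_at L"
proof -
  obtain L L' where "v \<in> inv_seqs_at L" "w \<in> inv_seqs_at L'" using assms inv_seqsE by metis
  hence "v \<in> inv_seqs_at (max L L')" "w \<in> inv_seqs_at (max L L')" by (auto simp: inv_seqs_at_def intro: spherical_data.Inv_mono[OF sph])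
  thus ?thesis by (rule that)
qed

lemma admissible_ut: assumes v: "v \<in> inv_seqs" shows "admissible DM DM (ut v)"
proof -
  obtain d where d: "v \<in> inv_seqs_at d" using v by (rule inv_seqsE)
  have "good (DM L) (DM (L + d)) (ut v)" for L
    unfolding good_def pgood_def
  proof (intro allI ballI conjI impI)
    fix n c assume c: "c \<in> DM L n"
    interpret s: spherical_data "K n" "m n" "ts n" "ks n" by (rule sph)
    show "ut v n c \<in> carrier (vec (K n) (DM (L + d) n))"
      using s.uc_PL[OF inv_seqs_atD[OF d]] c by (simp add: ut_def DM_def)
    fix g r assume g: "g permutes {..<m n}"
    show "ut v n (bact g c) (bact g r) = ut v n c r"
      using s.uc_G[OF inv_seqs_atD[OF d] DM_PB[OF c] g] by (simp add: ut_def)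
  qed
  thus ?thesis unfolding admissible_def using ae_refl by blast
qed

lemma endo_hom: assumes v: "v \<in> inv_seqs" shows "endo v \<in> RepH_hom C (MM, XM, YM) (MM, XM, YM)"
  unfolding endo_def RepH_hom_iff[OF admissible_ut[OF v]]
proof (intro allI always_eventually impI ballI)
  fix L n i p assume i: "i < m n" and "p \<in> DM L n"
  hence p: "p \<in> PB (m n)" using DM_PB by blast
  obtain d where d: "v \<in> inv_seqs_at d" using v by (rule inv_seqsE)
  interpret s: spherical_data "K n" "m n" "ts n" "ks n" by (rule sph)
  note vI = inv_seqs_atD[OF d, of n] note vP = s.Inv_P(1)[OF vI]
  have u: "ut v n = s.PU.uc (v n)" by (simp add: ut_def)
  show "ut v n (mx i p) = PX (K n) (m n) i (ut v n p) \<and>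
        lin (K n) (VK n) (ut v n) (PYcol (K n) (m n) (ts n) (ks n) i p) = PY (K n) (m n) (ts n) (ks n) i (ut v n p)"
    unfolding u s.U_VU[OF vP s.PYcol_P[OF i p]]
    using s.PU.U_X[OF vP i s.ve_P[OF p]] s.PU.U_Y[OF vP s.Inv_P(2)[OF vI] i s.ve_P[OF p]] vP i p
    by (simp add: s.PX_ve s.PY_ve s.PU.U_ve s.mult_x_PB)
qed

lemma on_DM: "on \<in> DM L n" by (simp add: DM_def pm_PBL)

lemma endo_eq: assumes v: "v \<in> inv_seqs" shows "endo v = endo w \<longleftrightarrow> (\<forall>\<^sub>F n in F. v n = w n)"
proof -
  have 1: "ut v n on = v n" for v n by (simp add: ut_def pm_def)
  have "(\<forall>L. ae (DM L) (ut v) (ut w)) \<longleftrightarrow> (\<forall>\<^sub>F n in F. v n = w n)"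
  proof
    assume "\<forall>L. ae (DM L) (ut v) (ut w)"
    hence "\<forall>\<^sub>F n in F. \<forall>c\<in>DM 0 n. ut v n c = ut w n c" by (simp add: ae_def)
    thus "\<forall>\<^sub>F n in F. v n = w n" by eventually_elim (metis 1 on_DM)
  next
    assume "\<forall>\<^sub>F n in F. v n = w n"
    hence "ae (DM L) (ut v) (ut w)" for L unfolding ae_def by eventually_elim (simp add: ut_def)
    thus "\<forall>L. ae (DM L) (ut v) (ut w)" ..
  qed
  thus ?thesis unfolding endo_def mk_indmor_eq[OF is_tower_M is_tower_M admissible_ut[OF v]] .
qed

lemma endo_surj:
  assumes f: "f \<in> RepH_hom C (MM, XM, YM) (MM, XM, YM)" shows "\<exists>v\<in>inv_seqs. f = endo v"
proof -
  have "f \<in> ind_hom C MM MM" using f by (simp add: RepH_hom_def)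
  then obtain T where T: "admissible DM DM T" "f = mk_indmor MM DM MM DM T" using hom_mk_indmor[OF is_tower_M is_tower_M] by metis
  note h = f[unfolded T(2) RepH_hom_iff[OF T(1)], rule_format]
  obtain L' A where A: "good (DM 0) (DM L') A" "ae (DM 0) A T" using admissibleE[OF T(1)] .
  \<comment> \<open>The value at 1 is taken from the good family in degree 0 and not from
    \<open>T\<close>. It is therefore invariant at every index and of degree at most
    \<open>L'\<close> uniformly; agreement with \<open>T\<close> is needed only almost
    everywhere.\<close>
  define v where "v = (\<lambda>n. A n on)"
  have vI: "v n \<in> Iv n L'" for n
  proof -
    interpret s: spherical_data "K n" "m n" "ts n" "ks n" by (rule sph)
    have a: "v n \<in> s.PL L'" "\<And>g r. g permutes {..<m n} \<Longrightarrow> v n (bact g r) = v n r"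
      using A(1) on_DM[of 0 n] by (auto simp: good_def pgood_def v_def DM_def bact_pm dest!: spec[of _ n] bspec[of _ _ on])
    have "PG (K n) (m n) g (v n) r = v n r" if g: "g permutes {..<m n}" for g r
    proof -
      have "r = bact g (bact (ginv g) r)" using bact_comp[of g "ginv g" r] permutes_inv_o(1)[OF g] bact_id by simp
      thus ?thesis using s.PG_eval[OF g s.PL_P[OF a(1)], of "bact (ginv g) r"] a(2)[OF g, of "bact (ginv g) r"] by simp
    qed
    thus ?thesis using a(1) by (auto simp: s.Inv_def)
  qed
  hence v: "v \<in> inv_seqs_at L'" by (simp add: inv_seqs_at_def)
  have "ae (DM L) T (ut v)" for L
    \<comment> \<open>Almost everywhere the identities hold at the index in degree at most L, and
      \<open>col_uniq\<close> applies to this index alone. Degree L + 1 is included because the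
      column at a product with y_i is also used.\<close>
    unfolding ae_def using h[of L] admissible_P[OF T(1), of "Suc L"] A(2)[unfolded ae_def]
  proof eventually_elim
    case (elim n)
    interpret s: spherical_data "K n" "m n" "ts n" "ks n" by (rule sph)
    show ?case
    proof
      fix c assume "c \<in> DM L n"
      hence c: "c \<in> PBL (m n) L" by (simp add: DM_def)
      show "T n c = ut v n c" unfolding ut_def
      proof (rule s.PU.col_uniq[OF s.Inv_P(1)[OF vI] _ _ _ c])
        show "T n on = v n" using elim(3) on_DM by (auto simp: v_def)
        show "T n (mx i c) = PX (K n) (m n) i (T n c)" if "i < m n" "c \<in> PBL (m n) L" for i c
          using elim(1) that by (simp add: DM_def)
        show "T n (pm {#} (add_mset (Yv i) b)) = PY (K n) (m n) (ts n) (ks n) i (T n (pm {#} b))" if i: "i < m n" and b: "pm {#} b \<in> PBL (m n) L" for i b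
        proof -
          have "pm {#} (add_mset (Yv i) b) \<in> DM (Suc L) n" using i b by (simp add: DM_def pm_PBL)
          hence "T n (pm {#} (add_mset (Yv i) b)) \<in> carrier (VK n)" using elim(2) s.P_VU by blast
          moreover have "lin (K n) (VK n) (T n) (PYcol (K n) (m n) (ts n) (ks n) i (pm {#} b)) = PY (K n) (m n) (ts n) (ks n) i (T n (pm {#} b))"
            using elim(1) i b by (simp add: DM_def)
          ultimately show ?thesis unfolding s.PYcol_base by (simp add: lin_ve_VK)
        qed
      qed
    qed
  qed
  hence "f = endo v" unfolding T(2) endo_def by (rule mk_indmor_cong)
  thus ?thesis using inv_seqsI[OF v] by blast
qed

lemma Ps_Pi: "v \<in> inv_seqs \<Longrightarrow> (\<lambda>n. Ps n (v n)) \<in> Pi UNIV (\<lambda>n. carrier (Sp n))"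
  using spherical_data.Psi_Sph[OF sph inv_seqs_atD] by (blast elim: inv_seqsE)

lemma theta_eq: assumes v: "v \<in> inv_seqs" and w: "w \<in> inv_seqs" shows "theta v = theta w \<longleftrightarrow> (\<forall>\<^sub>F n in F. v n = w n)"
proof -
  have "Ps n (v n) = Ps n (w n) \<longleftrightarrow> v n = w n" for n
  proof -
    interpret s: spherical_data "K n" "m n" "ts n" "ks n" by (rule sph)
    show ?thesis using s.Psi_inj v w s.Inv_P(1) by (metis inv_seqs_atD inv_seqsE)
  qed
  thus ?thesis unfolding theta_def uclass_eq[OF Ps_Pi[OF v]] by simp
qed

text \<open>\<open>Psi\<close> is a bijection between invariants and spherical elements in each
  filtered piece separately, so a sequence in the L-th pieces lifts to a sequence of invariants with
  the same bound L.\<close>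

lemma RR_carrier: "carrier RR = theta ` inv_seqs"
proof -
  have "cl ` Pi UNIV (\<lambda>n. spherical_filt (K n) (m n) (ts n) (ks n) L) = theta ` inv_seqs_at L" for L
  proof (rule subset_antisym; rule subsetI)
    fix x assume "x \<in> cl ` Pi UNIV (\<lambda>n. spherical_filt (K n) (m n) (ts n) (ks n) L)"
    then obtain s where s: "x = cl s" "\<And>n. s n \<in> spherical_filt (K n) (m n) (ts n) (ks n) L" by auto
    have "\<exists>v. v \<in> Iv n L \<and> s n = Ps n v" for n
      using s(2)[of n] spherical_data.Psi_bij[OF sph, of n L] unfolding bij_betw_def by blast
    then obtain v where v: "\<And>n. v n \<in> Iv n L" "\<And>n. s n = Ps n (v n)" by metis
    have "x = theta v" using s(1) v(2) by (simp add: theta_def flip: v(2))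
    thus "x \<in> theta ` inv_seqs_at L" using v(1) by (auto simp: inv_seqs_at_def)
  next
    fix x assume "x \<in> theta ` inv_seqs_at L"
    then obtain v where v: "v \<in> inv_seqs_at L" "x = theta v" by blast
    have "Ps n (v n) \<in> spherical_filt (K n) (m n) (ts n) (ks n) L" for n
      using inv_seqs_atD[OF v(1), of n] spherical_data.Psi_bij[OF sph, of n L] unfolding bij_betw_def by blast
    thus "x \<in> cl ` Pi UNIV (\<lambda>n. spherical_filt (K n) (m n) (ts n) (ks n) L)" using v(2) by (auto simp: theta_def)
  qed
  thus ?thesis by (simp add: restricted_uprod_def Let_def inv_seqs_def image_UN)
qed

definition "vm v w = (\<lambda>n. uu n (v n) (w n))"
definition "va v w = (\<lambda>n. v n \<oplus>\<^bsub>PK' n\<^esub> w n)"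
definition "vs c v = (\<lambda>n. sq c n \<odot>\<^bsub>PK' n\<^esub> v n)"
definition "vo = (\<lambda>n. ve (K n) on)"

lemma sqK: "sq c n \<in> carrier (K n)" using sq(1) by auto

lemma inv_seqs_ops:
  assumes v: "v \<in> inv_seqs"
  shows "w \<in> inv_seqs \<Longrightarrow> vm v w \<in> inv_seqs" "w \<in> inv_seqs \<Longrightarrow> va v w \<in> inv_seqs" "vs c v \<in> inv_seqs"
proof -
  show "vm v w \<in> inv_seqs" if "w \<in> inv_seqs"
  proof -
    obtain L where L: "v \<in> inv_seqs_at L" "w \<in> inv_seqs_at L" using v \<open>w \<in> inv_seqs\<close> by (rule inv_seqs_common)
    have "vm v w \<in> inv_seqs_at (L + L)" unfolding inv_seqs_at_def vm_def using spherical_data.U_Inv[OF sph inv_seqs_atD[OF L(1)] inv_seqs_atD[OF L(2)]] by blast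
    thus ?thesis by (rule inv_seqsI)
  qed
  show "va v w \<in> inv_seqs" if "w \<in> inv_seqs"
  proof -
    obtain L where L: "v \<in> inv_seqs_at L" "w \<in> inv_seqs_at L" using v \<open>w \<in> inv_seqs\<close> by (rule inv_seqs_common)
    have "va v w \<in> inv_seqs_at L" unfolding inv_seqs_at_def va_def using spherical_data.Inv_add[OF sph inv_seqs_atD[OF L(1)] inv_seqs_atD[OF L(2)]] by blast
    thus ?thesis by (rule inv_seqsI)
  qed
  obtain L where L: "v \<in> inv_seqs_at L" using v by (rule inv_seqsE)
  have "vs c v \<in> inv_seqs_at L" unfolding inv_seqs_at_def vs_def using spherical_data.Inv_smult[OF sph inv_seqs_atD[OF L] sqK] by blast
  thus "vs c v \<in> inv_seqs" by (rule inv_seqsI)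
qed

lemma vo_Seq: "vo \<in> inv_seqs"
proof -
  have "vo \<in> inv_seqs_at 0" unfolding inv_seqs_at_def vo_def using spherical_data.Inv_uno[OF sph] by blast
  thus ?thesis by (rule inv_seqsI)
qed

lemma endo_ops:
  assumes v: "v \<in> inv_seqs"
  shows "w \<in> inv_seqs \<Longrightarrow> endo v \<star>\<^bsub>C\<^esub> endo w = endo (vm v w)" "w \<in> inv_seqs \<Longrightarrow> endo v \<boxplus>\<^bsub>C\<^esub> endo w = endo (va v w)"
    "ind_scl C c (endo v) = endo (vs c v)" "ind_id C MM = endo vo"
proof -
  note M = is_tower_M and a = admissible_ut
  show "endo v \<star>\<^bsub>C\<^esub> endo w = endo (vm v w)" if w: "w \<in> inv_seqs"
  proof -
    obtain L where L: "v \<in> inv_seqs_at L" "w \<in> inv_seqs_at L" using v w by (rule inv_seqs_common)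
    have "kcmp (ut v) (ut w) n c = ut (vm v w) n c" if "c \<in> DM L' n" for n c L'
      unfolding kcmp_lin using spherical_data.uc_cmp[OF sph inv_seqs_atD[OF L(1)] inv_seqs_atD[OF L(2)] DM_PB[OF that]] by (simp add: ut_def vm_def)
    thus ?thesis unfolding endo_def ind_cmp_mk_indmor[OF M M M a[OF w] a[OF v]] by (intro mk_indmor_cong) (simp add: ae_def)
  qed
  show "endo v \<boxplus>\<^bsub>C\<^esub> endo w = endo (va v w)" if w: "w \<in> inv_seqs"
  proof -
    obtain L where L: "v \<in> inv_seqs_at L" "w \<in> inv_seqs_at L" using v w by (rule inv_seqs_common)
    have "addf (ut v) (ut w) n c = ut (va v w) n c" if "c \<in> DM L' n" for n c L'
    proof -
      interpret s: spherical_data "K n" "m n" "ts n" "ks n" by (rule sph)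
      show ?thesis using s.uc_add[OF inv_seqs_atD[OF L(1)] inv_seqs_atD[OF L(2)] DM_PB[OF that]] by (simp add: ut_def va_def addf_def s.Pmod_ops s.vec_simps)
    qed
    thus ?thesis unfolding endo_def ind_pls_mk_indmor[OF M M a[OF v] a[OF w]] by (intro mk_indmor_cong) (simp add: ae_def)
  qed
  obtain L where L: "v \<in> inv_seqs_at L" using v by (rule inv_seqsE)
  have "sclf (sq c) (ut v) n p = ut (vs c v) n p" if "p \<in> DM L' n" for n p L'
  proof -
    interpret s: spherical_data "K n" "m n" "ts n" "ks n" by (rule sph)
    show ?thesis using s.uc_smult[OF inv_seqs_atD[OF L] sqK DM_PB[OF that]] by (simp add: ut_def vs_def sclf_def s.Pmod_ops s.vec_simps)
  qed
  thus "ind_scl C c (endo v) = endo (vs c v)" unfolding endo_def ind_scl_mk_indmor[OF M M a[OF v] sq] by (intro mk_indmor_cong) (simp add: ae_def)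
  have "vee n p = ut vo n p" if "p \<in> DM L' n" for n p L'
    using spherical_data.uc_uno[OF sph DM_PB[OF that]] by (simp add: ut_def vo_def vee_def)
  thus "ind_id C MM = endo vo" unfolding endo_def ind_id_mk_indmor(1)[OF M] by (intro mk_indmor_cong) (simp add: ae_def)
qed

lemma theta_ops:
  assumes v: "v \<in> inv_seqs"
  shows "w \<in> inv_seqs \<Longrightarrow> theta v \<otimes>\<^bsub>RR\<^esub> theta w = theta (vm v w)" "w \<in> inv_seqs \<Longrightarrow> theta v \<oplus>\<^bsub>RR\<^esub> theta w = theta (va v w)"
    "c \<odot>\<^bsub>RR\<^esub> theta v = theta (vs c v)" "\<one>\<^bsub>RR\<^esub> = theta vo"
proof -
  have "Ps n (v n) \<otimes>\<^bsub>Sp n\<^esub> Ps n (w n) = Ps n (vm v w n) \<and> Ps n (v n) \<oplus>\<^bsub>Sp n\<^esub> Ps n (w n) = Ps n (va v w n)" if w: "w \<in> inv_seqs" for w n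
  proof -
    interpret s: spherical_data "K n" "m n" "ts n" "ks n" by (rule sph)
    obtain L where L: "v \<in> inv_seqs_at L" "w \<in> inv_seqs_at L" using v w by (rule inv_seqs_common)
    note I = inv_seqs_atD[OF L(1), of n] inv_seqs_atD[OF L(2), of n]
    show ?thesis using s.Psi_hom[OF I(1) s.Inv_P(1)[OF I(2)]] klinD(2)[OF s.Psi_klin s.Inv_P(1)[OF I(1)] s.Inv_P(1)[OF I(2)]]
      by (simp add: vm_def va_def s.Sph_simps)
  qed
  thus "w \<in> inv_seqs \<Longrightarrow> theta v \<otimes>\<^bsub>RR\<^esub> theta w = theta (vm v w)" "w \<in> inv_seqs \<Longrightarrow> theta v \<oplus>\<^bsub>RR\<^esub> theta w = theta (va v w)"
    using UN_uclass2[OF Ps_Pi[OF v] Ps_Pi[of w], where F = F and D = "\<lambda>n. carrier (Sp n)" and f = "\<lambda>n. monoid.mult (Sp n)"]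
      UN_uclass2[OF Ps_Pi[OF v] Ps_Pi[of w], where F = F and D = "\<lambda>n. carrier (Sp n)" and f = "\<lambda>n. add (Sp n)"]
    unfolding theta_def by (simp_all add: restricted_uprod_def Let_def)
  have "sq c n \<odot>\<^bsub>Sp n\<^esub> Ps n (v n) = Ps n (vs c v n)" for n
  proof -
    interpret s: spherical_data "K n" "m n" "ts n" "ks n" by (rule sph)
    obtain L where L: "v \<in> inv_seqs_at L" using v by (rule inv_seqsE)
    show ?thesis using klinD(3)[OF s.Psi_klin sqK s.Inv_P(1)[OF inv_seqs_atD[OF L]]] by (simp add: vs_def s.Sph_simps)
  qed
  thus "c \<odot>\<^bsub>RR\<^esub> theta v = theta (vs c v)"
    using UN_uclass2[OF sq(1) Ps_Pi[OF v], where F = F and D = "\<lambda>n. carrier (Sp n)" and f = "\<lambda>n. module.smult (Sp n)"]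
    unfolding theta_def by (simp add: restricted_uprod_def Let_def uscalar_sq ucar_def)
  have "\<one>\<^bsub>Sp n\<^esub> = Ps n (vo n)" for n
  proof -
    interpret s: spherical_data "K n" "m n" "ts n" "ks n" by (rule sph)
    show ?thesis by (simp add: vo_def s.Sph_simps s.Psi_one)
  qed
  thus "\<one>\<^bsub>RR\<^esub> = theta vo" unfolding theta_def by (simp add: restricted_uprod_def Let_def)
qed

lemma DDCA_simps: "carrier (DDCA F K m \<psi> t k) = endo ` inv_seqs" "monoid.mult (DDCA F K m \<psi> t k) = ind_cmp C" "add (DDCA F K m \<psi> t k) = ind_pls C"
  "\<one>\<^bsub>DDCA F K m \<psi> t k\<^esub> = ind_id C MM" "module.smult (DDCA F K m \<psi> t k) = ind_scl C"
proof -
  have "DDCA F K m \<psi> t k = RepH_End C (MM, XM, YM)"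
    unfolding DDCA_def Let_def induced_def mult_x_mk_indmor(1) ind_y_YM unfolding MM_def ..
  moreover have "RepH_hom C (MM, XM, YM) (MM, XM, YM) = endo ` inv_seqs" using endo_hom endo_surj by blast
  ultimately show "carrier (DDCA F K m \<psi> t k) = endo ` inv_seqs" "monoid.mult (DDCA F K m \<psi> t k) = ind_cmp C" "add (DDCA F K m \<psi> t k) = ind_pls C"
    "\<one>\<^bsub>DDCA F K m \<psi> t k\<^esub> = ind_id C MM" "module.smult (DDCA F K m \<psi> t k) = ind_scl C"
    by (simp_all add: RepH_End_def Let_def)
qed

text \<open>Endomorphisms and elements of the restricted ultraproduct are both parametrized by
  sequences of invariants of bounded degree. On either side two sequences give the same element
  exactly when they agree almost everywhere, so the correspondence is well defined and bijective;
  the operations match on sequences.\<close>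

theorem DDCA_iso: "\<exists>\<phi>. \<phi> \<in> algebra_iso complex_ring (DDCA F K m \<psi> t k) RR"
proof -
  define ph where "ph a = theta (SOME v. v \<in> inv_seqs \<and> endo v = a)" for a
  have ph: "ph (endo v) = theta v" if v: "v \<in> inv_seqs" for v
  proof -
    have "\<exists>w. w \<in> inv_seqs \<and> endo w = endo v" using v by blast
    from someI_ex[OF this] show ?thesis unfolding ph_def using theta_eq endo_eq v by blast
  qed
  note vo = vo_Seq endo_ops(4)[OF vo_Seq] theta_ops(4)[OF vo_Seq]
  have "bij_betw ph (endo ` inv_seqs) (theta ` inv_seqs)"
    unfolding bij_betw_def inj_on_def using endo_eq theta_eq by (auto simp: ph image_image)
  hence "ph \<in> algebra_iso complex_ring (DDCA F K m \<psi> t k) RR"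
    unfolding algebra_iso_def ring_iso_def ring_hom_def
    by (auto simp: DDCA_simps RR_carrier ph endo_ops theta_ops inv_seqs_ops vo)
  thus ?thesis by blast
qed

end

lemma unit_of_char:
  assumes "field R" "has_characteristic R p" "\<not> p dvd j"
  shows "[j] \<cdot>\<^bsub>R\<^esub> \<one>\<^bsub>R\<^esub> \<in> Units R"
proof -
  interpret field R by fact
  show ?thesis using assms(2,3) by (simp add: field_Units has_characteristic_def)
qed

theorem proposition4p1p5:
  fixes F :: "nat filter" and K :: "nat \<Rightarrow> 'k ring" and p \<nu>s :: "nat \<Rightarrow> nat"
    and \<psi> :: "(nat \<Rightarrow> 'k) set \<Rightarrow> complex" and \<nu> t k :: complex and ts ks :: "nat \<Rightarrow> 'k"
  assumes "nonprincipal_ultrafilter F"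
    and "\<nu> \<notin> \<nat>"
    and "\<And>n. is_prime_field_closure (p n) (K n)"
    and "\<not> algebraic \<nu> \<Longrightarrow> \<forall>n. \<nu>s n = n \<and> p n = 0"
    and "algebraic \<nu> \<Longrightarrow> inj p \<and> (\<forall>n. prime (p n) \<and> 0 < \<nu>s n \<and> \<nu>s n < p n)
           \<and> filterlim \<nu>s at_top sequentially"
    and "\<psi> \<in> ring_iso (uprod_ring F K) complex_ring"
    and "\<psi> (uclass F (\<lambda>n. carrier (K n)) (\<lambda>n. [\<nu>s n] \<cdot>\<^bsub>K n\<^esub> \<one>\<^bsub>K n\<^esub>)) = \<nu>"
    and "ts \<in> Pi UNIV (\<lambda>n. carrier (K n))" and "\<psi> (uclass F (\<lambda>n. carrier (K n)) ts) = t"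
    and "ks \<in> Pi UNIV (\<lambda>n. carrier (K n))" and "\<psi> (uclass F (\<lambda>n. carrier (K n)) ks) = k"
  shows "\<exists>\<phi>. \<phi> \<in> algebra_iso complex_ring (DDCA F K \<nu>s \<psi> t k)
           (restricted_uprod F K \<psi> (\<lambda>n. spherical (K n) (\<nu>s n) (ts n) (ks n))
              (\<lambda>n. spherical_filt (K n) (\<nu>s n) (ts n) (ks n)))"
proof -
  have fld: "field (K n)" and ch: "has_characteristic (K n) (p n)" for n
    using assms(3)[of n] by (auto simp: is_prime_field_closure_def algebraic_closure_def)
  have coeff_ring: "coeff_ring (K n)" for n
    unfolding coeff_ring_def using field.axioms(1)[OF fld] by (simp add: domain_def)
  \<comment> \<open>In positive characteristic a prime divides n! only if it is at most n, and the
    rank is smaller than the prime; in characteristic 0, zero divides no factorial.\<close>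
  have fct: "\<not> p n dvd fact (\<nu>s n)" for n
  proof (cases "algebraic \<nu>")
    case True thus ?thesis using assms(5)[OF True] by (simp add: prime_dvd_fact_iff not_le)
  next
    case False thus ?thesis using assms(4) by simp
  qed
  have inv: "\<forall>\<^sub>F n in F. [Suc j] \<cdot>\<^bsub>K n\<^esub> \<one>\<^bsub>K n\<^esub> \<in> Units (K n)" for j
  proof -
    have "\<forall>\<^sub>F n in F. \<not> p n dvd Suc j"
    proof (cases "algebraic \<nu>")
      case True
      \<comment> \<open>The primes are distinct and j + 1 has finitely many divisors, so only
        finitely many indices are bad; a finite set of indices is null for a nonprincipal
        ultrafilter.\<close>
      hence "finite {n. p n dvd Suc j}"
        using finite_vimageI[of "{d. d dvd Suc j}" p] assms(5) by (simp add: vimage_def)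
      hence "\<forall>\<^sub>F n in F. \<forall>i\<in>{n. p n dvd Suc j}. n \<noteq> i"
        using assms(1) by (intro eventually_ball_finite) (auto simp: nonprincipal_ultrafilter_def)
      thus ?thesis by eventually_elim blast
    next
      case False thus ?thesis using assms(4) by simp
    qed
    thus ?thesis by eventually_elim (rule unit_of_char[OF fld ch])
  qed
  have sph: "spherical_data (K n) (\<nu>s n) (ts n) (ks n)" for n
    using coeff_ring[of n] assms(8,10) unit_of_char[OF fld ch fct]
    by (intro spherical_data.intro cherednik_data.intro spherical_data_axioms.intro cherednik_data_axioms.intro) auto
  interpret ultra_setting F K \<nu>s \<psi> t k by (rule ultra_setting.intro) (rule assms(1,6) coeff_ring)+
  have "ultra_setting_spherical F K \<nu>s \<psi> t k ts ks"
    by (intro ultra_setting_spherical.intro ultra_setting_params.intro ultra_setting_units.intro ultra_setting_spherical_axioms.intro ultra_setting_params_axioms.intro ultra_setting_units_axioms.intro ultra_setting_axioms)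
      (use assms(8-11) inv sph in \<open>simp_all add: ucar_def\<close>)
  thus ?thesis by (rule ultra_setting_spherical.DDCA_iso)
qed

end
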